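(* Let $U=U(0,1)$ be the open unit ball in $\mathbb{R}^m$, let $1<p<\infty$ and let $f\in W^1_p(U;\mathcal{Q}_Q(\ell_2))$. Then $f$ is approximately differentiable $\mathcal{L}^m$-almost everywhere in $U$ and $$\mathcal{E}_p^p(f;V)=\int_V|Df(x)|^p\,d\mathcal{L}^m(x)$$ for every open set $V\subset U$.
   Context: $Q,m\ge1$ are integers; $\mathbb{R}^m$ has its Euclidean norm; $\ell_2$ is the infinite dimensional separable real Hilbert space. $\mathcal{Q}_Q(\ell_2)$ is the quotient of $\ell_2^Q$ (the $Q$-fold Cartesian product) by the permutation action of $S_Q$; the class of $(y_1,\dots,y_Q)$ is $[\![y_1,\dots,y_Q]\!]$, $Q[\![0]\!]=[\![0,\dots,0]\!]$, and $\mathcal{G}([\![y_1,\dots,y_Q]\!],[\![y_1',\dots,y_Q']\!])=\min_{\sigma\in S_Q}\big(\sum_i\|y_i-y'_{\sigma(i)}\|^2\big)^{1/2}$. A Borel map $f:U\to\mathcal{Q}_Q(\ell_2)$ is approximately differentiable at $a\in U$ if there are affine maps $A_1,\dots,A_Q:\mathbb{R}^m\to\ell_2$ such that for every $\varepsilon>0$ the set $\{x:\mathcal{G}(f(x),[\![A_1(x),\dots,A_Q(x)]\!])>\varepsilon\|x-a\|\}$ has $m$-dimensional density $0$ at $a$; the unordered tuple is unique; with $L_i=A_i-A_i(0)$ put $Df(a)=[\![L_1,\dots,L_Q]\!]$ and $|Df(a)|=\big(\sum_{i=1}^Q\sum_{j=1}^m\|L_i(e_j)\|^2\big)^{1/2}$,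 $e_1,\dots,e_m$ being the canonical basis of $\mathbb{R}^m$. Lipschitz maps are approximately differentiable a.e. $L_p(U;\mathcal{Q}_Q(\ell_2))$: Borel maps $f:U\to\mathcal{Q}_Q(\ell_2)$ with $\int_U\mathcal{G}(f,Q[\![0]\!])^pd\mathcal{L}^m<\infty$; $d_p(f,g)=(\int_U\mathcal{G}(f,g)^pd\mathcal{L}^m)^{1/p}$. $W^1_p(U;\mathcal{Q}_Q(\ell_2))$: those $f\in L_p(U;\mathcal{Q}_Q(\ell_2))$ for which there are Lipschitz maps $f_j:\mathbb{R}^m\to\mathcal{Q}_Q(\ell_2)$ with $\sup_j\int_U|Df_j|^pd\mathcal{L}^m<\infty$ and $d_p(f,f_j)\to0$. For $V\subset U$ open, the $p$-energy is $\mathcal{E}_p^p(f;V)=\inf\{\liminf_j\int_V|Df_j|^pd\mathcal{L}^m\}$, the infimum over all sequences $\{f_j\}$ of Lipschitz maps $U\to\mathcal{Q}_Q(\ell_2)$ with $d_p(f,f_j)\to0$. *)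

theory Defs
  imports "HOL-Analysis.Analysis" "HOL-Combinatorics.Permutations"
begin

section \<open>Unordered tuples\<close>

text \<open>The index type \<open>'q\<close> plays the role of the set of indices \<open>1, \<dots>, Q\<close>, that is
  \<open>Q = CARD('q)\<close>; similarly \<open>m = CARD('m)\<close> below.\<close>

definition perm_equiv :: "'a ^ 'q \<Rightarrow> 'a ^ 'q \<Rightarrow> bool" where
  "perm_equiv x y \<longleftrightarrow> (\<exists>\<sigma>. \<sigma> permutes UNIV \<and> y = (\<chi> i. x $ \<sigma> i))"

lemma equivp_perm_equiv: "equivp (perm_equiv :: 'a ^ 'q \<Rightarrow> 'a ^ 'q \<Rightarrow> bool)"
proof (rule equivpI)
  show "reflp (perm_equiv :: 'a ^ 'q \<Rightarrow> 'a ^ 'q \<Rightarrow> bool)"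
    unfolding reflp_def perm_equiv_def by (auto intro!: exI[of _ id] permutes_id)
  show "symp (perm_equiv :: 'a ^ 'q \<Rightarrow> 'a ^ 'q \<Rightarrow> bool)"
  proof (rule sympI)
    fix x y :: "'a ^ 'q" assume "perm_equiv x y"
    then obtain \<sigma> where \<sigma>: "\<sigma> permutes UNIV" and y: "y = (\<chi> i. x $ \<sigma> i)"
      unfolding perm_equiv_def by blast
    have "x = (\<chi> i. y $ inv \<sigma> i)"
      by (simp add: y vec_eq_iff permutes_inverses[OF \<sigma>])
    then show "perm_equiv y x"
      unfolding perm_equiv_def using permutes_inv[OF \<sigma>] by blast
  qed
  show "transp (perm_equiv :: 'a ^ 'q \<Rightarrow> 'a ^ 'q \<Rightarrow> bool)"
  proof (rule transpI)
    fix x y z :: "'a ^ 'q" assume "perm_equiv x y" "perm_equiv y z"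
    then obtain \<sigma> \<tau> where \<sigma>: "\<sigma> permutes UNIV" and y: "y = (\<chi> i. x $ \<sigma> i)"
      and \<tau>: "\<tau> permutes UNIV" and z: "z = (\<chi> i. y $ \<tau> i)"
      unfolding perm_equiv_def by blast
    have "z = (\<chi> i. x $ (\<sigma> \<circ> \<tau>) i)"
      by (simp add: y z vec_eq_iff)
    then show "perm_equiv x z"
      unfolding perm_equiv_def using permutes_compose[OF \<tau> \<sigma>] by blast
  qed
qed

quotient_type ('a, 'q) utuple = "'a ^ 'q::finite" / perm_equiv
  morphisms rep_utuple unordered
  by (rule equivp_perm_equiv)

definition match_cost :: "'a::metric_space ^ 'q \<Rightarrow> 'a ^ 'q \<Rightarrow> ('q \<Rightarrow> 'q) \<Rightarrow> real" where
  "match_cost x y \<sigma> = sqrt (\<Sum>i\<in>UNIV. (dist (x $ i) (y $ \<sigma> i))\<^sup>2)"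

definition match_dist :: "'a::metric_space ^ 'q \<Rightarrow> 'a ^ 'q \<Rightarrow> real" where
  "match_dist x y = Min (match_cost x y ` {\<sigma>. \<sigma> permutes UNIV})"

lemma finite_perms: "finite {\<sigma>::'q::finite \<Rightarrow> 'q. \<sigma> permutes UNIV}"
  by (simp add: finite_permutations)

lemma match_dist_le: "\<sigma> permutes UNIV \<Longrightarrow> match_dist x y \<le> match_cost x y \<sigma>"
  unfolding match_dist_def by (rule Min_le) (auto simp: finite_perms)

lemma match_dist_attained:
  obtains \<sigma> where "\<sigma> permutes UNIV" "match_dist x y = match_cost x y \<sigma>"
proof -
  have "match_dist x y \<in> match_cost x y ` {\<sigma>. \<sigma> permutes UNIV}"
    unfolding match_dist_def
    by (rule Min_in) (auto simp: finite_perms intro: permutes_id)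
  then show ?thesis using that by auto
qed

lemma match_cost_reindex:
  assumes "\<rho> permutes UNIV"
  shows "match_cost x y \<sigma> = sqrt (\<Sum>i\<in>UNIV. (dist (x $ \<rho> i) (y $ \<sigma> (\<rho> i)))\<^sup>2)"
  unfolding match_cost_def
  using sum.permute[OF assms, of "\<lambda>i. (dist (x $ i) (y $ \<sigma> i))\<^sup>2"] by (simp add: o_def)

lemma match_dist_sym: "match_dist x y = match_dist y x"
proof -
  have le: "match_dist y x \<le> match_dist x y" for x y :: "'a::metric_space ^ 'q"
  proof -
    obtain \<sigma> where \<sigma>: "\<sigma> permutes UNIV" "match_dist x y = match_cost x y \<sigma>"
      by (rule match_dist_attained)
    have "match_cost y x (inv \<sigma>) = match_cost x y \<sigma>"
      unfolding match_cost_reindex[OF \<sigma>(1), of y x]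
      by (simp add: match_cost_def permutes_inverses[OF \<sigma>(1)] dist_commute)
    then show ?thesis
      using match_dist_le[OF permutes_inv[OF \<sigma>(1)], of y x] \<sigma>(2) by simp
  qed
  show ?thesis using le[of x y] le[of y x] by simp
qed

lemma match_dist_perm_right:
  fixes x y y' :: "'a::metric_space ^ 'q"
  assumes "perm_equiv y y'" shows "match_dist x y = match_dist x y'"
proof -
  have le: "match_dist x y \<le> match_dist x y'" if yy': "perm_equiv y y'" for y y' :: "'a ^ 'q"
  proof -
    obtain \<tau> where \<tau>: "\<tau> permutes UNIV" "y' = (\<chi> i. y $ \<tau> i)"
      using yy' unfolding perm_equiv_def by blast
    obtain \<sigma> where \<sigma>: "\<sigma> permutes UNIV" "match_dist x y' = match_cost x y' \<sigma>"
      by (rule match_dist_attained)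
    have "match_cost x y (\<tau> \<circ> \<sigma>) = match_cost x y' \<sigma>"
      by (simp add: match_cost_def \<tau>(2))
    then show ?thesis
      using match_dist_le[OF permutes_compose[OF \<sigma>(1) \<tau>(1)], of x y] \<sigma>(2) by simp
  qed
  show ?thesis
    using le[OF assms] le[OF equivp_symp[OF equivp_perm_equiv assms]] by simp
qed

lemma match_dist_eq_0: "match_dist x y = 0 \<longleftrightarrow> perm_equiv x y"
proof
  assume 0: "match_dist x y = 0"
  obtain \<sigma> where \<sigma>: "\<sigma> permutes UNIV" "match_dist x y = match_cost x y \<sigma>"
    by (rule match_dist_attained)
  have "x = (\<chi> i. y $ \<sigma> i)"
    using 0 \<sigma>(2) by (simp add: match_cost_def vec_eq_iff sum_nonneg_eq_0_iff)
  then have "perm_equiv y x"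
    unfolding perm_equiv_def using \<sigma>(1) by blast
  then show "perm_equiv x y" by (rule equivp_symp[OF equivp_perm_equiv])
next
  assume eq: "perm_equiv x y"
  have "match_dist x x \<le> match_cost x x id"
    by (rule match_dist_le) (rule permutes_id)
  moreover have "match_cost x x id = 0" by (simp add: match_cost_def)
  moreover have "match_dist x x \<ge> 0"
  proof -
    obtain \<sigma> where "match_dist x x = match_cost x x \<sigma>" by (rule match_dist_attained)
    then show ?thesis by (simp add: match_cost_def sum_nonneg)
  qed
  ultimately show "match_dist x y = 0"
    using match_dist_perm_right[OF eq, of x] by simp
qed

lemma match_dist_triangle: "match_dist x z \<le> match_dist x y + match_dist y z"
proof -
  obtain \<sigma> where \<sigma>: "\<sigma> permutes UNIV" "match_dist x y = match_cost x y \<sigma>"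
    by (rule match_dist_attained)
  obtain \<tau> where \<tau>: "\<tau> permutes UNIV" "match_dist y z = match_cost y z \<tau>"
    by (rule match_dist_attained)
  have "match_dist x z \<le> match_cost x z (\<tau> \<circ> \<sigma>)"
    by (rule match_dist_le) (rule permutes_compose[OF \<sigma>(1) \<tau>(1)])
  also have "\<dots> = L2_set (\<lambda>i. dist (x $ i) (z $ \<tau> (\<sigma> i))) UNIV"
    by (simp add: match_cost_def L2_set_def)
  also have "\<dots> \<le> L2_set (\<lambda>i. dist (x $ i) (y $ \<sigma> i) + dist (y $ \<sigma> i) (z $ \<tau> (\<sigma> i))) UNIV"
    by (rule L2_set_mono) (auto intro: dist_triangle)
  also have "\<dots> \<le> L2_set (\<lambda>i. dist (x $ i) (y $ \<sigma> i)) UNIV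
      + L2_set (\<lambda>i. dist (y $ \<sigma> i) (z $ \<tau> (\<sigma> i))) UNIV"
    by (rule L2_set_triangle_ineq)
  also have "\<dots> = match_cost x y \<sigma> + match_cost y z \<tau>"
    unfolding match_cost_reindex[OF \<sigma>(1), of y z] by (simp add: match_cost_def L2_set_def)
  finally show ?thesis using \<sigma>(2) \<tau>(2) by simp
qed

instantiation utuple :: (metric_space, finite) metric_space
begin

lift_definition dist_utuple :: "('a, 'b) utuple \<Rightarrow> ('a, 'b) utuple \<Rightarrow> real" is match_dist
  using match_dist_perm_right match_dist_sym by metis

definition uniformity_utuple :: "(('a, 'b) utuple \<times> ('a, 'b) utuple) filter" where
  "uniformity_utuple = (INF e\<in>{0<..}. principal {(x, y). dist x y < e})"

definition open_utuple :: "('a, 'b) utuple set \<Rightarrow> bool" where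
  "open_utuple S = (\<forall>x\<in>S. \<forall>\<^sub>F (x', y) in uniformity. x' = x \<longrightarrow> y \<in> S)"

instance
proof
  fix x y z :: "('a, 'b) utuple"
  show "dist x y = 0 \<longleftrightarrow> x = y"
    by transfer (rule match_dist_eq_0)
  show "dist x y \<le> dist x z + dist y z"
    by transfer (metis match_dist_triangle match_dist_sym)
qed (simp_all add: uniformity_utuple_def open_utuple_def)

end

section \<open>Approximate differentiability\<close>

definition density_zero :: "'a::euclidean_space set \<Rightarrow> 'a \<Rightarrow> bool" where
  "density_zero S a \<longleftrightarrow>
     ((\<lambda>r. measure lebesgue (S \<inter> cball a r) / measure lebesgue (cball a r)) \<longlongrightarrow> 0) (at_right 0)"

definition affine_map :: "('a::real_vector \<Rightarrow> 'b::real_vector) \<Rightarrow> bool" where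
  "affine_map A \<longleftrightarrow> linear (\<lambda>x. A x - A 0)"

text \<open>A map with domain \<open>U\<close> is represented by a total function, of which only the values on \<open>U\<close>
  are relevant.\<close>

definition borel_map_on :: "'a::topological_space set \<Rightarrow> ('a \<Rightarrow> 'b::topological_space) \<Rightarrow> bool" where
  "borel_map_on U f \<longleftrightarrow> f \<in> borel_measurable (restrict_space borel U)"

definition approx_affine_at ::
  "(real ^ 'm) set \<Rightarrow> (real ^ 'm \<Rightarrow> ('h::real_normed_vector, 'q::finite) utuple) \<Rightarrow> real ^ 'm
    \<Rightarrow> (real ^ 'm \<Rightarrow> 'h) ^ 'q \<Rightarrow> bool" where
  "approx_affine_at U f a A \<longleftrightarrow>
     (\<forall>i. affine_map (A $ i)) \<and>
     (\<forall>\<epsilon>>0. density_zero {x \<in> U. dist (f x) (unordered (\<chi> i. (A $ i) x)) > \<epsilon> * norm (x - a)} a)"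

definition approx_differentiable ::
  "(real ^ 'm) set \<Rightarrow> (real ^ 'm \<Rightarrow> ('h::real_normed_vector, 'q::finite) utuple) \<Rightarrow> real ^ 'm \<Rightarrow> bool"
  where
  "approx_differentiable U f a \<longleftrightarrow> borel_map_on U f \<and> a \<in> U \<and> (\<exists>A. approx_affine_at U f a A)"

text \<open>The approximate derivative is an unordered tuple of linear maps. It is only meaningful at
  points of approximate differentiability; elsewhere it is set to \<open>Q[[0]]\<close>.\<close>

definition approx_deriv ::
  "(real ^ 'm) set \<Rightarrow> (real ^ 'm \<Rightarrow> ('h::real_normed_vector, 'q::finite) utuple) \<Rightarrow> real ^ 'm
    \<Rightarrow> (real ^ 'm \<Rightarrow> 'h, 'q) utuple" where
  "approx_deriv U f a =
     (if approx_differentiable U f a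
      then THE T. \<exists>A. approx_affine_at U f a A \<and> T = unordered (\<chi> i. (\<lambda>x. (A $ i) x - (A $ i) 0))
      else unordered (\<chi> i. (\<lambda>x. 0)))"

lift_definition utuple_HS_norm :: "(real ^ 'm \<Rightarrow> 'h::real_normed_vector, 'q::finite) utuple \<Rightarrow> real"
  is "\<lambda>L. sqrt (\<Sum>i\<in>UNIV. \<Sum>j\<in>UNIV. (norm ((L $ i) (axis j 1)))\<^sup>2)"
proof -
  fix L L' :: "(real ^ 'm \<Rightarrow> 'h) ^ 'q" assume "perm_equiv L L'"
  then obtain \<sigma> where \<sigma>: "\<sigma> permutes UNIV" "L' = (\<chi> i. L $ \<sigma> i)"
    unfolding perm_equiv_def by blast
  show "sqrt (\<Sum>i\<in>UNIV. \<Sum>j\<in>UNIV. (norm ((L $ i) (axis j 1)))\<^sup>2)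
      = sqrt (\<Sum>i\<in>UNIV. \<Sum>j\<in>UNIV. (norm ((L' $ i) (axis j 1)))\<^sup>2)"
    using sum.permute[OF \<sigma>(1), of "\<lambda>i. \<Sum>j\<in>UNIV. (norm ((L $ i) (axis j 1)))\<^sup>2"]
    by (simp add: \<sigma>(2) o_def)
qed

text \<open>\<open>deriv_integral p U f V\<close> is the integral over \<open>V\<close> of the \<open>p\<close>-th power of \<open>|Df|\<close>, for
  a map \<open>f\<close> with domain \<open>U\<close>.\<close>

definition deriv_integral ::
  "real \<Rightarrow> (real ^ 'm) set \<Rightarrow> (real ^ 'm \<Rightarrow> ('h::real_normed_vector, 'q::finite) utuple)
    \<Rightarrow> (real ^ 'm) set \<Rightarrow> ennreal" where
  "deriv_integral p U f V =
     (\<integral>\<^sup>+x\<in>V. ennreal (utuple_HS_norm (approx_deriv U f x) powr p) \<partial>lebesgue)"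

section \<open>Lebesgue and Sobolev classes, energy\<close>

definition Lp_class ::
  "real \<Rightarrow> (real ^ 'm) set \<Rightarrow> (real ^ 'm \<Rightarrow> ('h::real_normed_vector, 'q::finite) utuple) set" where
  "Lp_class p U =
     {f. borel_map_on U f \<and>
         (\<integral>\<^sup>+x\<in>U. ennreal (dist (f x) (unordered (\<chi> i. 0)) powr p) \<partial>lebesgue) < \<infinity>}"

text \<open>The \<open>p\<close>-th root of an infinite integral is \<open>\<infinity>\<close>.\<close>

definition Lp_dist ::
  "real \<Rightarrow> (real ^ 'm) set \<Rightarrow> (real ^ 'm \<Rightarrow> ('h::real_normed_vector, 'q::finite) utuple)
    \<Rightarrow> (real ^ 'm \<Rightarrow> ('h, 'q) utuple) \<Rightarrow> ennreal" where
  "Lp_dist p U f g =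
     (let I = (\<integral>\<^sup>+x\<in>U. ennreal (dist (f x) (g x) powr p) \<partial>lebesgue)
      in if I = \<infinity> then \<infinity> else ennreal (enn2real I powr (1 / p)))"

definition lipschitz_map_on :: "'a::metric_space set \<Rightarrow> ('a \<Rightarrow> 'b::metric_space) \<Rightarrow> bool" where
  "lipschitz_map_on U f \<longleftrightarrow> (\<exists>C. C-lipschitz_on U f)"

definition W1p_class ::
  "real \<Rightarrow> (real ^ 'm) set \<Rightarrow> (real ^ 'm \<Rightarrow> ('h::real_normed_vector, 'q::finite) utuple) set" where
  "W1p_class p U =
     {f \<in> Lp_class p U.
        \<exists>F. (\<forall>j::nat. lipschitz_map_on UNIV (F j)) \<and>
            (SUP j. deriv_integral p UNIV (F j) U) < \<infinity> \<and>
            (\<lambda>j. Lp_dist p U f (F j)) \<longlonglongrightarrow> 0}"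

text \<open>The \<open>p\<close>-th power of the \<open>p\<close>-energy on \<open>V\<close> of a map \<open>f\<close> with domain \<open>U\<close>. The approximating
  maps are Lipschitz on \<open>U\<close> and converge on all of \<open>U\<close>, not only on \<open>V\<close>.\<close>

definition p_energy ::
  "real \<Rightarrow> (real ^ 'm) set \<Rightarrow> (real ^ 'm \<Rightarrow> ('h::real_normed_vector, 'q::finite) utuple)
    \<Rightarrow> (real ^ 'm) set \<Rightarrow> ennreal" where
  "p_energy p U f V =
     (INF F \<in> {F. (\<forall>j::nat. lipschitz_map_on U (F j)) \<and> (\<lambda>j. Lp_dist p U f (F j)) \<longlonglongrightarrow> 0}.
        liminf (\<lambda>j. deriv_integral p U (F j) V))"

end

theory Submission
  imports Defs
begin

text \<open>
  Lower bound: almost all of the ball is a countable disjoint union of pieces on which \<open>f\<close> is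
  isometric to a Lipschitz map into \<open>H\<^sup>Q\<close>, because a tuple with well separated values has a
  neighbourhood that is isometric to a ball of \<open>H\<^sup>k\<close> in its stratum. Rademacher's theorem
  on the pieces gives \<open>Df\<close>, and \<open>|\<partial>\<^sub>j f|\<close> is the limit of the metric difference quotients of \<open>f\<close>.
  These pass to limits of Lipschitz maps in the mean, so \<open>\<integral>\<^sub>E |\<partial>\<^sub>j f|\<close> is lower semicontinuous for every
  measurable \<open>E\<close>, and by convexity so is the \<open>p\<close>-energy.

  Upper bound: let \<open>G\<close> be the lower limit of the maximal functions of \<open>|Df\<^sub>j|\<close>. On
  \<open>{G \<le> \<lambda>}\<close> the map \<open>f\<close> has Lipschitz constant \<open>O(\<lambda>)\<close>, and the complement has measure \<open>o(\<lambda>\<^sup>-\<^sup>p)\<close>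
  along \<open>\<lambda> = 2\<^sup>n\<close>. A Lipschitz extension from a closed subset therefore has the derivative of \<open>f\<close>
  on that subset and an error energy \<open>O(\<lambda>\<^sup>p) o(\<lambda>\<^sup>-\<^sup>p)\<close> elsewhere.
\<close>

section \<open>Unordered tuples\<close>

text \<open>The space of tuples has no linear structure and is not locally compact, so neither weak
  derivatives of \<open>f\<close> nor compactness of its values is available. A tuple-valued map has
  in general no Lipschitz selection; lifts exist on Borel pieces only, and derivatives are read off
  at density points of the pieces. The lower bound becomes linear because \<open>|Df|\<close> is the
  Euclidean norm of the vector of the numbers \<open>|\<partial>_j f|\<close>, each of them a purely
  metric speed: no weak limit is taken in the Hilbert space, and convexity is used only for
  nonnegative vectors of length \<open>m\<close>. As the lifts have values in an infinite
  dimensional space, Rademacher's theorem is proved through mean convergence of dyadic difference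
  quotients, where Pythagoras replaces compactness. The upper bound needs extensions whose Lipschitz
  constant is a fixed multiple of the given one, since the error is the p-th power of that constant
  times a measure. Tuples cannot be averaged linearly, so the extension fills simplices by
  cones.\<close>

lemma dist_unordered: "dist (unordered x) (unordered y) = match_dist x y"
  by transfer simp

lemma unordered_eq_iff: "unordered x = unordered y \<longleftrightarrow> perm_equiv x y"
  by (simp add: utuple.abs_eq_iff)

lemma unordered_surj: "\<exists>y. T = unordered y"
  by (metis Quotient3_abs_rep Quotient3_utuple)

lemma unordered_permute: "\<sigma> permutes UNIV \<Longrightarrow> unordered (\<chi> i. x $ \<sigma> i) = unordered x"
  by (metis unordered_eq_iff perm_equiv_def)

lemma match_cost_vec: "match_cost x y \<sigma> = dist x (\<chi> i. y $ \<sigma> i)"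
  by (simp add: match_cost_def dist_vec_def L2_set_def)

lemma dist_unordered_le: "dist (unordered x) (unordered y) \<le> dist x y"
  using match_dist_le[OF permutes_id, of x y]
  by (simp add: dist_unordered match_cost_vec)

lemma nearest_perm:
  obtains \<sigma> where "\<sigma> permutes UNIV" "dist (unordered x) (unordered y) = dist x (\<chi> i. y $ \<sigma> i)"
  using match_dist_attained[of x y] unfolding dist_unordered match_cost_vec by metis

lemma nearest_lift:
  obtains y where "T = unordered y" "dist (unordered x) T = dist x y"
  by (metis nearest_perm unordered_permute unordered_surj)

lemma continuous_unordered: "continuous_on S unordered"
  unfolding continuous_on_iff by (meson dist_unordered_le le_less_trans)


lemma norm_vec_le_sum: "norm (x :: 'a::real_normed_vector ^ 'n::finite) \<le> (\<Sum>i\<in>UNIV. norm (x $ i))"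
  unfolding norm_vec_def by (rule L2_set_le_sum) simp

section \<open>Sheets: sets of tuples that lift isometrically to the product space\<close>

definition well_separated :: "'a::metric_space ^ 'q \<Rightarrow> real \<Rightarrow> bool" where
  "well_separated t r \<longleftrightarrow> (\<forall>i j. t $ i \<noteq> t $ j \<longrightarrow> 4 * r < dist (t $ i) (t $ j))"

text \<open>The equality pattern of \<open>t\<close> is imposed on \<open>y\<close>, so the set is a
  ball in the stratum of \<open>t\<close>; without it a tuple that splits a multiple value would
  have several lifts. The factor 4 in \<open>well_separated\<close> is the sum of two displacements
  by at most \<open>r\<close> and a matching distance of at most \<open>2 * r\<close>.\<close>

definition sheets :: "'a::metric_space ^ 'q::finite \<Rightarrow> real \<Rightarrow> ('a ^ 'q) set" where
  "sheets t r = {y. dist t y \<le> r \<and> (\<forall>i j. t $ i = t $ j \<longrightarrow> y $ i = y $ j)}"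

text \<open>An optimal matching moves each entry by at most \<open>2 * r\<close>, so by separation
  it only permutes indices on which \<open>t\<close> has the same value. On those \<open>y'\<close>
  is constant, and the matching acts as the identity.\<close>

lemma sheets_isometry:
  assumes "well_separated t r" "y \<in> sheets t r" "y' \<in> sheets t r"
  shows "dist (unordered y) (unordered y') = dist y y'"
proof -
  obtain \<sigma> where \<sigma>: "\<sigma> permutes UNIV" "dist (unordered y) (unordered y') = dist y (\<chi> i. y' $ \<sigma> i)"
    by (rule nearest_perm)
  have yt: "dist t y \<le> r" "dist t y' \<le> r" using assms by (auto simp: sheets_def)
  have "dist y (\<chi> i. y' $ \<sigma> i) \<le> dist y y'"
    using \<sigma>(2) dist_unordered_le[of y y'] by simp
  also have "\<dots> \<le> 2 * r" using dist_triangle3[of y y' t] yt by linarith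
  finally have d: "dist y (\<chi> i. y' $ \<sigma> i) \<le> 2 * r" .
  have "y' $ \<sigma> i = y' $ i" for i
  proof -
    have 1: "dist (t $ i) (y $ i) \<le> r" using dist_vec_nth_le[of t i y] yt by linarith
    have 2: "dist (t $ \<sigma> i) (y' $ \<sigma> i) \<le> r" using dist_vec_nth_le[of t "\<sigma> i" y'] yt by linarith
    have 3: "dist (y $ i) (y' $ \<sigma> i) \<le> 2 * r"
      using dist_vec_nth_le[of y i "\<chi> i. y' $ \<sigma> i"] d by simp
    have "dist (t $ i) (t $ \<sigma> i) \<le> 4 * r"
      using dist_triangle[of "t $ i" "t $ \<sigma> i" "y $ i"] dist_triangle2[of "y $ i" "t $ \<sigma> i" "y' $ \<sigma> i"] 1 2 3
      by linarith
    then have "t $ i = t $ \<sigma> i" using assms(1) unfolding well_separated_def by (meson not_le)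
    moreover have "t $ i = t $ \<sigma> i \<Longrightarrow> y' $ i = y' $ \<sigma> i"
      using assms(3) unfolding sheets_def by blast
    ultimately show ?thesis by metis
  qed
  then have "(\<chi> i. y' $ \<sigma> i) = y'" by (simp add: vec_eq_iff)
  then show ?thesis using \<sigma>(2) by simp
qed

lemma well_separated_exists: "\<exists>r>0. well_separated (t :: 'a::metric_space ^ 'q::finite) r"
proof -
  \<comment> \<open>The inserted 1 keeps the set nonempty when all entries of \<open>t\<close>
    coincide.\<close>
  define S where "S = insert 1 ((\<lambda>(i,j). dist (t $ i) (t $ j)) ` {(i,j). t $ i \<noteq> t $ j})"
  have fin: "finite S" by (simp add: S_def)
  have pos: "Min S > 0" by (subst Min_gr_iff) (auto simp: S_def)
  have "well_separated t (Min S / 8)"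
    unfolding well_separated_def
  proof (intro allI impI)
    fix i j assume "t $ i \<noteq> t $ j"
    then have "Min S \<le> dist (t $ i) (t $ j)" by (intro Min_le[OF fin]) (auto simp: S_def)
    then show "4 * (Min S / 8) < dist (t $ i) (t $ j)" using pos by linarith
  qed
  then show ?thesis using pos by (intro exI[of _ "Min S / 8"]) auto
qed

lemma closed_sheets: "closed (sheets t r)"
proof -
  have eq: "sheets t r = cball t r \<inter> (\<Inter>i. \<Inter>j\<in>{j. t $ i = t $ j}. {y. y $ i = y $ j})"
    by (auto simp: sheets_def)
  have cl: "closed {y::'a^'b. y $ i = y $ j}" for i j
    by (intro closed_Collect_eq continuous_on_component continuous_on_id)
  show ?thesis unfolding eq
    by (rule closed_Int[OF closed_cball], rule closed_INT, rule ballI, rule closed_INT, rule ballI, rule cl)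
qed

text \<open>By \<open>sheets_isometry\<close> a convergent sequence of tuples lifts to a Cauchy
  sequence, and completeness gives its limit a lift. Closedness is wanted so that preimages of the
  sheets under a Borel map are Borel.\<close>

lemma closed_unordered_sheets:
  fixes t :: "'a::complete_space ^ 'q::finite"
  assumes "well_separated t r"
  shows "closed (unordered ` sheets t r)"
  unfolding closed_sequential_limits
proof (intro allI impI, elim conjE)
  fix x l assume x: "\<forall>n. x n \<in> unordered ` sheets t r" and lim: "x \<longlonglongrightarrow> l"
  from x have "\<forall>n. \<exists>y. y \<in> sheets t r \<and> x n = unordered y" by blast
  then obtain y where y: "\<And>n. y n \<in> sheets t r" "\<And>n. x n = unordered (y n)"
    by metis
  have "Cauchy x" using lim by (simp add: LIMSEQ_imp_Cauchy)
  then have "Cauchy y"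
    unfolding Cauchy_def y(2) using sheets_isometry[OF assms y(1) y(1)] by simp
  then obtain l' where l': "y \<longlonglongrightarrow> l'" by (meson Cauchy_convergent convergent_def)
  have in_l: "l' \<in> sheets t r"
    using closed_sequentially[OF closed_sheets _ l'] y(1) by auto
  have "(\<lambda>n. unordered (y n)) \<longlonglongrightarrow> unordered l'"
    using continuous_on_tendsto_compose[OF continuous_unordered[of UNIV] l'] by simp
  then have "x \<longlonglongrightarrow> unordered l'" using y(2) by presburger
  then have "l = unordered l'" using LIMSEQ_unique lim by blast
  then show "l \<in> unordered ` sheets t r" using in_l by blast
qed

lemma countable_vec:
  assumes "countable D" shows "countable {t :: 'a ^ 'q::finite. \<forall>i. t $ i \<in> D}"
proof -
  have 1: "countable (PiE (UNIV::'q set) (\<lambda>_. D))"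
    by (rule countable_PiE) (use assms in simp_all)
  have "countable ((vec_lambda :: ('q \<Rightarrow> 'a) \<Rightarrow> 'a ^ 'q) ` (PiE (UNIV::'q set) (\<lambda>_. D)))"
    by (rule countable_image[OF 1])
  moreover have "{t :: 'a ^ 'q. \<forall>i. t $ i \<in> D} \<subseteq> vec_lambda ` (PiE (UNIV::'q set) (\<lambda>_. D))"
  proof
    fix t :: "'a ^ 'q" assume "t \<in> {t. \<forall>i. t $ i \<in> D}"
    then have "vec_nth t \<in> PiE UNIV (\<lambda>_. D)" by (auto simp: PiE_def)
    then show "t \<in> vec_lambda ` (PiE (UNIV::'q set) (\<lambda>_. D))" by (metis imageI vec_nth_inverse)
  qed
  ultimately show ?thesis by (rule countable_subset[rotated])
qed

text \<open>Each entry is replaced by a function of its value, so equal entries stay equal. This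
  gives a centre from a countable set the stratum of \<open>y\<close>, once \<open>e\<close> is
  small compared with the gaps of \<open>y\<close>.\<close>

lemma dense_vec:
  fixes y :: "'a::metric_space ^ 'q::finite"
  assumes D: "\<forall>X::'a set. open X \<longrightarrow> X \<noteq> {} \<longrightarrow> (\<exists>d\<in>D. d \<in> X)" and "e > 0"
  shows "\<exists>t. (\<forall>i. t $ i \<in> D) \<and> dist t y < e \<and> (\<forall>i j. y $ i = y $ j \<longrightarrow> t $ i = t $ j)"
proof -
  define e' where "e' = e / real (CARD('q))"
  have e': "e' > 0" using assms by (simp add: e'_def)
  have "\<exists>d\<in>D. d \<in> ball v e'" for v :: 'a using D e' by force
  then obtain \<tau> where \<tau>: "\<And>v. \<tau> v \<in> D" "\<And>v. dist v (\<tau> v) < e'" by (metis mem_ball)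
  have "dist (\<chi> i. \<tau> (y $ i)) y \<le> (\<Sum>i\<in>UNIV. dist (\<tau> (y $ i)) (y $ i))"
    unfolding dist_vec_def by (rule order_trans[OF L2_set_le_sum]) auto
  also have "\<dots> < (\<Sum>i\<in>(UNIV::'q set). e')"
    using \<tau>(2) by (intro sum_strict_mono) (auto simp: dist_commute)
  also have "\<dots> = e" by (simp add: e'_def)
  finally show ?thesis using \<tau>(1) by (intro exI[of _ "\<chi> i. \<tau> (y $ i)"]) simp
qed

lemma countable_sheet_cover:
  obtains I :: "((('a::{metric_space,second_countable_topology}) ^ ('q::finite)) \<times> real) set"
  where "countable I" "\<And>t r. (t, r) \<in> I \<Longrightarrow> r > 0 \<and> well_separated t r"
    "(\<Union>(t,r)\<in>I. unordered ` sheets t r) = UNIV"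
proof -
  obtain D :: "'a set" where D: "countable D" "\<forall>X. open X \<longrightarrow> X \<noteq> {} \<longrightarrow> (\<exists>d\<in>D. d \<in> X)"
    using countable_dense_exists by auto
  define I where "I = {(t::'a^'q, r). (\<forall>i. t $ i \<in> D) \<and> r \<in> \<rat> \<and> r > 0 \<and> well_separated t r}"
  have "countable ({t :: 'a ^ 'q. \<forall>i. t $ i \<in> D} \<times> \<rat>)"
    by (intro countable_SIGMA countable_vec D countable_rat)
  then have cI: "countable I" by (rule countable_subset[rotated]) (auto simp: I_def)
  have "T \<in> (\<Union>(t,r)\<in>I. unordered ` sheets t r)" for T
  proof -
    obtain y where y: "T = unordered y" using unordered_surj by blast
    obtain s where s: "s > 0" "well_separated y s" using well_separated_exists by blast
    \<comment> \<open>The gaps of \<open>y\<close> exceed \<open>4 * s\<close>; moving both ends by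
      less than \<open>r < s / 4\<close> leaves gaps above \<open>4 * r\<close>, so the approximate
      centre is well separated and has exactly the equality pattern of \<open>y\<close>.\<close>
    obtain r where r: "r \<in> \<rat>" "0 < r" "r < s / 4" using Rats_dense_in_real[of 0 "s/4"] s by auto
    obtain t where t0: "(\<forall>i. t $ i \<in> D) \<and> dist t y < r \<and> (\<forall>i j. y $ i = y $ j \<longrightarrow> t $ i = t $ j)"
      using dense_vec[OF D(2) r(2), of y] ..
    then have t: "\<And>i. t $ i \<in> D" "dist t y < r" "\<And>i j. y $ i = y $ j \<Longrightarrow> t $ i = t $ j"
      by blast+
    have sep: "4 * r < dist (t $ i) (t $ j) \<and> y $ i \<noteq> y $ j" if "y $ i \<noteq> y $ j" for i j
    proof -
      have "4 * s < dist (y $ i) (y $ j)" using s that by (auto simp: well_separated_def)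
      moreover have "dist (t $ i) (y $ i) < r" "dist (t $ j) (y $ j) < r"
        using dist_vec_nth_le[of t i y] dist_vec_nth_le[of t j y] t(2) by linarith+
      ultimately show ?thesis
        using dist_triangle[of "y $ i" "y $ j" "t $ i"] dist_triangle[of "t $ i" "y $ j" "t $ j"] r that s
        by (simp add: dist_commute)
    qed
    have "well_separated t r" unfolding well_separated_def using sep t(3) by metis
    moreover have "y \<in> sheets t r"
    proof -
      have "y $ i = y $ j" if "t $ i = t $ j" for i j
      proof (rule ccontr)
        assume "y $ i \<noteq> y $ j"
        from sep[OF this] that r(2) show False by simp
      qed
      then show ?thesis unfolding sheets_def mem_Collect_eq using t(2) less_imp_le by blast
    qed
    ultimately have "(t, r) \<in> I \<and> T \<in> unordered ` sheets t r" using t(1) r y unfolding I_def by blast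
    then show ?thesis by blast
  qed
  then have cov: "(\<Union>(t,r)\<in>I. unordered ` sheets t r) = UNIV" by blast
  show ?thesis by (rule that[OF cI _ cov]) (simp add: I_def)
qed

text \<open>Separability of the space of tuples makes the distance between two Borel tuple-valued
  maps a Borel function.\<close>

instance utuple :: ("{metric_space,second_countable_topology}", finite) second_countable_topology
proof
  obtain D :: "'a set" where D: "countable D" "\<forall>X. open X \<longrightarrow> X \<noteq> {} \<longrightarrow> (\<exists>d\<in>D. d \<in> X)"
    using countable_dense_exists by auto
  define B where "B = (\<lambda>(t::'a^'b, r). ball (unordered t) r) ` ({t. \<forall>i. t $ i \<in> D} \<times> \<rat>)"
  have "countable B" unfolding B_def by (intro countable_image countable_SIGMA countable_vec D countable_rat)
  moreover have "topological_basis B"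
  proof (rule topological_basisI)
    show "open b" if "b \<in> B" for b using that by (auto simp: B_def)
    fix O' :: "('a,'b) utuple set" and x assume "open O'" "x \<in> O'"
    then obtain e where e: "e > 0" "ball x e \<subseteq> O'" by (meson openE)
    obtain y where y: "x = unordered y" using unordered_surj by blast
    obtain r where r: "r \<in> \<rat>" "0 < r" "r < e / 2" using Rats_dense_in_real[of 0 "e/2"] e by auto
    obtain t where t0: "(\<forall>i. t $ i \<in> D) \<and> dist t y < r \<and> (\<forall>i j. y $ i = y $ j \<longrightarrow> t $ i = t $ j)"
      using dense_vec[OF D(2) r(2), of y] ..
    then have t: "\<And>i. t $ i \<in> D" "dist t y < r"
      by blast+
    have d: "dist (unordered t) x < r" using dist_unordered_le[of t y] t y by simp
    have "ball (unordered t) r \<subseteq> ball x e"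
    proof
      fix z assume "z \<in> ball (unordered t) r"
      then show "z \<in> ball x e" using d r(3) dist_triangle2[of x z "unordered t"]
          dist_triangle[of x z "unordered t"] by (simp add: dist_commute)
    qed
    then show "\<exists>B'\<in>B. x \<in> B' \<and> B' \<subseteq> O'" using e d t r
      unfolding B_def by (intro bexI[of _ "ball (unordered t) r"]) auto
  qed
  ultimately show "\<exists>B::('a,'b) utuple set set. countable B \<and> open = generate_topology B"
    using topological_basis_imp_subbasis by blast
qed

section \<open>Lipschitz cones\<close>

text \<open>Every ball of radius \<open>R\<close> contracts to a point with speed proportional to \<open>R\<close>; balls of
  Hilbert space contract linearly, balls of \<open>Q\<close>-tuples contract towards cluster centres.\<close>

definition has_cones :: "'x::metric_space itself \<Rightarrow> real \<Rightarrow> bool" where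
  "has_cones T \<kappa> \<longleftrightarrow> \<kappa> \<ge> 0 \<and> (\<forall>(x0::'x) R. R \<ge> 0 \<longrightarrow> (\<exists>K :: real \<Rightarrow> 'x \<Rightarrow> 'x. (\<forall>x. K 1 x = x) \<and>
     (\<forall>x\<in>cball x0 R. \<forall>x'\<in>cball x0 R. \<forall>s\<in>{0..1}. \<forall>s'\<in>{0..1}.
        dist (K s x) (K s' x') \<le> s * dist x x' + \<kappa> * R * \<bar>s - s'\<bar>)))"

lemma has_cones_normed: "has_cones TYPE('a::real_normed_vector) 1"
  unfolding has_cones_def
proof (intro conjI allI impI)
  fix x0 :: 'a and R :: real assume "R \<ge> 0"
  have "dist (x0 + s *\<^sub>R (x - x0)) (x0 + s' *\<^sub>R (x' - x0)) \<le> s * dist x x' + 1 * R * \<bar>s - s'\<bar>"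
    if "x' \<in> cball x0 R" "s \<in> {0..1}" for x x' s s'
  proof -
    have "dist (x0 + s *\<^sub>R (x - x0)) (x0 + s' *\<^sub>R (x' - x0)) = norm (s *\<^sub>R (x - x') + (s - s') *\<^sub>R (x' - x0))"
      by (simp add: dist_norm algebra_simps)
    also have "\<dots> \<le> s * norm (x - x') + \<bar>s - s'\<bar> * norm (x' - x0)"
      using that by (intro norm_triangle_le) auto
    also have "\<dots> \<le> s * norm (x - x') + \<bar>s - s'\<bar> * R"
      using that by (intro add_left_mono mult_left_mono) (auto simp: dist_norm norm_minus_commute)
    finally show ?thesis by (simp add: dist_norm mult.commute)
  qed
  then show "\<exists>K. (\<forall>x. K 1 x = x) \<and>
     (\<forall>x\<in>cball x0 R. \<forall>x'\<in>cball x0 R. \<forall>s\<in>{0..1}. \<forall>s'\<in>{0..1}.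
        dist (K s x) (K s' x') \<le> s * dist x x' + 1 * R * \<bar>s - s'\<bar>)"
    by (intro exI[of _ "\<lambda>s x. x0 + s *\<^sub>R (x - x0)"]) auto
qed simp

text \<open>The entries of \<open>t\<close> are grouped into clusters, and each cluster contracts to
  one of its own points. Two tuples within \<open>R\<close> of \<open>t\<close> are matched inside
  the clusters, so the contraction respects the matching, and the clusters have diameter of order
  \<open>R\<close>, which bounds the radial speed.\<close>

lemma has_cones_utuple:
  "has_cones TYPE(('h::real_normed_vector, 'q::finite) utuple) (real CARD('q) * (1 + 4 * real (CARD('q) ^ 2)))"
  (is "has_cones _ ?\<kappa>")
  unfolding has_cones_def
proof (intro conjI allI impI)
  fix x0 :: "('h,'q) utuple" and R :: real assume R: "R \<ge> 0"
  obtain t where t: "x0 = unordered t" using unordered_surj by blast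
  \<comment> \<open>Matched entries of two tuples in the ball differ by at most
    \<open>2 * R\<close>, so they come from entries of \<open>t\<close> at distance at most
    \<open>R + 2 * R + R\<close>.\<close>
  define E where "E = {(i,j). dist (t $ i) (t $ j) \<le> 4 * R}"
  have symE: "sym E" by (auto simp: E_def sym_def dist_commute)
  have cE: "card E \<le> CARD('q) ^ 2"
    using card_mono[of "UNIV \<times> UNIV :: ('q \<times> 'q) set" E]
    by (simp add: card_cartesian_product power2_eq_square)
  \<comment> \<open>The choice depends on \<open>i\<close> only through the set of indices reachable
    from it, so it is constant on each cluster.\<close>
  define c where "c i = t $ (SOME j. (i, j) \<in> E\<^sup>*)" for i
  have c_eq: "c i = c j" if "(i, j) \<in> E" for i j
  proof -
    have "(i, k) \<in> E\<^sup>* \<longleftrightarrow> (j, k) \<in> E\<^sup>*" for k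
      by (meson converse_rtrancl_into_rtrancl symD[OF symE] that)
    then show ?thesis by (simp add: c_def)
  qed
  have pow: "(i, j) \<in> E ^^ n \<Longrightarrow> dist (t $ i) (t $ j) \<le> 4 * R * real n" for i j n
  proof (induction n arbitrary: j)
    case (Suc n)
    then obtain k where k: "(i, k) \<in> E ^^ n" "(k, j) \<in> E" by auto
    then have "dist (t $ i) (t $ k) \<le> 4 * R * real n" "dist (t $ k) (t $ j) \<le> 4 * R"
      using Suc by (auto simp: E_def)
    then show ?case using dist_triangle[of "t $ i" "t $ j" "t $ k"] by (simp add: algebra_simps)
  qed simp
  have c_dist: "dist (t $ i) (c i) \<le> 4 * R * real (CARD('q) ^ 2)" for i
  proof -
    have "(i, SOME j. (i, j) \<in> E\<^sup>*) \<in> E\<^sup>*" by (rule someI[of _ i]) simp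
    \<comment> \<open>A path in a finite relation can be taken with at most \<open>card E\<close>
      edges, and each edge costs \<open>4 * R\<close>.\<close>
    then obtain n where n: "n \<le> card E" "(i, SOME j. (i, j) \<in> E\<^sup>*) \<in> E ^^ n"
      using rtrancl_finite_eq_relpow[of E] by auto
    have "dist (t $ i) (c i) \<le> 4 * R * real n" using pow[OF n(2)] by (simp add: c_def)
    also have "\<dots> \<le> 4 * R * real (CARD('q) ^ 2)"
      using n(1) cE R by (intro mult_left_mono) linarith+
    finally show ?thesis .
  qed
  have "\<forall>T. \<exists>y. T = unordered y \<and> dist (unordered t) T = dist t y" by (metis nearest_lift)
  then obtain l where l: "\<And>T. T = unordered (l T)" "\<And>T. dist (unordered t) T = dist t (l T)" by metis
  define K where "K s T = (unordered (\<chi> i. c i + s *\<^sub>R (l T $ i - c i)))" for s T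
  have K1: "K 1 T = T" for T
    using l(1)[of T] by (simp add: K_def)
  have "dist (K s T) (K s' T') \<le> s * dist T T' + ?\<kappa> * R * \<bar>s - s'\<bar>"
    if T: "T \<in> cball x0 R" and T': "T' \<in> cball x0 R" and s: "s \<in> {0..1}" "s' \<in> {0..1}" for T T' s s'
  proof -
    obtain \<sigma> where \<sigma>: "\<sigma> permutes UNIV" "dist T T' = dist (l T) (\<chi> i. l T' $ \<sigma> i)"
      using nearest_perm[of "l T" "l T'"] l(1) by metis
    have lt: "dist t (l T) \<le> R" "dist t (l T') \<le> R" using l(2) T T' t by auto
    have "dist T T' \<le> 2 * R" using T T' dist_triangle3[of T T' x0] by auto
    then have b3: "dist (l T $ i) (l T' $ \<sigma> i) \<le> 2 * R" for i
      using dist_vec_nth_le[of "l T" i "\<chi> i. l T' $ \<sigma> i"] \<sigma>(2) by simp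
    have b1: "dist (t $ i) (l T $ i) \<le> R" for i using dist_vec_nth_le[of t i "l T"] lt by linarith
    have b2: "dist (t $ i) (l T' $ i) \<le> R" for i using dist_vec_nth_le[of t i "l T'"] lt by linarith
    \<comment> \<open>The matching stays within clusters, so matched entries contract to the same
      centre.\<close>
    have ceq: "c (\<sigma> i) = c i" for i
    proof -
      have "dist (t $ i) (t $ \<sigma> i) \<le> 4 * R"
        using dist_triangle[of "t $ i" "t $ \<sigma> i" "l T $ i"]
          dist_triangle2[of "l T $ i" "t $ \<sigma> i" "l T' $ \<sigma> i"] b1[of i] b2[of "\<sigma> i"] b3[of i] by linarith
      then show ?thesis using c_eq[of i "\<sigma> i"] by (simp add: E_def)
    qed
    have "K s' T' = unordered (\<chi> i. c i + s' *\<^sub>R (l T' $ \<sigma> i - c i))"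
      using unordered_permute[OF \<sigma>(1), of "\<chi> i. c i + s' *\<^sub>R (l T' $ i - c i)"] by (simp add: K_def ceq)
    then have "dist (K s T) (K s' T') \<le> dist (\<chi> i. c i + s *\<^sub>R (l T $ i - c i)) (\<chi> i. c i + s' *\<^sub>R (l T' $ \<sigma> i - c i))"
      using dist_unordered_le by (simp add: K_def)
    also have "\<dots> = norm (s *\<^sub>R (l T - (\<chi> i. l T' $ \<sigma> i)) + (s - s') *\<^sub>R (\<chi> i. l T' $ \<sigma> i - c i))"
      unfolding dist_norm by (rule arg_cong[of _ _ norm]) (simp add: vec_eq_iff algebra_simps)
    also have "\<dots> \<le> s * dist T T' + \<bar>s - s'\<bar> * norm (\<chi> i. l T' $ \<sigma> i - c i)"
      using s by (intro norm_triangle_le) (auto simp: \<sigma>(2) dist_norm)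
    also have "\<dots> \<le> s * dist T T' + \<bar>s - s'\<bar> * (\<Sum>i\<in>(UNIV::'q set). R * (1 + 4 * real (CARD('q) ^ 2)))"
    proof (intro add_left_mono mult_left_mono order_trans[OF norm_vec_le_sum] sum_mono)
      fix i :: 'q
      have "norm (l T' $ \<sigma> i - c i) \<le> dist (t $ \<sigma> i) (l T' $ \<sigma> i) + dist (t $ \<sigma> i) (c (\<sigma> i))"
        using dist_triangle3[of "l T' $ \<sigma> i" "c (\<sigma> i)" "t $ \<sigma> i"] by (simp add: ceq dist_norm)
      also have "\<dots> \<le> R + 4 * R * real (CARD('q) ^ 2)" by (intro add_mono b2 c_dist)
      finally show "norm ((\<chi> i. l T' $ \<sigma> i - c i) $ i) \<le> R * (1 + 4 * real (CARD('q) ^ 2))"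
        by (simp add: algebra_simps)
    qed auto
    also have "\<dots> = s * dist T T' + ?\<kappa> * R * \<bar>s - s'\<bar>" by simp
    finally show ?thesis .
  qed
  then show "\<exists>K. (\<forall>x. K 1 x = x) \<and>
     (\<forall>x\<in>cball x0 R. \<forall>x'\<in>cball x0 R. \<forall>s\<in>{0..1}. \<forall>s'\<in>{0..1}.
        dist (K s x) (K s' x') \<le> s * dist x x' + ?\<kappa> * R * \<bar>s - s'\<bar>)"
    using K1 by blast
qed simp

section \<open>Extension of Lipschitz maps\<close>

definition support :: "('i \<Rightarrow> real) \<Rightarrow> 'i set" where
  "support w = {v. w v \<noteq> 0}"

definition spread :: "('i \<Rightarrow> 'x::metric_space) \<Rightarrow> 'i set \<Rightarrow> real" where
  "spread T S = Max ((\<lambda>(u, v). dist (T u) (T v)) ` (S \<times> S))"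

lemma dist_le_spread: "finite S \<Longrightarrow> u \<in> S \<Longrightarrow> v \<in> S \<Longrightarrow> dist (T u) (T v) \<le> spread T S"
  unfolding spread_def by (rule Max_ge) force+

lemma spread_le:
  assumes "finite S" "S \<noteq> {}" "\<And>u v. u \<in> S \<Longrightarrow> v \<in> S \<Longrightarrow> dist (T u) (T v) \<le> d"
  shows "spread T S \<le> d"
  unfolding spread_def using assms by (subst Max_le_iff) auto

lemma spread_nonneg: "finite S \<Longrightarrow> S \<noteq> {} \<Longrightarrow> spread T S \<ge> 0"
  using dist_le_spread zero_le_dist by (metis all_not_in_conv order_trans)

lemma spread_mono: "finite S \<Longrightarrow> S' \<noteq> {} \<Longrightarrow> S' \<subseteq> S \<Longrightarrow> spread T S' \<le> spread T S"
  by (rule spread_le) (auto intro: dist_le_spread finite_subset)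

text \<open>Distance, in units of the spread, from the filling of a simplex with \<open>k\<close>
  vertices to its vertices. The boundary of a simplex with \<open>Suc k\<close> vertices lies in the
  ball of radius \<open>cone_radius \<kappa> k + 1\<close> about the base vertex; coning moves
  points by at most \<kappa> times that radius, and the last 1 leads from the base to another
  vertex.\<close>

fun cone_radius :: "real \<Rightarrow> nat \<Rightarrow> real" where
  "cone_radius \<kappa> 0 = 0"
| "cone_radius \<kappa> (Suc k) = (\<kappa> + 1) * (cone_radius \<kappa> k + 1) + 1"

text \<open>The bracket is the Lipschitz constant on the boundary of the simplex, the factor 2
  before it is the expansion in \<open>face_proj_diff\<close>, and the last term is the radial speed
  of the cone.\<close>

fun cone_lip :: "real \<Rightarrow> nat \<Rightarrow> real" where
  "cone_lip \<kappa> 0 = 0"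
| "cone_lip \<kappa> (Suc k) = 2 * (2 * cone_lip \<kappa> k + 2 * cone_radius \<kappa> k + 1) + \<kappa> * (cone_radius \<kappa> k + 1)"

lemma cone_radius_nonneg: "\<kappa> \<ge> 0 \<Longrightarrow> cone_radius \<kappa> k \<ge> 0"
  by (induction k) auto

lemma cone_radius_Suc: "\<kappa> \<ge> 0 \<Longrightarrow> cone_radius \<kappa> k \<le> cone_radius \<kappa> (Suc k)"
proof -
  assume k: "\<kappa> \<ge> 0"
  have "cone_radius \<kappa> k + 1 \<le> (\<kappa> + 1) * (cone_radius \<kappa> k + 1)"
    using mult_right_mono[of 1 "\<kappa> + 1" "cone_radius \<kappa> k + 1"] k cone_radius_nonneg[OF k, of k] by simp
  then show ?thesis by simp
qed

lemma cone_radius_mono: "\<kappa> \<ge> 0 \<Longrightarrow> j \<le> k \<Longrightarrow> cone_radius \<kappa> j \<le> cone_radius \<kappa> k"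
  using lift_Suc_mono_le[of "cone_radius \<kappa>"] cone_radius_Suc by blast

lemma cone_lip_nonneg: "\<kappa> \<ge> 0 \<Longrightarrow> cone_lip \<kappa> k \<ge> 0"
  by (induction k) (auto simp: cone_radius_nonneg)

lemma cone_lip_mono: "\<kappa> \<ge> 0 \<Longrightarrow> j \<le> k \<Longrightarrow> cone_lip \<kappa> j \<le> cone_lip \<kappa> k"
proof (rule lift_Suc_mono_le[of "cone_lip \<kappa>"])
  fix k assume k: "\<kappa> \<ge> 0"
  have "\<kappa> * (cone_radius \<kappa> k + 1) \<ge> 0" using k cone_radius_nonneg[OF k, of k] by simp
  then show "cone_lip \<kappa> k \<le> cone_lip \<kappa> (Suc k)"
    using cone_lip_nonneg[OF k, of k] cone_radius_nonneg[OF k, of k] by simp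
qed

text \<open>The boundary consists of simplices with one vertex less, whence
  \<open>card S - 1\<close>; the extra 1 is the way from a vertex to the base vertex.\<close>

definition cone_ball :: "real \<Rightarrow> ('i \<Rightarrow> 'x::metric_space) \<Rightarrow> 'i set \<Rightarrow> real" where
  "cone_ball \<kappa> T S = (cone_radius \<kappa> (card S - 1) + 1) * spread T S"

text \<open>Interpolation of the values \<open>T\<close> over the simplex with weights normalised by
  \<open>max w = 1\<close>: the point with weights \<open>w\<close> lies on the segment from the barycentre of its face
  (all weights \<open>1\<close>) to the point \<open>(w - min w) / (1 - min w)\<close> of the boundary of that face, and the
  face is filled by coning off the boundary values.\<close>

function cone_map :: "('x \<Rightarrow> real \<Rightarrow> real \<Rightarrow> 'x \<Rightarrow> 'x) \<Rightarrow> real \<Rightarrow> ('i \<Rightarrow> 'x::metric_space) \<Rightarrow>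
    ('i \<Rightarrow> real) \<Rightarrow> 'x" where
  "cone_map K \<kappa> T w =
    (let S = support w; m = Min (w ` S); b = T (SOME v. v \<in> S) in
     if finite S \<and> S \<noteq> {} \<and> m < 1
     then K b (cone_ball \<kappa> T S) (1 - m) (cone_map K \<kappa> T (\<lambda>v. if v \<in> S then (w v - m) / (1 - m) else 0))
     else K b (cone_ball \<kappa> T S) 0 b)"
  by pat_completeness auto
termination
proof (relation "Wellfounded.measure (\<lambda>(K, \<kappa>, T, w). card (support w))", goal_cases)
  case (2 K \<kappa> T w S m b)
  then have S: "finite S" "S \<noteq> {}" by auto
  have "Min (w ` S) \<in> w ` S" using S by (intro Min_in) auto
  then obtain v where "Min (w ` S) = w v" "v \<in> S" by (rule imageE)
  with 2 have v: "v \<in> S" "w v = m" by simp_all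
  \<comment> \<open>Subtracting the minimum removes at least the vertex where it is attained, so the
    recursion descends to proper faces.\<close>
  have "support (\<lambda>v. if v \<in> S then (w v - m) / (1 - m) else 0) \<subseteq> S - {v}"
    using v by (auto simp: support_def split: if_splits)
  then have "card (support (\<lambda>v. if v \<in> S then (w v - m) / (1 - m) else 0)) < card S"
    using S v by (meson card_Diff1_less card_mono finite_Diff le_less_trans)
  then show ?case using 2 by simp
qed auto

declare cone_map.simps[simp del]

definition simplex_weights :: "'i set \<Rightarrow> ('i \<Rightarrow> real) set" where
  "simplex_weights S = {w. support w \<subseteq> S \<and> (\<forall>v. 0 \<le> w v \<and> w v \<le> 1) \<and> (\<exists>v\<in>S. w v = 1)}"

lemma simplex_weights_mono: "S \<subseteq> S' \<Longrightarrow> simplex_weights S \<subseteq> simplex_weights S'"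
  by (auto simp: simplex_weights_def)

lemma simplex_weights_Diff:
  "w \<in> simplex_weights S \<Longrightarrow> w v = 0 \<Longrightarrow> w \<in> simplex_weights (S - {v})"
  by (force simp: simplex_weights_def support_def)

locale cone_interp =
  fixes K :: "'x::metric_space \<Rightarrow> real \<Rightarrow> real \<Rightarrow> 'x \<Rightarrow> 'x" and \<kappa> :: real
  assumes \<kappa>: "\<kappa> \<ge> 0" and K1: "\<And>x0 R x. R \<ge> 0 \<Longrightarrow> K x0 R 1 x = x"
    and K: "\<And>x0 R x x' s s'. R \<ge> 0 \<Longrightarrow> x \<in> cball x0 R \<Longrightarrow> x' \<in> cball x0 R \<Longrightarrow> s \<in> {0..1} \<Longrightarrow> s' \<in> {0..1} \<Longrightarrow>
        dist (K x0 R s x) (K x0 R s' x') \<le> s * dist x x' + \<kappa> * R * \<bar>s - s'\<bar>"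
begin

abbreviation "\<Phi> \<equiv> cone_map K \<kappa>"

definition face_min :: "'i set \<Rightarrow> ('i \<Rightarrow> real) \<Rightarrow> real" where
  "face_min S w = Min (w ` S)"

definition face_proj :: "'i set \<Rightarrow> ('i \<Rightarrow> real) \<Rightarrow> 'i \<Rightarrow> real" where
  "face_proj S w = (\<lambda>v. if v \<in> S then (w v - face_min S w) / (1 - face_min S w) else 0)"

definition base :: "('i \<Rightarrow> 'x) \<Rightarrow> 'i set \<Rightarrow> 'x" where
  "base T S = T (SOME v. v \<in> S)"

definition cone_arg :: "('i \<Rightarrow> 'x) \<Rightarrow> 'i set \<Rightarrow> ('i \<Rightarrow> real) \<Rightarrow> 'x" where
  "cone_arg T S w = (if face_min S w < 1 then \<Phi> T (face_proj S w) else base T S)"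

lemma face_min:
  assumes "finite S" "w \<in> simplex_weights S"
  shows "0 \<le> face_min S w" "face_min S w \<le> 1" "\<And>v. v \<in> S \<Longrightarrow> face_min S w \<le> w v"
    "\<exists>v\<in>S. w v = face_min S w"
proof -
  have ne: "w ` S \<noteq> {}" "finite (w ` S)" using assms by (auto simp: simplex_weights_def)
  then have "Min (w ` S) \<in> w ` S" by (intro Min_in) auto
  then show "\<exists>v\<in>S. w v = face_min S w" by (auto simp: face_min_def)
  then show "0 \<le> face_min S w" "face_min S w \<le> 1" using assms by (auto simp: simplex_weights_def) metis+
  show "face_min S w \<le> w v" if "v \<in> S" for v using that ne by (auto simp: face_min_def)
qed

lemma face_proj:
  assumes "finite S" "w \<in> simplex_weights S" "face_min S w < 1"
  shows "\<exists>v\<in>S. face_proj S w \<in> simplex_weights (S - {v})"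
proof -
  obtain v where v: "v \<in> S" "w v = face_min S w" using face_min[OF assms(1,2)] by blast
  have "face_proj S w \<in> simplex_weights S"
    using assms face_min[OF assms(1,2)]
    by (auto simp: simplex_weights_def face_proj_def support_def divide_simps)
  then show ?thesis using v by (intro bexI[of _ v] simplex_weights_Diff) (auto simp: face_proj_def)
qed

text \<open>The face \<open>S\<close> may be larger than the support of \<open>w\<close>. Then the
  minimum over \<open>S\<close> is 0, the projection fixes \<open>w\<close>, and the cone at
  parameter 1 is the identity. Thus the fillings of different faces are compatible, and two weights
  can be compared in one common face.\<close>

lemma cone_map_eq:
  assumes S: "finite S" and w: "w \<in> simplex_weights S"
  shows "\<Phi> T w = K (base T S) (cone_ball \<kappa> T S) (1 - face_min S w) (cone_arg T S w)"
proof (cases "support w = S")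
  case True
  then have "S \<noteq> {}" using w by (auto simp: simplex_weights_def)
  then show ?thesis
    using True S face_min(2)[OF S w]
    by (subst cone_map.simps) (simp add: Let_def cone_arg_def base_def face_proj_def face_min_def[symmetric])
next
  case False
  have Sne: "S \<noteq> {}" using w by (auto simp: simplex_weights_def)
  have pos: "cone_ball \<kappa> T S \<ge> 0"
    using cone_radius_nonneg[OF \<kappa>, of "card S - 1"] spread_nonneg[OF S Sne, of T] unfolding cone_ball_def
    by (intro mult_nonneg_nonneg) auto
  obtain v where v: "v \<in> S" "w v = 0" using False w by (auto simp: simplex_weights_def support_def)
  then have m: "face_min S w = 0" using face_min[OF S w] by fastforce
  have "face_proj S w = w"
    using w by (auto simp: face_proj_def m simplex_weights_def support_def fun_eq_iff)
  then show ?thesis using m K1[OF pos] by (simp add: cone_arg_def)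
qed

text \<open>The projection to the boundary expands by a factor of order
  \<open>1 / (1 - face_min S w)\<close>, which the contraction factor
  \<open>1 - face_min S w\<close> of the cone cancels. Only the minimum of \<open>w\<close> may
  occur in the bound, because the asymmetric cone inequality offers only one of the two
  factors.\<close>

lemma face_proj_diff:
  assumes S: "finite S" and w: "w \<in> simplex_weights S" and u: "u \<in> simplex_weights S"
    and lt: "face_min S w < 1" "face_min S u < 1"
    and \<epsilon>: "\<And>v. v \<in> S \<Longrightarrow> \<bar>w v - u v\<bar> \<le> \<epsilon>"
  shows "\<bar>face_proj S w v - face_proj S u v\<bar> \<le> 2 * \<epsilon> / (1 - face_min S w)"
    and "\<bar>face_min S w - face_min S u\<bar> \<le> \<epsilon>"
proof -
  define m n where "m = face_min S w" and "n = face_min S u"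
  have "w \<in> simplex_weights S" by fact
  obtain a where a: "a \<in> S" "w a = m" using face_min[OF S w] m_def by blast
  obtain b where b: "b \<in> S" "u b = n" using face_min[OF S u] n_def by blast
  have "n \<le> u a" "m \<le> w b" using a b face_min[OF S w] face_min[OF S u] by (auto simp: m_def n_def)
  then have mn: "\<bar>m - n\<bar> \<le> \<epsilon>" using \<epsilon>[OF a(1)] \<epsilon>[OF b(1)] a b by linarith
  then show "\<bar>face_min S w - face_min S u\<bar> \<le> \<epsilon>" by (simp add: m_def n_def)
  have e0: "\<epsilon> \<ge> 0" using mn by linarith
  have lt': "m < 1" "n < 1" using lt by (simp_all add: m_def n_def)
  show "\<bar>face_proj S w v - face_proj S u v\<bar> \<le> 2 * \<epsilon> / (1 - face_min S w)"
  proof (cases "v \<in> S")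
    case True
    define t where "t = (u v - n) / (1 - n)"
    have t: "0 \<le> t" "t \<le> 1" using face_min[OF S u] True u lt'
      by (auto simp: t_def n_def simplex_weights_def divide_simps)
    have fu: "face_proj S u v = t" using True by (simp add: face_proj_def n_def t_def)
    have fw: "(1 - m) * face_proj S w v = w v - m"
      using lt' True by (simp add: face_proj_def m_def[symmetric])
    have "t * (1 - n) = u v - n" using lt' by (simp add: t_def)
    \<comment> \<open>Multiplying by \<open>1 - m\<close> alone, and not by both denominators,
      expresses the difference by the change of the weight and \<open>1 - t\<close> times the change
      of the minimum.\<close>
    then have tn: "(1 - m) * t = (u v - n) - t * (m - n)" by (simp add: algebra_simps)
    have "(1 - m) * (face_proj S w v - face_proj S u v) = (w v - m) - (1 - m) * t"
      by (simp only: right_diff_distrib fw fu)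
    also note tn
    finally have "(1 - m) * (face_proj S w v - face_proj S u v) = (w v - u v) - (1 - t) * (m - n)"
      by (simp add: algebra_simps)
    moreover have "\<bar>(1 - t) * (m - n)\<bar> \<le> 1 * \<epsilon>"
      unfolding abs_mult using t mn by (intro mult_mono) auto
    ultimately have "\<bar>(1 - m) * (face_proj S w v - face_proj S u v)\<bar> \<le> 2 * \<epsilon>"
      using \<epsilon>[OF True] by linarith
    then show ?thesis using lt' by (simp add: abs_mult m_def[symmetric] pos_le_divide_eq mult.commute)
  next
    case False
    then show ?thesis using e0 lt by (simp add: face_proj_def)
  qed
qed

text \<open>Simultaneous induction on the number of vertices: closeness to the vertices places the
  boundary values in the ball of radius \<open>cone_ball \<kappa> T S\<close>, where the cone
  inequality applies, and the Lipschitz bound on proper faces yields the one on the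
  boundary.\<close>

lemma cone_map_lipschitz:
  fixes T :: "'i \<Rightarrow> 'x"
  assumes "finite S" "card S = k"
  shows "w \<in> simplex_weights S \<Longrightarrow> v \<in> S \<Longrightarrow> dist (\<Phi> T w) (T v) \<le> cone_radius \<kappa> k * spread T S"
    and "w \<in> simplex_weights S \<Longrightarrow> u \<in> simplex_weights S \<Longrightarrow> (\<And>v. v \<in> S \<Longrightarrow> \<bar>w v - u v\<bar> \<le> \<epsilon>) \<Longrightarrow>
       dist (\<Phi> T w) (\<Phi> T u) \<le> cone_lip \<kappa> k * spread T S * \<epsilon>"
  using assms
proof (induction k arbitrary: S w u v \<epsilon>)
  case 0
  { case 1 then show ?case by (auto simp: simplex_weights_def) }
  { case 2 then show ?case by (auto simp: simplex_weights_def) }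
next
  case (Suc k)
  have main: "cone_arg T S w \<in> cball (base T S) (cone_ball \<kappa> T S) \<and> base T S \<in> cball (base T S) (cone_ball \<kappa> T S)
    \<and> (\<forall>v\<in>S. dist (base T S) (T v) \<le> spread T S) \<and> cone_ball \<kappa> T S = (cone_radius \<kappa> k + 1) * spread T S
    \<and> cone_ball \<kappa> T S \<ge> 0"
    if S: "finite S" "card S = Suc k" and w: "w \<in> simplex_weights S" for S w
  proof -
    have Sne: "S \<noteq> {}" using S by auto
    have sp: "spread T S \<ge> 0" by (rule spread_nonneg[OF S(1) Sne])
    have "(SOME v. v \<in> S) \<in> S" using Sne by (simp add: some_in_eq)
    then have bs: "dist (base T S) (T v) \<le> spread T S" if "v \<in> S" for v
      unfolding base_def using dist_le_spread[OF S(1)] that by blast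
    have R: "cone_ball \<kappa> T S = (cone_radius \<kappa> k + 1) * spread T S" by (simp add: cone_ball_def S)
    have pos: "cone_ball \<kappa> T S \<ge> 0" using cone_radius_nonneg[OF \<kappa>, of k] sp R by simp
    have "dist (base T S) (cone_arg T S w) \<le> cone_ball \<kappa> T S"
    proof (cases "face_min S w < 1")
      case True
      obtain a where a: "a \<in> S" "face_proj S w \<in> simplex_weights (S - {a})"
        using face_proj[OF S(1) w True] by blast
      then obtain c where c: "c \<in> S - {a}" by (auto simp: simplex_weights_def)
      have "dist (\<Phi> T (face_proj S w)) (T c) \<le> cone_radius \<kappa> k * spread T (S - {a})"
        by (rule Suc.IH(1)[OF a(2) c]) (use S a in auto)
      also have "\<dots> \<le> cone_radius \<kappa> k * spread T S"
        using c by (intro mult_left_mono spread_mono cone_radius_nonneg[OF \<kappa>] S) auto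
      finally show ?thesis
        using bs[of c] c dist_triangle2[of "base T S" "\<Phi> T (face_proj S w)" "T c"] True
        by (simp add: R cone_arg_def algebra_simps)
    qed (use pos in \<open>simp add: cone_arg_def\<close>)
    then show ?thesis using bs R pos by simp
  qed
  \<comment> \<open>The two points lie in the faces opposite \<open>a\<close> and \<open>b\<close>;
    they are to be joined through the intersection of these faces.\<close>
  have lipB: "dist (\<Phi> T w) (\<Phi> T u) \<le> (2 * cone_lip \<kappa> k + 2 * cone_radius \<kappa> k + 1) * spread T S * \<delta>"
    if S: "finite S" "card S = Suc k" and a: "a \<in> S" "w \<in> simplex_weights (S - {a})"
      and b: "b \<in> S" "u \<in> simplex_weights (S - {b})" and \<delta>: "\<And>v. \<bar>w v - u v\<bar> \<le> \<delta>" for S w u a b \<delta>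
  proof -
    have Sne: "S \<noteq> {}" using a by auto
    have sp: "spread T S \<ge> 0" by (rule spread_nonneg[OF S(1) Sne])
    have d0: "\<delta> \<ge> 0" using \<delta>[of a] by linarith
    have cL: "cone_lip \<kappa> k \<ge> 0" "cone_radius \<kappa> k \<ge> 0" using cone_lip_nonneg cone_radius_nonneg \<kappa> by auto
    have IH2: "dist (\<Phi> T w') (\<Phi> T u') \<le> cone_lip \<kappa> k * spread T S * \<delta>"
      if c: "c \<in> S" "w' \<in> simplex_weights (S - {c})" "u' \<in> simplex_weights (S - {c})"
        "\<And>v. \<bar>w' v - u' v\<bar> \<le> \<delta>" for w' u' c
    proof -
      have "dist (\<Phi> T w') (\<Phi> T u') \<le> cone_lip \<kappa> k * spread T (S - {c}) * \<delta>"
        by (rule Suc.IH(2)[OF c(2,3)]) (use c(4) S c in auto)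
      also have "\<dots> \<le> cone_lip \<kappa> k * spread T S * \<delta>"
        using c d0 cL S(1) by (intro mult_right_mono mult_left_mono spread_mono) (auto simp: simplex_weights_def)
      finally show ?thesis .
    qed
    have P: "0 \<le> cone_lip \<kappa> k * spread T S * \<delta>" "0 \<le> cone_radius \<kappa> k * spread T S * \<delta>" "0 \<le> spread T S * \<delta>"
      using cL sp d0 by simp_all
    have E: "(2 * cone_lip \<kappa> k + 2 * cone_radius \<kappa> k + 1) * spread T S * \<delta> =
      2 * (cone_lip \<kappa> k * spread T S * \<delta>) + 2 * (cone_radius \<kappa> k * spread T S * \<delta>) + spread T S * \<delta>"
      by (simp add: algebra_simps)
    \<comment> \<open>Clearing the weight at \<open>b\<close> moves \<open>w\<close> into the
      intersection at cost at most \<delta>, since \<open>u b = 0\<close>. A vertex of weight 1 must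
      survive this, so \<open>w b = 1\<close> is separate: then \<open>\<delta> \<ge> 1\<close>, and
      the bound on the diameter of the filling suffices.\<close>
    have "w b \<le> 1" using a(2) by (auto simp: simplex_weights_def)
    then consider "w b = 0" | "w b = 1" | "w b \<noteq> 0" "w b < 1" by fastforce
    then show ?thesis
    proof cases
      case 1
      have "w \<in> simplex_weights S" using a(2) simplex_weights_mono[of "S - {a}" S] by blast
      then have "w \<in> simplex_weights (S - {b})" using 1 by (rule simplex_weights_Diff)
      from IH2[OF b(1) this b(2) \<delta>] show ?thesis using P unfolding E by linarith
    next
      case 2
      have "u b = 0" using b(2) by (auto simp: simplex_weights_def support_def)
      then have "\<delta> \<ge> 1" using \<delta>[of b] 2 by simp
      obtain c where c: "c \<in> S - {a}" using a(2) by (auto simp: simplex_weights_def)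
      obtain e where e: "e \<in> S - {b}" using b(2) by (auto simp: simplex_weights_def)
      have 1: "dist (\<Phi> T w) (T c) \<le> cone_radius \<kappa> k * spread T S"
        by (rule order_trans[OF Suc.IH(1)[OF a(2) c]])
          (use S a c cL in \<open>auto intro!: mult_left_mono spread_mono\<close>)
      have 2: "dist (\<Phi> T u) (T e) \<le> cone_radius \<kappa> k * spread T S"
        by (rule order_trans[OF Suc.IH(1)[OF b(2) e]])
          (use S b e cL in \<open>auto intro!: mult_left_mono spread_mono\<close>)
      have 3: "dist (T c) (T e) \<le> spread T S" using c e S by (intro dist_le_spread) auto
      have "dist (\<Phi> T w) (\<Phi> T u) \<le> (2 * cone_radius \<kappa> k + 1) * spread T S"
        using 1 2 3 dist_triangle[of "\<Phi> T w" "\<Phi> T u" "T c"] dist_triangle2[of "T c" "\<Phi> T u" "T e"]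
        by (simp add: algebra_simps)
      also have "\<dots> \<le> (2 * cone_radius \<kappa> k + 1) * spread T S * \<delta>"
        using mult_left_mono[OF \<open>\<delta> \<ge> 1\<close>, of "(2 * cone_radius \<kappa> k + 1) * spread T S"] cL sp by simp
      also have "\<dots> = 2 * (cone_radius \<kappa> k * spread T S * \<delta>) + spread T S * \<delta>"
        by (simp add: algebra_simps)
      finally show ?thesis using P unfolding E by linarith
    next
      case 3
      define \<nu> where "\<nu> = w(b := 0)"
      have ub: "u b = 0" using b(2) by (auto simp: simplex_weights_def support_def)
      have wa: "w a = 0" using a(2) by (auto simp: simplex_weights_def support_def)
      have nu: "\<nu> \<in> simplex_weights S"
      proof -
        obtain c where c: "c \<in> S" "w c = 1" using a(2) by (auto simp: simplex_weights_def)
        then have "c \<noteq> b" using 3 by auto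
        then have "\<exists>v\<in>S. \<nu> v = 1" using c by (intro bexI[of _ c]) (auto simp: \<nu>_def)
        moreover have "support \<nu> \<subseteq> S" "\<forall>v. 0 \<le> \<nu> v \<and> \<nu> v \<le> 1"
          using a(2) by (auto simp: \<nu>_def simplex_weights_def support_def)
        ultimately show ?thesis by (simp add: simplex_weights_def)
      qed
      have "\<nu> \<in> simplex_weights (S - {a})" "\<nu> \<in> simplex_weights (S - {b})"
        using simplex_weights_Diff[OF nu] wa by (auto simp: \<nu>_def)
      moreover have "\<bar>w v - \<nu> v\<bar> \<le> \<delta>" "\<bar>\<nu> v - u v\<bar> \<le> \<delta>" for v
        using \<delta>[of v] d0 ub by (auto simp: \<nu>_def)
      ultimately have "dist (\<Phi> T w) (\<Phi> T \<nu>) \<le> cone_lip \<kappa> k * spread T S * \<delta>"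
        "dist (\<Phi> T \<nu>) (\<Phi> T u) \<le> cone_lip \<kappa> k * spread T S * \<delta>"
        using IH2[OF a(1) a(2)] IH2[OF b(1) _ b(2)] by blast+
      then show ?thesis using P dist_triangle[of "\<Phi> T w" "\<Phi> T u" "\<Phi> T \<nu>"] unfolding E by linarith
    qed
  qed
  { case 1
    note m = main[OF 1(3,4,1)]
    define x s R where "x = cone_arg T S w" and "s = 1 - face_min S w" and "R = cone_ball \<kappa> T S"
    have s: "s \<in> {0..1}" using face_min[OF 1(3) 1(1)] by (auto simp: s_def)
    have "dist (\<Phi> T w) x = dist (K (base T S) R s x) (K (base T S) R 1 x)"
      using cone_map_eq[OF 1(3) 1(1)] K1 m by (simp add: x_def s_def R_def)
    also have "\<dots> \<le> s * dist x x + \<kappa> * R * \<bar>s - 1\<bar>"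
      using s m by (intro K) (auto simp: x_def R_def)
    also have "\<dots> \<le> \<kappa> * R * 1" using s m \<kappa> by (auto simp: R_def intro!: mult_left_le)
    finally have "dist (\<Phi> T w) x \<le> \<kappa> * R" by simp
    moreover have "dist (base T S) x \<le> R" using m by (simp add: x_def R_def)
    moreover have "dist (base T S) (T v) \<le> spread T S" using m 1 by blast
    ultimately have "dist (\<Phi> T w) (T v) \<le> (\<kappa> + 1) * R + spread T S"
      using dist_triangle[of "\<Phi> T w" "T v" x] dist_triangle[of x "T v" "base T S"]
      by (simp add: algebra_simps dist_commute)
    also have "\<dots> = cone_radius \<kappa> (Suc k) * spread T S" using m by (simp add: R_def algebra_simps)
    finally show ?case . }
  { case 2
    note m = main[OF 2(4,5,1)] and m' = main[OF 2(4,5,2)]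
    define R s s' where "R = cone_ball \<kappa> T S" and "s = 1 - face_min S w" and "s' = 1 - face_min S u"
    have R: "R \<ge> 0" "R = (cone_radius \<kappa> k + 1) * spread T S" using m by (auto simp: R_def)
    have s: "s \<in> {0..1}" "s' \<in> {0..1}"
      using face_min[OF 2(4) 2(1)] face_min[OF 2(4) 2(2)] by (auto simp: s_def s'_def)
    obtain v0 where v0: "v0 \<in> S" using 2 by (auto simp: simplex_weights_def)
    have e0: "\<epsilon> \<ge> 0" using 2(3)[OF v0] by linarith
    have sp: "spread T S \<ge> 0" using v0 2(4) by (intro spread_nonneg) auto
    have ss: "\<bar>s - s'\<bar> \<le> \<epsilon>"
    proof -
      obtain a where a: "a \<in> S" "w a = face_min S w" using face_min[OF 2(4) 2(1)] by blast
      obtain b where b: "b \<in> S" "u b = face_min S u" using face_min[OF 2(4) 2(2)] by blast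
      have "face_min S u \<le> u a" "face_min S w \<le> w b"
        using a b face_min[OF 2(4) 2(1)] face_min[OF 2(4) 2(2)] by auto
      then show ?thesis using 2(3)[OF a(1)] 2(3)[OF b(1)] a b by (auto simp: s_def s'_def)
    qed
    have kR: "\<kappa> * R * \<bar>s - s'\<bar> \<le> \<kappa> * R * \<epsilon>" using ss \<kappa> R by (intro mult_left_mono) auto
    define A where "A = 2 * (2 * cone_lip \<kappa> k + 2 * cone_radius \<kappa> k + 1) * spread T S * \<epsilon>"
    have A: "A \<ge> 0" using cone_lip_nonneg[OF \<kappa>, of k] cone_radius_nonneg[OF \<kappa>, of k] sp e0 by (simp add: A_def)
    have eqs: "\<Phi> T w = K (base T S) R s (cone_arg T S w)" "\<Phi> T u = K (base T S) R s' (cone_arg T S u)"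
      using cone_map_eq[OF 2(4) 2(1)] cone_map_eq[OF 2(4) 2(2)] by (auto simp: R_def s_def s'_def)
    have "dist (\<Phi> T w) (\<Phi> T u) \<le> A + \<kappa> * R * \<epsilon>"
    \<comment> \<open>The cone inequality weights the distance by the parameter of its first
      argument. When one parameter vanishes that point is put first, and \<open>cone_arg\<close>,
      which is then only a default value, drops out.\<close>
    proof (cases "s = 0 \<or> s' = 0")
      case True
      have "dist (\<Phi> T w) (\<Phi> T u) \<le> s * dist (cone_arg T S w) (cone_arg T S u) + \<kappa> * R * \<bar>s - s'\<bar>"
        unfolding eqs using s R m m' by (intro K) (auto simp: R_def)
      moreover have "dist (\<Phi> T u) (\<Phi> T w) \<le> s' * dist (cone_arg T S u) (cone_arg T S w) + \<kappa> * R * \<bar>s' - s\<bar>"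
        unfolding eqs using s R m m' by (intro K) (auto simp: R_def)
      ultimately show ?thesis using True kR A by (auto simp: dist_commute abs_minus_commute)
    next
      case False
      then have lt: "face_min S w < 1" "face_min S u < 1" using s by (auto simp: s_def s'_def)
      obtain a where a: "a \<in> S" "face_proj S w \<in> simplex_weights (S - {a})" using face_proj[OF 2(4) 2(1) lt(1)] by blast
      obtain b where b: "b \<in> S" "face_proj S u \<in> simplex_weights (S - {b})" using face_proj[OF 2(4) 2(2) lt(2)] by blast
      have sp': "s > 0" using False s by auto
      have "dist (\<Phi> T (face_proj S w)) (\<Phi> T (face_proj S u)) \<le>
         (2 * cone_lip \<kappa> k + 2 * cone_radius \<kappa> k + 1) * spread T S * (2 * \<epsilon> / s)"
        unfolding s_def by (rule lipB[OF 2(4,5) a b face_proj_diff(1)[OF 2(4,1,2) lt 2(3)]])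
      also have "\<dots> = A / s" by (simp add: A_def)
      finally have "s * dist (cone_arg T S w) (cone_arg T S u) \<le> A"
        using sp' lt by (simp add: cone_arg_def field_simps)
      moreover have "dist (\<Phi> T w) (\<Phi> T u) \<le> s * dist (cone_arg T S w) (cone_arg T S u) + \<kappa> * R * \<bar>s - s'\<bar>"
        unfolding eqs using s R m m' by (intro K) (auto simp: R_def)
      ultimately show ?thesis using kR by linarith
    qed
    also have "\<dots> = cone_lip \<kappa> (Suc k) * spread T S * \<epsilon>"
      by (simp add: A_def R algebra_simps)
    finally show ?case . }
qed

end

text \<open>Tent functions on dyadic grids; \<open>(n, v)\<close> is centred at the grid point \<open>2\<^sup>-\<^sup>n v\<close>, and only
  the scales \<open>2\<^sup>-\<^sup>n\<close> comparable with the distance to \<open>A\<close> are switched on.\<close>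

definition whitney :: "'a::euclidean_space set \<Rightarrow> 'a \<Rightarrow> int \<times> 'a \<Rightarrow> real" where
  "whitney A x = (\<lambda>(n, v). if \<forall>b\<in>Basis. v \<bullet> b \<in> \<int> then
     max 0 (min (1 - infnorm ((2 powr n) *\<^sub>R x - v))
       (min (2 powr n * infdist x A - 1) (4 - 2 powr n * infdist x A))) else 0)"

lemma whitney_nonneg: "whitney A x i \<ge> 0"
  by (cases i) (auto simp: whitney_def)

lemma whitney_active:
  assumes "whitney A x (n, v) \<noteq> 0"
  shows "\<forall>b\<in>Basis. v \<bullet> b \<in> \<int>" "infnorm ((2 powr n) *\<^sub>R x - v) < 1"
    "1 < 2 powr n * infdist x A" "2 powr n * infdist x A < 4"
  using assms by (auto simp: whitney_def max_def split: if_splits)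

text \<open>The scale puts \<open>2 powr n * infdist x A\<close> into the interval from 3/2 to 3,
  where both distance terms are at least 1/2, and rounding to the grid costs at most 1/2 in the sup
  norm. The bound makes the later division by the largest tent harmless.\<close>

lemma whitney_large:
  fixes A :: "'a::euclidean_space set"
  assumes "infdist x A > 0"
  obtains i where "whitney A x i \<ge> 1/2"
proof -
  define \<delta> where "\<delta> = infdist x A"
  \<comment> \<open>The largest integer with \<open>2 powr n < 3 / \<delta>\<close>.\<close>
  define n where "n = \<lceil>log 2 (3 / \<delta>)\<rceil> - 1"
  have d: "\<delta> > 0" using assms by (simp add: \<delta>_def)
  have n: "real_of_int n < log 2 (3 / \<delta>)" "log 2 (3 / \<delta>) \<le> real_of_int n + 1"
    unfolding n_def by linarith+
  have "2 powr n < 3 / \<delta>" using n(1) d by (simp add: less_log_iff)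
  then have u: "2 powr n * \<delta> < 3" using d by (simp add: field_simps)
  have "3 / \<delta> \<le> 2 powr (n + 1)" using n(2) d by (simp add: log_le_iff)
  then have l: "3 / 2 \<le> 2 powr n * \<delta>" using d by (simp add: powr_add field_simps)
  define v where "v = (\<Sum>b\<in>Basis. of_int (round (((2 powr n) *\<^sub>R x) \<bullet> b)) *\<^sub>R b)"
  have vb: "v \<bullet> b = of_int (round (((2 powr n) *\<^sub>R x) \<bullet> b))" if "b \<in> Basis" for b
    using that by (simp add: v_def)
  have "infnorm ((2 powr n) *\<^sub>R x - v) \<le> 1 / 2"
    unfolding infnorm_Max
  proof (rule Max.boundedI)
    fix t assume "t \<in> (\<lambda>i. \<bar>((2 powr n) *\<^sub>R x - v) \<bullet> i\<bar>) ` Basis"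
    then obtain b where b: "b \<in> Basis" "t = \<bar>((2 powr n) *\<^sub>R x - v) \<bullet> b\<bar>" by auto
    have "t = \<bar>of_int (round (((2 powr n) *\<^sub>R x) \<bullet> b)) - ((2 powr n) *\<^sub>R x) \<bullet> b\<bar>"
      unfolding b(2) inner_diff_left vb[OF b(1)] by (rule abs_minus_commute)
    also have "\<dots> \<le> 1 / 2" by (rule of_int_round_abs_le)
    finally show "t \<le> 1 / 2" .
  qed auto
  moreover have "\<forall>b\<in>Basis. v \<bullet> b \<in> \<int>" using vb by auto
  ultimately have "whitney A x (n, v) \<ge> 1/2" using l u by (auto simp: whitney_def \<delta>_def)
  then show ?thesis by (rule that)
qed

text \<open>The activity condition on \<open>2 powr n * infdist x A\<close>, between 1 and 4, leaves
  two integers \<open>n\<close>, and an open interval of length 2 contains at most two integers in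
  each coordinate. So the simplices to be filled have boundedly many vertices, in terms of the
  dimension alone.\<close>

lemma whitney_support:
  fixes A :: "'a::euclidean_space set"
  assumes "infdist x A > 0"
  shows "finite (support (whitney A x))" "card (support (whitney A x)) \<le> 2 * 2 ^ DIM('a)"
proof -
  define \<delta> where "\<delta> = infdist x A"
  have d: "\<delta> > 0" using assms by (simp add: \<delta>_def)
  define k where "k = \<lfloor>log 2 (1 / \<delta>)\<rfloor>"
  define G where "G n = (\<lambda>g. \<Sum>b\<in>Basis. of_int (g b) *\<^sub>R b) ` (PiE (Basis::'a set) (\<lambda>b. {\<lfloor>((2 powr n) *\<^sub>R x) \<bullet> b\<rfloor>..\<lfloor>((2 powr n) *\<^sub>R x) \<bullet> b\<rfloor> + 1}))" for n :: int
  have finP: "finite (PiE (Basis::'a set) (\<lambda>b. {\<lfloor>((2 powr n) *\<^sub>R x) \<bullet> b\<rfloor>..\<lfloor>((2 powr n) *\<^sub>R x) \<bullet> b\<rfloor> + 1}))" for n :: int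
    by (rule finite_PiE) auto
  have fin: "finite (G n)" for n unfolding G_def by (intro finite_imageI finP)
  have cd: "card (G n) \<le> 2 ^ DIM('a)" for n
    unfolding G_def by (rule order_trans[OF card_image_le[OF finP]]) (simp add: card_PiE)
  have sub: "support (whitney A x) \<subseteq> Sigma {k + 1..k + 2} G"
  proof
    fix i assume i: "i \<in> support (whitney A x)"
    obtain n v where nv: "i = (n, v)" by (cases i)
    note act = whitney_active[of A x n v]
    have w: "whitney A x (n, v) \<noteq> 0" using i nv by (simp add: support_def)
    have "1 / \<delta> < 2 powr n" using act(3)[OF w] d by (simp add: \<delta>_def field_simps)
    then have "log 2 (1 / \<delta>) < n" using d by (simp add: log_less_iff)
    moreover have "2 powr (n - 2) < 1 / \<delta>" using act(4)[OF w] d by (simp add: \<delta>_def field_simps powr_diff)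
    then have "real_of_int n - 2 < log 2 (1 / \<delta>)" using d by (simp add: less_log_iff)
    ultimately have n: "n \<in> {k + 1..k + 2}" unfolding k_def by (auto simp: ) linarith+
    have vb: "v \<bullet> b \<in> \<int> \<and> \<bar>((2 powr n) *\<^sub>R x) \<bullet> b - v \<bullet> b\<bar> < 1" if "b \<in> Basis" for b
      using act(1,2)[OF w] Basis_le_infnorm[OF that, of "(2 powr n) *\<^sub>R x - v"] that
      by (auto simp: inner_diff_left)
    define g where "g = (\<lambda>b\<in>Basis. \<lfloor>v \<bullet> b\<rfloor>)"
    have gb: "of_int (g b) = v \<bullet> b" if "b \<in> Basis" for b
      using vb[OF that] that by (auto simp: g_def Ints_def)
    have "g \<in> PiE (Basis::'a set) (\<lambda>b. {\<lfloor>((2 powr n) *\<^sub>R x) \<bullet> b\<rfloor>..\<lfloor>((2 powr n) *\<^sub>R x) \<bullet> b\<rfloor> + 1})"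
    proof (rule PiE_I)
      fix b :: 'a assume b: "b \<in> Basis"
      have "\<bar>((2 powr n) *\<^sub>R x) \<bullet> b - of_int (g b)\<bar> < 1" using vb[OF b] gb[OF b] by simp
      then show "g b \<in> {\<lfloor>((2 powr n) *\<^sub>R x) \<bullet> b\<rfloor>..\<lfloor>((2 powr n) *\<^sub>R x) \<bullet> b\<rfloor> + 1}" by (auto simp del: inner_scaleR_left) linarith+
    qed (auto simp: g_def)
    moreover have "v = (\<Sum>b\<in>Basis. of_int (g b) *\<^sub>R b)"
      using gb by (simp add: euclidean_representation)
    ultimately have "v \<in> G n" unfolding G_def by blast
    then show "i \<in> Sigma {k + 1..k + 2} G" using n nv by blast
  qed
  have finS: "finite (Sigma {k + 1..k + 2} G)" using fin by auto
  then show "finite (support (whitney A x))" using sub finite_subset by blast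
  have "card (support (whitney A x)) \<le> card (Sigma {k + 1..k + 2} G)" by (rule card_mono[OF finS sub])
  also have "\<dots> = (\<Sum>n\<in>{k + 1..k + 2}. card (G n))" using fin by (subst card_SigmaI) auto
  also have "\<dots> \<le> (\<Sum>n\<in>{k + 1..k + 2}. 2 ^ DIM('a))" using cd by (rule sum_mono)
  also have "\<dots> = 2 * 2 ^ DIM('a)" by simp
  finally show "card (support (whitney A x)) \<le> 2 * 2 ^ DIM('a)" .
qed

text \<open>One-sided, so that only activity at \<open>x\<close> matters: it forces
  \<open>2 powr n \<le> 8 / \<delta>\<close>, and every term of the minimum changes at most
  \<open>2 powr n\<close> times as fast as the point.\<close>

lemma whitney_lipschitz_step:
  assumes "whitney A x i \<noteq> 0" "infdist x A \<ge> \<delta> / 2" "\<delta> > 0"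
  shows "whitney A x i - whitney A y i \<le> 8 * dist x y / \<delta>"
proof -
  obtain n v where nv: "i = (n, v)" by (cases i)
  note act = whitney_active[OF assms(1)[unfolded nv]]
  have s0: "(2::real) powr n > 0" by simp
  have "2 powr n * \<delta> / 2 < 4" using act(4) mult_left_mono[OF assms(2), of "2 powr n"] s0 by linarith
  then have s: "2 powr n \<le> 8 / \<delta>" using assms(3) by (simp add: field_simps)
  have sd: "2 powr n * dist x y \<le> 8 / \<delta> * dist x y" by (intro mult_right_mono s) simp
  have "infnorm ((2 powr n) *\<^sub>R y - v) - infnorm ((2 powr n) *\<^sub>R x - v) \<le> infnorm ((2 powr n) *\<^sub>R y - (2 powr n) *\<^sub>R x)"
    using absdiff_infnorm[of "(2 powr n) *\<^sub>R y - v" "(2 powr n) *\<^sub>R x - v"] by simp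
  also have "\<dots> = 2 powr n * infnorm (y - x)"
    unfolding scaleR_diff_right[symmetric] infnorm_mul by simp
  also have "\<dots> \<le> 2 powr n * dist x y"
    using infnorm_le_norm[of "y - x"] by (simp add: dist_norm norm_minus_commute)
  finally have 1: "infnorm ((2 powr n) *\<^sub>R y - v) - infnorm ((2 powr n) *\<^sub>R x - v) \<le> 8 * dist x y / \<delta>"
    using sd by simp
  have "\<bar>2 powr n * infdist x A - 2 powr n * infdist y A\<bar> = 2 powr n * \<bar>infdist x A - infdist y A\<bar>"
    by (simp add: right_diff_distrib[symmetric] abs_mult)
  also have "\<dots> \<le> 2 powr n * dist x y"
    by (intro mult_left_mono infdist_triangle_abs) simp
  finally have 2: "\<bar>2 powr n * infdist x A - 2 powr n * infdist y A\<bar> \<le> 8 * dist x y / \<delta>"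
    using sd by simp
  have 3: "8 * dist x y / \<delta> \<ge> 0" using assms(3) by simp
  define a b c a' b' c' e where abc: "a = 1 - infnorm ((2 powr n) *\<^sub>R x - v)" "b = 2 powr n * infdist x A - 1"
    "c = 4 - 2 powr n * infdist x A" "a' = 1 - infnorm ((2 powr n) *\<^sub>R y - v)" "b' = 2 powr n * infdist y A - 1"
    "c' = 4 - 2 powr n * infdist y A" "e = 8 * dist x y / \<delta>"
  have "whitney A x i = max 0 (min a (min b c))" "whitney A y i = max 0 (min a' (min b' c'))"
    using act(1) by (simp_all add: whitney_def nv abc)
  moreover have "a - a' \<le> e" "b - b' \<le> e" "c - c' \<le> e" "e \<ge> 0" using 1 2 3 by (auto simp: abc)
  ultimately show ?thesis unfolding abc(7)[symmetric] by linarith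
qed

definition whitney_weights :: "'a::euclidean_space set \<Rightarrow> 'a \<Rightarrow> int \<times> 'a \<Rightarrow> real" where
  "whitney_weights A x = (\<lambda>i. whitney A x i / Max (whitney A x ` support (whitney A x)))"

lemma whitney_weights:
  fixes A :: "'a::euclidean_space set"
  assumes "infdist x A > 0"
  shows "whitney_weights A x \<in> simplex_weights (support (whitney A x))"
    and "Max (whitney A x ` support (whitney A x)) \<ge> 1/2"
    and "whitney A x i \<le> Max (whitney A x ` support (whitney A x))"
    and "\<exists>i. whitney A x i = Max (whitney A x ` support (whitney A x))"
    and "support (whitney A x) \<noteq> {}"
proof -
  define M where "M = Max (whitney A x ` support (whitney A x))"
  have fin: "finite (whitney A x ` support (whitney A x))" using whitney_support[OF assms] by simp
  obtain j where j: "whitney A x j \<ge> 1/2" using whitney_large[OF assms] by blast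
  then have jS: "j \<in> support (whitney A x)" by (auto simp: support_def)
  then show "support (whitney A x) \<noteq> {}" by blast
  have up: "whitney A x i \<le> M" if "i \<in> support (whitney A x)" for i
    unfolding M_def using fin that by (intro Max_ge) auto
  then show M2: "Max (whitney A x ` support (whitney A x)) \<ge> 1/2" using j jS unfolding M_def by fastforce
  have up': "whitney A x i \<le> M" for i
    using up[of i] M2 unfolding M_def support_def by (cases "whitney A x i = 0") auto
  then show "whitney A x i \<le> Max (whitney A x ` support (whitney A x))" by (simp add: M_def)
  have "M \<in> whitney A x ` support (whitney A x)" unfolding M_def using fin jS by (intro Max_in) auto
  then obtain i where i: "i \<in> support (whitney A x)" "whitney A x i = M" by auto
  then show "\<exists>i. whitney A x i = Max (whitney A x ` support (whitney A x))" unfolding M_def by blast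
  have M0: "M > 0" using M2 by (simp add: M_def)
  have "support (whitney_weights A x) \<subseteq> support (whitney A x)"
    by (auto simp: support_def whitney_weights_def)
  moreover have "whitney_weights A x i = 1" using i M0 by (simp add: whitney_weights_def M_def)
  moreover have "0 \<le> whitney_weights A x j \<and> whitney_weights A x j \<le> 1" for j
    using up'[of j] M0 whitney_nonneg[of A x j] by (simp add: whitney_weights_def M_def)
  ultimately show "whitney_weights A x \<in> simplex_weights (support (whitney A x))"
    using i(1) unfolding simplex_weights_def by blast
qed

text \<open>Numerator and normalising maximum both change by at most
  \<open>8 * dist x y / infdist x A\<close>, and the maximum is at least 1/2; hence
  \<open>2 * 8 * 2 = 32\<close>.\<close>

lemma whitney_weights_lipschitz:
  fixes A :: "'a::euclidean_space set"
  assumes "infdist x A > 0" "dist x y \<le> infdist x A / 2"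
  shows "\<bar>whitney_weights A x i - whitney_weights A y i\<bar> \<le> 32 * dist x y / infdist x A"
proof -
  define \<delta> where "\<delta> = infdist x A"
  define e where "e = 8 * dist x y / \<delta>"
  define M N where "M = Max (whitney A x ` support (whitney A x))" and "N = Max (whitney A y ` support (whitney A y))"
  have d: "\<delta> > 0" using assms by (simp add: \<delta>_def)
  have dy: "infdist y A \<ge> \<delta> / 2"
    using infdist_triangle[of x A y] assms(2) unfolding \<delta>_def by linarith
  then have y0: "infdist y A > 0" using d by linarith
  have e0: "e \<ge> 0" using d by (simp add: e_def)
  have diff: "\<bar>whitney A x i - whitney A y i\<bar> \<le> e" for i
  proof -
    have "whitney A x i - whitney A y i \<le> e"
    proof (cases "whitney A x i = 0")
      case False
      then show ?thesis unfolding e_def using d by (intro whitney_lipschitz_step) (auto simp: \<delta>_def)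
    qed (use whitney_nonneg[of A y i] e0 in linarith)
    moreover have "whitney A y i - whitney A x i \<le> e"
    proof (cases "whitney A y i = 0")
      case False
      then show ?thesis unfolding e_def dist_commute[of x y] using d dy by (intro whitney_lipschitz_step) auto
    qed (use whitney_nonneg[of A x i] e0 in linarith)
    ultimately show ?thesis by linarith
  qed
  note wx = whitney_weights[OF assms(1), folded M_def] and wy = whitney_weights[OF y0, folded N_def]
  obtain i1 where i1: "whitney A x i1 = M" using wx(4) by blast
  obtain i2 where i2: "whitney A y i2 = N" using wy(4) by blast
  have MN: "\<bar>M - N\<bar> \<le> e"
    using diff[of i1] diff[of i2] wx(3)[of i2] wy(3)[of i1] i1 i2 by linarith
  define a b where "a = whitney A x i" and "b = whitney A y i"
  have M0: "M \<ge> 1/2" "N > 0" using wx(2) wy(2) by linarith+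
  have b: "0 \<le> b" "b \<le> N" using whitney_nonneg[of A y i] wy(3)[of i] by (auto simp: b_def)
  have "a / M - b / N = ((a - b) - (b / N) * (M - N)) / M"
    using M0 by (simp add: field_simps)
  then have "\<bar>a / M - b / N\<bar> = \<bar>(a - b) - (b / N) * (M - N)\<bar> / M" using M0 by simp
  also have "\<dots> \<le> (e + 1 * e) / M"
  proof (rule divide_right_mono)
    have 1: "\<bar>b / N * (M - N)\<bar> \<le> 1 * e"
      unfolding abs_mult using b M0 MN by (intro mult_mono) auto
    have 2: "\<bar>a - b\<bar> \<le> e" using diff[of i] by (simp add: a_def b_def)
    show "\<bar>a - b - b / N * (M - N)\<bar> \<le> e + 1 * e"
      by (rule order_trans[OF abs_triangle_ineq4 add_mono[OF 2 1]])
  qed (use M0 in auto)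
  also have "\<dots> \<le> (e + 1 * e) / (1 / 2)" using M0 e0 by (intro divide_left_mono) auto
  also have "\<dots> = 32 * dist x y / \<delta>" by (simp add: e_def)
  finally show ?thesis by (simp add: whitney_weights_def a_def b_def M_def N_def \<delta>_def)
qed

text \<open>Whitney's extension without linear averages: off \<open>A\<close> the value is
  interpolated by \<open>cone_map\<close> from values of \<open>f\<close> near the active grid
  points. The spread of these values is of order \<open>L * infdist x A\<close>, while the weights
  vary at the rate \<open>1 / infdist x A\<close>; the product is of order \<open>L\<close>, with a
  factor that depends only on \<kappa> and the dimension.\<close>

theorem lipschitz_extension:
  assumes cones: "has_cones TYPE('x::metric_space) \<kappa>"
  shows "\<exists>C\<ge>1. \<forall>(A::'a::euclidean_space set) (f :: 'a \<Rightarrow> 'x) L. closed A \<longrightarrow> A \<noteq> {} \<longrightarrow> L-lipschitz_on A f \<longrightarrow>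
    (\<exists>F. (C * L)-lipschitz_on UNIV F \<and> (\<forall>x\<in>A. F x = f x))"
proof -
  have k0: "\<kappa> \<ge> 0" using cones by (simp add: has_cones_def)
  have "\<forall>(x0::'x) R. \<exists>K. R \<ge> 0 \<longrightarrow> (\<forall>x. K 1 x = x) \<and>
     (\<forall>x\<in>cball x0 R. \<forall>x'\<in>cball x0 R. \<forall>s\<in>{0..1}. \<forall>s'\<in>{0..1}.
        dist (K s x) (K s' x') \<le> s * dist x x' + \<kappa> * R * \<bar>s - s'\<bar>)"
    using cones unfolding has_cones_def by blast
  then obtain K where K: "\<forall>(x0::'x) R. R \<ge> 0 \<longrightarrow> (\<forall>x. K x0 R 1 x = x) \<and>
     (\<forall>x\<in>cball x0 R. \<forall>x'\<in>cball x0 R. \<forall>s\<in>{0..1}. \<forall>s'\<in>{0..1}.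
        dist (K x0 R s x) (K x0 R s' x') \<le> s * dist x x' + \<kappa> * R * \<bar>s - s'\<bar>)"
    by metis
  interpret cone_interp K \<kappa> by unfold_locales (use k0 K in auto)
  define N where "N = 2 * (2::nat) ^ DIM('a)"
  \<comment> \<open>An active grid point \<open>p\<close> satisfies
    \<open>dist x p \<le> sqrt DIM('a) * infdist x A\<close>, and its nearest point of
    \<open>A\<close> is at distance at most \<open>infdist x A + dist x p\<close> from
    \<open>p\<close>.\<close>
  define c1 where "c1 = 1 + 2 * sqrt DIM('a)"
  \<comment> \<open>Two neighbouring points together activate at most \<open>2 * N\<close> grid
    points; \<open>4 * c1\<close> comes from the spread of their vertices and 32 from
    \<open>whitney_weights_lipschitz\<close>.\<close>
  define C1 where "C1 = cone_lip \<kappa> (2 * N) * (4 * c1) * 32"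
  define C2 where "C2 = cone_radius \<kappa> N * (2 * c1) + c1 + 1"
  define C where "C = 1 + C1 + 5 * C2"
  have c1: "c1 \<ge> 1" by (simp add: c1_def)
  have C1: "C1 \<ge> 0" using cone_lip_nonneg[OF k0] c1 by (simp add: C1_def)
  have C2: "C2 \<ge> 1" using cone_radius_nonneg[OF k0] c1 by (simp add: C2_def)
  have "\<exists>F. (C * L)-lipschitz_on UNIV F \<and> (\<forall>x\<in>A. F x = f x)"
    if A: "closed A" "A \<noteq> {}" and f: "L-lipschitz_on A f" for A :: "'a set" and f :: "'a \<Rightarrow> 'x" and L
  proof -
    have L: "L \<ge> 0" using f by (rule lipschitz_on_nonneg)
    have "\<exists>a\<in>A. dist x a = infdist x A" for x
      using distance_attains_inf[OF A, of x] infdist_notempty[OF A(2), of x]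
      by (metis A(2) cINF_greatest infdist_le antisym)
    then obtain near where near: "\<And>x. near x \<in> A" "\<And>x. dist x (near x) = infdist x A" by metis
    \<comment> \<open>The vertex attached to a grid index does not depend on \<open>x\<close>, so
      neighbouring points share their vertices.\<close>
    define a where "a = (\<lambda>(n::int, v). near ((2 powr - n) *\<^sub>R v))"
    define F where "F x = (if x \<in> A then f x else \<Phi> (f \<circ> a) (whitney_weights A x))" for x
    have pos: "infdist x A > 0" if "x \<notin> A" for x using infdist_pos_not_in_closed[OF A that] .
    have aA: "a i \<in> A" for i by (simp add: a_def near split: prod.splits)
    have a_near: "dist x (a i) \<le> c1 * infdist x A" if x: "x \<notin> A" and i: "i \<in> support (whitney A x)" for x i
    proof -
      obtain n v where nv: "i = (n, v)" by (cases i)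
      define p where "p = (2 powr - n) *\<^sub>R v"
      have "whitney A x (n, v) \<noteq> 0" using i nv by (simp add: support_def)
      note act = whitney_active[OF this]
      have inv: "(2 powr - n) * 2 powr n = (1::real)" by (simp add: powr_minus)
      have "x - p = (2 powr - n) *\<^sub>R ((2 powr n) *\<^sub>R x - v)"
        unfolding p_def scaleR_diff_right scaleR_scaleR inv by simp
      then have "infnorm (x - p) = 2 powr - n * infnorm ((2 powr n) *\<^sub>R x - v)" by (simp add: infnorm_mul)
      also have "\<dots> \<le> 2 powr - n * 1" using act(2) by (intro mult_left_mono) auto
      also have "\<dots> \<le> 2 powr - n * (2 powr n * infdist x A)" using act(3) by (intro mult_left_mono) auto
      also have "\<dots> = infdist x A" using inv by (simp add: mult.assoc[symmetric])
      finally have inf: "infnorm (x - p) \<le> infdist x A" .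
      have "norm (x - p) \<le> sqrt DIM('a) * infnorm (x - p)" by (rule norm_le_infnorm)
      also have "\<dots> \<le> sqrt DIM('a) * infdist x A" using inf by (intro mult_left_mono) auto
      finally have xp: "dist x p \<le> sqrt DIM('a) * infdist x A" by (simp add: dist_norm)
      have "dist p (a i) = infdist p A" by (simp add: a_def nv p_def near)
      also have "\<dots> \<le> infdist x A + dist x p" using infdist_triangle[of p A x] by (simp add: dist_commute)
      finally show ?thesis using dist_triangle[of x "a i" p] xp by (simp add: c1_def algebra_simps)
    qed
    have Fnear: "dist (F x) (f b) \<le> C2 * L * dist x b" if x: "x \<notin> A" and b: "b \<in> A" for x b
    proof -
      define S where "S = support (whitney A x)"
      note W = whitney_weights[OF pos[OF x], folded S_def]
      have S: "finite S" "S \<noteq> {}" "card S \<le> N"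
        using whitney_support[OF pos[OF x]] W(5) by (auto simp: S_def N_def)
      obtain i where i: "i \<in> S" using S by blast
      have lf: "dist (f (a i)) (f (a j)) \<le> L * dist (a i) (a j)" for i j
        using lipschitz_onD[OF f aA aA] .
      have ax: "dist x (a i) \<le> c1 * infdist x A" if "i \<in> S" for i using a_near[OF x] that by (simp add: S_def)
      have sp: "spread (f \<circ> a) S \<le> L * (2 * c1 * infdist x A)"
      proof (rule spread_le[OF S(1,2)])
        fix i j assume "i \<in> S" "j \<in> S"
        then have "dist (a i) (a j) \<le> 2 * c1 * infdist x A"
          using ax[of i] ax[of j] dist_triangle3[of "a i" "a j" x] by linarith
        then show "dist ((f \<circ> a) i) ((f \<circ> a) j) \<le> L * (2 * c1 * infdist x A)"
          using lf[of i j] mult_left_mono[OF _ L] by (metis comp_apply order_trans)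
      qed
      have xb: "infdist x A \<le> dist x b" by (rule infdist_le[OF b])
      have "dist (F x) (f (a i)) \<le> cone_radius \<kappa> (card S) * spread (f \<circ> a) S"
        using cone_map_lipschitz(1)[OF S(1) refl W(1) i, of "f \<circ> a"] x by (simp add: F_def)
      also have "\<dots> \<le> cone_radius \<kappa> N * (L * (2 * c1 * infdist x A))"
        using S sp by (intro mult_mono cone_radius_mono k0 cone_radius_nonneg spread_nonneg)
      also have "\<dots> \<le> cone_radius \<kappa> N * (L * (2 * c1 * dist x b))"
        using xb L c1 cone_radius_nonneg[OF k0] by (intro mult_left_mono) auto
      finally have 1: "dist (F x) (f (a i)) \<le> cone_radius \<kappa> N * (2 * c1) * (L * dist x b)"
        by (simp add: algebra_simps)
      have "dist (a i) b \<le> c1 * infdist x A + dist x b"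
        using ax[OF i] dist_triangle3[of "a i" b x] by linarith
      also have "\<dots> \<le> c1 * dist x b + dist x b" using xb c1 by (intro add_mono mult_left_mono) auto
      finally have "L * dist (a i) b \<le> L * (c1 * dist x b + dist x b)" using L by (rule mult_left_mono)
      then have 2: "dist (f (a i)) (f b) \<le> (c1 + 1) * (L * dist x b)"
        using lipschitz_onD[OF f aA b, of i] by (simp add: algebra_simps)
      show ?thesis using 1 2 dist_triangle[of "F x" "f b" "f (a i)"] by (simp add: C2_def algebra_simps)
    qed
    have main: "dist (F x) (F y) \<le> C * L * dist x y" if x: "x \<notin> A" for x y
    proof -
      have LD: "L * dist x y \<ge> 0" using L by simp
      \<comment> \<open>Points closer to each other than half the distance to \<open>A\<close> are
        compared inside one simplex. Otherwise both are compared with a nearest point of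
        \<open>A\<close>, which is within \<open>2 * dist x y\<close> of \<open>x\<close> and
        \<open>3 * dist x y\<close> of \<open>y\<close>.\<close>
      consider "y \<in> A" | "y \<notin> A" "dist x y \<le> infdist x A / 2" | "y \<notin> A" "dist x y > infdist x A / 2"
        by linarith
      then show ?thesis
      proof cases
        case 1
        have "dist (F x) (F y) \<le> C2 * (L * dist x y)" using Fnear[OF x 1] 1 by (simp add: F_def mult.assoc)
        also have "\<dots> \<le> C * (L * dist x y)" using C1 C2 by (intro mult_right_mono LD) (simp add: C_def)
        finally show ?thesis by (simp add: mult.assoc)
      next
        case 2
        define \<delta> where "\<delta> = infdist x A"
        have d: "\<delta> > 0" using pos[OF x] by (simp add: \<delta>_def)
        define S where "S = support (whitney A x) \<union> support (whitney A y)"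
        have fin: "finite S" using whitney_support(1) pos x 2 by (auto simp: S_def)
        have cS: "card S \<le> 2 * N"
          unfolding S_def using whitney_support(2)[OF pos[OF x]] whitney_support(2)[OF pos[OF 2(1)]]
          by (intro order_trans[OF card_Un_le]) (simp add: N_def)
        have wx: "whitney_weights A x \<in> simplex_weights S"
          using whitney_weights(1)[OF pos[OF x]] simplex_weights_mono[of "support (whitney A x)" S] by (auto simp: S_def)
        have wy: "whitney_weights A y \<in> simplex_weights S"
          using whitney_weights(1)[OF pos[OF 2(1)]] simplex_weights_mono[of "support (whitney A y)" S] by (auto simp: S_def)
        have Sne: "S \<noteq> {}" using whitney_weights(5)[OF pos[OF x]] by (auto simp: S_def)
        have dy: "infdist y A \<le> 3 / 2 * \<delta>"
          using infdist_triangle[of y A x] 2(2) by (simp add: dist_commute \<delta>_def)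
        have ax: "dist x (a i) \<le> 2 * c1 * \<delta>" if "i \<in> S" for i
        proof (cases "i \<in> support (whitney A x)")
          case True
          moreover have "c1 * \<delta> \<le> 2 * c1 * \<delta>" using c1 d by simp
          ultimately show ?thesis using a_near[OF x True] by (simp add: \<delta>_def)
        next
          case False
          then have "i \<in> support (whitney A y)" using that by (simp add: S_def)
          then have "dist y (a i) \<le> c1 * infdist y A" by (rule a_near[OF 2(1)])
          also have "\<dots> \<le> c1 * (3 / 2 * \<delta>)" using dy c1 by (intro mult_left_mono) auto
          finally have "dist x (a i) \<le> \<delta> / 2 + c1 * (3 / 2 * \<delta>)"
            using dist_triangle[of x "a i" y] 2(2) by (simp add: \<delta>_def)
          also have "\<dots> \<le> c1 * \<delta> / 2 + c1 * (3 / 2 * \<delta>)"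
          proof -
            have "1 * \<delta> \<le> c1 * \<delta>" using c1 d by (intro mult_right_mono) auto
            then show ?thesis by linarith
          qed
          finally show ?thesis by (simp add: algebra_simps)
        qed
        have sp: "spread (f \<circ> a) S \<le> L * (4 * c1 * \<delta>)"
        proof (rule spread_le[OF fin Sne])
          fix i j assume "i \<in> S" "j \<in> S"
          then have "dist (a i) (a j) \<le> 4 * c1 * \<delta>"
            using ax[of i] ax[of j] dist_triangle3[of "a i" "a j" x] by linarith
          then show "dist ((f \<circ> a) i) ((f \<circ> a) j) \<le> L * (4 * c1 * \<delta>)"
            using lipschitz_onD[OF f aA aA, of i j] mult_left_mono[OF _ L] by (metis comp_apply order_trans)
        qed
        have "dist (F x) (F y) \<le> cone_lip \<kappa> (card S) * spread (f \<circ> a) S * (32 * dist x y / \<delta>)"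
          using cone_map_lipschitz(2)[OF fin refl wx wy, of "32 * dist x y / \<delta>" "f \<circ> a"]
            whitney_weights_lipschitz[OF pos[OF x] 2(2)] x 2(1) by (simp add: F_def \<delta>_def)
        also have "\<dots> \<le> cone_lip \<kappa> (2 * N) * (L * (4 * c1 * \<delta>)) * (32 * dist x y / \<delta>)"
          using cS sp d by (intro mult_mono cone_lip_mono cone_lip_nonneg k0 spread_nonneg fin Sne mult_nonneg_nonneg)
            (use L c1 in auto)
        also have "\<dots> = C1 * (L * dist x y)" using d by (simp add: C1_def)
        also have "\<dots> \<le> C * (L * dist x y)" using C1 C2 by (intro mult_right_mono LD) (simp add: C_def)
        finally show ?thesis by (simp add: mult.assoc)
      next
        case 3
        define b where "b = near x"
        have b: "b \<in> A" "dist x b \<le> 2 * dist x y" using near 3 by (auto simp: b_def)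
        have yb: "dist y b \<le> 3 * dist x y" using b(2) dist_triangle3[of y b x] by linarith
        have "dist (F x) (F y) \<le> C2 * L * dist x b + C2 * L * dist y b"
          using Fnear[OF x b(1)] Fnear[OF 3(1) b(1)] dist_triangle2[of "F x" "F y" "f b"] by linarith
        also have "\<dots> \<le> C2 * L * (2 * dist x y) + C2 * L * (3 * dist x y)"
          using b yb C2 L by (intro add_mono mult_left_mono) auto
        also have "\<dots> = 5 * C2 * (L * dist x y)" by simp
        also have "\<dots> \<le> C * (L * dist x y)" using C1 by (intro mult_right_mono LD) (simp add: C_def)
        finally show ?thesis by (simp add: mult.assoc)
      qed
    qed
    have C1': "C \<ge> 1" using C1 C2 by (simp add: C_def)
    have "(C * L)-lipschitz_on UNIV F"
    proof (rule lipschitz_onI)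
      fix x y
      show "dist (F x) (F y) \<le> C * L * dist x y"
      proof (cases "x \<in> A \<and> y \<in> A")
        case True
        then have "dist (F x) (F y) \<le> 1 * (L * dist x y)" using lipschitz_onD[OF f] by (simp add: F_def)
        also have "\<dots> \<le> C * (L * dist x y)" using C1' L by (intro mult_right_mono) auto
        finally show ?thesis by (simp add: mult.assoc)
      next
        case False
        then show ?thesis using main[of x y] main[of y x] by (auto simp: dist_commute)
      qed
    qed (use C1' L in auto)
    moreover have "\<forall>x\<in>A. F x = f x" by (simp add: F_def)
    ultimately show ?thesis by blast
  qed
  then show ?thesis using C1 C2 by (intro exI[of _ C]) (auto simp: C_def)
qed

section \<open>The maximal function\<close>

lemma ball_in_sets_borel[measurable]: "ball x r \<in> sets borel"
  by simp

definition ball_vol :: "'a::euclidean_space itself \<Rightarrow> real \<Rightarrow> ennreal" where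
  "ball_vol _ r = ennreal (unit_ball_vol (DIM('a)) * r ^ DIM('a))"

lemma emeasure_ball_vol: "r \<ge> 0 \<Longrightarrow> emeasure lborel (ball (x::'a::euclidean_space) r) = ball_vol TYPE('a) r"
  by (simp add: ball_vol_def emeasure_ball)

lemma ball_vol_pos: "r > 0 \<Longrightarrow> ball_vol TYPE('a::euclidean_space) r > 0"
  and ball_vol_finite: "ball_vol TYPE('a::euclidean_space) r < \<infinity>"
  by (simp_all add: ball_vol_def ennreal_zero_less_mult_iff)

lemma ball_vol_scale: "c \<ge> 0 \<Longrightarrow> ball_vol TYPE('a::euclidean_space) (c * r) = ennreal (c ^ DIM('a)) * ball_vol TYPE('a) r"
  by (cases "r ^ DIM('a) \<ge> 0")
    (simp_all add: ball_vol_def ennreal_mult[symmetric] power_mult_distrib algebra_simps mult_nonneg_nonpos ennreal_neg)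

definition ball_avg :: "('a::euclidean_space \<Rightarrow> ennreal) \<Rightarrow> 'a \<Rightarrow> real \<Rightarrow> ennreal" where
  "ball_avg h x r = (\<integral>\<^sup>+y\<in>ball x r. h y \<partial>lborel) / ball_vol TYPE('a) r"

text \<open>Radii stop at 2, the diameter of the unit ball: this serves all pairs of points of the
  ball, and Vitali's covering lemma needs bounded radii.\<close>

definition maximal :: "('a::euclidean_space \<Rightarrow> ennreal) \<Rightarrow> 'a \<Rightarrow> ennreal" where
  "maximal h x = (SUP r\<in>{0<..<2}. ball_avg h x r)"

lemma ball_integral_eq:
  fixes x :: "'a::euclidean_space"
  assumes "r > 0"
  shows "(\<integral>\<^sup>+y\<in>ball x r. h y \<partial>lborel) = ball_avg h x r * ball_vol TYPE('a) r"
  unfolding ball_avg_def ennreal_divide_times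
  using ball_vol_pos[OF assms, where 'a='a] ball_vol_finite[of r, where 'a='a] by simp

lemma ball_integral_le_maximal:
  fixes x :: "'a::euclidean_space"
  assumes "0 < r" "r < 2"
  shows "(\<integral>\<^sup>+y\<in>ball x r. h y \<partial>lborel) \<le> maximal h x * ball_vol TYPE('a) r"
  unfolding ball_integral_eq[OF assms(1)] maximal_def using assms
  by (intro mult_right_mono SUP_upper) auto

lemma less_maximalE:
  fixes x :: "'a::euclidean_space"
  assumes "s < maximal h x"
  obtains r where "0 < r" "r < 2" "s * ball_vol TYPE('a) r < (\<integral>\<^sup>+y\<in>ball x r. h y \<partial>lborel)"
proof -
  obtain r where r: "r \<in> {0<..<2}" "s < ball_avg h x r"
    using assms unfolding maximal_def less_SUP_iff by blast
  then have "s * ball_vol TYPE('a) r < ball_avg h x r * ball_vol TYPE('a) r"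
    using ball_vol_pos[where 'a='a] ball_vol_finite[of r, where 'a='a]
    by (intro ennreal_mult_strict_right_mono) auto
  then show ?thesis using r ball_integral_eq[of r h x] by (intro that[of r]) auto
qed

lemma maximal_ge:
  fixes x :: "'a::euclidean_space"
  assumes "0 < r" "r < 2" "s * ball_vol TYPE('a) r < (\<integral>\<^sup>+y\<in>ball x r. h y \<partial>lborel)"
  shows "s < maximal h x"
proof (rule ccontr)
  assume "\<not> s < maximal h x"
  then have "maximal h x * ball_vol TYPE('a) r \<le> s * ball_vol TYPE('a) r" by (intro mult_right_mono) auto
  then show False using ball_integral_le_maximal[OF assms(1,2), of h x] assms(3) by simp
qed

text \<open>The strict inequality survives a slightly larger radius \<rho>, and the larger ball
  about any nearby centre still contains the original ball.\<close>

lemma open_maximal_gt: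
  fixes h :: "'a::euclidean_space \<Rightarrow> ennreal"
  assumes "s < \<infinity>"
  shows "open {x. s < maximal h x}"
  unfolding open_contains_ball
proof
  fix x assume "x \<in> {x. s < maximal h x}"
  then obtain r where r: "0 < r" "r < 2" "s * ball_vol TYPE('a) r < (\<integral>\<^sup>+y\<in>ball x r. h y \<partial>lborel)"
    by (auto elim: less_maximalE)
  obtain t where t: "s = ennreal t" "t \<ge> 0" using assms by (cases s) auto
  have "((\<lambda>\<rho>. s * ball_vol TYPE('a) \<rho>) \<longlongrightarrow> s * ball_vol TYPE('a) r) (at_right r)"
    unfolding t(1) ball_vol_def
    by (intro ennreal_tendsto_cmult tendsto_intros) auto
  then have "\<forall>\<^sub>F \<rho> in at_right r. s * ball_vol TYPE('a) \<rho> < (\<integral>\<^sup>+y\<in>ball x r. h y \<partial>lborel)"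
    using r(3) by (rule order_tendstoD)
  moreover have "\<forall>\<^sub>F \<rho> in at_right r. \<rho> \<in> {r<..<2}" using r by (intro eventually_at_right_real)
  ultimately have "\<forall>\<^sub>F \<rho> in at_right r. \<rho> \<in> {r<..<2} \<and> s * ball_vol TYPE('a) \<rho> < (\<integral>\<^sup>+y\<in>ball x r. h y \<partial>lborel)"
    by eventually_elim simp
  then obtain \<rho> where \<rho>: "\<rho> \<in> {r<..<2}" "s * ball_vol TYPE('a) \<rho> < (\<integral>\<^sup>+y\<in>ball x r. h y \<partial>lborel)"
    using eventually_happens by fastforce
  show "\<exists>e>0. ball x e \<subseteq> {x. s < maximal h x}"
  proof (intro exI[of _ "\<rho> - r"] conjI subsetI)
    fix y assume "y \<in> ball x (\<rho> - r)"
    then have sub: "ball x r \<subseteq> ball y \<rho>" by (auto simp: subset_iff) (metis add.commute dist_commute dist_triangle_less_add diff_add_cancel)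
    have "(\<integral>\<^sup>+y\<in>ball x r. h y \<partial>lborel) \<le> (\<integral>\<^sup>+y\<in>ball y \<rho>. h y \<partial>lborel)"
      using sub by (intro nn_integral_mono mult_left_mono) (auto simp: indicator_def)
    with \<rho> r(1) show "y \<in> {x. s < maximal h x}" by (auto intro!: maximal_ge[of \<rho>])
  qed (use \<rho> in auto)
qed

lemma borel_measurable_maximal[measurable]: "maximal h \<in> borel_measurable borel"
proof (rule borel_measurableI_greater)
  fix y :: ennreal
  show "{x \<in> space borel. y < maximal h x} \<in> sets borel"
  proof (cases "y < \<infinity>")
    case True
    then show ?thesis using borel_open[OF open_maximal_gt] by simp
  next
    case False
    then have "{x. y < maximal h x} = {}" by (auto simp: not_less top.extremum_unique)
    then show ?thesis by simp
  qed
qed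

lemma maximal_mono: "(\<And>y. h y \<le> g y) \<Longrightarrow> maximal h x \<le> maximal g x"
  unfolding maximal_def ball_avg_def
  by (intro SUP_mono') (auto intro!: divide_right_mono_ennreal nn_integral_mono mult_right_mono)

lemma maximal_add_const:
  fixes h :: "'a::euclidean_space \<Rightarrow> ennreal"
  assumes [measurable]: "h \<in> borel_measurable borel"
  shows "maximal (\<lambda>y. h y + c) x \<le> maximal h x + c"
  unfolding maximal_def
proof (rule SUP_least)
  fix r :: real assume r: "r \<in> {0<..<2}"
  have "(\<integral>\<^sup>+y\<in>ball x r. (h y + c) \<partial>lborel) = (\<integral>\<^sup>+y\<in>ball x r. h y \<partial>lborel) + c * ball_vol TYPE('a) r"
    using r by (simp add: distrib_right, subst nn_integral_add)
      (auto simp: nn_integral_cmult_indicator emeasure_ball_vol)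
  then have "ball_avg (\<lambda>y. h y + c) x r = ball_avg h x r + c * (ball_vol TYPE('a) r / ball_vol TYPE('a) r)"
    by (simp add: ball_avg_def add_divide_distrib_ennreal ennreal_times_divide)
  also have "\<dots> = ball_avg h x r + c"
    using r ball_vol_pos[of r, where 'a='a] ball_vol_finite[of r, where 'a='a] by simp
  also have "\<dots> \<le> (SUP r\<in>{0<..<2}. ball_avg h x r) + c" using r by (intro add_mono SUP_upper) auto
  finally show "ball_avg (\<lambda>y. h y + c) x r \<le> (SUP r\<in>{0<..<2}. ball_avg h x r) + c" .
qed

text \<open>Vitali: among the balls that witness \<open>s < maximal h x\<close> there is a disjoint
  subfamily whose fivefold enlargements cover the set, and over disjoint balls the integrals of
  \<open>h\<close> add up.\<close>

lemma maximal_weak_type: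
  fixes h :: "'a::euclidean_space \<Rightarrow> ennreal"
  assumes [measurable]: "h \<in> borel_measurable borel"
  shows "s * emeasure lborel {x. s < maximal h x} \<le> 5 ^ DIM('a) * (\<integral>\<^sup>+y. h y \<partial>lborel)"
proof -
  define E where "E = {x. s < maximal h x}"
  have "\<exists>r. 0 < r \<and> r < 2 \<and> s * ball_vol TYPE('a) r < (\<integral>\<^sup>+y\<in>ball x r. h y \<partial>lborel)" if "x \<in> E" for x
    using that unfolding E_def by (auto elim: less_maximalE)
  then obtain r where r: "\<And>x. x \<in> E \<Longrightarrow> 0 < r x \<and> r x < 2"
      "\<And>x. x \<in> E \<Longrightarrow> s * ball_vol TYPE('a) (r x) < (\<integral>\<^sup>+y\<in>ball x (r x). h y \<partial>lborel)" by metis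
  have sub: "E \<subseteq> (\<Union>x\<in>E. ball x (r x))" using r by force
  have r': "\<And>x. x \<in> E \<Longrightarrow> 0 < r x \<and> r x \<le> 2" using r by force
  have "\<exists>C. countable C \<and> C \<subseteq> E \<and> pairwise (\<lambda>i j. disjnt (ball i (r i)) (ball j (r j))) C \<and>
     E \<subseteq> (\<Union>i\<in>C. ball i (5 * r i))"
    using Vitali_covering_lemma_balls[where a="\<lambda>x. x" and r=r and K=E and B=2 and S=E] sub r'
    by (metis (mono_tags, lifting))
  then obtain C where C: "countable C" "C \<subseteq> E" "pairwise (\<lambda>i j. disjnt (ball i (r i)) (ball j (r j))) C"
     "E \<subseteq> (\<Union>i\<in>C. ball i (5 * r i))" by (elim exE conjE)
  \<comment> \<open>The subfamily may be finite; it is indexed by natural numbers, with empty sets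
    outside \<open>T\<close>.\<close>
  define T where "T = to_nat_on C ` C"
  define g where "g = from_nat_into C"
  have gT: "g n \<in> C" if "n \<in> T" for n using that C(1) by (auto simp: T_def g_def)
  have ginj: "i = j" if "i \<in> T" "j \<in> T" "g i = g j" for i j
    using that C(1) by (auto simp: T_def g_def)
  have gonto: "\<exists>n\<in>T. g n = c" if "c \<in> C" for c using that C(1) by (auto simp: T_def g_def)
  define A where "A n = (if n \<in> T then ball (g n) (r (g n)) else {})" for n
  define A5 where "A5 n = (if n \<in> T then ball (g n) (5 * r (g n)) else {})" for n
  have dis: "disjoint_family A"
    unfolding disjoint_family_on_def
  proof (intro ballI impI)
    fix m n :: nat assume "m \<noteq> n"
    show "A m \<inter> A n = {}"
    proof (cases "m \<in> T \<and> n \<in> T")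
      case True
      then have "g m \<noteq> g n" using ginj \<open>m \<noteq> n\<close> by blast
      then have "disjnt (ball (g m) (r (g m))) (ball (g n) (r (g n)))"
        using pairwiseD[OF C(3)] gT True by blast
      then show ?thesis using True unfolding A_def disjnt_def by simp
    qed (auto simp: A_def)
  qed
  have [measurable]: "A n \<in> sets borel" "A5 n \<in> sets borel" for n by (auto simp: A_def A5_def)
  have "s * emeasure lborel E \<le> s * emeasure lborel (\<Union>n. A5 n)"
  proof (intro mult_left_mono emeasure_mono)
    show "E \<subseteq> (\<Union>n. A5 n)" using C(4) gonto by (fastforce simp: A5_def)
  qed auto
  also have "\<dots> \<le> s * (\<Sum>n. emeasure lborel (A5 n))"
    by (intro mult_left_mono emeasure_subadditive_countably) auto
  also have "\<dots> = (\<Sum>n. s * emeasure lborel (A5 n))" by simp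
  also have "\<dots> \<le> (\<Sum>n. 5 ^ DIM('a) * (\<integral>\<^sup>+y\<in>A n. h y \<partial>lborel))"
  proof (intro suminf_le summableI)
    fix n
    show "s * emeasure lborel (A5 n) \<le> 5 ^ DIM('a) * (\<integral>\<^sup>+y\<in>A n. h y \<partial>lborel)"
    proof (cases "n \<in> T")
      case True
      have gE: "g n \<in> E" using gT[OF True] C(2) by blast
      have b5: "ball_vol TYPE('a) (5 * \<rho>) = 5 ^ DIM('a) * ball_vol TYPE('a) \<rho>" for \<rho>
        using ball_vol_scale[of 5 \<rho>, where 'a='a] by (simp add: ennreal_power[symmetric])
      have "emeasure lborel (A5 n) = ball_vol TYPE('a) (5 * r (g n))"
        using True r(1)[OF gE] emeasure_ball_vol[of "5 * r (g n)" "g n"] by (simp add: A5_def)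
      then have "s * emeasure lborel (A5 n) = 5 ^ DIM('a) * (s * ball_vol TYPE('a) (r (g n)))"
        unfolding b5 by (simp add: mult_ac)
      also have "\<dots> \<le> 5 ^ DIM('a) * (\<integral>\<^sup>+y\<in>ball (g n) (r (g n)). h y \<partial>lborel)"
        using r(2)[OF gE] by (intro mult_left_mono) auto
      finally show ?thesis using True by (simp add: A_def)
    qed (simp add: A_def A5_def)
  qed
  also have "\<dots> = 5 ^ DIM('a) * (\<Sum>n. \<integral>\<^sup>+y. h y * indicator (A n) y \<partial>lborel)" by simp
  also have "(\<Sum>n. \<integral>\<^sup>+y. h y * indicator (A n) y \<partial>lborel) = (\<Sum>n. emeasure (density lborel h) (A n))"
    by (simp add: emeasure_density)
  also have "\<dots> = emeasure (density lborel h) (\<Union>n. A n)"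
    by (rule suminf_emeasure) (use dis in auto)
  also have "\<dots> = (\<integral>\<^sup>+y. h y * indicator (\<Union>n. A n) y \<partial>lborel)" by (simp add: emeasure_density)
  also have "\<dots> \<le> (\<integral>\<^sup>+y. h y \<partial>lborel)" by (intro nn_integral_mono) (auto simp: indicator_def)
  finally show ?thesis by (simp add: E_def mult_left_mono)
qed

text \<open>\<open>h\<close> is at most its part above \<open>s\<close> plus the constant
  \<open>s\<close>, so only the part above \<open>s\<close> can lift the maximal function past
  \<open>2 * s\<close>. Restricting the integral in this way makes the dyadic sum of the estimates
  converge.\<close>

lemma maximal_weak_type_truncated:
  fixes h :: "'a::euclidean_space \<Rightarrow> ennreal"
  assumes [measurable]: "h \<in> borel_measurable borel"
  shows "s * emeasure lborel {x. 2 * s < maximal h x} \<le> 5 ^ DIM('a) * (\<integral>\<^sup>+y\<in>{y. s < h y}. h y \<partial>lborel)"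
proof -
  define g where "g y = h y * indicator {y. s < h y} y" for y
  have [measurable]: "g \<in> borel_measurable borel" unfolding g_def by measurable
  have "maximal h x \<le> maximal g x + s" for x
  proof -
    have "maximal h x \<le> maximal (\<lambda>y. g y + s) x"
      by (rule maximal_mono) (auto simp: g_def indicator_def not_less)
    also have "\<dots> \<le> maximal g x + s" by (rule maximal_add_const) measurable
    finally show ?thesis .
  qed
  then have "{x. 2 * s < maximal h x} \<subseteq> {x. s < maximal g x}"
    by (auto simp: mult_2) (metis add_mono_thms_linordered_semiring(3) not_le order_trans)
  then have "s * emeasure lborel {x. 2 * s < maximal h x} \<le> s * emeasure lborel {x. s < maximal g x}"
    by (intro mult_left_mono emeasure_mono) auto
  also have "\<dots> \<le> 5 ^ DIM('a) * (\<integral>\<^sup>+y. g y \<partial>lborel)" by (rule maximal_weak_type) measurable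
  finally show ?thesis by (simp add: g_def)
qed

text \<open>A geometric sum is a multiple of its last term, and \<open>q powr (log 2 y)\<close>
  equals \<open>y powr (log 2 q)\<close>. For \<open>q = 2 powr (p - 1)\<close> the exponent is
  \<open>p - 1\<close>.\<close>

lemma geometric_dyadic_sum:
  fixes q y :: real
  assumes "q > 1" "y \<ge> 0"
  shows "(\<Sum>n. ennreal (q ^ n) * indicator {n. 2 ^ n < y} n) \<le> ennreal (q / (q - 1) * y powr (log 2 q))"
proof (cases "y \<le> 1")
  case True
  have "1 \<le> (2::real) ^ n" for n by simp
  then have "\<not> 2 ^ n < y" for n using True by (meson leD le_less_trans less_imp_le order_trans)
  then have "indicator {n. 2 ^ n < y} n = (0::ennreal)" for n by simp
  then show ?thesis by simp
next
  case False
  define N where "N = nat \<lfloor>log 2 y\<rfloor>"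
  have fin: "n \<le> N" if "2 ^ n < y" for n
  proof -
    have "real n < log 2 y" using that False by (simp add: less_log_iff powr_realpow)
    then show ?thesis unfolding N_def by linarith
  qed
  have l0: "log 2 y \<ge> 0" using False by simp
  have "(\<Sum>n. ennreal (q ^ n) * indicator {n. 2 ^ n < y} n) = (\<Sum>n\<le>N. ennreal (q ^ n) * indicator {n. 2 ^ n < y} n)"
    by (rule suminf_finite) (auto dest: fin simp: indicator_def)
  also have "\<dots> \<le> (\<Sum>n\<le>N. ennreal (q ^ n))"
    by (intro sum_mono) (auto simp: indicator_def)
  also have "\<dots> = ennreal (\<Sum>n\<le>N. q ^ n)" using assms by simp
  also have "(\<Sum>n\<le>N. q ^ n) = (q ^ Suc N - 1) / (q - 1)"
    using assms geometric_sum[of q "Suc N"] by (simp add: lessThan_Suc_atMost)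
  also have "ennreal \<dots> \<le> ennreal (q / (q - 1) * y powr (log 2 q))"
  proof (rule ennreal_leI)
    have "q ^ N = q powr N" using assms by (simp add: powr_realpow)
    also have "\<dots> \<le> q powr (log 2 y)" using assms l0 by (intro powr_mono) (auto simp: N_def)
    also have "\<dots> = y powr (log 2 q)"
      using assms False by (simp add: powr_def log_def)
    finally have "q * q ^ N \<le> q * y powr (log 2 q)" using assms by (intro mult_left_mono) auto
    then have "q ^ Suc N - 1 \<le> q * y powr (log 2 q)" unfolding power_Suc by linarith
    then have "(q ^ Suc N - 1) / (q - 1) \<le> (q * y powr (log 2 q)) / (q - 1)"
      using assms by (intro divide_right_mono) simp_all
    then show "(q ^ Suc N - 1) / (q - 1) \<le> q / (q - 1) * y powr (log 2 q)" by simp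
  qed
  finally show ?thesis .
qed

text \<open>A dyadic form of the strong type inequality. It is this form that is used later: the
  terms of the convergent series tend to 0, which is the decay of the measure of the superlevel
  sets. It follows by summing the truncated weak type estimates and exchanging sum and integral;
  \<open>p > 1\<close> makes the geometric ratio exceed 1.\<close>

lemma maximal_strong_type:
  fixes h :: "'a::euclidean_space \<Rightarrow> real"
  assumes [measurable]: "h \<in> borel_measurable borel" and h: "\<And>x. h x \<ge> 0" and p: "p > 1"
  shows "(\<Sum>n. ennreal (2 powr (p * real n)) * emeasure lborel {x. ennreal (2 ^ Suc n) < maximal (\<lambda>y. ennreal (h y)) x})
    \<le> 5 ^ DIM('a) * ennreal (2 powr (p - 1) / (2 powr (p - 1) - 1)) * (\<integral>\<^sup>+y. ennreal (h y powr p) \<partial>lborel)"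
proof -
  define q where "q = 2 powr (p - 1)"
  have q: "q > 1" using p by (simp add: q_def)
  \<comment> \<open>The factor \<open>2 ^ n\<close> is spent on the weak type inequality, and
    \<open>q ^ n\<close> remains for the geometric sum.\<close>
  have qn: "2 powr (p * real n) = q ^ n * 2 ^ n" for n
  proof -
    have "q ^ n = 2 powr ((p - 1) * real n)" by (simp add: q_def powr_power mult.commute)
    then show ?thesis by (simp add: powr_realpow[symmetric] powr_add[symmetric] algebra_simps)
  qed
  have step: "ennreal (2 powr (p * real n)) * emeasure lborel {x. ennreal (2 ^ Suc n) < maximal (\<lambda>y. ennreal (h y)) x}
     \<le> 5 ^ DIM('a) * (\<integral>\<^sup>+y. ennreal (q ^ n) * indicator {n. 2 ^ n < h y} n * ennreal (h y) \<partial>lborel)" for n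
  proof -
    have e2: "ennreal (2 ^ Suc n) = 2 * ennreal (2 ^ n)"
      by (simp add: ennreal_mult)
    have "ennreal (2 powr (p * real n)) * emeasure lborel {x. ennreal (2 ^ Suc n) < maximal (\<lambda>y. ennreal (h y)) x}
      = ennreal (q ^ n) * (ennreal (2 ^ n) * emeasure lborel {x. 2 * ennreal (2 ^ n) < maximal (\<lambda>y. ennreal (h y)) x})"
      using q unfolding qn e2 by (simp add: ennreal_mult mult.assoc)
    also have "\<dots> \<le> ennreal (q ^ n) * (5 ^ DIM('a) * (\<integral>\<^sup>+y\<in>{y. ennreal (2 ^ n) < ennreal (h y)}. ennreal (h y) \<partial>lborel))"
      by (intro mult_left_mono maximal_weak_type_truncated) auto
    also have "\<dots> = 5 ^ DIM('a) * (\<integral>\<^sup>+y. ennreal (q ^ n) * (ennreal (h y) * indicator {y. ennreal (2 ^ n) < ennreal (h y)} y) \<partial>lborel)"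
      by (subst nn_integral_cmult) (auto simp: mult_ac)
    also have "(\<integral>\<^sup>+y. ennreal (q ^ n) * (ennreal (h y) * indicator {y. ennreal (2 ^ n) < ennreal (h y)} y) \<partial>lborel)
       = (\<integral>\<^sup>+y. ennreal (q ^ n) * indicator {n. 2 ^ n < h y} n * ennreal (h y) \<partial>lborel)"
      by (intro nn_integral_cong) (auto simp: indicator_def ennreal_less_iff mult_ac)
    finally show ?thesis .
  qed
  have "(\<Sum>n. ennreal (2 powr (p * real n)) * emeasure lborel {x. ennreal (2 ^ Suc n) < maximal (\<lambda>y. ennreal (h y)) x})
    \<le> (\<Sum>n. 5 ^ DIM('a) * (\<integral>\<^sup>+y. ennreal (q ^ n) * indicator {n. 2 ^ n < h y} n * ennreal (h y) \<partial>lborel))"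
    by (intro suminf_le summableI step)
  also have "\<dots> = 5 ^ DIM('a) * (\<integral>\<^sup>+y. (\<Sum>n. ennreal (q ^ n) * indicator {n. 2 ^ n < h y} n) * ennreal (h y) \<partial>lborel)"
    by (simp add: nn_integral_suminf[symmetric])
  also have "\<dots> \<le> 5 ^ DIM('a) * (\<integral>\<^sup>+y. ennreal (q / (q - 1)) * ennreal (h y powr p) \<partial>lborel)"
  proof (intro mult_left_mono nn_integral_mono)
    fix y
    have "(\<Sum>n. ennreal (q ^ n) * indicator {n. 2 ^ n < h y} n) * ennreal (h y) \<le>
      ennreal (q / (q - 1) * h y powr (log 2 q)) * ennreal (h y)"
      by (intro mult_right_mono geometric_dyadic_sum q h) simp
    also have "log 2 q = p - 1" by (simp add: q_def)
    also have "ennreal (q / (q - 1) * h y powr (p - 1)) * ennreal (h y) = ennreal (q / (q - 1)) * ennreal (h y powr (p - 1) * h y)"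
      using q h by (simp add: ennreal_mult[symmetric] mult_ac)
    also have "h y powr (p - 1) * h y = h y powr p"
      using h[of y] powr_add[of "h y" "p - 1" 1] by (cases "h y = 0") auto
    finally show "(\<Sum>n. ennreal (q ^ n) * indicator {n. 2 ^ n < h y} n) * ennreal (h y)
       \<le> ennreal (q / (q - 1)) * ennreal (h y powr p)" .
  qed auto
  also have "\<dots> = 5 ^ DIM('a) * ennreal (q / (q - 1)) * (\<integral>\<^sup>+y. ennreal (h y powr p) \<partial>lborel)"
    by (simp add: nn_integral_cmult mult.assoc)
  finally show ?thesis by (simp add: q_def)
qed

section \<open>Difference quotients along lines\<close>

text \<open>The integral of a difference quotient of \<phi> over the unit interval is a difference
  of two difference quotients of a primitive of \<phi>, which tends to
  \<open>\<phi> 1 - \<phi> 0\<close> by continuity of \<phi>. No differentiability of \<phi> enters;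
  \<open>ennreal\<close> only drops negative parts.\<close>

lemma lipschitz_increment_le_liminf:
  fixes \<phi> :: "real \<Rightarrow> real"
  assumes lip: "C-lipschitz_on UNIV \<phi>" and h: "\<And>n. 0 < h n" "\<And>n. h n \<le> 1" "h \<longlonglongrightarrow> 0"
  shows "ennreal (\<phi> 1 - \<phi> 0) \<le> liminf (\<lambda>n. \<integral>\<^sup>+t\<in>{0..1}. ennreal ((\<phi> (t + h n) - \<phi> t) / h n) \<partial>lborel)"
proof -
  have cont: "continuous_on S \<phi>" for S
    using lipschitz_on_continuous_on[OF lip] continuous_on_subset by blast
  \<comment> \<open>The interval from -1 to 3 leaves room for \<open>t\<close> and
    \<open>t + h n\<close> when \<open>t\<close> is in the unit interval.\<close>
  define P where "P = (\<lambda>x. integral {-1..x} \<phi>)"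
  have P: "(P has_real_derivative \<phi> x) (at x)" if "-1 < x" "x < 3" for x
    using integral_has_real_derivative[OF cont, of x "-1" 3] that
    by (simp add: P_def at_within_Icc_at)
  define I where "I n = ((P (1 + h n) - P 1) - (P (h n) - P 0)) / h n" for n
  have hi: "((\<lambda>t. (\<phi> (t + h n) - \<phi> t) / h n) has_integral I n) {0..1}" for n
  proof -
    have "((\<lambda>t. (\<phi> (t + h n) - \<phi> t) / h n) has_integral
       ((P (1 + h n) - P 1) / h n - (P (0 + h n) - P 0) / h n)) {0..1}"
    proof (rule fundamental_theorem_of_calculus)
      fix t :: real assume t: "t \<in> {0..1}"
      have "(P has_real_derivative \<phi> (t + h n)) (at (t + h n))"
        using t h(1,2)[of n] by (intro P) auto
      then have 1: "((\<lambda>t. P (t + h n)) has_real_derivative \<phi> (t + h n)) (at t)"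
        by (simp add: DERIV_shift)
      have 2: "(P has_real_derivative \<phi> t) (at t)" using t by (intro P) auto
      have "((\<lambda>t. (P (t + h n) - P t) / h n) has_real_derivative (\<phi> (t + h n) - \<phi> t) / h n) (at t)"
        by (intro DERIV_cdivide DERIV_diff 1 2)
      then show "((\<lambda>t. (P (t + h n) - P t) / h n) has_vector_derivative (\<phi> (t + h n) - \<phi> t) / h n) (at t within {0..1})"
        using has_real_derivative_iff_has_vector_derivative has_vector_derivative_at_within by blast
    qed simp
    then show ?thesis by (simp add: I_def diff_divide_distrib)
  qed
  have hlim: "filterlim h (at 0) sequentially"
    using h(1,3) by (intro filterlim_atI) (auto intro!: always_eventually simp: less_imp_neq[symmetric])
  have Pl: "(\<lambda>n. (P (x + h n) - P x) / h n) \<longlonglongrightarrow> \<phi> x" if "-1 < x" "x < 3" for x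
    using filterlim_compose[OF DERIV_D[OF P[OF that]] hlim] .
  have "(\<lambda>n. (P (1 + h n) - P 1) / h n - (P (0 + h n) - P 0) / h n) \<longlonglongrightarrow> \<phi> 1 - \<phi> 0"
    by (intro tendsto_diff Pl) auto
  then have "I \<longlonglongrightarrow> \<phi> 1 - \<phi> 0" unfolding I_def[abs_def] by (simp add: diff_divide_distrib)
  then have Ilim: "(\<lambda>n. ennreal (I n)) \<longlonglongrightarrow> ennreal (\<phi> 1 - \<phi> 0)" by (rule tendsto_ennrealI)
  have Iu: "ennreal (I n) \<le> (\<integral>\<^sup>+t\<in>{0..1}. ennreal ((\<phi> (t + h n) - \<phi> t) / h n) \<partial>lborel)" for n
  proof -
    define g where "g t = max 0 ((\<phi> (t + h n) - \<phi> t) / h n)" for t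
    have "continuous_on {0..1} g"
      unfolding g_def using h(1,2)[of n]
      by (intro continuous_intros continuous_on_compose2[OF cont[of UNIV]] cont) auto
    then have "g integrable_on {0..1}" by (rule integrable_continuous_interval)
    then have gi: "(g has_integral integral {0..1} g) {0..1}" by (rule integrable_integral)
    have "I n \<le> integral {0..1} g" by (rule has_integral_le[OF hi gi]) (simp add: g_def)
    then have "ennreal (I n) \<le> ennreal (integral {0..1} g)" by (rule ennreal_leI)
    also have "\<dots> = (\<integral>\<^sup>+t. ennreal (g t) * indicator {0..1} t \<partial>lborel)"
      by (rule nn_integral_has_integral_lebesgue'[OF _ gi, symmetric]) (simp add: g_def)
    also have "\<dots> = (\<integral>\<^sup>+t\<in>{0..1}. ennreal ((\<phi> (t + h n) - \<phi> t) / h n) \<partial>lborel)"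
      by (intro nn_integral_cong) (simp add: g_def max_def ennreal_neg)
    finally show ?thesis .
  qed
  have "ennreal (\<phi> 1 - \<phi> 0) = liminf (\<lambda>n. ennreal (I n))"
    using lim_imp_Liminf[OF _ Ilim] by simp
  also have "\<dots> \<le> liminf (\<lambda>n. \<integral>\<^sup>+t\<in>{0..1}. ennreal ((\<phi> (t + h n) - \<phi> t) / h n) \<partial>lborel)"
    by (intro Liminf_mono always_eventually allI Iu)
  finally show ?thesis .
qed

lemma lipschitz_increment_le_UNIV:
  fixes \<phi> :: "real \<Rightarrow> real"
  assumes lip: "C-lipschitz_on UNIV \<phi>"
  shows "ennreal (\<phi> 1 - \<phi> 0) \<le>
    (\<integral>\<^sup>+t\<in>{0..1}. limsup (\<lambda>n. ennreal (real (Suc n) * (\<phi> (t + 1 / real (Suc n)) - \<phi> t))) \<partial>lborel)"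
proof -
  have [measurable]: "\<phi> \<in> borel_measurable borel"
    using lipschitz_on_continuous_on[OF lip] by (rule borel_measurable_continuous_onI)
  define h where "h n = 1 / real (Suc n)" for n
  have h: "0 < h n" "h n \<le> 1" for n by (auto simp: h_def)
  have h0: "h \<longlonglongrightarrow> 0" unfolding h_def by real_asymp
  define u where "u n t = ennreal ((\<phi> (t + h n) - \<phi> t) / h n) * indicator {0..1} t" for n t
  have [measurable]: "u n \<in> borel_measurable lborel" for n unfolding u_def by measurable
  have "ennreal (\<phi> 1 - \<phi> 0) \<le> liminf (\<lambda>n. integral\<^sup>N lborel (u n))"
    unfolding u_def by (rule lipschitz_increment_le_liminf[OF lip h h0])
  also have "\<dots> \<le> limsup (\<lambda>n. integral\<^sup>N lborel (u n))" by (rule Liminf_le_Limsup) simp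
  also have "\<dots> \<le> (\<integral>\<^sup>+t. limsup (\<lambda>n. u n t) \<partial>lborel)"
  \<comment> \<open>Reverse Fatou, dominated by the Lipschitz constant.\<close>
  proof (rule nn_integral_limsup)
    show "AE t in lborel. u n t \<le> ennreal C * indicator {0..1} t" for n
    proof (rule AE_I2)
      fix t
      have "\<phi> (t + h n) - \<phi> t \<le> C * h n"
        using lipschitz_onD[OF lip, of "t + h n" t] h[of n] by (simp add: dist_real_def)
      then have "(\<phi> (t + h n) - \<phi> t) / h n \<le> C" using h[of n] by (simp add: field_simps)
      then show "u n t \<le> ennreal C * indicator {0..1} t"
        unfolding u_def by (intro mult_right_mono ennreal_leI) auto
    qed
    show "(\<integral>\<^sup>+ x. ennreal C * indicator {0..1::real} x \<partial>lborel) < \<infinity>"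
      by (simp add: nn_integral_cmult_indicator ennreal_mult_less_top)
  qed measurable
  also have "\<dots> = (\<integral>\<^sup>+t\<in>{0..1}. limsup (\<lambda>n. ennreal (real (Suc n) * (\<phi> (t + 1 / real (Suc n)) - \<phi> t))) \<partial>lborel)"
    by (intro nn_integral_cong) (auto simp: u_def h_def indicator_def Limsup_const mult.commute)
  finally show ?thesis .
qed

lemma lipschitz_increment_le:
  fixes \<phi> :: "real \<Rightarrow> real"
  assumes lip: "C-lipschitz_on {0..1} \<phi>"
  shows "ennreal (\<phi> 1 - \<phi> 0) \<le>
    (\<integral>\<^sup>+t\<in>{0..1}. limsup (\<lambda>n. ennreal (real (Suc n) * (\<phi> (t + 1 / real (Suc n)) - \<phi> t))) \<partial>lborel)"
proof -
  define \<psi> where "\<psi> t = \<phi> (max 0 (min t 1))" for t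
  have "C-lipschitz_on UNIV \<psi>"
  proof (rule lipschitz_onI)
    fix x y :: real
    have "dist (\<psi> x) (\<psi> y) \<le> C * dist (max 0 (min x 1)) (max 0 (min y 1))"
      unfolding \<psi>_def by (rule lipschitz_onD[OF lip]) auto
    also have "\<dots> \<le> C * dist x y"
      using lipschitz_on_nonneg[OF lip] by (intro mult_left_mono) (auto simp: dist_real_def)
    finally show "dist (\<psi> x) (\<psi> y) \<le> C * dist x y" .
  qed (rule lipschitz_on_nonneg[OF lip])
  from lipschitz_increment_le_UNIV[OF this]
  have "ennreal (\<phi> 1 - \<phi> 0) \<le>
    (\<integral>\<^sup>+t\<in>{0..1}. limsup (\<lambda>n. ennreal (real (Suc n) * (\<psi> (t + 1 / real (Suc n)) - \<psi> t))) \<partial>lborel)"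
    by (simp add: \<psi>_def)
  also have "\<dots> = (\<integral>\<^sup>+t\<in>{0..1}. limsup (\<lambda>n. ennreal (real (Suc n) * (\<phi> (t + 1 / real (Suc n)) - \<phi> t))) \<partial>lborel)"
  proof (rule nn_integral_cong_AE)
    have "AE t in lborel. t \<noteq> (1::real)" by (rule AE_lborel_singleton)
    then show "AE t in lborel. limsup (\<lambda>n. ennreal (real (Suc n) * (\<psi> (t + 1 / real (Suc n)) - \<psi> t))) * indicator {0..1} t =
        limsup (\<lambda>n. ennreal (real (Suc n) * (\<phi> (t + 1 / real (Suc n)) - \<phi> t))) * indicator {0..1} t"
    proof eventually_elim
      case (elim t)
      show ?case
      proof (cases "t \<in> {0..1}")
        case True
        then have t: "0 \<le> t" "t < 1" using elim by auto
        have "(\<lambda>n. t + 1 / real (Suc n)) \<longlonglongrightarrow> t + 0" by (intro tendsto_add tendsto_const) real_asymp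
        then have "\<forall>\<^sub>F n in sequentially. t + 1 / real (Suc n) < 1" using t by (intro order_tendstoD) auto
        then have "\<forall>\<^sub>F n in sequentially. ennreal (real (Suc n) * (\<psi> (t + 1 / real (Suc n)) - \<psi> t)) =
           ennreal (real (Suc n) * (\<phi> (t + 1 / real (Suc n)) - \<phi> t))"
          by (rule eventually_mono) (use t in \<open>simp add: \<psi>_def min_def max_def\<close>)
        then have "limsup (\<lambda>n. ennreal (real (Suc n) * (\<psi> (t + 1 / real (Suc n)) - \<psi> t))) =
           limsup (\<lambda>n. ennreal (real (Suc n) * (\<phi> (t + 1 / real (Suc n)) - \<phi> t)))"
          by (rule Limsup_eq)
        then show ?thesis by simp
      qed simp
    qed
  qed
  finally show ?thesis .
qed

text \<open>Metric speed in direction \<open>z\<close>. Restricting to the steps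
  \<open>1 / Suc n\<close> keeps it Borel for continuous \<open>F\<close>, and the upper limit is
  the side that bounds increments from above.\<close>

definition upper_speed :: "('a::real_normed_vector \<Rightarrow> 'x::metric_space) \<Rightarrow> 'a \<Rightarrow> 'a \<Rightarrow> ennreal" where
  "upper_speed F z x = limsup (\<lambda>n. ennreal (real (Suc n) * dist (F (x + z /\<^sub>R real (Suc n))) (F x)))"

text \<open>The real function of t given by \<open>dist (F (x + t *\<^sub>R z)) (F x)\<close>
  absorbs the metric target: by the triangle inequality its increments are at most those of
  \<open>F\<close>.\<close>

lemma dist_le_upper_speed:
  fixes F :: "'a::real_normed_vector \<Rightarrow> 'x::metric_space"
  assumes lip: "C-lipschitz_on S F" and seg: "\<And>t. t \<in> {0..1} \<Longrightarrow> x + t *\<^sub>R z \<in> S"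
  shows "ennreal (dist (F (x + z)) (F x)) \<le> (\<integral>\<^sup>+t\<in>{0..1}. upper_speed F z (x + t *\<^sub>R z) \<partial>lborel)"
proof -
  define \<phi> where "\<phi> t = dist (F (x + t *\<^sub>R z)) (F x)" for t
  have "(C * norm z)-lipschitz_on {0..1} \<phi>"
  proof (rule lipschitz_onI)
    fix s t :: real assume st: "s \<in> {0..1}" "t \<in> {0..1}"
    have "dist (\<phi> s) (\<phi> t) \<le> dist (F (x + s *\<^sub>R z)) (F (x + t *\<^sub>R z))"
      unfolding \<phi>_def dist_real_def
      using dist_triangle[of "F (x + s *\<^sub>R z)" "F x" "F (x + t *\<^sub>R z)"]
        dist_triangle3[of "F (x + t *\<^sub>R z)" "F x" "F (x + s *\<^sub>R z)"] by (auto simp: abs_le_iff)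
    also have "\<dots> \<le> C * dist (x + s *\<^sub>R z) (x + t *\<^sub>R z)" using st by (intro lipschitz_onD[OF lip] seg)
    also have "\<dots> = C * norm z * dist s t"
      by (simp add: dist_norm scaleR_diff_left[symmetric] mult_ac)
    finally show "dist (\<phi> s) (\<phi> t) \<le> C * norm z * dist s t" .
  qed (use lipschitz_on_nonneg[OF lip] in simp)
  from lipschitz_increment_le[OF this]
  have "ennreal (dist (F (x + z)) (F x)) \<le>
    (\<integral>\<^sup>+t\<in>{0..1}. limsup (\<lambda>n. ennreal (real (Suc n) * (\<phi> (t + 1 / real (Suc n)) - \<phi> t))) \<partial>lborel)"
    by (simp add: \<phi>_def)
  also have "\<dots> \<le> (\<integral>\<^sup>+t\<in>{0..1}. upper_speed F z (x + t *\<^sub>R z) \<partial>lborel)"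
    unfolding upper_speed_def
  proof (intro nn_integral_mono mult_right_mono Limsup_mono always_eventually allI ennreal_leI mult_left_mono)
    fix t :: real and n
    have e: "x + (t + 1 / real (Suc n)) *\<^sub>R z = x + t *\<^sub>R z + z /\<^sub>R real (Suc n)"
      by (simp add: scaleR_add_left inverse_eq_divide)
    show "\<phi> (t + 1 / real (Suc n)) - \<phi> t \<le> dist (F (x + t *\<^sub>R z + z /\<^sub>R real (Suc n))) (F (x + t *\<^sub>R z))"
      unfolding \<phi>_def e
      using dist_triangle[of "F (x + t *\<^sub>R z + z /\<^sub>R real (Suc n))" "F x" "F (x + t *\<^sub>R z)"]
      by linarith
  qed auto
  finally show ?thesis .
qed

lemma nn_integral_lborel_shift:
  fixes g :: "'a::euclidean_space \<Rightarrow> ennreal"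
  assumes [measurable]: "g \<in> borel_measurable borel"
  shows "(\<integral>\<^sup>+x. g (x + z) \<partial>lborel) = (\<integral>\<^sup>+x. g x \<partial>lborel)"
proof -
  have "(\<integral>\<^sup>+x. g x \<partial>lborel) = (\<integral>\<^sup>+x. g x \<partial>distr lborel borel ((+) z))" by (simp add: lborel_distr_plus)
  also have "\<dots> = (\<integral>\<^sup>+x. g (z + x) \<partial>lborel)" by (rule nn_integral_distr) auto
  finally show ?thesis by (simp add: add.commute)
qed

lemma nn_integral_lborel_scale:
  fixes g :: "'a::euclidean_space \<Rightarrow> ennreal"
  assumes [measurable]: "g \<in> borel_measurable borel" and "t > 0"
  shows "(\<integral>\<^sup>+x. g x \<partial>lborel) = ennreal (t ^ DIM('a)) * (\<integral>\<^sup>+z. g (x + t *\<^sub>R z) \<partial>lborel)"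
proof -
  have "(\<integral>\<^sup>+w. g w \<partial>lborel) = (\<integral>\<^sup>+w. g w \<partial>density (distr lborel borel (\<lambda>z. x + t *\<^sub>R z)) (\<lambda>_. \<bar>t\<bar>^DIM('a)))"
    using lborel_affine[of t x] assms(2) by simp
  also have "\<dots> = ennreal (t ^ DIM('a)) * (\<integral>\<^sup>+z. g (x + t *\<^sub>R z) \<partial>lborel)"
    using assms(2) by (simp add: nn_integral_density nn_integral_distr nn_integral_cmult)
  finally show ?thesis .
qed

text \<open>Fubini in direction and time: for fixed \<open>t > 0\<close> the map from
  \<open>z\<close> to \<open>x + t *\<^sub>R z\<close> preserves null sets. It holds for every
  \<open>x\<close>, as required for estimates at a prescribed vertex.\<close>

lemma AE_line:
  fixes x :: "'a::euclidean_space"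
  assumes "N \<in> null_sets lborel"
  shows "AE z in lborel. AE t in lborel. t \<in> {0..1} \<longrightarrow> x + t *\<^sub>R z \<notin> N"
proof -
  have [measurable]: "N \<in> sets borel" using assms by auto
  have "(\<integral>\<^sup>+z. (\<integral>\<^sup>+t. indicator N (x + t *\<^sub>R z) * indicator {0..1} t \<partial>lborel) \<partial>(lborel :: 'a measure)) =
      (\<integral>\<^sup>+t. (\<integral>\<^sup>+z. indicator N (x + t *\<^sub>R z) * indicator {0..1} t \<partial>(lborel :: 'a measure)) \<partial>lborel)"
    by (rule lborel_pair.Fubini'[symmetric]) measurable
  also have "\<dots> = (\<integral>\<^sup>+(t::real). 0 \<partial>lborel)"
  proof (rule nn_integral_cong_AE)
    have "AE t in lborel. t \<noteq> (0::real)" by (rule AE_lborel_singleton)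
    then show "AE t in lborel. (\<integral>\<^sup>+z. indicator N (x + t *\<^sub>R z) * indicator {0..1} t \<partial>(lborel :: 'a measure)) = 0"
    proof eventually_elim
      case (elim t)
      show ?case
      proof (cases "t \<in> {0..1}")
        case True
        then have t: "t > 0" using elim by auto
        have "0 = (\<integral>\<^sup>+x. indicator N x \<partial>lborel)" using assms by (simp add: null_setsD1)
        also have "\<dots> = ennreal (t ^ DIM('a)) * (\<integral>\<^sup>+z. indicator N (x + t *\<^sub>R z) \<partial>lborel)"
          by (rule nn_integral_lborel_scale[OF _ t]) measurable
        finally show ?thesis using t True by simp
      qed simp
    qed
  qed
  finally have "(\<integral>\<^sup>+z. (\<integral>\<^sup>+t. indicator N (x + t *\<^sub>R z) * indicator {0..1} t \<partial>lborel) \<partial>(lborel :: 'a measure)) = 0"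
    by simp
  then have "AE z in (lborel :: 'a measure). (\<integral>\<^sup>+t. indicator N (x + t *\<^sub>R z) * indicator {0..1} t \<partial>lborel) = 0"
    by (subst (asm) nn_integral_0_iff_AE) measurable
  then show ?thesis
  proof eventually_elim
    case (elim z)
    then have "AE t in lborel. indicator N (x + t *\<^sub>R z) * indicator {0..1} t = (0::ennreal)"
      by (subst (asm) nn_integral_0_iff_AE) measurable
    then show ?case by eventually_elim (auto simp: indicator_def split: if_splits)
  qed
qed

text \<open>The companion of \<open>AE_line\<close> with fixed direction and generic base point;
  translations preserve null sets for every \<open>t\<close>.\<close>

lemma AE_line_shift:
  fixes z :: "'a::euclidean_space"
  assumes "N \<in> null_sets lborel"
  shows "AE x in lborel. AE t in lborel. t \<in> {0..1} \<longrightarrow> x + t *\<^sub>R z \<notin> N"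
proof -
  have [measurable]: "N \<in> sets borel" using assms by auto
  have "(\<integral>\<^sup>+x. (\<integral>\<^sup>+t. indicator N (x + t *\<^sub>R z) * indicator {0..1} t \<partial>lborel) \<partial>(lborel :: 'a measure)) =
      (\<integral>\<^sup>+t. (\<integral>\<^sup>+x. indicator N (x + t *\<^sub>R z) * indicator {0..1} t \<partial>(lborel :: 'a measure)) \<partial>lborel)"
    by (rule lborel_pair.Fubini'[symmetric]) measurable
  also have "\<dots> = (\<integral>\<^sup>+(t::real). 0 \<partial>lborel)"
  proof (rule nn_integral_cong)
    fix t :: real
    have "(\<integral>\<^sup>+x. indicator N (x + t *\<^sub>R z) \<partial>lborel) = (\<integral>\<^sup>+x. indicator N x \<partial>lborel)"
      by (rule nn_integral_lborel_shift) measurable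
    also have "\<dots> = 0" using assms by (simp add: null_setsD1)
    finally show "(\<integral>\<^sup>+x. indicator N (x + t *\<^sub>R z) * indicator {0..1} t \<partial>(lborel :: 'a measure)) = 0"
      by (simp add: indicator_def)
  qed
  finally have "(\<integral>\<^sup>+x. (\<integral>\<^sup>+t. indicator N (x + t *\<^sub>R z) * indicator {0..1} t \<partial>lborel) \<partial>(lborel :: 'a measure)) = 0"
    by simp
  then have "AE x in (lborel :: 'a measure). (\<integral>\<^sup>+t. indicator N (x + t *\<^sub>R z) * indicator {0..1} t \<partial>lborel) = 0"
    by (subst (asm) nn_integral_0_iff_AE) measurable
  then show ?thesis
  proof eventually_elim
    case (elim x)
    then have "AE t in lborel. indicator N (x + t *\<^sub>R z) * indicator {0..1} t = (0::ennreal)"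
      by (subst (asm) nn_integral_0_iff_AE) measurable
    then show ?case by eventually_elim (auto simp: indicator_def split: if_splits)
  qed
qed

text \<open>For fixed \<open>t\<close> the substitution \<open>x + t *\<^sub>R z\<close> turns the
  average over the ball of radius \<open>r\<close> into the average over the ball of radius
  \<open>t * r\<close> about \<open>x\<close>, which is at most \<open>M\<close> by
  hypothesis.\<close>

lemma line_average_le_maximal:
  fixes g :: "'a::euclidean_space \<Rightarrow> ennreal"
  assumes [measurable]: "g \<in> borel_measurable borel" and bound: "\<And>\<rho>. 0 < \<rho> \<Longrightarrow> \<rho> \<le> r \<Longrightarrow> (\<integral>\<^sup>+y\<in>ball x \<rho>. g y \<partial>lborel) \<le> M * ball_vol TYPE('a) \<rho>"
    and r: "0 < r"
  shows "(\<integral>\<^sup>+z\<in>ball 0 r. (\<integral>\<^sup>+t\<in>{0..1}. g (x + t *\<^sub>R z) \<partial>lborel) \<partial>lborel) \<le> M * ball_vol TYPE('a) r"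
proof -
  have "(\<integral>\<^sup>+z\<in>ball 0 r. (\<integral>\<^sup>+t\<in>{0..1}. g (x + t *\<^sub>R z) \<partial>lborel) \<partial>lborel) =
    (\<integral>\<^sup>+z. (\<integral>\<^sup>+t. g (x + t *\<^sub>R z) * indicator {0..1} t * indicator (ball 0 r) z \<partial>lborel) \<partial>lborel)"
    by (simp add: nn_integral_multc)
  also have "\<dots> = (\<integral>\<^sup>+t. (\<integral>\<^sup>+z. g (x + t *\<^sub>R z) * indicator {0..1} t * indicator (ball 0 r) z \<partial>lborel) \<partial>lborel)"
    by (rule lborel_pair.Fubini'[symmetric]) measurable
  also have "\<dots> \<le> (\<integral>\<^sup>+t. M * ball_vol TYPE('a) r * indicator {0..1::real} t \<partial>lborel)"
  proof (rule nn_integral_mono_AE)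
    have "AE t in lborel. t \<noteq> (0::real)" by (rule AE_lborel_singleton)
    then show "AE t in lborel. (\<integral>\<^sup>+z. g (x + t *\<^sub>R z) * indicator {0..1} t * indicator (ball 0 r) z \<partial>lborel)
      \<le> M * ball_vol TYPE('a) r * indicator {0..1::real} t"
    proof eventually_elim
      case (elim t)
      show ?case
      proof (cases "t \<in> {0..1}")
        case True
        then have t: "t > 0" "t \<le> 1" using elim by auto
        define J where "J = (\<integral>\<^sup>+z. g (x + t *\<^sub>R z) * indicator (ball 0 r) z \<partial>lborel)"
        have "(\<integral>\<^sup>+w. g w * indicator (ball x (t * r)) w \<partial>lborel) =
          ennreal (t ^ DIM('a)) * (\<integral>\<^sup>+z. g (x + t *\<^sub>R z) * indicator (ball x (t * r)) (x + t *\<^sub>R z) \<partial>lborel)"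
          by (rule nn_integral_lborel_scale[OF _ t(1)]) measurable
        also have "(\<integral>\<^sup>+z. g (x + t *\<^sub>R z) * indicator (ball x (t * r)) (x + t *\<^sub>R z) \<partial>lborel) = J"
          unfolding J_def using t by (intro nn_integral_cong) (auto simp: indicator_def dist_norm)
        finally have "ennreal (t ^ DIM('a)) * J = (\<integral>\<^sup>+w. g w * indicator (ball x (t * r)) w \<partial>lborel)" ..
        also have "\<dots> \<le> M * ball_vol TYPE('a) (t * r)"
          using t r by (intro bound) (auto simp: mult_le_cancel_right1)
        also have "\<dots> = ennreal (t ^ DIM('a)) * (M * ball_vol TYPE('a) r)"
          using t by (subst ball_vol_scale) (auto simp: mult_ac)
        finally have "J \<le> M * ball_vol TYPE('a) r"
          using t by (subst (asm) ennreal_mult_le_mult_iff) auto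
        then show ?thesis using True by (simp add: J_def)
      qed simp
    qed
  qed
  also have "\<dots> = M * ball_vol TYPE('a) r" by (simp add: nn_integral_cmult_indicator)
  finally show ?thesis .
qed

text \<open>A difference quotient from the vertex \<open>x\<close> is at most the mean of \<Gamma>
  along the segment, and averaging over directions leads back to ball averages about
  \<open>x\<close>. The left side involves values of \<open>F\<close> only, so the estimate survives
  limits almost everywhere.\<close>

lemma lipschitz_cone_average:
  fixes F :: "'a::euclidean_space \<Rightarrow> 'x::metric_space"
  assumes lip: "C-lipschitz_on U F" and U: "convex U" and \<Gamma>[measurable]: "\<Gamma> \<in> borel_measurable borel"
    and Um[measurable]: "U \<in> sets borel"
    and speed: "AE y in lborel. y \<in> U \<longrightarrow> (\<forall>z. upper_speed F z y \<le> ennreal (norm z) * \<Gamma> y)"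
    and x: "x \<in> U" and r: "0 < r" "r < 2"
  shows "(\<integral>\<^sup>+z\<in>ball 0 r. ennreal (dist (F (x + z)) (F x) / norm z) * indicator U (x + z) \<partial>lborel)
    \<le> maximal (\<lambda>y. \<Gamma> y * indicator U y) x * ball_vol TYPE('a) r"
proof -
  obtain N where N: "{y. \<not> (y \<in> U \<longrightarrow> (\<forall>z. upper_speed F z y \<le> ennreal (norm z) * \<Gamma> y))} \<subseteq> N" "N \<in> null_sets lborel"
    using speed by (auto elim: AE_E simp: null_sets_def)
  define g where "g y = \<Gamma> y * indicator U y" for y
  have [measurable]: "g \<in> borel_measurable borel" unfolding g_def by measurable
  have "(\<integral>\<^sup>+z\<in>ball 0 r. ennreal (dist (F (x + z)) (F x) / norm z) * indicator U (x + z) \<partial>lborel)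
    \<le> (\<integral>\<^sup>+z\<in>ball 0 r. (\<integral>\<^sup>+t\<in>{0..1}. g (x + t *\<^sub>R z) \<partial>lborel) \<partial>lborel)"
  proof (rule nn_integral_mono_AE)
    show "AE z in lborel. ennreal (dist (F (x + z)) (F x) / norm z) * indicator U (x + z) * indicator (ball 0 r) z
      \<le> (\<integral>\<^sup>+t\<in>{0..1}. g (x + t *\<^sub>R z) \<partial>lborel) * indicator (ball 0 r) z"
      using AE_line[OF N(2), of x]
    proof eventually_elim
      case (elim z)
      have "ennreal (dist (F (x + z)) (F x) / norm z) * indicator U (x + z) \<le> (\<integral>\<^sup>+t\<in>{0..1}. g (x + t *\<^sub>R z) \<partial>lborel)"
      proof (cases "x + z \<in> U \<and> z \<noteq> 0")
        case True
        have seg: "x + t *\<^sub>R z \<in> U" if "t \<in> {0..1}" for t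
        proof -
          have "(1 - t) *\<^sub>R x + t *\<^sub>R (x + z) \<in> U" using U x True that by (intro convexD) auto
          then show ?thesis by (simp add: algebra_simps)
        qed
        have "ennreal (dist (F (x + z)) (F x)) \<le> (\<integral>\<^sup>+t\<in>{0..1}. upper_speed F z (x + t *\<^sub>R z) \<partial>lborel)"
          by (rule dist_le_upper_speed[OF lip seg])
        also have "\<dots> \<le> (\<integral>\<^sup>+t. ennreal (norm z) * (g (x + t *\<^sub>R z) * indicator {0..1} t) \<partial>lborel)"
        proof (rule nn_integral_mono_AE)
          show "AE t in lborel. upper_speed F z (x + t *\<^sub>R z) * indicator {0..1} t
             \<le> ennreal (norm z) * (g (x + t *\<^sub>R z) * indicator {0..1} t)"
            using elim
          proof eventually_elim
            case (elim t)
            then show ?case using seg[of t] N(1) by (auto simp: indicator_def g_def)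
          qed
        qed
        also have "\<dots> = ennreal (norm z) * (\<integral>\<^sup>+t\<in>{0..1}. g (x + t *\<^sub>R z) \<partial>lborel)"
          by (rule nn_integral_cmult) measurable
        finally have *: "ennreal (dist (F (x + z)) (F x)) \<le> ennreal (norm z) * (\<integral>\<^sup>+t\<in>{0..1}. g (x + t *\<^sub>R z) \<partial>lborel)" .
        have "ennreal (norm z) * ennreal (dist (F (x + z)) (F x) / norm z) = ennreal (dist (F (x + z)) (F x))"
          using True by (simp add: ennreal_mult[symmetric])
        with * have "ennreal (norm z) * ennreal (dist (F (x + z)) (F x) / norm z) \<le> ennreal (norm z) * (\<integral>\<^sup>+t\<in>{0..1}. g (x + t *\<^sub>R z) \<partial>lborel)"
          by simp
        then have "ennreal (dist (F (x + z)) (F x) / norm z) \<le> (\<integral>\<^sup>+t\<in>{0..1}. g (x + t *\<^sub>R z) \<partial>lborel)"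
          using True by (subst (asm) ennreal_mult_le_mult_iff) auto
        then show ?thesis using True by simp
      qed auto
      then show ?case by (rule mult_right_mono) simp
    qed
  qed
  also have "\<dots> \<le> maximal g x * ball_vol TYPE('a) r"
    using r by (intro line_average_le_maximal ball_integral_le_maximal) auto
  finally show ?thesis by (simp add: g_def[abs_def])
qed

text \<open>Translation estimate in the mean: integrate the speed along the segment first, then over
  the base point by translation invariance. Base points whose segment leaves \<open>V\<close> are
  left out.\<close>

lemma lipschitz_shift_integral:
  fixes F :: "'a::euclidean_space \<Rightarrow> 'x::metric_space"
  assumes lip: "C-lipschitz_on V F" and [measurable]: "a \<in> borel_measurable borel"
    and Vm[measurable]: "V \<in> sets borel"
    and speed: "AE y in lborel. y \<in> V \<longrightarrow> upper_speed F z y \<le> a y"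
  shows "(\<integral>\<^sup>+x\<in>{x. \<forall>t\<in>{0..1}. x + t *\<^sub>R z \<in> V}. ennreal (dist (F (x + z)) (F x)) \<partial>lborel) \<le> (\<integral>\<^sup>+x\<in>V. a x \<partial>lborel)"
proof -
  obtain N where N: "{y. \<not> (y \<in> V \<longrightarrow> upper_speed F z y \<le> a y)} \<subseteq> N" "N \<in> null_sets lborel"
    using speed by (auto elim: AE_E simp: null_sets_def)
  define g where "g y = a y * indicator V y" for y
  have [measurable]: "g \<in> borel_measurable borel" unfolding g_def by measurable
  have "(\<integral>\<^sup>+x\<in>{x. \<forall>t\<in>{0..1}. x + t *\<^sub>R z \<in> V}. ennreal (dist (F (x + z)) (F x)) \<partial>lborel)
    \<le> (\<integral>\<^sup>+x. (\<integral>\<^sup>+t. g (x + t *\<^sub>R z) * indicator {0..1} t \<partial>lborel) \<partial>lborel)"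
  proof (rule nn_integral_mono_AE)
    show "AE x in lborel. ennreal (dist (F (x + z)) (F x)) * indicator {x. \<forall>t\<in>{0..1}. x + t *\<^sub>R z \<in> V} x
       \<le> (\<integral>\<^sup>+t. g (x + t *\<^sub>R z) * indicator {0..1} t \<partial>lborel)"
      using AE_line_shift[OF N(2), of z]
    proof eventually_elim
      case (elim x)
      show ?case
      proof (cases "\<forall>t\<in>{0..1}. x + t *\<^sub>R z \<in> V")
        case True
        have "ennreal (dist (F (x + z)) (F x)) \<le> (\<integral>\<^sup>+t\<in>{0..1}. upper_speed F z (x + t *\<^sub>R z) \<partial>lborel)"
          using True by (intro dist_le_upper_speed[OF lip]) auto
        also have "\<dots> \<le> (\<integral>\<^sup>+t. g (x + t *\<^sub>R z) * indicator {0..1} t \<partial>lborel)"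
        proof (rule nn_integral_mono_AE)
          show "AE t in lborel. upper_speed F z (x + t *\<^sub>R z) * indicator {0..1} t
             \<le> g (x + t *\<^sub>R z) * indicator {0..1} t"
            using elim
          proof eventually_elim
            case (elim t)
            then show ?case using True N(1) by (auto simp: indicator_def g_def)
          qed
        qed
        finally show ?thesis using True by simp
      qed simp
    qed
  qed
  also have "\<dots> = (\<integral>\<^sup>+t. (\<integral>\<^sup>+x. g (x + t *\<^sub>R z) * indicator {0..1} t \<partial>lborel) \<partial>lborel)"
    by (rule lborel_pair.Fubini'[symmetric]) measurable
  also have "\<dots> = (\<integral>\<^sup>+t. (\<integral>\<^sup>+x. g x \<partial>lborel) * indicator {0..1::real} t \<partial>lborel)"
    by (intro nn_integral_cong) (simp add: nn_integral_multc nn_integral_lborel_shift)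
  also have "\<dots> = (\<integral>\<^sup>+x. g x \<partial>lborel)" by (simp add: nn_integral_cmult_indicator)
  finally show ?thesis by (simp add: g_def)
qed

section \<open>Lebesgue points and completeness of \<open>L\<^sub>1\<close>\<close>

lemma nn_integral_norm_triangle:
  fixes f g h :: "'a \<Rightarrow> 'h::{real_normed_vector,second_countable_topology}"
  assumes [measurable]: "f \<in> borel_measurable M" "g \<in> borel_measurable M" "h \<in> borel_measurable M"
  shows "(\<integral>\<^sup>+x. ennreal (norm (f x - h x)) \<partial>M) \<le>
    (\<integral>\<^sup>+x. ennreal (norm (f x - g x)) \<partial>M) + (\<integral>\<^sup>+x. ennreal (norm (g x - h x)) \<partial>M)"
proof -
  have "(\<integral>\<^sup>+x. ennreal (norm (f x - h x)) \<partial>M) \<le>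
    (\<integral>\<^sup>+x. ennreal (norm (f x - g x)) + ennreal (norm (g x - h x)) \<partial>M)"
    by (intro nn_integral_mono) (metis dist_norm dist_triangle ennreal_leI ennreal_plus norm_ge_zero)
  then show ?thesis by (simp add: nn_integral_add)
qed

text \<open>Riesz-Fischer: along a subsequence with geometrically small differences the series of
  increments converges almost everywhere, and Fatou's lemma identifies the limit in the
  mean.\<close>

lemma L1_complete:
  fixes f :: "nat \<Rightarrow> 'a \<Rightarrow> 'h::{real_normed_vector,complete_space,second_countable_topology}"
  assumes f[measurable]: "\<And>n. f n \<in> borel_measurable M"
    and cau: "\<And>e. e > 0 \<Longrightarrow> \<exists>K. \<forall>m\<ge>K. \<forall>n\<ge>K. (\<integral>\<^sup>+x. ennreal (norm (f m x - f n x)) \<partial>M) \<le> ennreal e"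
  shows "\<exists>g\<in>borel_measurable M. (\<lambda>n. \<integral>\<^sup>+x. ennreal (norm (f n x - g x)) \<partial>M) \<longlonglongrightarrow> 0"
proof -
  have "\<forall>i. \<exists>K. \<forall>m\<ge>K. \<forall>n\<ge>K. (\<integral>\<^sup>+x. ennreal (norm (f m x - f n x)) \<partial>M) \<le> ennreal ((1/2) ^ i)"
    using cau by simp
  then obtain r where r: "\<And>i m n. m \<ge> r i \<Longrightarrow> n \<ge> r i \<Longrightarrow>
      (\<integral>\<^sup>+x. ennreal (norm (f m x - f n x)) \<partial>M) \<le> ennreal ((1/2) ^ i)" by metis
  define R where "R i = i + (\<Sum>j\<le>i. r j)" for i
  have Rr: "R i \<ge> r i" "R (Suc i) \<ge> r i" "R i \<ge> i" for i
    using member_le_sum[of i "{..i}" r] by (auto simp: R_def)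
  define d where "d i x = norm (f (R (Suc i)) x - f (R i) x)" for i x
  have [measurable]: "d i \<in> borel_measurable M" for i unfolding d_def by measurable
  have "(\<integral>\<^sup>+x. (\<Sum>i. ennreal (d i x)) \<partial>M) = (\<Sum>i. \<integral>\<^sup>+x. ennreal (d i x) \<partial>M)"
    by (rule nn_integral_suminf) measurable
  also have "\<dots> \<le> (\<Sum>i. ennreal ((1/2) ^ i))"
    unfolding d_def using Rr by (intro suminf_le summableI r) auto
  also have "\<dots> = ennreal (\<Sum>i. (1/2) ^ i)"
    by (rule suminf_ennreal2) (auto intro: summable_geometric)
  finally have "(\<integral>\<^sup>+x. (\<Sum>i. ennreal (d i x)) \<partial>M) \<noteq> \<infinity>"
    using ennreal_less_top le_less_trans less_top by (metis infinity_ennreal_def neq_top_trans ennreal_neq_top)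
  then have fin: "AE x in M. (\<Sum>i. ennreal (d i x)) \<noteq> \<infinity>" by (intro nn_integral_noteq_infinite) auto
  define E where "E = {x. (\<Sum>i. ennreal (d i x)) \<noteq> \<infinity>}"
  define F where "F i x = (if (\<Sum>i. ennreal (d i x)) \<noteq> \<infinity> then f (R i) x else 0)" for i x
  have [measurable]: "F i \<in> borel_measurable M" for i unfolding F_def by measurable
  have conv: "\<exists>l. (\<lambda>i. F i x) \<longlonglongrightarrow> l" for x
  proof (cases "x \<in> E")
    case True
    then have sm: "summable (\<lambda>i. d i x)"
      by (intro summable_suminf_not_top) (auto simp: E_def d_def)
    have tel: "dist (f (R m) x) (f (R n) x) \<le> (\<Sum>i\<in>{m..<n}. d i x)" if "m \<le> n" for m n
      using that
    proof (induction n rule: dec_induct)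
      case (step n)
      then show ?case using dist_triangle[of "f (R m) x" "f (R (Suc n)) x" "f (R n) x"]
        by (simp add: d_def dist_norm norm_minus_commute)
    qed simp
    have "Cauchy (\<lambda>i. f (R i) x)"
      unfolding Cauchy_altdef
    proof (intro allI impI)
      fix e :: real assume "e > 0"
      then obtain N where N: "\<And>m n. m \<ge> N \<Longrightarrow> norm (\<Sum>i\<in>{m..<n}. d i x) < e"
        using sm unfolding summable_Cauchy by blast
      have "dist (f (R m) x) (f (R n) x) < e" if "m \<ge> N" "n > m" for m n
        using tel[of m n] N[of m n] that by simp
      then show "\<exists>N. \<forall>m\<ge>N. \<forall>n>m. dist (f (R m) x) (f (R n) x) < e" by blast
    qed
    then show ?thesis using True by (auto simp: F_def E_def convergent_def dest: Cauchy_convergent)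
  next
    case False
    then have "F i x = 0" for i by (simp add: F_def E_def)
    then show ?thesis by auto
  qed
  then obtain g where g: "\<And>x. (\<lambda>i. F i x) \<longlonglongrightarrow> g x" by metis
  have gm[measurable]: "g \<in> borel_measurable M"
    by (rule borel_measurable_LIMSEQ_metric[of F]) (auto intro: g)
  have "(\<lambda>n. \<integral>\<^sup>+x. ennreal (norm (f n x - g x)) \<partial>M) \<longlonglongrightarrow> 0"
  proof (rule tendsto_zero_ennreal)
    fix e :: real assume e: "0 < e"
    then obtain K where K: "\<And>m n. m \<ge> K \<Longrightarrow> n \<ge> K \<Longrightarrow> (\<integral>\<^sup>+x. ennreal (norm (f m x - f n x)) \<partial>M) \<le> ennreal (e/2)"
      using cau[of "e/2"] by (metis half_gt_zero)
    have "(\<integral>\<^sup>+x. ennreal (norm (f n x - g x)) \<partial>M) < ennreal e" if "n \<ge> K" for n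
    proof -
      have "(\<integral>\<^sup>+x. ennreal (norm (f n x - g x)) \<partial>M) = (\<integral>\<^sup>+x. liminf (\<lambda>i. ennreal (norm (f n x - f (R i) x))) \<partial>M)"
      proof (rule nn_integral_cong_AE)
        show "AE x in M. ennreal (norm (f n x - g x)) = liminf (\<lambda>i. ennreal (norm (f n x - f (R i) x)))"
          using fin
        proof eventually_elim
          case (elim x)
          then have "(\<lambda>i. f (R i) x) \<longlonglongrightarrow> g x" using g[of x] by (simp add: F_def)
          then have "(\<lambda>i. ennreal (norm (f n x - f (R i) x))) \<longlonglongrightarrow> ennreal (norm (f n x - g x))"
            by (intro tendsto_ennrealI tendsto_norm tendsto_diff tendsto_const)
          then show ?case by (intro lim_imp_Liminf[symmetric]) auto
        qed
      qed
      also have "\<dots> \<le> liminf (\<lambda>i. \<integral>\<^sup>+x. ennreal (norm (f n x - f (R i) x)) \<partial>M)"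
        by (rule nn_integral_liminf) measurable
      also have "\<dots> \<le> liminf (\<lambda>i::nat. ennreal (e/2))"
      proof (rule Liminf_mono)
        show "\<forall>\<^sub>F i in sequentially. (\<integral>\<^sup>+x. ennreal (norm (f n x - f (R i) x)) \<partial>M) \<le> ennreal (e/2)"
          using eventually_ge_at_top[of K]
        proof eventually_elim
          case (elim i)
          then show ?case using Rr(3)[of i] that by (intro K) auto
        qed
      qed
      also have "\<dots> < ennreal e" using e by (simp add: Liminf_const ennreal_less_iff)
      finally show ?thesis .
    qed
    then show "\<forall>\<^sub>F n in sequentially. (\<integral>\<^sup>+x. ennreal (norm (f n x - g x)) \<partial>M) < ennreal e"
      by (rule eventually_sequentiallyI)
  qed
  then show ?thesis using gm by blast
qed

text \<open>For continuous functions every point is a Lebesgue point, so the oscillation of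
  \<open>g\<close> reduces to that of \<open>g - f k\<close>, controlled by a maximal function and
  the value at \<open>x\<close>. The approximants are given, because difference quotients will
  supply them.\<close>

lemma lebesgue_point:
  fixes g :: "'a::euclidean_space \<Rightarrow> 'h::{real_normed_vector,second_countable_topology}"
  assumes g[measurable]: "g \<in> borel_measurable borel" and f: "\<And>k. continuous_on UNIV (f k)"
    and lim: "(\<lambda>k. \<integral>\<^sup>+x. ennreal (norm (f k x - g x)) \<partial>lborel) \<longlonglongrightarrow> 0"
  shows "AE x in lborel. \<forall>\<epsilon>>0. \<exists>\<delta>>0. \<forall>r. 0 < r \<and> r < \<delta> \<longrightarrow>
    (\<integral>\<^sup>+y\<in>ball x r. ennreal (norm (g y - g x)) \<partial>lborel) \<le> ennreal \<epsilon> * ball_vol TYPE('a) r"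
proof -
  have fm[measurable]: "f k \<in> borel_measurable borel" for k
    using f by (rule borel_measurable_continuous_onI)
  define w where "w k x = ennreal (norm (f k x - g x))" for k x
  have [measurable]: "w k \<in> borel_measurable borel" for k unfolding w_def by measurable
  have null: "AE x in lborel. \<exists>k. maximal (w k) x \<le> ennreal s \<and> w k x \<le> ennreal s" if s: "s > 0" for s
  proof -
    \<comment> \<open>Points that are bad for every \<open>k\<close>: the measure of this set is
      bounded by a multiple of the mean distance of each \<open>f k\<close> to \<open>g\<close>, so
      it vanishes.\<close>
    define B where "B = {x. \<forall>k. \<not> (maximal (w k) x \<le> ennreal s \<and> w k x \<le> ennreal s)}"
    have [measurable]: "B \<in> sets borel" unfolding B_def by measurable
    have "ennreal s * emeasure lborel B \<le> (5 ^ DIM('a) + 1) * (\<integral>\<^sup>+x. w k x \<partial>lborel)" for k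
    proof -
      have 1: "ennreal s * emeasure lborel {x. ennreal s < maximal (w k) x} \<le> 5 ^ DIM('a) * (\<integral>\<^sup>+x. w k x \<partial>lborel)"
        by (rule maximal_weak_type) measurable
      have "ennreal s * emeasure lborel {x. ennreal s < w k x} = (\<integral>\<^sup>+x. ennreal s * indicator {x. ennreal s < w k x} x \<partial>lborel)"
        by (simp add: nn_integral_cmult_indicator)
      also have "\<dots> \<le> (\<integral>\<^sup>+x. w k x \<partial>lborel)" by (intro nn_integral_mono) (auto simp: indicator_def)
      finally have 2: "ennreal s * emeasure lborel {x. ennreal s < w k x} \<le> (\<integral>\<^sup>+x. w k x \<partial>lborel)" .
      have "emeasure lborel B \<le> emeasure lborel ({x. ennreal s < maximal (w k) x} \<union> {x. ennreal s < w k x})"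
        by (intro emeasure_mono) (auto simp: B_def not_le)
      also have "\<dots> \<le> emeasure lborel {x. ennreal s < maximal (w k) x} + emeasure lborel {x. ennreal s < w k x}"
        by (intro emeasure_subadditive) auto
      finally have "ennreal s * emeasure lborel B \<le> ennreal s * (emeasure lborel {x. ennreal s < maximal (w k) x} + emeasure lborel {x. ennreal s < w k x})"
        by (rule mult_left_mono) simp
      also have "\<dots> \<le> 5 ^ DIM('a) * (\<integral>\<^sup>+x. w k x \<partial>lborel) + (\<integral>\<^sup>+x. w k x \<partial>lborel)"
        unfolding distrib_left by (rule add_mono[OF 1 2])
      finally show ?thesis by (simp add: distrib_right)
    qed
    moreover have "(\<lambda>k. (5 ^ DIM('a) + 1) * (\<integral>\<^sup>+x. w k x \<partial>lborel)) \<longlonglongrightarrow> (5 ^ DIM('a) + 1) * 0"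
      unfolding w_def by (intro ennreal_tendsto_cmult lim) (simp add: less_top[symmetric] power_eq_top_ennreal)
    ultimately have "ennreal s * emeasure lborel B \<le> (5 ^ DIM('a) + 1) * 0"
      by (intro LIMSEQ_le_const) auto
    then have "emeasure lborel B = 0" using s by simp
    then have "B \<in> null_sets lborel" by (simp add: null_sets_def)
    then have "AE x in lborel. x \<notin> B" by (rule AE_not_in)
    then show ?thesis by (simp add: B_def)
  qed
  have "AE x in lborel. \<forall>n::nat. \<exists>k. maximal (w k) x \<le> ennreal (1 / Suc n) \<and> w k x \<le> ennreal (1 / Suc n)"
    unfolding AE_all_countable by (intro allI null) simp
  then show ?thesis
  proof eventually_elim
    case (elim x)
    show ?case
    proof (intro allI impI)
      fix \<epsilon> :: real assume e: "\<epsilon> > 0"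
      then obtain n where n: "1 / real (Suc n) < \<epsilon> / 3" by (metis nat_approx_posE zero_less_divide_iff zero_less_numeral)
      define s where "s = 1 / real (Suc n)"
      have s: "s > 0" "3 * s \<le> \<epsilon>" using n by (auto simp: s_def)
      obtain k where k: "maximal (w k) x \<le> ennreal s" "w k x \<le> ennreal s" using elim unfolding s_def by blast
      obtain \<delta> where d: "\<delta> > 0" "\<And>y. dist y x < \<delta> \<Longrightarrow> dist (f k y) (f k x) < s"
        using f[of k] s(1) unfolding continuous_on_iff by (metis UNIV_I)
      have "(\<integral>\<^sup>+y\<in>ball x r. ennreal (norm (g y - g x)) \<partial>lborel) \<le> ennreal \<epsilon> * ball_vol TYPE('a) r"
        if r: "0 < r" "r < min \<delta> 2" for r
      proof -
        have "(\<integral>\<^sup>+y\<in>ball x r. ennreal (norm (g y - g x)) \<partial>lborel) \<le> (\<integral>\<^sup>+y. w k y * indicator (ball x r) y + ennreal (2 * s) * indicator (ball x r) y \<partial>lborel)"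
        proof (intro nn_integral_mono)
          fix y
          show "ennreal (norm (g y - g x)) * indicator (ball x r) y \<le> w k y * indicator (ball x r) y + ennreal (2 * s) * indicator (ball x r) y"
          proof (cases "y \<in> ball x r")
            case True
            then have 1: "norm (f k y - f k x) \<le> s" using d(2)[of y] r by (simp add: dist_norm norm_minus_commute less_imp_le)
            have 2: "norm (f k x - g x) \<le> s" using k(2) s by (simp add: w_def)
            have "norm (g y - g x) = norm ((g y - f k y) + ((f k y - f k x) + (f k x - g x)))" by simp
            also have "\<dots> \<le> norm (g y - f k y) + (norm (f k y - f k x) + norm (f k x - g x))"
              by (meson add_left_mono norm_triangle_ineq order_trans)
            also have "\<dots> \<le> norm (f k y - g y) + 2 * s" using 1 2 by (simp add: norm_minus_commute)
            finally have "ennreal (norm (g y - g x)) \<le> ennreal (norm (f k y - g y) + 2 * s)" by (rule ennreal_leI)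
            then show ?thesis using True s by (simp add: w_def)
          qed simp
        qed
        also have "\<dots> = (\<integral>\<^sup>+y\<in>ball x r. w k y \<partial>lborel) + ennreal (2 * s) * ball_vol TYPE('a) r"
          using r by (subst nn_integral_add) (auto simp: nn_integral_cmult_indicator emeasure_ball_vol)
        also have "\<dots> \<le> ennreal s * ball_vol TYPE('a) r + ennreal (2 * s) * ball_vol TYPE('a) r"
          using r k(1) by (intro add_right_mono order_trans[OF ball_integral_le_maximal] mult_right_mono) auto
        also have "\<dots> = ennreal (3 * s) * ball_vol TYPE('a) r"
          using s by (simp add: distrib_right[symmetric] ennreal_plus[symmetric] del: ennreal_plus)
        also have "\<dots> \<le> ennreal \<epsilon> * ball_vol TYPE('a) r" using s by (intro mult_right_mono ennreal_leI) auto
        finally show ?thesis .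
      qed
      then show "\<exists>\<delta>>0. \<forall>r. 0 < r \<and> r < \<delta> \<longrightarrow> (\<integral>\<^sup>+y\<in>ball x r. ennreal (norm (g y - g x)) \<partial>lborel) \<le> ennreal \<epsilon> * ball_vol TYPE('a) r"
        using d(1) by (intro exI[of _ "min \<delta> 2"]) auto
    qed
  qed
qed

section \<open>Rademacher's theorem\<close>

text \<open>Through this form of Pythagoras' theorem the inner product of the target enters the
  proof of Rademacher's theorem.\<close>

lemma variance_identity:
  fixes a :: "nat \<Rightarrow> 'h::real_inner"
  assumes "n > 0"
  shows "(\<Sum>i<n. (norm (a i - (\<Sum>j<n. a j) /\<^sub>R real n))\<^sup>2 / real n) + (norm ((\<Sum>j<n. a j) /\<^sub>R real n))\<^sup>2
    = (\<Sum>i<n. (norm (a i))\<^sup>2 / real n)"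
proof -
  define m where "m = (\<Sum>j<n. a j) /\<^sub>R real n"
  have sm: "(\<Sum>j<n. a j) = real n *\<^sub>R m" using assms by (simp add: m_def)
  have "(\<Sum>i<n. (norm (a i - m))\<^sup>2) = (\<Sum>i<n. (norm (a i))\<^sup>2 - 2 * (a i \<bullet> m) + (norm m)\<^sup>2)"
    by (intro sum.cong refl) (simp add: power2_norm_eq_inner inner_diff_left inner_diff_right inner_commute)
  also have "\<dots> = (\<Sum>i<n. (norm (a i))\<^sup>2) - 2 * ((\<Sum>i<n. a i) \<bullet> m) + real n * (norm m)\<^sup>2"
    by (simp add: sum.distrib sum_subtractf inner_sum_left sum_distrib_left)
  also have "\<dots> = (\<Sum>i<n. (norm (a i))\<^sup>2) - real n * (norm m)\<^sup>2"
    unfolding sm by (simp add: power2_norm_eq_inner)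
  finally have "(\<Sum>i<n. (norm (a i - m))\<^sup>2) + real n * (norm m)\<^sup>2 = (\<Sum>i<n. (norm (a i))\<^sup>2)" by simp
  then have "(\<Sum>i<n. (norm (a i - m))\<^sup>2) / real n + (norm m)\<^sup>2 = (\<Sum>i<n. (norm (a i))\<^sup>2) / real n"
    using assms by (simp add: field_simps)
  then show ?thesis unfolding m_def[symmetric] by (simp add: sum_divide_distrib)
qed

lemma norm_diff_average_le:
  fixes w :: "'h::real_inner"
  assumes "n > 0"
  shows "(norm (w - (\<Sum>j<n. b j) /\<^sub>R real n))\<^sup>2 \<le> (\<Sum>i<n. (norm (w - b i))\<^sup>2 / real n)"
proof -
  have "(\<Sum>j<n. w - b j) /\<^sub>R real n = w - (\<Sum>j<n. b j) /\<^sub>R real n"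
    using assms by (simp add: sum_subtractf scaleR_diff_right sum_constant_scaleR)
  moreover have "0 \<le> (\<Sum>i<n. (norm (w - b i - (\<Sum>j<n. w - b j) /\<^sub>R real n))\<^sup>2 / real n)"
    by (intro sum_nonneg) simp
  ultimately show ?thesis
    using variance_identity[OF assms, of "\<lambda>i. w - b i"] by simp
qed

text \<open>Bounded support gives all difference quotients finite energy; \<open>rademacher\<close>
  reduces to this case by a cutoff.\<close>

locale compact_lipschitz =
  fixes u :: "'a::euclidean_space \<Rightarrow> 'h::{real_inner,polish_space}" and C R :: real
  assumes lip: "C-lipschitz_on UNIV u" and supp: "\<And>x. norm x \<ge> R \<Longrightarrow> u x = 0" and R: "R > 0"
begin

text \<open>The steps are dyadic so that a difference quotient is the exact mean of finer ones along
  the segment, see \<open>dq_average\<close>.\<close>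

definition dq :: "nat \<Rightarrow> 'a \<Rightarrow> 'a \<Rightarrow> 'h" where
  "dq k z x = 2 ^ k *\<^sub>R (u (x + z /\<^sub>R 2 ^ k) - u x)"

lemma C0: "C \<ge> 0" using lip by (rule lipschitz_on_nonneg)

lemma u_dist: "norm (u x - u y) \<le> C * norm (x - y)"
  using lipschitz_onD[OF lip, of x y] by (simp add: dist_norm)

lemma cont_u: "continuous_on UNIV u" using lip by (rule lipschitz_on_continuous_on)

lemma cont_dq: "continuous_on UNIV (dq k z)"
  unfolding dq_def by (intro continuous_intros continuous_on_compose2[OF cont_u]) auto

lemma u_measurable[measurable]: "u \<in> borel_measurable borel"
  using cont_u by (rule borel_measurable_continuous_onI)

lemma dq_measurable[measurable]: "dq k z \<in> borel_measurable borel"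
  using cont_dq by (rule borel_measurable_continuous_onI)

lemma norm_dq_le: "norm (dq k z x) \<le> C * norm z"
proof -
  have "norm (dq k z x) \<le> 2 ^ k * (C * norm (z /\<^sub>R 2 ^ k))"
    unfolding dq_def norm_scaleR using u_dist[of "x + z /\<^sub>R 2 ^ k" x] by (simp add: mult_left_mono)
  then show ?thesis by (simp add: field_simps)
qed

lemma dq_supp: "norm x \<ge> R + norm z \<Longrightarrow> dq k z x = 0"
proof -
  assume x: "norm x \<ge> R + norm z"
  have "norm (z /\<^sub>R 2 ^ k) \<le> norm z" by (simp add: field_simps mult_le_cancel_left1)
  then have "norm (x + z /\<^sub>R 2 ^ k) \<ge> R" using x norm_diff_triangle_ineq[of x "z /\<^sub>R 2 ^ k" 0 0]
    by (smt (verit) norm_minus_cancel norm_triangle_ineq4 add_diff_cancel_right')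
  moreover have "norm x \<ge> R" using x norm_ge_zero[of z] by linarith
  ultimately show ?thesis by (simp add: dq_def supp)
qed

lemma dq_lip: "norm (dq k z x - dq k z y) \<le> 2 * 2 ^ k * C * norm (x - y)"
proof -
  have "dq k z x - dq k z y = 2 ^ k *\<^sub>R ((u (x + z /\<^sub>R 2 ^ k) - u (y + z /\<^sub>R 2 ^ k)) - (u x - u y))"
    by (simp add: dq_def algebra_simps)
  then have "norm (dq k z x - dq k z y) \<le> 2 ^ k * (norm (u (x + z /\<^sub>R 2 ^ k) - u (y + z /\<^sub>R 2 ^ k)) + norm (u x - u y))"
    by (simp add: norm_triangle_ineq4)
  also have "\<dots> \<le> 2 ^ k * (C * norm (x - y) + C * norm (x - y))"
    using u_dist[of "x + z /\<^sub>R 2 ^ k" "y + z /\<^sub>R 2 ^ k"] u_dist[of x y]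
    by (intro mult_left_mono add_mono) auto
  finally show ?thesis by simp
qed

lemma dq_average:
  "(\<Sum>i<2 ^ j. dq (k + j) z (x + (real i / 2 ^ (k + j)) *\<^sub>R z)) /\<^sub>R real (2 ^ j) = dq k z x"
proof -
  define \<eta> where "\<eta> = (1::real) / 2 ^ (k + j)"
  have step: "dq (k + j) z (x + (real i / 2 ^ (k + j)) *\<^sub>R z) =
     2 ^ (k + j) *\<^sub>R (u (x + (real (Suc i) * \<eta>) *\<^sub>R z) - u (x + (real i * \<eta>) *\<^sub>R z))" for i
  proof -
    have e1: "real i / 2 ^ (k + j) = real i * \<eta>" by (simp add: \<eta>_def)
    have e2: "z /\<^sub>R 2 ^ (k + j) = \<eta> *\<^sub>R z" by (simp add: \<eta>_def inverse_eq_divide)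
    have e3: "x + (real i * \<eta>) *\<^sub>R z + \<eta> *\<^sub>R z = x + (real (Suc i) * \<eta>) *\<^sub>R z" by (simp add: algebra_simps)
    show ?thesis unfolding dq_def e1 e2 e3 ..
  qed
  have "(\<Sum>i<2 ^ j. dq (k + j) z (x + (real i / 2 ^ (k + j)) *\<^sub>R z)) =
     2 ^ (k + j) *\<^sub>R (\<Sum>i<2 ^ j. u (x + (real (Suc i) * \<eta>) *\<^sub>R z) - u (x + (real i * \<eta>) *\<^sub>R z))"
    unfolding step by (rule scaleR_sum_right[symmetric])
  also have "(\<Sum>i<2 ^ j. u (x + (real (Suc i) * \<eta>) *\<^sub>R z) - u (x + (real i * \<eta>) *\<^sub>R z)) = u (x + (real (2 ^ j) * \<eta>) *\<^sub>R z) - u x"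
    using sum_lessThan_telescope[of "\<lambda>i. u (x + (real i * \<eta>) *\<^sub>R z)" "2 ^ j"] by simp
  also have "real (2 ^ j) * \<eta> = 1 / 2 ^ k" by (simp add: \<eta>_def power_add)
  finally show ?thesis by (simp add: dq_def power_add divide_inverse)
qed

definition energy :: "nat \<Rightarrow> 'a \<Rightarrow> ennreal" where
  "energy k z = (\<integral>\<^sup>+x. ennreal ((norm (dq k z x))\<^sup>2) \<partial>lborel)"

text \<open>The shifts of \<open>dq_average\<close> with the opposite sign, as they arise when a
  change of variables moves them from the fine to the coarse quotient.\<close>

definition shifted :: "nat \<Rightarrow> nat \<Rightarrow> 'a \<Rightarrow> 'a \<Rightarrow> 'h" where
  "shifted k j z x = (\<Sum>i<2 ^ j. dq k z (x - (real i / 2 ^ (k + j)) *\<^sub>R z)) /\<^sub>R real (2 ^ j)"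

lemma shifted_measurable[measurable]: "shifted k j z \<in> borel_measurable borel"
  unfolding shifted_def by measurable

text \<open>The coarse quotient at \<open>x\<close> is the mean of fine ones at shifted points, so
  \<open>energy (k + j)\<close> exceeds \<open>energy k\<close> by an integrated variance.
  Translating the variable of integration puts the shifts on the coarse quotient, and convexity of
  the squared norm bounds the distance to the mean of these translates.\<close>

lemma energy_gap:
  "(\<integral>\<^sup>+x. ennreal ((norm (dq (k + j) z x - shifted k j z x))\<^sup>2) \<partial>lborel) + energy k z \<le> energy (k + j) z"
proof -
  define n :: nat where "n = 2 ^ j"
  have n: "n > 0" by (simp add: n_def)
  define s where "s i = (real i / 2 ^ (k + j)) *\<^sub>R z" for i :: nat
  have avg: "(\<Sum>i<n. dq (k + j) z (x + s i)) /\<^sub>R real n = dq k z x" for x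
    unfolding s_def n_def by (rule dq_average)
  have sh: "shifted k j z x = (\<Sum>i<n. dq k z (x - s i)) /\<^sub>R real n" for x
    unfolding s_def n_def shifted_def ..
  have "(\<integral>\<^sup>+x. ennreal ((norm (dq (k + j) z x - shifted k j z x))\<^sup>2) \<partial>lborel)
     \<le> (\<integral>\<^sup>+x. (\<Sum>i<n. ennreal ((norm (dq (k + j) z x - dq k z (x - s i)))\<^sup>2 / real n)) \<partial>lborel)"
    unfolding sh using norm_diff_average_le[OF n]
    by (intro nn_integral_mono) (simp add: sum_ennreal sum_nonneg)
  also have "\<dots> = (\<Sum>i<n. \<integral>\<^sup>+x. ennreal ((norm (dq (k + j) z x - dq k z (x - s i)))\<^sup>2 / real n) \<partial>lborel)"
    by (rule nn_integral_sum) measurable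
  also have "\<dots> = (\<Sum>i<n. \<integral>\<^sup>+x. ennreal ((norm (dq (k + j) z (x + s i) - dq k z x))\<^sup>2 / real n) \<partial>lborel)"
  proof (intro sum.cong refl)
    fix i
    show "(\<integral>\<^sup>+x. ennreal ((norm (dq (k + j) z x - dq k z (x - s i)))\<^sup>2 / real n) \<partial>lborel) =
      (\<integral>\<^sup>+x. ennreal ((norm (dq (k + j) z (x + s i) - dq k z x))\<^sup>2 / real n) \<partial>lborel)"
      using nn_integral_lborel_shift[of "\<lambda>x. ennreal ((norm (dq (k + j) z x - dq k z (x - s i)))\<^sup>2 / real n)" "s i"] by simp
  qed
  also have "\<dots> = (\<integral>\<^sup>+x. (\<Sum>i<n. ennreal ((norm (dq (k + j) z (x + s i) - dq k z x))\<^sup>2 / real n)) \<partial>lborel)"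
    by (rule nn_integral_sum[symmetric]) measurable
  finally have "(\<integral>\<^sup>+x. ennreal ((norm (dq (k + j) z x - shifted k j z x))\<^sup>2) \<partial>lborel) + energy k z
    \<le> (\<integral>\<^sup>+x. (\<Sum>i<n. ennreal ((norm (dq (k + j) z (x + s i) - dq k z x))\<^sup>2 / real n)) \<partial>lborel) + energy k z"
    by (rule add_right_mono)
  also have "\<dots> = (\<integral>\<^sup>+x. (\<Sum>i<n. ennreal ((norm (dq (k + j) z (x + s i) - dq k z x))\<^sup>2 / real n)) + ennreal ((norm (dq k z x))\<^sup>2) \<partial>lborel)"
    unfolding energy_def by (rule nn_integral_add[symmetric]) measurable
  also have "\<dots> = (\<integral>\<^sup>+x. (\<Sum>i<n. ennreal ((norm (dq (k + j) z (x + s i)))\<^sup>2 / real n)) \<partial>lborel)"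
  proof (intro nn_integral_cong)
    fix x
    show "(\<Sum>i<n. ennreal ((norm (dq (k + j) z (x + s i) - dq k z x))\<^sup>2 / real n)) + ennreal ((norm (dq k z x))\<^sup>2) =
      (\<Sum>i<n. ennreal ((norm (dq (k + j) z (x + s i)))\<^sup>2 / real n))"
      using variance_identity[OF n, of "\<lambda>i. dq (k + j) z (x + s i)", unfolded avg]
      by (simp add: sum_ennreal sum_nonneg ennreal_plus[symmetric] del: ennreal_plus)
  qed
  also have "\<dots> = (\<Sum>i<n. \<integral>\<^sup>+x. ennreal ((norm (dq (k + j) z (x + s i)))\<^sup>2 / real n) \<partial>lborel)"
    by (rule nn_integral_sum) measurable
  also have "\<dots> = (\<Sum>i<n. \<integral>\<^sup>+x. ennreal ((norm (dq (k + j) z x))\<^sup>2 / real n) \<partial>lborel)"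
    using nn_integral_lborel_shift[of "\<lambda>x. ennreal ((norm (dq (k + j) z x))\<^sup>2 / real n)"] by simp
  also have "\<dots> = (\<integral>\<^sup>+x. (\<Sum>i<n. ennreal ((norm (dq (k + j) z x))\<^sup>2 / real n)) \<partial>lborel)"
    by (rule nn_integral_sum[symmetric]) measurable
  also have "\<dots> = energy (k + j) z"
    unfolding energy_def using n by (intro nn_integral_cong) (simp add: ennreal_of_nat_eq_real_of_nat ennreal_mult[symmetric])
  finally show ?thesis .
qed

lemma energy_finite: "energy k z \<le> ennreal ((C * norm z)\<^sup>2) * ball_vol TYPE('a) (R + norm z)"
proof -
  have "energy k z \<le> (\<integral>\<^sup>+x. ennreal ((C * norm z)\<^sup>2) * indicator (ball (0::'a) (R + norm z)) x \<partial>lborel)"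
    unfolding energy_def
  proof (intro nn_integral_mono)
    fix x
    show "ennreal ((norm (dq k z x))\<^sup>2) \<le> ennreal ((C * norm z)\<^sup>2) * indicator (ball 0 (R + norm z)) x"
      using dq_supp[of z x k] norm_dq_le[of k z x] power_mono[OF norm_dq_le norm_ge_zero, of k z x 2]
      by (auto simp: indicator_def not_less intro!: ennreal_leI)
  qed
  also have "\<dots> = ennreal ((C * norm z)\<^sup>2) * ball_vol TYPE('a) (R + norm z)"
    using R by (simp add: nn_integral_cmult_indicator emeasure_ball_vol add_nonneg_nonneg)
  finally show ?thesis .
qed

lemma shifted_supp: "norm x \<ge> R + 2 * norm z \<Longrightarrow> shifted k j z x = 0"
proof -
  assume x: "norm x \<ge> R + 2 * norm z"
  have "dq k z (x - (real i / 2 ^ (k + j)) *\<^sub>R z) = 0" if "i < 2 ^ j" for i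
  proof (rule dq_supp)
    have "real i \<le> real (2 ^ j)" using that by linarith
    also have "\<dots> \<le> 2 ^ (k + j)" by (simp add: power_add)
    finally have "real i / 2 ^ (k + j) \<le> 1" by simp
    then have "norm ((real i / 2 ^ (k + j)) *\<^sub>R z) \<le> 1 * norm z"
      unfolding norm_scaleR by (intro mult_right_mono) auto
    then show "R + norm z \<le> norm (x - (real i / 2 ^ (k + j)) *\<^sub>R z)"
      using x norm_triangle_ineq2[of x "(real i / 2 ^ (k + j)) *\<^sub>R z"] by linarith
  qed
  then show ?thesis by (simp add: shifted_def)
qed

text \<open>For fixed \<open>k\<close> the averages are Riemann sums, in the shift, of a Lipschitz
  function, so they converge uniformly as \<open>j\<close> grows.\<close>

lemma shifted_close:
  assumes "j \<le> j'"
  shows "norm (shifted k j' z x - shifted k j z x) \<le> 2 * C * norm z / 2 ^ j"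
proof -
  define n m :: nat where "n = 2 ^ j" and "m = 2 ^ (j' - j)"
  have nm: "2 ^ j' = n * m" using assms by (simp add: n_def m_def power_add[symmetric])
  have pos: "n > 0" "m > 0" by (simp_all add: n_def m_def)
  define F where "F i = dq k z (x - (real i / 2 ^ (k + j')) *\<^sub>R z)" for i
  have pw: "2 ^ (k + j') = 2 ^ (k + j) * real m" using assms by (simp add: m_def power_add[symmetric])
  \<comment> \<open>Each shift of the coarser sum is compared with a block of \<open>m\<close>
    shifts of the finer one.\<close>
  have 1: "shifted k j' z x = (\<Sum>a<n. \<Sum>i\<in>{a * m..<a * m + m}. F i) /\<^sub>R (real n * real m)"
    unfolding shifted_def nm sum.nat_group F_def by simp
  have "(\<Sum>a<n. dq k z (x - (real a / 2 ^ (k + j)) *\<^sub>R z)) = (\<Sum>a<n. F (a * m))"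
    unfolding F_def pw using pos by (intro sum.cong refl) simp
  then have 2: "shifted k j z x = (\<Sum>a<n. \<Sum>i\<in>{a * m..<a * m + m}. F (a * m)) /\<^sub>R (real n * real m)"
    unfolding shifted_def n_def[symmetric] using pos
    by (simp add: scaleR_sum_right[symmetric] sum_constant_scaleR)
  have t: "norm (F i - F (a * m)) \<le> 2 * C * norm z / 2 ^ j" if "i \<in> {a * m..<a * m + m}" for i a
  proof -
    have "norm (F i - F (a * m)) \<le> 2 * 2 ^ k * C * norm ((x - (real i / 2 ^ (k + j')) *\<^sub>R z) - (x - (real (a * m) / 2 ^ (k + j')) *\<^sub>R z))"
      unfolding F_def by (rule dq_lip)
    also have "(x - (real i / 2 ^ (k + j')) *\<^sub>R z) - (x - (real (a * m) / 2 ^ (k + j')) *\<^sub>R z) = ((real (a * m) - real i) / 2 ^ (k + j')) *\<^sub>R z"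
      by (simp add: scaleR_diff_left[symmetric] diff_divide_distrib)
    also have "norm \<dots> \<le> (real m / 2 ^ (k + j')) * norm z"
    proof -
      have "a * m \<le> i" "i < a * m + m" using that by auto
      then have "real (a * m) \<le> real i" "real i < real (a * m + m)" by (simp_all only: of_nat_le_iff of_nat_less_iff)
      then have "\<bar>real (a * m) - real i\<bar> \<le> real m" by simp
      then have "\<bar>real (a * m) - real i\<bar> / 2 ^ (k + j') \<le> real m / 2 ^ (k + j')" by (rule divide_right_mono) simp
      then show ?thesis unfolding norm_scaleR abs_divide by (intro mult_right_mono) simp_all
    qed
    also have "real m / 2 ^ (k + j') = 1 / (2 ^ k * 2 ^ j)" unfolding pw using pos by (simp add: power_add)
    finally have "norm (F i - F (a * m)) \<le> 2 * 2 ^ k * C * (1 / (2 ^ k * 2 ^ j) * norm z)"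
      using C0 by (simp add: mult_left_mono)
    then show ?thesis by simp
  qed
  have "shifted k j' z x - shifted k j z x = (\<Sum>a<n. \<Sum>i\<in>{a * m..<a * m + m}. F i - F (a * m)) /\<^sub>R (real n * real m)"
    unfolding 1 2 by (simp add: sum_subtractf scaleR_diff_right)
  then have "norm (shifted k j' z x - shifted k j z x) = norm (\<Sum>a<n. \<Sum>i\<in>{a * m..<a * m + m}. F i - F (a * m)) / (real n * real m)"
    by (simp add: divide_inverse mult.commute)
  also have "\<dots> \<le> (\<Sum>a<n. \<Sum>i\<in>{a * m..<a * m + m}. 2 * C * norm z / 2 ^ j) / (real n * real m)"
    using t by (intro divide_right_mono sum_norm_le) auto
  also have "\<dots> = 2 * C * norm z / 2 ^ j" using pos by simp
  finally show ?thesis .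
qed

text \<open>The energies increase and are bounded, so from some \<open>k\<close> on the gap is
  small. Then \<open>dq (k + j)\<close> is close in L2 to \<open>shifted k j\<close>, which for this
  fixed \<open>k\<close> converges uniformly in \<open>j\<close>; all functions live in one ball,
  where closeness in L2 or uniformly implies closeness in the mean.\<close>

lemma dq_L1_Cauchy:
  assumes "e > 0"
  shows "\<exists>K. \<forall>m\<ge>K. \<forall>n\<ge>K. (\<integral>\<^sup>+x. ennreal (norm (dq m z x - dq n z x)) \<partial>lborel) \<le> ennreal e"
proof -
  define W where "W = R + 2 * norm z"
  have W: "W > 0" using R by (simp add: W_def add_pos_nonneg)
  define V where "V = measure lborel (ball (0::'a) W)"
  have V: "emeasure lborel (ball (0::'a) W) = ennreal V"
    unfolding V_def using W by (intro emeasure_eq_ennreal_measure) (simp add: emeasure_ball)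
  have V0: "V > 0" unfolding V_def using W by (simp add: content_ball_pos)
  define en where "en k = enn2real (energy k z)" for k
  have enE: "energy k z = ennreal (en k)" for k
    unfolding en_def using energy_finite[of k z] ball_vol_finite[of "R + norm z", where 'a='a]
    by (intro ennreal_enn2real[symmetric]) (metis ennreal_mult_less_top ennreal_less_top infinity_ennreal_def le_less_trans)
  have en0: "en k \<ge> 0" for k by (simp add: en_def)
  have gap: "(\<integral>\<^sup>+x. ennreal ((norm (dq (k + j) z x - shifted k j z x))\<^sup>2) \<partial>lborel) + ennreal (en k) \<le> ennreal (en (k + j))" for k j
    using energy_gap[of k j z] by (simp add: enE)
  have "ennreal (en k) \<le> ennreal (en (k + j))" for k j using gap[of k j] by (meson add_increasing order_trans zero_le order_refl)
  then have mono: "en k \<le> en (k + j)" for k j using en0 by simp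
  have inc: "incseq en" using mono by (intro incseq_SucI) (metis Suc_eq_plus1)
  define B where "B = enn2real (ennreal ((C * norm z)\<^sup>2) * ball_vol TYPE('a) (R + norm z))"
  have "en k \<le> B" for k
    unfolding en_def B_def using energy_finite[of k z] ball_vol_finite[of "R + norm z", where 'a='a]
    by (intro enn2real_mono) (auto simp: ennreal_mult_less_top)
  then have "convergent en" using inc by (meson Bseq_monoseq_convergent incseq_convergent convergentI)
  then have cau: "Cauchy en" by (rule convergent_Cauchy)
  \<comment> \<open>The inequality \<open>t \<le> e1 + t\<^sup>2 / e1\<close> on a ball of volume
    \<open>V\<close> costs \<open>e1 * V = e / 6\<close> and \<open>e2 / e1 = e / 6\<close>.\<close>
  define e1 where "e1 = e / (6 * V)"
  define e2 where "e2 = e1 * (e / 6)"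
  have e12: "e1 > 0" "e2 > 0" using assms V0 by (auto simp: e1_def e2_def)
  obtain k where k: "\<And>l. l \<ge> k \<Longrightarrow> \<bar>en l - en k\<bar> < e2"
    using cau e12(2) unfolding Cauchy_def dist_real_def by (metis order_refl)
  have near: "(\<integral>\<^sup>+x. ennreal (norm (dq (k + j) z x - shifted k j z x)) \<partial>lborel) \<le> ennreal (e / 3)" for j
  proof -
    have "(\<integral>\<^sup>+x. ennreal ((norm (dq (k + j) z x - shifted k j z x))\<^sup>2) \<partial>lborel) + ennreal (en k) \<le> ennreal e2 + ennreal (en k)"
      using gap[of k j] k[of "k + j"] en0 e12
      by (intro order_trans[OF gap]) (simp add: ennreal_plus[symmetric] del: ennreal_plus)
    then have g2: "(\<integral>\<^sup>+x. ennreal ((norm (dq (k + j) z x - shifted k j z x))\<^sup>2) \<partial>lborel) \<le> ennreal e2"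
      by (metis add.commute ennreal_add_left_cancel_le ennreal_neq_top infinity_ennreal_def)
    have "(\<integral>\<^sup>+x. ennreal (norm (dq (k + j) z x - shifted k j z x)) \<partial>lborel) \<le>
       (\<integral>\<^sup>+x. ennreal e1 * indicator (ball 0 W) x + ennreal (1 / e1) * ennreal ((norm (dq (k + j) z x - shifted k j z x))\<^sup>2) \<partial>lborel)"
    proof (intro nn_integral_mono)
      fix x
      define t where "t = norm (dq (k + j) z x - shifted k j z x)"
      have amgm: "t \<le> e1 + 1 / e1 * t\<^sup>2"
      proof (cases "t \<le> e1")
        case True
        then show ?thesis using e12 by (smt (verit) zero_le_divide_1_iff mult_nonneg_nonneg zero_le_power2)
      next
        case False
        then have "1 * t \<le> (t / e1) * t" using e12 by (intro mult_right_mono) auto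
        then show ?thesis using e12 by (simp add: power2_eq_square)
      qed
      show "ennreal (norm (dq (k + j) z x - shifted k j z x)) \<le> ennreal e1 * indicator (ball 0 W) x + ennreal (1 / e1) * ennreal ((norm (dq (k + j) z x - shifted k j z x))\<^sup>2)"
      proof (cases "norm x < W")
        case True
        have "ennreal t \<le> ennreal (e1 + 1 / e1 * t\<^sup>2)" by (rule ennreal_leI[OF amgm])
        also have "\<dots> = ennreal e1 + ennreal (1 / e1) * ennreal (t\<^sup>2)"
          using e12 by (subst ennreal_plus) (auto simp: ennreal_mult[symmetric])
        finally show ?thesis using True by (simp add: t_def)
      next
        case False
        then have "dq (k + j) z x = 0" "shifted k j z x = 0"
          using dq_supp[of z x "k + j"] shifted_supp[of z x k j] norm_ge_zero[of z] by (auto simp: W_def)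
        then show ?thesis by simp
      qed
    qed
    also have "\<dots> = ennreal e1 * ennreal V + ennreal (1 / e1) * (\<integral>\<^sup>+x. ennreal ((norm (dq (k + j) z x - shifted k j z x))\<^sup>2) \<partial>lborel)"
      by (subst nn_integral_add) (auto simp: nn_integral_cmult nn_integral_cmult_indicator V)
    also have "\<dots> \<le> ennreal e1 * ennreal V + ennreal (1 / e1) * ennreal e2"
      by (intro add_left_mono mult_left_mono g2) simp
    also have "\<dots> = ennreal (e1 * V + 1 / e1 * e2)"
    proof -
      have "ennreal e1 * ennreal V = ennreal (e1 * V)" using e12 V0 by (intro ennreal_mult[symmetric]) auto
      moreover have "ennreal (1 / e1) * ennreal e2 = ennreal (1 / e1 * e2)" using e12 by (intro ennreal_mult[symmetric]) auto
      ultimately show ?thesis using e12 V0 by (simp add: ennreal_plus[symmetric] del: ennreal_plus)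
    qed
    also have "e1 * V + 1 / e1 * e2 = e / 3" using e12 V0 by (simp add: e2_def) (simp add: e1_def)
    finally show ?thesis .
  qed
  have "(\<lambda>J. 2 * C * norm z * V * (1/2) ^ J) \<longlonglongrightarrow> 2 * C * norm z * V * 0"
    by (intro tendsto_mult tendsto_const LIMSEQ_power_zero) auto
  then have "\<forall>\<^sub>F J in sequentially. 2 * C * norm z * V * (1/2) ^ J < e / 6"
    using assms by (intro order_tendstoD) auto
  then obtain J where J: "2 * C * norm z * V * (1/2) ^ J < e / 6"
    by (metis eventually_happens sequentially_bot)
  have shift_near: "(\<integral>\<^sup>+x. ennreal (norm (shifted k j z x - shifted k J z x)) \<partial>lborel) \<le> ennreal (e / 6)" if "j \<ge> J" for j
  proof -
    have "(\<integral>\<^sup>+x. ennreal (norm (shifted k j z x - shifted k J z x)) \<partial>lborel) \<le>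
      (\<integral>\<^sup>+x. ennreal (2 * C * norm z / 2 ^ J) * indicator (ball (0::'a) W) x \<partial>lborel)"
      using shifted_close[OF that, of k z] shifted_supp[of z _ k]
      by (intro nn_integral_mono) (auto simp: indicator_def W_def not_less intro!: ennreal_leI)
    also have "\<dots> = ennreal (2 * C * norm z / 2 ^ J * V)"
      using C0 V0 by (simp add: nn_integral_cmult_indicator V ennreal_mult[symmetric])
    also have "\<dots> \<le> ennreal (e / 6)"
      using J by (intro ennreal_leI) (simp add: power_divide algebra_simps)
    finally show ?thesis .
  qed
  have near_J: "(\<integral>\<^sup>+x. ennreal (norm (dq l z x - shifted k J z x)) \<partial>lborel) \<le> ennreal (e / 2)" if "l \<ge> k + J" for l
  proof -
    define j where "j = l - k"
    have j: "l = k + j" "j \<ge> J" using that by (simp_all add: j_def)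
    have "(\<integral>\<^sup>+x. ennreal (norm (dq l z x - shifted k J z x)) \<partial>lborel) \<le> ennreal (e / 3) + ennreal (e / 6)"
      unfolding j(1) by (intro order_trans[OF nn_integral_norm_triangle[where g = "shifted k j z"]] add_mono near shift_near j) measurable
    also have "\<dots> = ennreal (e / 2)" using assms by (simp add: ennreal_plus[symmetric] del: ennreal_plus)
    finally show ?thesis .
  qed
  show ?thesis
  proof (intro exI[of _ "k + J"] allI impI)
    fix m n assume mn: "k + J \<le> m" "k + J \<le> n"
    have "(\<integral>\<^sup>+x. ennreal (norm (dq m z x - dq n z x)) \<partial>lborel) \<le> ennreal (e / 2) + (\<integral>\<^sup>+x. ennreal (norm (shifted k J z x - dq n z x)) \<partial>lborel)"
      by (intro order_trans[OF nn_integral_norm_triangle[where g = "shifted k J z"]] add_right_mono near_J mn) measurable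
    also have "\<dots> \<le> ennreal (e / 2) + ennreal (e / 2)"
      using near_J[OF mn(2)] by (intro add_left_mono) (simp add: norm_minus_commute)
    also have "\<dots> = ennreal e" using assms by (simp add: ennreal_plus[symmetric] del: ennreal_plus)
    finally show "(\<integral>\<^sup>+x. ennreal (norm (dq m z x - dq n z x)) \<partial>lborel) \<le> ennreal e" .
  qed
qed

end

section \<open>Directional derivatives as limits in the mean, and their linearity\<close>

context compact_lipschitz
begin

definition slope :: "'a \<Rightarrow> 'a \<Rightarrow> 'h" where
  "slope z = (SOME g. g \<in> borel_measurable borel \<and> (\<lambda>k. \<integral>\<^sup>+x. ennreal (norm (dq k z x - g x)) \<partial>lborel) \<longlonglongrightarrow> 0)"

lemma slope:
  shows slope_measurable[measurable]: "slope z \<in> borel_measurable borel"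
    and slope_lim: "(\<lambda>k. \<integral>\<^sup>+x. ennreal (norm (dq k z x - slope z x)) \<partial>lborel) \<longlonglongrightarrow> 0"
proof -
  have "\<exists>g\<in>borel_measurable lborel. (\<lambda>k. \<integral>\<^sup>+x. ennreal (norm (dq k z x - g x)) \<partial>lborel) \<longlonglongrightarrow> 0"
    by (rule L1_complete[OF _ dq_L1_Cauchy]) measurable
  then have "\<exists>g. g \<in> borel_measurable borel \<and> (\<lambda>k. \<integral>\<^sup>+x. ennreal (norm (dq k z x - g x)) \<partial>lborel) \<longlonglongrightarrow> 0"
    by auto
  from someI_ex[OF this] show "slope z \<in> borel_measurable borel"
    "(\<lambda>k. \<integral>\<^sup>+x. ennreal (norm (dq k z x - slope z x)) \<partial>lborel) \<longlonglongrightarrow> 0"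
    unfolding slope_def by auto
qed

lemma AE_eqI:
  fixes g h :: "'a \<Rightarrow> 'h"
  assumes [measurable]: "g \<in> borel_measurable borel" "h \<in> borel_measurable borel"
    and b: "\<And>k::nat. (\<integral>\<^sup>+x. ennreal (norm (g x - h x)) \<partial>lborel) \<le> b k" and lim: "b \<longlonglongrightarrow> 0"
  shows "AE x in lborel. g x = h x"
proof -
  have "(\<integral>\<^sup>+x. ennreal (norm (g x - h x)) \<partial>lborel) \<le> 0"
    using lim by (rule LIMSEQ_le_const) (use b in auto)
  then have "AE x in lborel. ennreal (norm (g x - h x)) = 0"
    by (subst nn_integral_0_iff_AE[symmetric]) auto
  then show ?thesis by eventually_elim simp
qed

lemma slope_unique:
  assumes g[measurable]: "g \<in> borel_measurable borel"
    and lim: "(\<lambda>k. \<integral>\<^sup>+x. ennreal (norm (dq (r k) z x - g x)) \<partial>lborel) \<longlonglongrightarrow> 0"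
    and r: "filterlim r at_top sequentially"
  shows "AE x in lborel. slope z x = g x"
proof (rule AE_eqI)
  show "(\<lambda>k. (\<integral>\<^sup>+x. ennreal (norm (dq (r k) z x - slope z x)) \<partial>lborel) + (\<integral>\<^sup>+x. ennreal (norm (dq (r k) z x - g x)) \<partial>lborel)) \<longlonglongrightarrow> 0"
    using tendsto_add[OF filterlim_compose[OF slope_lim r] lim] by simp
  show "(\<integral>\<^sup>+x. ennreal (norm (slope z x - g x)) \<partial>lborel) \<le>
    (\<integral>\<^sup>+x. ennreal (norm (dq (r k) z x - slope z x)) \<partial>lborel) + (\<integral>\<^sup>+x. ennreal (norm (dq (r k) z x - g x)) \<partial>lborel)" for k
    using nn_integral_norm_triangle[of "slope z" lborel "dq (r k) z" g] by (simp add: norm_minus_commute)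
qed measurable

text \<open>The identity \<open>dq k (z + w) x = dq k w (x + y) + dq k z x\<close> with
  \<open>y = z /\<^sub>R 2 ^ k\<close> is exact, so only the translation by \<open>y\<close> has to
  be removed. A quotient \<open>dq j w\<close> with \<open>j\<close> fixed is stable under small
  translations; therefore \<open>k\<close> tends to infinity first and \<open>j\<close>
  afterwards.\<close>

lemma slope_add: "AE x in lborel. slope (z + w) x = slope z x + slope w x"
proof -
  define a where "a z k = (\<integral>\<^sup>+x. ennreal (norm (dq k z x - slope z x)) \<partial>lborel)" for z k
  have a: "a z \<longlonglongrightarrow> 0" for z unfolding a_def by (rule slope_lim)
  define V where "V y = unit_ball_vol DIM('a) * (R + norm w + norm y) ^ DIM('a)" for y :: 'a
  define T where "T j y = (\<integral>\<^sup>+x. ennreal (norm (dq j w (x + y) - dq j w x)) \<partial>lborel)" for j y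
  have T: "T j y \<le> ennreal (2 * 2 ^ j * C * norm y * V z)" if "norm y \<le> norm z" for j y
  proof -
    have pos: "R + norm w + norm z > 0" using R by (simp add: add_pos_nonneg)
    have "T j y \<le> (\<integral>\<^sup>+x. ennreal (2 * 2 ^ j * C * norm y) * indicator (ball (0::'a) (R + norm w + norm z)) x \<partial>lborel)"
      unfolding T_def
    proof (intro nn_integral_mono)
      fix x
      show "ennreal (norm (dq j w (x + y) - dq j w x)) \<le> ennreal (2 * 2 ^ j * C * norm y) * indicator (ball (0::'a) (R + norm w + norm z)) x"
      proof (cases "norm x < R + norm w + norm z")
        case True
        then show ?thesis using dq_lip[of j w "x + y" x] by (auto intro!: ennreal_leI)
      next
        case False
        have "norm x \<le> norm (x + y) + norm y" using norm_triangle_ineq4[of "x + y" y] by simp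
        then have "norm (x + y) \<ge> R + norm w" using False that by linarith
        moreover have "norm x \<ge> R + norm w" using False norm_ge_zero[of z] by linarith
        ultimately show ?thesis using dq_supp by simp
      qed
    qed
    also have "\<dots> = ennreal (2 * 2 ^ j * C * norm y * V z)"
      using pos C0 by (simp add: nn_integral_cmult_indicator emeasure_ball_vol V_def ball_vol_def ennreal_mult[symmetric])
    finally show ?thesis .
  qed
  have Tlim: "(\<lambda>k. T j (z /\<^sub>R 2 ^ k)) \<longlonglongrightarrow> 0" for j
  proof (rule tendsto_sandwich[of "\<lambda>_. 0" _ _ "\<lambda>k. ennreal (2 * 2 ^ j * C * norm (z /\<^sub>R 2 ^ k) * V z)"])
    have "norm (z /\<^sub>R 2 ^ k) \<le> norm z" for k by (simp add: field_simps mult_le_cancel_left1)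
    then show "\<forall>\<^sub>F k in sequentially. T j (z /\<^sub>R 2 ^ k) \<le> ennreal (2 * 2 ^ j * C * norm (z /\<^sub>R 2 ^ k) * V z)"
      by (intro always_eventually allI T)
    have nz: "norm (z /\<^sub>R 2 ^ k) = norm z * (1/2) ^ k" for k :: nat
      unfolding norm_scaleR by (simp add: power_divide inverse_eq_divide)
    have "(\<lambda>k. 2 * 2 ^ j * C * (norm z * (1/2) ^ k) * V z) \<longlonglongrightarrow> 2 * 2 ^ j * C * (norm z * 0) * V z"
      by (intro tendsto_mult tendsto_const LIMSEQ_power_zero) auto
    then have "(\<lambda>k. ennreal (2 * 2 ^ j * C * (norm z * (1/2) ^ k) * V z)) \<longlonglongrightarrow> ennreal 0"
      by (intro tendsto_ennrealI) simp
    then show "(\<lambda>k. ennreal (2 * 2 ^ j * C * norm (z /\<^sub>R 2 ^ k) * V z)) \<longlonglongrightarrow> 0"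
      by (simp only: nz ennreal_0)
  qed auto
  have main: "(\<integral>\<^sup>+x. ennreal (norm (slope (z + w) x - (slope z x + slope w x))) \<partial>lborel) \<le>
     a (z + w) k + a z k + a w k + (2 * a w j + T j (z /\<^sub>R 2 ^ k))" for j k
  proof -
    define y where "y = z /\<^sub>R 2 ^ k"
    have dqa: "dq k (z + w) x = dq k w (x + y) + dq k z x" for x
      by (simp add: dq_def y_def scaleR_add_right algebra_simps)
    have pw: "norm (slope (z + w) x - (slope z x + slope w x)) \<le>
      norm (dq k (z + w) x - slope (z + w) x) + norm (dq k z x - slope z x) +
      norm (dq k w (x + y) - slope w (x + y)) + norm (dq j w (x + y) - slope w (x + y)) +
      norm (dq j w (x + y) - dq j w x) + norm (dq j w x - slope w x)" for x
    proof -
      have "slope (z + w) x - (slope z x + slope w x) =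
        (dq k z x - slope z x) - (dq k (z + w) x - slope (z + w) x) +
        (dq k w (x + y) - slope w (x + y)) - (dq j w (x + y) - slope w (x + y)) +
        (dq j w (x + y) - dq j w x) + (dq j w x - slope w x)"
        unfolding dqa by simp
      then show ?thesis
        by (smt (verit) norm_triangle_ineq norm_triangle_ineq4)
    qed
    have "(\<integral>\<^sup>+x. ennreal (norm (slope (z + w) x - (slope z x + slope w x))) \<partial>lborel) \<le>
      (\<integral>\<^sup>+x. ennreal (norm (dq k (z + w) x - slope (z + w) x)) + ennreal (norm (dq k z x - slope z x)) +
      ennreal (norm (dq k w (x + y) - slope w (x + y))) + ennreal (norm (dq j w (x + y) - slope w (x + y))) +
      ennreal (norm (dq j w (x + y) - dq j w x)) + ennreal (norm (dq j w x - slope w x)) \<partial>lborel)"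
      using pw by (intro nn_integral_mono) (simp add: ennreal_plus[symmetric] ennreal_leI del: ennreal_plus)
    also have "\<dots> = a (z + w) k + a z k + (\<integral>\<^sup>+x. ennreal (norm (dq k w (x + y) - slope w (x + y))) \<partial>lborel)
       + (\<integral>\<^sup>+x. ennreal (norm (dq j w (x + y) - slope w (x + y))) \<partial>lborel) + T j y + a w j"
      unfolding a_def T_def by (simp add: nn_integral_add)
    also have "\<dots> = a (z + w) k + a z k + a w k + a w j + T j y + a w j"
      unfolding a_def using nn_integral_lborel_shift[of "\<lambda>x. ennreal (norm (dq k w x - slope w x))" y]
        nn_integral_lborel_shift[of "\<lambda>x. ennreal (norm (dq j w x - slope w x))" y] by simp
    finally show ?thesis by (simp add: y_def mult_2 add_ac)
  qed
  show ?thesis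
  proof (rule AE_eqI)
    have "(\<integral>\<^sup>+x. ennreal (norm (slope (z + w) x - (slope z x + slope w x))) \<partial>lborel) \<le> 2 * a w j" for j
    proof (rule LIMSEQ_le_const)
      have "(\<lambda>k. a (z + w) k + a z k + a w k + (2 * a w j + T j (z /\<^sub>R 2 ^ k))) \<longlonglongrightarrow> 0 + 0 + 0 + (2 * a w j + 0)"
        by (intro tendsto_add a Tlim tendsto_const)
      then show "(\<lambda>k. a (z + w) k + a z k + a w k + (2 * a w j + T j (z /\<^sub>R 2 ^ k))) \<longlonglongrightarrow> 2 * a w j" by simp
    qed (use main in auto)
    then show "(\<integral>\<^sup>+x. ennreal (norm (slope (z + w) x - (slope z x + slope w x))) \<partial>lborel) \<le> 2 * a w j" for j .
    show "(\<lambda>j. 2 * a w j) \<longlonglongrightarrow> 0" using ennreal_tendsto_cmult[OF _ a, of 2 w] by simp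
  qed measurable
qed

text \<open>Continuity in the direction, which carries linearity from dyadic combinations of the
  basis to all directions.\<close>

lemma slope_diff_le:
  assumes "norm z \<le> \<rho>" "norm w \<le> \<rho>"
  shows "(\<integral>\<^sup>+x. ennreal (norm (slope z x - slope w x)) \<partial>lborel) \<le> ennreal (C * norm (z - w)) * ball_vol TYPE('a) (R + \<rho>)"
proof -
  define a where "a z k = (\<integral>\<^sup>+x. ennreal (norm (dq k z x - slope z x)) \<partial>lborel)" for z k
  have a: "a z \<longlonglongrightarrow> 0" for z unfolding a_def by (rule slope_lim)
  have rho: "\<rho> \<ge> 0" using assms norm_ge_zero order_trans by blast
  have dqd: "(\<integral>\<^sup>+x. ennreal (norm (dq k z x - dq k w x)) \<partial>lborel) \<le> ennreal (C * norm (z - w)) * ball_vol TYPE('a) (R + \<rho>)" for k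
  proof -
    have "(\<integral>\<^sup>+x. ennreal (norm (dq k z x - dq k w x)) \<partial>lborel) \<le> (\<integral>\<^sup>+x. ennreal (C * norm (z - w)) * indicator (ball (0::'a) (R + \<rho>)) x \<partial>lborel)"
    proof (intro nn_integral_mono)
      fix x
      show "ennreal (norm (dq k z x - dq k w x)) \<le> ennreal (C * norm (z - w)) * indicator (ball (0::'a) (R + \<rho>)) x"
      proof (cases "norm x < R + \<rho>")
        case True
        have "dq k z x - dq k w x = 2 ^ k *\<^sub>R (u (x + z /\<^sub>R 2 ^ k) - u (x + w /\<^sub>R 2 ^ k))"
          by (simp add: dq_def algebra_simps)
        then have "norm (dq k z x - dq k w x) \<le> 2 ^ k * (C * norm ((x + z /\<^sub>R 2 ^ k) - (x + w /\<^sub>R 2 ^ k)))"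
          using u_dist[of "x + z /\<^sub>R 2 ^ k" "x + w /\<^sub>R 2 ^ k"] by (simp only: norm_scaleR) (simp add: mult_left_mono)
        also have "(x + z /\<^sub>R 2 ^ k) - (x + w /\<^sub>R 2 ^ k) = (z - w) /\<^sub>R 2 ^ k" by (simp add: scaleR_diff_right)
        also have "2 ^ k * (C * norm ((z - w) /\<^sub>R 2 ^ k)) = C * norm (z - w)" by (simp only: norm_scaleR) simp
        finally have "norm (dq k z x - dq k w x) \<le> C * norm (z - w)" .
        then show ?thesis using True by (auto intro!: ennreal_leI)
      next
        case False
        then show ?thesis using assms dq_supp[of z x k] dq_supp[of w x k] by simp
      qed
    qed
    then show ?thesis using rho R by (simp add: nn_integral_cmult_indicator emeasure_ball_vol add_nonneg_nonneg)
  qed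
  have le: "(\<integral>\<^sup>+x. ennreal (norm (slope z x - slope w x)) \<partial>lborel) \<le> a z k + (ennreal (C * norm (z - w)) * ball_vol TYPE('a) (R + \<rho>) + a w k)" for k
  proof -
    have "(\<integral>\<^sup>+x. ennreal (norm (slope z x - slope w x)) \<partial>lborel) \<le> a z k + (\<integral>\<^sup>+x. ennreal (norm (dq k z x - slope w x)) \<partial>lborel)"
      unfolding a_def using nn_integral_norm_triangle[of "slope z" lborel "dq k z" "slope w"] by (simp add: norm_minus_commute)
    also have "\<dots> \<le> a z k + ((\<integral>\<^sup>+x. ennreal (norm (dq k z x - dq k w x)) \<partial>lborel) + a w k)"
      unfolding a_def by (intro add_left_mono nn_integral_norm_triangle) measurable
    also have "\<dots> \<le> a z k + (ennreal (C * norm (z - w)) * ball_vol TYPE('a) (R + \<rho>) + a w k)"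
      by (intro add_mono dqd order_refl)
    finally show ?thesis .
  qed
  have "(\<lambda>k. a z k + (ennreal (C * norm (z - w)) * ball_vol TYPE('a) (R + \<rho>) + a w k)) \<longlonglongrightarrow> 0 + (ennreal (C * norm (z - w)) * ball_vol TYPE('a) (R + \<rho>) + 0)"
    by (intro tendsto_add a tendsto_const)
  then show ?thesis using le by (intro LIMSEQ_le_const) auto
qed

definition gradient :: "'a \<Rightarrow> 'a \<Rightarrow> 'h" where
  "gradient x z = (\<Sum>b\<in>Basis. (z \<bullet> b) *\<^sub>R slope b x)"

lemma gradient_measurable[measurable]: "(\<lambda>x. gradient x z) \<in> borel_measurable borel"
  unfolding gradient_def by measurable

lemma gradient_add: "gradient x (z + w) = gradient x z + gradient x w"
  by (simp add: gradient_def inner_add_left scaleR_add_left sum.distrib)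

lemma gradient_scaleR: "gradient x (t *\<^sub>R z) = t *\<^sub>R gradient x z"
  by (simp add: gradient_def scaleR_sum_right)

lemma gradient_basis: "b \<in> Basis \<Longrightarrow> gradient x b = slope b x"
  by (simp add: gradient_def inner_Basis if_distrib[of "\<lambda>t. t *\<^sub>R _"] cong: if_cong)

lemma slope_zero: "AE x in lborel. slope 0 x = 0"
  using slope_add[of 0 0] by eventually_elim simp

text \<open>Dyadic steps give homogeneity directly for powers of two: dividing the direction by
  \<open>2 ^ j\<close> shifts the index of the quotients by \<open>j\<close>.\<close>

lemma slope_halve: "AE x in lborel. slope (z /\<^sub>R 2 ^ j) x = slope z x /\<^sub>R 2 ^ j"
proof (rule slope_unique[where r="\<lambda>k. k"])
  have eq: "dq k (z /\<^sub>R 2 ^ j) x = dq (k + j) z x /\<^sub>R 2 ^ j" for k x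
    by (simp add: dq_def power_add field_simps)
  have "(\<lambda>k. ennreal (1 / 2 ^ j) * (\<integral>\<^sup>+x. ennreal (norm (dq (k + j) z x - slope z x)) \<partial>lborel)) \<longlonglongrightarrow> ennreal (1 / 2 ^ j) * 0"
    by (intro ennreal_tendsto_cmult LIMSEQ_ignore_initial_segment[OF slope_lim]) simp
  moreover have "(\<integral>\<^sup>+x. ennreal (norm (dq k (z /\<^sub>R 2 ^ j) x - slope z x /\<^sub>R 2 ^ j)) \<partial>lborel) =
     ennreal (1 / 2 ^ j) * (\<integral>\<^sup>+x. ennreal (norm (dq (k + j) z x - slope z x)) \<partial>lborel)" for k
  proof -
    have "norm (dq k (z /\<^sub>R 2 ^ j) x - slope z x /\<^sub>R 2 ^ j) = (1 / 2 ^ j) * norm (dq (k + j) z x - slope z x)" for x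
      unfolding eq scaleR_diff_right[symmetric] norm_scaleR by (simp add: inverse_eq_divide)
    then show ?thesis by (simp add: ennreal_mult nn_integral_cmult del: times_divide_eq_left mult_1)
  qed
  ultimately show "(\<lambda>k. \<integral>\<^sup>+x. ennreal (norm (dq k (z /\<^sub>R 2 ^ j) x - slope z x /\<^sub>R 2 ^ j)) \<partial>lborel) \<longlonglongrightarrow> 0" by simp
qed (auto simp: filterlim_ident)

lemma slope_finite: "(\<integral>\<^sup>+x. ennreal (norm (slope z x)) \<partial>lborel) < \<infinity>"
proof -
  have "(\<integral>\<^sup>+x. ennreal (norm (slope z x)) \<partial>lborel) = (\<integral>\<^sup>+x. ennreal (norm (slope z x - slope 0 x)) \<partial>lborel)"
    using slope_zero by (intro nn_integral_cong_AE) (auto elim: eventually_mono)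
  also have "\<dots> \<le> ennreal (C * norm (z - 0)) * ball_vol TYPE('a) (R + norm z)"
    by (rule slope_diff_le) auto
  also have "\<dots> < \<infinity>" using ball_vol_finite[of "R + norm z", where 'a='a] by (simp add: ennreal_mult_less_top)
  finally show ?thesis .
qed

text \<open>The directions for which the claim holds contain the basis and are closed under
  addition, negation and division by powers of two. Such combinations approximate every
  \<open>z\<close>, and \<open>slope_diff_le\<close> passes to the limit.\<close>

lemma slope_eq_gradient: "AE x in lborel. slope z x = gradient x z"
proof -
  define Z where "Z = {z. AE x in lborel. slope z x = gradient x z}"
  have add: "z + w \<in> Z" if "z \<in> Z" "w \<in> Z" for z w
  proof -
    have "AE x in lborel. slope z x = gradient x z" "AE x in lborel. slope w x = gradient x w"
      using that by (simp_all add: Z_def)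
    then have "AE x in lborel. slope (z + w) x = gradient x (z + w)"
      using slope_add[of z w] by eventually_elim (simp add: gradient_add)
    then show ?thesis by (simp add: Z_def)
  qed
  have zero: "0 \<in> Z" using slope_zero unfolding Z_def by (auto simp: gradient_def)
  have neg: "- z \<in> Z" if "z \<in> Z" for z
  proof -
    have "AE x in lborel. slope z x + slope (-z) x = 0"
      using slope_add[of z "-z"] slope_zero by eventually_elim simp
    moreover have "AE x in lborel. slope z x = gradient x z" using that by (simp add: Z_def)
    ultimately have "AE x in lborel. slope (- z) x = gradient x (- z)"
    proof eventually_elim
      case (elim x)
      then show ?case using gradient_scaleR[of x "-1" z] by (simp add: add_eq_0_iff)
    qed
    then show ?thesis by (simp add: Z_def)
  qed
  have nat: "real n *\<^sub>R z \<in> Z" if "z \<in> Z" for n z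
  proof (induction n)
    case (Suc n)
    have "real (Suc n) *\<^sub>R z = z + real n *\<^sub>R z" by (simp add: algebra_simps)
    then show ?case using add[OF that Suc] by simp
  qed (use zero in simp)
  have int: "of_int n *\<^sub>R z \<in> Z" if z: "z \<in> Z" for n :: int and z
  proof (cases "n \<ge> 0")
    case True
    then show ?thesis using nat[OF z, of "nat n"] by simp
  next
    case False
    then show ?thesis using nat[OF neg[OF z], of "nat (- n)"] by simp
  qed
  have halve: "z /\<^sub>R 2 ^ j \<in> Z" if "z \<in> Z" for z j
  proof -
    have "AE x in lborel. slope z x = gradient x z" using that by (simp add: Z_def)
    then have "AE x in lborel. slope (z /\<^sub>R 2 ^ j) x = gradient x (z /\<^sub>R 2 ^ j)"
      using slope_halve[of j z] by eventually_elim (simp add: gradient_scaleR)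
    then show ?thesis by (simp add: Z_def)
  qed
  have basis: "b \<in> Z" if "b \<in> Basis" for b using that by (simp add: Z_def gradient_basis)
  have lattice: "(\<Sum>b\<in>S. of_int (n b) *\<^sub>R (b /\<^sub>R 2 ^ j)) \<in> Z" if "finite S" "S \<subseteq> Basis" for S n j
    using that
  proof (induction S rule: finite_induct)
    case (insert b S)
    then show ?case using add[OF int[OF halve[OF basis]]] by (subst sum.insert) auto
  qed (use zero in simp)
  define w where "w j = (\<Sum>b\<in>Basis. of_int \<lfloor>2 ^ j * (z \<bullet> b)\<rfloor> *\<^sub>R (b /\<^sub>R 2 ^ j))" for j :: nat
  have wZ: "w j \<in> Z" for j unfolding w_def by (rule lattice) auto
  have wz: "norm (z - w j) \<le> DIM('a) / 2 ^ j" for j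
  proof -
    have "\<bar>(z - w j) \<bullet> b\<bar> \<le> 1 / 2 ^ j" if "b \<in> Basis" for b
    proof -
      have "(z - w j) \<bullet> b = (2 ^ j * (z \<bullet> b) - of_int \<lfloor>2 ^ j * (z \<bullet> b)\<rfloor>) / 2 ^ j"
        using that by (simp add: w_def inner_diff_left inner_sum_left inner_Basis if_distrib cong: if_cong) (simp add: field_simps)
      moreover have "0 \<le> 2 ^ j * (z \<bullet> b) - of_int \<lfloor>2 ^ j * (z \<bullet> b)\<rfloor>" "2 ^ j * (z \<bullet> b) - of_int \<lfloor>2 ^ j * (z \<bullet> b)\<rfloor> \<le> 1"
        by linarith+
      ultimately show ?thesis by (simp add: divide_right_mono)
    qed
    then have "(\<Sum>b\<in>Basis. \<bar>(z - w j) \<bullet> b\<bar>) \<le> (\<Sum>b\<in>(Basis::'a set). 1 / 2 ^ j)" by (intro sum_mono)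
    then show ?thesis using norm_le_l1[of "z - w j"] by simp
  qed
  define \<rho> where "\<rho> = norm z + DIM('a)"
  have wr: "norm (w j) \<le> \<rho>" for j
  proof -
    have "DIM('a) / 2 ^ j \<le> DIM('a)" by (simp add: field_simps)
    then show ?thesis using wz[of j] norm_triangle_ineq3[of z "w j"] by (simp add: \<rho>_def abs_le_iff)
  qed
  define N1 where "N1 = (\<Sum>b\<in>(Basis::'a set). \<integral>\<^sup>+x. ennreal (norm (slope b x)) \<partial>lborel)"
  have N1: "N1 < top" unfolding N1_def using slope_finite by (simp add: less_top)
  define M where "M = ennreal C * ball_vol TYPE('a) (R + \<rho>) + N1"
  have M: "M < top" unfolding M_def using N1 ball_vol_finite[of "R + \<rho>", where 'a='a] by (simp add: ennreal_mult_less_top)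
  show ?thesis
  proof (rule AE_eqI)
    fix j :: nat
    have "(\<integral>\<^sup>+x. ennreal (norm (slope z x - gradient x z)) \<partial>lborel) \<le>
      (\<integral>\<^sup>+x. ennreal (norm (slope z x - slope (w j) x)) \<partial>lborel) + (\<integral>\<^sup>+x. ennreal (norm (slope (w j) x - gradient x z)) \<partial>lborel)"
      by (rule nn_integral_norm_triangle) measurable
    also have "\<dots> \<le> ennreal (C * norm (z - w j)) * ball_vol TYPE('a) (R + \<rho>) + ennreal (norm (z - w j)) * N1"
    proof (rule add_mono)
      show "(\<integral>\<^sup>+x. ennreal (norm (slope z x - slope (w j) x)) \<partial>lborel) \<le> ennreal (C * norm (z - w j)) * ball_vol TYPE('a) (R + \<rho>)"
        by (rule slope_diff_le[OF _ wr]) (simp add: \<rho>_def)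
      have "(\<integral>\<^sup>+x. ennreal (norm (slope (w j) x - gradient x z)) \<partial>lborel) \<le>
      (\<integral>\<^sup>+x. ennreal (norm (z - w j)) * (\<Sum>b\<in>Basis. ennreal (norm (slope b x))) \<partial>lborel)"
    proof (rule nn_integral_mono_AE)
      have "AE x in lborel. slope (w j) x = gradient x (w j)" using wZ[of j] by (simp add: Z_def)
      then show "AE x in lborel. ennreal (norm (slope (w j) x - gradient x z)) \<le> ennreal (norm (z - w j)) * (\<Sum>b\<in>Basis. ennreal (norm (slope b x)))"
      proof eventually_elim
        case (elim x)
        have "slope (w j) x - gradient x z = gradient x (w j - z)"
          unfolding elim by (simp add: gradient_def inner_diff_left scaleR_diff_left sum_subtractf)
        then have "norm (slope (w j) x - gradient x z) \<le> (\<Sum>b\<in>Basis. \<bar>(w j - z) \<bullet> b\<bar> * norm (slope b x))"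
          unfolding gradient_def by (auto intro!: order_trans[OF norm_sum])
        also have "\<dots> \<le> (\<Sum>b\<in>Basis. norm (z - w j) * norm (slope b x))"
          by (intro sum_mono mult_right_mono) (auto simp: norm_minus_commute[of z] Basis_le_norm)
        finally have "ennreal (norm (slope (w j) x - gradient x z)) \<le> ennreal (norm (z - w j) * (\<Sum>b\<in>Basis. norm (slope b x)))"
          by (intro ennreal_leI) (simp add: sum_distrib_left)
        then show ?case by (simp add: ennreal_mult sum_nonneg)
      qed
    qed
      also have "\<dots> = ennreal (norm (z - w j)) * N1"
        unfolding N1_def by (simp add: nn_integral_cmult nn_integral_sum del: sum_ennreal)
      finally show "(\<integral>\<^sup>+x. ennreal (norm (slope (w j) x - gradient x z)) \<partial>lborel) \<le> ennreal (norm (z - w j)) * N1" .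
    qed
    also have "\<dots> = ennreal (norm (z - w j)) * M"
      using C0 by (simp add: M_def distrib_left ennreal_mult mult_ac)
    also have "\<dots> \<le> ennreal (DIM('a) / 2 ^ j) * M" by (intro mult_right_mono ennreal_leI wz) simp
    finally show "(\<integral>\<^sup>+x. ennreal (norm (slope z x - gradient x z)) \<partial>lborel) \<le> ennreal (DIM('a) / 2 ^ j) * M" .
  next
    have "(\<lambda>j. real DIM('a) * (1 / 2) ^ j) \<longlonglongrightarrow> real DIM('a) * 0"
      by (intro tendsto_mult tendsto_const LIMSEQ_power_zero) auto
    then have "(\<lambda>j. ennreal (real DIM('a) * (1 / 2) ^ j)) \<longlonglongrightarrow> 0" using tendsto_ennrealI by fastforce
    then have "(\<lambda>j. M * ennreal (real DIM('a) * (1 / 2) ^ j)) \<longlonglongrightarrow> M * 0" by (rule ennreal_tendsto_cmult[OF M])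
    then show "(\<lambda>j. ennreal (DIM('a) / 2 ^ j) * M) \<longlonglongrightarrow> 0" by (simp add: power_divide mult.commute)
  qed measurable
qed

end

lemma AE_tendsto_zero:
  fixes A :: "nat \<Rightarrow> 'a \<Rightarrow> ennreal"
  assumes [measurable]: "\<And>i. A i \<in> borel_measurable M" and le: "\<And>i. (\<integral>\<^sup>+x. A i x \<partial>M) \<le> ennreal ((1/2) ^ i)"
  shows "AE x in M. (\<lambda>i. A i x) \<longlonglongrightarrow> 0"
proof -
  have "(\<integral>\<^sup>+x. (\<Sum>i. A i x) \<partial>M) = (\<Sum>i. \<integral>\<^sup>+x. A i x \<partial>M)" by (rule nn_integral_suminf) measurable
  also have "\<dots> \<le> (\<Sum>i. ennreal ((1/2) ^ i))" by (intro suminf_le summableI le)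
  also have "\<dots> = ennreal (\<Sum>i. (1/2) ^ i)" by (rule suminf_ennreal2) (auto intro: summable_geometric)
  also have "\<dots> < top" by simp
  finally have "AE x in M. (\<Sum>i. A i x) \<noteq> \<infinity>" by (intro nn_integral_noteq_infinite) auto
  then show ?thesis
  proof eventually_elim
    case (elim x)
    have ntop: "A i x \<noteq> top" for i
      using elim ennreal_suminf_lessD[of "\<lambda>i. A i x" top i] by (auto simp: less_top)
    then have eq: "A i x = ennreal (enn2real (A i x))" for i by (simp add: less_top)
    have "(\<Sum>i. ennreal (enn2real (A i x))) \<noteq> top" using elim by (subst (asm) eq) simp
    then have "summable (\<lambda>i. enn2real (A i x))" by (intro summable_suminf_not_top) auto
    then have "(\<lambda>i. enn2real (A i x)) \<longlonglongrightarrow> 0" by (rule summable_LIMSEQ_zero)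
    then have "(\<lambda>i. ennreal (enn2real (A i x))) \<longlonglongrightarrow> ennreal 0" by (rule tendsto_ennrealI)
    then show ?case using eq by simp
  qed
qed

section \<open>From the gradient in the mean to differentiability almost everywhere\<close>

context compact_lipschitz
begin

text \<open>The norm of the increment along the segment minus a linear term is a real Lipschitz
  function, so \<open>lipschitz_increment_le_liminf\<close> applies before anything is known about
  derivatives of \<open>u\<close>. Later \<open>c\<close> is the gradient at \<open>x\<close>
  applied to \<open>z\<close>.\<close>

lemma increment_le_dq:
  assumes r: "filterlim r at_top sequentially"
  shows "ennreal (norm (u (x + z) - u x - c)) \<le>
    liminf (\<lambda>i. \<integral>\<^sup>+t\<in>{0..1}. ennreal (norm (dq (r i) z (x + t *\<^sub>R z) - c)) \<partial>lborel)"
proof -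
  define \<phi> where "\<phi> t = norm (u (x + t *\<^sub>R z) - u x - t *\<^sub>R c)" for t
  define h :: "nat \<Rightarrow> real" where "h i = 1 / 2 ^ r i" for i
  have lip\<phi>: "(C * norm z + norm c)-lipschitz_on UNIV \<phi>"
  proof (rule lipschitz_onI)
    fix s t :: real
    have "dist (\<phi> s) (\<phi> t) \<le> norm ((u (x + s *\<^sub>R z) - u x - s *\<^sub>R c) - (u (x + t *\<^sub>R z) - u x - t *\<^sub>R c))"
      unfolding \<phi>_def dist_real_def by (rule norm_triangle_ineq3)
    also have "\<dots> = norm ((u (x + s *\<^sub>R z) - u (x + t *\<^sub>R z)) - (s - t) *\<^sub>R c)" by (simp add: algebra_simps)
    also have "\<dots> \<le> C * norm ((x + s *\<^sub>R z) - (x + t *\<^sub>R z)) + \<bar>s - t\<bar> * norm c"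
      using u_dist[of "x + s *\<^sub>R z" "x + t *\<^sub>R z"] norm_triangle_ineq4[of "u (x + s *\<^sub>R z) - u (x + t *\<^sub>R z)" "(s - t) *\<^sub>R c"] by simp
    also have "(x + s *\<^sub>R z) - (x + t *\<^sub>R z) = (s - t) *\<^sub>R z" by (simp add: algebra_simps)
    also have "norm ((s - t) *\<^sub>R z) = \<bar>s - t\<bar> * norm z" by simp
    finally show "dist (\<phi> s) (\<phi> t) \<le> (C * norm z + norm c) * dist s t" by (simp add: dist_real_def algebra_simps)
  qed (use C0 in auto)
  have h0: "h \<longlonglongrightarrow> 0"
  proof -
    have "(\<lambda>k::nat. (1/2::real) ^ k) \<longlonglongrightarrow> 0" by (rule LIMSEQ_power_zero) auto
    from filterlim_compose[OF this r] show ?thesis by (simp add: h_def[abs_def] power_divide)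
  qed
  have "ennreal (\<phi> 1 - \<phi> 0) \<le> liminf (\<lambda>n. \<integral>\<^sup>+t\<in>{0..1}. ennreal ((\<phi> (t + h n) - \<phi> t) / h n) \<partial>lborel)"
    by (rule lipschitz_increment_le_liminf[OF lip\<phi> _ _ h0]) (auto simp: h_def)
  also have "\<dots> \<le> liminf (\<lambda>i. \<integral>\<^sup>+t\<in>{0..1}. ennreal (norm (dq (r i) z (x + t *\<^sub>R z) - c)) \<partial>lborel)"
  proof (intro Liminf_mono always_eventually allI nn_integral_mono mult_right_mono ennreal_leI)
    fix i t
    have hp: "h i > 0" by (simp add: h_def)
    have e: "dq (r i) z (x + t *\<^sub>R z) - c = ((u (x + (t + h i) *\<^sub>R z) - u x - (t + h i) *\<^sub>R c) - (u (x + t *\<^sub>R z) - u x - t *\<^sub>R c)) /\<^sub>R h i"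
    proof -
      have 1: "x + t *\<^sub>R z + z /\<^sub>R 2 ^ r i = x + (t + h i) *\<^sub>R z" by (simp add: h_def scaleR_add_left inverse_eq_divide)
      have 2: "(2::real) ^ r i = inverse (h i)" by (simp add: h_def)
      have 3: "dq (r i) z (x + t *\<^sub>R z) = (u (x + (t + h i) *\<^sub>R z) - u (x + t *\<^sub>R z)) /\<^sub>R h i"
        unfolding dq_def 1 by (simp add: 2)
      have 4: "((u (x + (t + h i) *\<^sub>R z) - u x - (t + h i) *\<^sub>R c) - (u (x + t *\<^sub>R z) - u x - t *\<^sub>R c)) =
        (u (x + (t + h i) *\<^sub>R z) - u (x + t *\<^sub>R z)) - h i *\<^sub>R c" by (simp add: algebra_simps)
      show ?thesis unfolding 3 4 scaleR_diff_right using hp by simp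
    qed
    have "(\<phi> (t + h i) - \<phi> t) / h i \<le> norm ((u (x + (t + h i) *\<^sub>R z) - u x - (t + h i) *\<^sub>R c) - (u (x + t *\<^sub>R z) - u x - t *\<^sub>R c)) / h i"
      unfolding \<phi>_def using hp by (intro divide_right_mono norm_triangle_ineq2) auto
    also have "\<dots> = norm (dq (r i) z (x + t *\<^sub>R z) - c)" unfolding e norm_scaleR using hp by (simp add: divide_inverse)
    finally show "(\<phi> (t + h i) - \<phi> t) / h i \<le> norm (dq (r i) z (x + t *\<^sub>R z) - c)" .
  qed simp
  finally show ?thesis by (simp add: \<phi>_def)
qed

text \<open>Along a subsequence that converges fast in the mean, the line integrals of the
  difference between \<open>dq\<close> and \<open>slope\<close> tend to 0 for almost every
  \<open>x\<close>. The exceptional set is independent of \<open>c\<close>, which may thus be chosen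
  depending on \<open>x\<close>.\<close>

lemma increment_le_slope:
  "AE x in lborel. \<forall>c. ennreal (norm (u (x + z) - u x - c)) \<le> (\<integral>\<^sup>+t\<in>{0..1}. ennreal (norm (slope z (x + t *\<^sub>R z) - c)) \<partial>lborel)"
proof -
  define a where "a k = (\<integral>\<^sup>+x. ennreal (norm (dq k z x - slope z x)) \<partial>lborel)" for k
  have a: "a \<longlonglongrightarrow> 0" unfolding a_def by (rule slope_lim)
  have "\<exists>k\<ge>i. a k \<le> ennreal ((1/2) ^ i)" for i :: nat
  proof -
    have "\<forall>\<^sub>F k in sequentially. a k < ennreal ((1/2) ^ i)" using a by (rule order_tendstoD) simp
    then have "\<forall>\<^sub>F k in sequentially. k \<ge> i \<and> a k < ennreal ((1/2) ^ i)"
      using eventually_ge_at_top[of i] by eventually_elim simp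
    then obtain K where "\<forall>k\<ge>K. k \<ge> i \<and> a k < ennreal ((1/2) ^ i)" unfolding eventually_sequentially by blast
    then have "K \<ge> i \<and> a K < ennreal ((1/2) ^ i)" by blast
    then show ?thesis by (intro exI[of _ K]) auto
  qed
  then obtain r where r: "\<And>i. r i \<ge> i" "\<And>i. a (r i) \<le> ennreal ((1/2) ^ i)" by metis
  have rlim: "filterlim r at_top sequentially"
    using r(1) by (intro filterlim_at_top_mono[OF filterlim_ident]) auto
  define A where "A i x = (\<integral>\<^sup>+t. ennreal (norm (dq (r i) z (x + t *\<^sub>R z) - slope z (x + t *\<^sub>R z))) * indicator {0..1} t \<partial>lborel)" for i x
  have Am[measurable]: "A i \<in> borel_measurable lborel" for i unfolding A_def by measurable
  have "(\<integral>\<^sup>+x. A i x \<partial>lborel) \<le> ennreal ((1/2) ^ i)" for i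
  proof -
    have "(\<integral>\<^sup>+x. A i x \<partial>lborel) = (\<integral>\<^sup>+t. (\<integral>\<^sup>+x. ennreal (norm (dq (r i) z (x + t *\<^sub>R z) - slope z (x + t *\<^sub>R z))) * indicator {0..1} t \<partial>lborel) \<partial>lborel)"
      unfolding A_def by (rule lborel_pair.Fubini'[symmetric]) measurable
    also have "\<dots> = (\<integral>\<^sup>+t. a (r i) * indicator {0..1::real} t \<partial>lborel)"
      unfolding a_def using nn_integral_lborel_shift[of "\<lambda>x. ennreal (norm (dq (r i) z x - slope z x))"]
      by (intro nn_integral_cong) (simp add: nn_integral_multc)
    also have "\<dots> = a (r i)" by (simp add: nn_integral_cmult_indicator)
    finally show ?thesis using r(2) by simp
  qed
  from AE_tendsto_zero[OF Am this] show ?thesis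
  proof eventually_elim
    case (elim x)
    show ?case
    proof
      fix c
      define B where "B = (\<integral>\<^sup>+t\<in>{0..1}. ennreal (norm (slope z (x + t *\<^sub>R z) - c)) \<partial>lborel)"
      have "ennreal (norm (u (x + z) - u x - c)) \<le> liminf (\<lambda>i. \<integral>\<^sup>+t\<in>{0..1}. ennreal (norm (dq (r i) z (x + t *\<^sub>R z) - c)) \<partial>lborel)"
        by (rule increment_le_dq[OF rlim])
      also have "\<dots> \<le> liminf (\<lambda>i. A i x + B)"
      proof (intro Liminf_mono always_eventually allI)
        fix i
        have "(\<integral>\<^sup>+t\<in>{0..1}. ennreal (norm (dq (r i) z (x + t *\<^sub>R z) - c)) \<partial>lborel) \<le>
          (\<integral>\<^sup>+t. ennreal (norm (dq (r i) z (x + t *\<^sub>R z) - slope z (x + t *\<^sub>R z))) * indicator {0..1} t +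
             ennreal (norm (slope z (x + t *\<^sub>R z) - c)) * indicator {0..1} t \<partial>lborel)"
        proof (intro nn_integral_mono)
          fix t :: real
          have "norm (dq (r i) z (x + t *\<^sub>R z) - c) \<le> norm (dq (r i) z (x + t *\<^sub>R z) - slope z (x + t *\<^sub>R z)) + norm (slope z (x + t *\<^sub>R z) - c)"
            by (metis dist_norm dist_triangle)
          then show "ennreal (norm (dq (r i) z (x + t *\<^sub>R z) - c)) * indicator {0..1} t \<le>
             ennreal (norm (dq (r i) z (x + t *\<^sub>R z) - slope z (x + t *\<^sub>R z))) * indicator {0..1} t +
             ennreal (norm (slope z (x + t *\<^sub>R z) - c)) * indicator {0..1} t"
            unfolding distrib_right[symmetric]
            by (intro mult_right_mono) (simp_all add: ennreal_plus[symmetric] ennreal_leI del: ennreal_plus)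
        qed
        also have "\<dots> = A i x + B" unfolding A_def B_def by (rule nn_integral_add) measurable
        finally show "(\<integral>\<^sup>+t\<in>{0..1}. ennreal (norm (dq (r i) z (x + t *\<^sub>R z) - c)) \<partial>lborel) \<le> A i x + B" .
      qed
      also have "\<dots> = 0 + B" by (intro lim_imp_Liminf tendsto_add elim tendsto_const) simp
      finally show "ennreal (norm (u (x + z) - u x - c)) \<le> (\<integral>\<^sup>+t\<in>{0..1}. ennreal (norm (slope z (x + t *\<^sub>R z) - c)) \<partial>lborel)"
        by (simp add: B_def)
    qed
  qed
qed

definition oscillation :: "'a \<Rightarrow> 'a \<Rightarrow> ennreal" where
  "oscillation x y = (\<Sum>b\<in>Basis. ennreal (norm (slope b y - slope b x)))"

lemma oscillation_measurable[measurable (raw)]: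
  assumes [measurable]: "f \<in> borel_measurable M" "g \<in> borel_measurable M"
  shows "(\<lambda>x. oscillation (f x) (g x)) \<in> borel_measurable M"
  unfolding oscillation_def by measurable

lemma norm_gradient_diff: "ennreal (norm (gradient y z - gradient x z)) \<le> ennreal (norm z) * oscillation x y"
proof -
  have "gradient y z - gradient x z = (\<Sum>b\<in>Basis. (z \<bullet> b) *\<^sub>R (slope b y - slope b x))"
    by (simp add: gradient_def sum_subtractf scaleR_diff_right)
  then have "norm (gradient y z - gradient x z) \<le> (\<Sum>b\<in>Basis. \<bar>z \<bullet> b\<bar> * norm (slope b y - slope b x))"
    by (auto intro!: order_trans[OF norm_sum])
  also have "\<dots> \<le> (\<Sum>b\<in>Basis. norm z * norm (slope b y - slope b x))"
    by (intro sum_mono mult_right_mono Basis_le_norm) auto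
  finally have "ennreal (norm (gradient y z - gradient x z)) \<le> ennreal (norm z * (\<Sum>b\<in>Basis. norm (slope b y - slope b x)))"
    by (intro ennreal_leI) (simp add: sum_distrib_left)
  then show ?thesis by (simp add: ennreal_mult sum_nonneg oscillation_def)
qed

text \<open>The null set of \<open>increment_le_slope\<close> depends on \<open>z\<close>; joint
  measurability permits the exchange of the two quantifiers, so that one \<open>x\<close> serves
  almost all \<open>z\<close>.\<close>

lemma increment_le_oscillation:
  "AE x in lborel. AE z in lborel. ennreal (norm (u (x + z) - u x - gradient x z)) \<le>
     ennreal (norm z) * (\<integral>\<^sup>+t. oscillation x (x + t *\<^sub>R z) * indicator {0..1} t \<partial>lborel)"
proof (subst lborel_pair.AE_commute)
  have gm[measurable]: "(\<lambda>x::'a \<times> 'a. gradient (fst x) (snd x)) \<in> borel_measurable (lborel \<Otimes>\<^sub>M lborel)"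
    unfolding gradient_def by measurable
  show "{x \<in> space (lborel \<Otimes>\<^sub>M lborel). ennreal (norm (u (fst x + snd x) - u (fst x) - gradient (fst x) (snd x))) \<le>
     ennreal (norm (snd x)) * (\<integral>\<^sup>+t. oscillation (fst x) (fst x + t *\<^sub>R snd x) * indicator {0..1} t \<partial>lborel)} \<in> sets (lborel \<Otimes>\<^sub>M lborel)"
    by measurable
  show "AE z in lborel. AE x in lborel. ennreal (norm (u (x + z) - u x - gradient x z)) \<le>
     ennreal (norm z) * (\<integral>\<^sup>+t. oscillation x (x + t *\<^sub>R z) * indicator {0..1} t \<partial>lborel)"
  proof (rule AE_I2)
    fix z :: 'a
    obtain N where N: "{y. \<not> (slope z y = gradient y z)} \<subseteq> N" "N \<in> null_sets lborel"
      using slope_eq_gradient[of z] by (auto elim: AE_E simp: null_sets_def)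
    show "AE x in lborel. ennreal (norm (u (x + z) - u x - gradient x z)) \<le>
     ennreal (norm z) * (\<integral>\<^sup>+t. oscillation x (x + t *\<^sub>R z) * indicator {0..1} t \<partial>lborel)"
      using increment_le_slope[of z] AE_line_shift[OF N(2), of z]
    proof eventually_elim
      case (elim x)
      have "ennreal (norm (u (x + z) - u x - gradient x z)) \<le> (\<integral>\<^sup>+t\<in>{0..1}. ennreal (norm (slope z (x + t *\<^sub>R z) - gradient x z)) \<partial>lborel)"
        using elim(1) by blast
      also have "\<dots> \<le> (\<integral>\<^sup>+t. ennreal (norm z) * (oscillation x (x + t *\<^sub>R z) * indicator {0..1} t) \<partial>lborel)"
      proof (rule nn_integral_mono_AE)
        show "AE t in lborel. ennreal (norm (slope z (x + t *\<^sub>R z) - gradient x z)) * indicator {0..1} t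
          \<le> ennreal (norm z) * (oscillation x (x + t *\<^sub>R z) * indicator {0..1} t)"
          using elim(2)
        proof eventually_elim
          case (elim t)
          show ?case
          proof (cases "t \<in> {0..1}")
            case True
            then have "slope z (x + t *\<^sub>R z) = gradient (x + t *\<^sub>R z) z" using elim N(1) by blast
            then show ?thesis using True norm_gradient_diff[of "x + t *\<^sub>R z" z x] by simp
          qed simp
        qed
      qed
      also have "\<dots> = ennreal (norm z) * (\<integral>\<^sup>+t. oscillation x (x + t *\<^sub>R z) * indicator {0..1} t \<partial>lborel)"
        by (rule nn_integral_cmult) measurable
      finally show ?case .
    qed
  qed
qed

lemma linear_gradient: "linear (gradient x)"
  by (intro linearI gradient_add gradient_scaleR)

lemma oscillation_average:
  "AE x in lborel. \<forall>\<epsilon>>0. \<exists>\<delta>>0. \<forall>r. 0 < r \<and> r < \<delta> \<longrightarrow>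
    (\<integral>\<^sup>+y\<in>ball x r. oscillation x y \<partial>lborel) \<le> ennreal \<epsilon> * ball_vol TYPE('a) r"
proof -
  have "AE x in lborel. \<forall>b\<in>Basis. \<forall>\<epsilon>>0. \<exists>\<delta>>0. \<forall>r. 0 < r \<and> r < \<delta> \<longrightarrow>
    (\<integral>\<^sup>+y\<in>ball x r. ennreal (norm (slope b y - slope b x)) \<partial>lborel) \<le> ennreal \<epsilon> * ball_vol TYPE('a) r"
  proof (rule AE_finite_allI)
    show "AE x in lborel. \<forall>\<epsilon>>0. \<exists>\<delta>>0. \<forall>r. 0 < r \<and> r < \<delta> \<longrightarrow>
      (\<integral>\<^sup>+y\<in>ball x r. ennreal (norm (slope b y - slope b x)) \<partial>lborel) \<le> ennreal \<epsilon> * ball_vol TYPE('a) r" for b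
      by (rule lebesgue_point[where f="\<lambda>k. dq k b", OF slope_measurable cont_dq slope_lim])
  qed simp
  then show ?thesis
  proof eventually_elim
    case (elim x)
    show ?case
    proof (intro allI impI)
      fix \<epsilon> :: real assume e: "\<epsilon> > 0"
      define \<epsilon>' where "\<epsilon>' = \<epsilon> / DIM('a)"
      have e': "\<epsilon>' > 0" using e by (simp add: \<epsilon>'_def)
      from elim e' have "\<forall>b\<in>Basis. \<exists>\<delta>>0. \<forall>r. 0 < r \<and> r < \<delta> \<longrightarrow>
        (\<integral>\<^sup>+y\<in>ball x r. ennreal (norm (slope b y - slope b x)) \<partial>lborel) \<le> ennreal \<epsilon>' * ball_vol TYPE('a) r" by blast
      then obtain \<delta> where d: "\<And>b. b \<in> Basis \<Longrightarrow> \<delta> b > 0"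
        "\<And>b r. b \<in> Basis \<Longrightarrow> 0 < r \<Longrightarrow> r < \<delta> b \<Longrightarrow> (\<integral>\<^sup>+y\<in>ball x r. ennreal (norm (slope b y - slope b x)) \<partial>lborel) \<le> ennreal \<epsilon>' * ball_vol TYPE('a) r"
        by metis
      define D where "D = Min (\<delta> ` Basis)"
      have D: "D > 0" "\<And>b. b \<in> Basis \<Longrightarrow> D \<le> \<delta> b" using d(1) by (auto simp: D_def)
      have "(\<integral>\<^sup>+y\<in>ball x r. oscillation x y \<partial>lborel) \<le> ennreal \<epsilon> * ball_vol TYPE('a) r" if r: "0 < r" "r < D" for r
      proof -
        have "(\<integral>\<^sup>+y\<in>ball x r. oscillation x y \<partial>lborel) = (\<Sum>b\<in>Basis. \<integral>\<^sup>+y\<in>ball x r. ennreal (norm (slope b y - slope b x)) \<partial>lborel)"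
          unfolding oscillation_def sum_distrib_right by (rule nn_integral_sum) measurable
        also have "\<dots> \<le> (\<Sum>b\<in>(Basis::'a set). ennreal \<epsilon>' * ball_vol TYPE('a) r)"
          using r D(2) by (intro sum_mono d(2)) force+
        also have "\<dots> = ennreal (DIM('a) * \<epsilon>') * ball_vol TYPE('a) r"
          using e' by (simp add: ennreal_mult ennreal_of_nat_eq_real_of_nat mult.assoc)
        also have "DIM('a) * \<epsilon>' = \<epsilon>" by (simp add: \<epsilon>'_def)
        finally show ?thesis .
      qed
      then show "\<exists>\<delta>>0. \<forall>r. 0 < r \<and> r < \<delta> \<longrightarrow> (\<integral>\<^sup>+y\<in>ball x r. oscillation x y \<partial>lborel) \<le> ennreal \<epsilon> * ball_vol TYPE('a) r"
        using D(1) by blast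
    qed
  qed
qed

text \<open>The error \<open>E\<close> is Lipschitz, and at a Lebesgue point of the slopes it is
  small on average over balls. If it exceeded \<open>\<eta> * norm z\<close> at one
  \<open>z\<close>, it would stay above half of that on a ball of comparable radius, against the
  average.\<close>

lemma AE_has_derivative: "AE x in lborel. (u has_derivative gradient x) (at x)"
  using increment_le_oscillation oscillation_average
proof eventually_elim
  case (elim x)
  have bl: "bounded_linear (gradient x)" using linear_gradient linear_conv_bounded_linear by blast
  obtain B where B: "B > 0" "\<And>z. norm (gradient x z) \<le> norm z * B" using bounded_linear.pos_bounded[OF bl] by blast
  define E where "E z = u (x + z) - u x - gradient x z" for z
  define C' where "C' = C + B"
  have C': "C' > 0" using C0 B by (simp add: C'_def)
  have Elip: "norm (E z - E w) \<le> C' * norm (z - w)" for z w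
  proof -
    have "E z - E w = (u (x + z) - u (x + w)) - gradient x (z - w)"
      using linear_diff[OF linear_gradient, of x z w] by (simp add: E_def)
    then have "norm (E z - E w) \<le> norm (u (x + z) - u (x + w)) + norm (gradient x (z - w))"
      by (simp add: norm_triangle_ineq4)
    also have "\<dots> \<le> C * norm ((x + z) - (x + w)) + norm (z - w) * B" by (intro add_mono u_dist B)
    finally show ?thesis by (simp add: C'_def algebra_simps)
  qed
  have Em[measurable]: "E \<in> borel_measurable borel"
    unfolding E_def gradient_def by measurable
  have avg: "(\<integral>\<^sup>+z\<in>ball 0 r. ennreal (norm (E z)) \<partial>lborel) \<le> ennreal (r * \<epsilon>) * ball_vol TYPE('a) r"
    if r: "r > 0" and e: "\<epsilon> > 0" and osc: "\<And>\<rho>. 0 < \<rho> \<Longrightarrow> \<rho> \<le> r \<Longrightarrow> (\<integral>\<^sup>+y\<in>ball x \<rho>. oscillation x y \<partial>lborel) \<le> ennreal \<epsilon> * ball_vol TYPE('a) \<rho>" for r \<epsilon>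
  proof -
    have "(\<integral>\<^sup>+z\<in>ball 0 r. ennreal (norm (E z)) \<partial>lborel) \<le>
      (\<integral>\<^sup>+z. ennreal r * ((\<integral>\<^sup>+t. oscillation x (x + t *\<^sub>R z) * indicator {0..1} t \<partial>lborel) * indicator (ball 0 r) z) \<partial>lborel)"
    proof (rule nn_integral_mono_AE)
      show "AE z in lborel. ennreal (norm (E z)) * indicator (ball 0 r) z \<le>
        ennreal r * ((\<integral>\<^sup>+t. oscillation x (x + t *\<^sub>R z) * indicator {0..1} t \<partial>lborel) * indicator (ball 0 r) z)"
        using elim(1)
      proof eventually_elim
        case (elim z)
        show ?case
        proof (cases "z \<in> ball 0 r")
          case True
          have "ennreal (norm (E z)) \<le> ennreal (norm z) * (\<integral>\<^sup>+t. oscillation x (x + t *\<^sub>R z) * indicator {0..1} t \<partial>lborel)"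
            using elim by (simp add: E_def)
          also have "\<dots> \<le> ennreal r * (\<integral>\<^sup>+t. oscillation x (x + t *\<^sub>R z) * indicator {0..1} t \<partial>lborel)"
            using True by (intro mult_right_mono ennreal_leI) auto
          finally show ?thesis using True by simp
        qed simp
      qed
    qed
    also have "\<dots> = ennreal r * (\<integral>\<^sup>+z\<in>ball 0 r. (\<integral>\<^sup>+t. oscillation x (x + t *\<^sub>R z) * indicator {0..1} t \<partial>lborel) \<partial>lborel)"
      by (rule nn_integral_cmult) measurable
    also have "\<dots> \<le> ennreal r * (ennreal \<epsilon> * ball_vol TYPE('a) r)"
    proof (rule mult_left_mono)
      have om: "oscillation x \<in> borel_measurable borel" by measurable
      show "(\<integral>\<^sup>+z\<in>ball 0 r. (\<integral>\<^sup>+t. oscillation x (x + t *\<^sub>R z) * indicator {0..1} t \<partial>lborel) \<partial>lborel) \<le> ennreal \<epsilon> * ball_vol TYPE('a) r"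
        by (rule line_average_le_maximal[OF om osc r])
    qed simp
    also have "\<dots> = ennreal (r * \<epsilon>) * ball_vol TYPE('a) r" using r e by (simp add: ennreal_mult mult.assoc)
    finally show ?thesis .
  qed
  show ?case
    unfolding has_derivative_at_alt
  proof (intro conjI bl allI impI)
    fix \<eta>0 :: real assume \<eta>0: "\<eta>0 > 0"
    \<comment> \<open>Capping by \<open>C'\<close> keeps the radius \<open>s\<close> below at most
      \<open>norm z\<close>.\<close>
    define \<eta> where "\<eta> = min \<eta>0 C'"
    have \<eta>: "\<eta> > 0" "\<eta> \<le> \<eta>0" "\<eta> \<le> C'" using \<eta>0 C' by (auto simp: \<eta>_def)
    \<comment> \<open>Volume ratio of the ball of radius \<open>s\<close> where \<open>E\<close> is
      large to the ball of radius \<open>2 * \<rho>\<close> containing it. With the choice of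
      \<epsilon> below the two sides of the final comparison are off by a factor 2.\<close>
    define q where "q = (\<eta> / (4 * C')) ^ DIM('a)"
    have q: "q > 0" using \<eta> C' by (simp add: q_def)
    define \<epsilon> where "\<epsilon> = \<eta> * q / 8"
    have e: "\<epsilon> > 0" using \<eta> q by (simp add: \<epsilon>_def)
    obtain \<delta> where d: "\<delta> > 0" "\<And>r. 0 < r \<Longrightarrow> r < \<delta> \<Longrightarrow> (\<integral>\<^sup>+y\<in>ball x r. oscillation x y \<partial>lborel) \<le> ennreal \<epsilon> * ball_vol TYPE('a) r"
      using elim(2) e by blast
    have main: "norm (E z) \<le> \<eta> * norm z" if z: "norm z < \<delta> / 2" for z
    proof (rule ccontr)
      assume neg: "\<not> norm (E z) \<le> \<eta> * norm z"
      have z0: "z \<noteq> 0" using neg linear_0[OF linear_gradient] by (auto simp: E_def)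
      define \<rho> where "\<rho> = norm z"
      have \<rho>: "\<rho> > 0" using z0 by (simp add: \<rho>_def)
      define s where "s = \<eta> * \<rho> / (2 * C')"
      have s: "s > 0" "s \<le> \<rho>" using \<eta> C' \<rho> mult_right_mono[OF \<eta>(3), of \<rho>] by (auto simp: s_def field_simps)
      have sub: "w \<in> ball 0 (2 * \<rho>) \<and> \<eta> * \<rho> / 2 \<le> norm (E w)" if w: "w \<in> ball z s" for w
      proof
        have nw: "norm (z - w) < s" using w by (simp add: dist_norm)
        then show "w \<in> ball 0 (2 * \<rho>)" using s norm_triangle_ineq2[of w z] by (simp add: \<rho>_def norm_minus_commute)
        have "norm (E z) - norm (E w) \<le> C' * norm (z - w)" using Elip[of z w] norm_triangle_ineq2[of "E z" "E w"] by linarith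
        also have "\<dots> \<le> C' * s" using nw C' by (intro mult_left_mono) auto
        also have "C' * s = \<eta> * \<rho> / 2" using C' by (simp add: s_def)
        finally show "\<eta> * \<rho> / 2 \<le> norm (E w)" using neg by (simp add: \<rho>_def)
      qed
      have "ennreal (\<eta> * \<rho> / 2) * ball_vol TYPE('a) s = (\<integral>\<^sup>+w. ennreal (\<eta> * \<rho> / 2) * indicator (ball z s) w \<partial>lborel)"
        using s by (simp add: nn_integral_cmult_indicator emeasure_ball_vol)
      also have "\<dots> \<le> (\<integral>\<^sup>+w\<in>ball 0 (2 * \<rho>). ennreal (norm (E w)) \<partial>lborel)"
        using sub by (intro nn_integral_mono) (auto simp: indicator_def intro!: ennreal_leI)
      also have "\<dots> \<le> ennreal (2 * \<rho> * \<epsilon>) * ball_vol TYPE('a) (2 * \<rho>)"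
        using \<rho> z e by (intro avg d(2)) (auto simp: \<rho>_def)
      finally have fin: "ennreal (\<eta> * \<rho> / 2) * ball_vol TYPE('a) s \<le> ennreal (2 * \<rho> * \<epsilon>) * ball_vol TYPE('a) (2 * \<rho>)" .
      have seq: "s = \<eta> / (4 * C') * (2 * \<rho>)" by (simp add: s_def)
      have bs: "ball_vol TYPE('a) s = ennreal q * ball_vol TYPE('a) (2 * \<rho>)"
        unfolding seq q_def using \<eta> C' by (intro ball_vol_scale) simp
      have "ennreal (\<eta> * \<rho> / 2 * q) = ennreal (\<eta> * \<rho> / 2) * ennreal q"
        using \<eta> \<rho> q by (intro ennreal_mult) auto
      then have "ennreal (\<eta> * \<rho> / 2 * q) * ball_vol TYPE('a) (2 * \<rho>) \<le> ennreal (2 * \<rho> * \<epsilon>) * ball_vol TYPE('a) (2 * \<rho>)"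
        using fin unfolding bs by (simp only: mult.assoc)
      then have "ennreal (\<eta> * \<rho> / 2 * q) \<le> ennreal (2 * \<rho> * \<epsilon>)"
        using ball_vol_pos[of "2 * \<rho>", where 'a='a] ball_vol_finite[of "2 * \<rho>", where 'a='a] \<rho>
        by (metis ennreal_mult_strict_right_mono infinity_ennreal_def leD leI mult_pos_pos zero_less_numeral)
      then have "\<eta> * \<rho> / 2 * q \<le> 2 * \<rho> * \<epsilon>" using \<rho> e by (simp add: ennreal_le_iff)
      then show False using \<rho> \<eta> q by (simp add: \<epsilon>_def)
    qed
    show "\<exists>d>0. \<forall>y. norm (y - x) < d \<longrightarrow> norm (u y - u x - gradient x (y - x)) \<le> \<eta>0 * norm (y - x)"
    proof (intro exI[of _ "\<delta> / 2"] conjI allI impI)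
      fix y assume "norm (y - x) < \<delta> / 2"
      from main[OF this] have "norm (u y - u x - gradient x (y - x)) \<le> \<eta> * norm (y - x)" by (simp add: E_def)
      also have "\<dots> \<le> \<eta>0 * norm (y - x)" using \<eta> by (intro mult_right_mono) auto
      finally show "norm (u y - u x - gradient x (y - x)) \<le> \<eta>0 * norm (y - x)" .
    qed (use d in simp)
  qed
qed

end

text \<open>Differentiability is local, so \<open>u\<close> is multiplied by a Lipschitz cutoff that
  equals 1 on the ball of radius \<open>n\<close>; the product is Lipschitz because \<open>u\<close>
  is bounded where the cutoff lives.\<close>

theorem rademacher:
  fixes u :: "'a::euclidean_space \<Rightarrow> 'h::{real_inner,polish_space}"
  assumes lip: "C-lipschitz_on UNIV u"
  shows "AE x in lborel. \<exists>L. (u has_derivative L) (at x)"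
proof -
  have C0: "C \<ge> 0" using lip by (rule lipschitz_on_nonneg)
  have "AE x in lborel. norm x < real n \<longrightarrow> (\<exists>L. (u has_derivative L) (at x))" for n :: nat
  proof -
    define cut :: "'a \<Rightarrow> real" where "cut x = max 0 (min 1 (real n + 1 - norm x))" for x
    have chi: "0 \<le> cut x" "cut x \<le> 1" "\<bar>cut x - cut y\<bar> \<le> norm (x - y)" for x y
      using norm_triangle_ineq3[of x y] by (auto simp: cut_def)
    have chi0: "cut x = 0" if "norm x \<ge> real n + 1" for x using that by (simp add: cut_def)
    define M where "M = norm (u 0) + C * (real n + 1)"
    have M: "norm (u x) \<le> M" if "norm x \<le> real n + 1" for x
    proof -
      have "norm (u x - u 0) \<le> C * norm x" using lipschitz_onD[OF lip, of x 0] by (simp add: dist_norm)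
      also have "\<dots> \<le> C * (real n + 1)" using that C0 by (intro mult_left_mono) auto
      finally show ?thesis using norm_triangle_ineq2[of "u x" "u 0"] by (simp add: M_def)
    qed
    have M0: "M \<ge> 0" using C0 by (simp add: M_def)
    define v where "v x = cut x *\<^sub>R u x" for x
    have one: "norm (v x - v y) \<le> (C + M) * norm (x - y)" if "norm x \<le> real n + 1" for x y
    proof -
      have "v x - v y = (cut x - cut y) *\<^sub>R u x + cut y *\<^sub>R (u x - u y)" by (simp add: v_def algebra_simps)
      then have "norm (v x - v y) \<le> \<bar>cut x - cut y\<bar> * norm (u x) + cut y * norm (u x - u y)"
        using chi(1)[of y] norm_triangle_ineq[of "(cut x - cut y) *\<^sub>R u x" "cut y *\<^sub>R (u x - u y)"] by simp
      also have "\<dots> \<le> norm (x - y) * M + 1 * (C * norm (x - y))"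
        using chi M[OF that] lipschitz_onD[OF lip, of x y] by (intro add_mono mult_mono) (auto simp: dist_norm)
      finally show ?thesis by (simp add: algebra_simps)
    qed
    interpret compact_lipschitz v "C + M" "real n + 1"
    proof
      show "(C + M)-lipschitz_on UNIV v"
      proof (rule lipschitz_onI)
        fix x y :: 'a
        consider "norm x \<le> real n + 1" | "norm y \<le> real n + 1" | "norm x \<ge> real n + 1" "norm y \<ge> real n + 1" by linarith
        then show "dist (v x) (v y) \<le> (C + M) * dist x y"
        proof cases
          case 1
          then show ?thesis using one[of x y] by (simp add: dist_norm)
        next
          case 2
          then show ?thesis using one[of y x] by (simp add: dist_norm norm_minus_commute)
        next
          case 3
          then show ?thesis using chi0 C0 M0 by (simp add: v_def)
        qed
      qed (use C0 M0 in simp)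
    qed (auto simp: v_def chi0)
    show ?thesis using AE_has_derivative
    proof eventually_elim
      case (elim x)
      show ?case
      proof
        assume x: "norm x < real n"
        have "(u has_derivative gradient x) (at x)"
        proof (rule has_derivative_transform_within_open[OF elim])
          show "open (ball (0::'a) (real n))" "x \<in> ball 0 (real n)" using x by auto
          show "v y = u y" if "y \<in> ball 0 (real n)" for y using that by (simp add: v_def cut_def)
        qed
        then show "\<exists>L. (u has_derivative L) (at x)" by blast
      qed
    qed
  qed
  then have "AE x in lborel. \<forall>n::nat. norm x < real n \<longrightarrow> (\<exists>L. (u has_derivative L) (at x))"
    unfolding AE_all_countable by blast
  then show ?thesis by eventually_elim (meson reals_Archimedean2)
qed

section \<open>Density points\<close>

lemma measure_cball_pos: "r > 0 \<Longrightarrow> measure lebesgue (cball (a::'a::euclidean_space) r) > 0"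
  by (simp add: content_cball_pos)

lemma density_zero_iff:
  fixes a :: "'a::euclidean_space"
  shows "density_zero S a \<longleftrightarrow>
    (\<forall>e>0. \<exists>\<delta>>0. \<forall>r. 0 < r \<and> r < \<delta> \<longrightarrow> measure lebesgue (S \<inter> cball a r) \<le> e * measure lebesgue (cball a r))"
proof -
  have pos: "measure lebesgue (cball a r) > 0" if "r > 0" for r using measure_cball_pos[OF that] .
  show ?thesis
  proof
    assume "density_zero S a"
    then have L: "((\<lambda>r. measure lebesgue (S \<inter> cball a r) / measure lebesgue (cball a r)) \<longlongrightarrow> 0) (at_right 0)"
      by (simp add: density_zero_def)
    show "\<forall>e>0. \<exists>\<delta>>0. \<forall>r. 0 < r \<and> r < \<delta> \<longrightarrow> measure lebesgue (S \<inter> cball a r) \<le> e * measure lebesgue (cball a r)"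
    proof (intro allI impI)
      fix e :: real assume "e > 0"
      then have "\<forall>\<^sub>F r in at_right 0. measure lebesgue (S \<inter> cball a r) / measure lebesgue (cball a r) < e"
        using order_tendstoD(2)[OF L] by blast
      then obtain b where b: "b > 0" "\<And>r. 0 < r \<Longrightarrow> r < b \<Longrightarrow> measure lebesgue (S \<inter> cball a r) / measure lebesgue (cball a r) < e"
        unfolding eventually_at_right_field by auto
      then show "\<exists>\<delta>>0. \<forall>r. 0 < r \<and> r < \<delta> \<longrightarrow> measure lebesgue (S \<inter> cball a r) \<le> e * measure lebesgue (cball a r)"
        using pos by (intro exI[of _ b]) (auto simp: divide_less_eq less_imp_le)
    qed
  next
    assume R: "\<forall>e>0. \<exists>\<delta>>0. \<forall>r. 0 < r \<and> r < \<delta> \<longrightarrow> measure lebesgue (S \<inter> cball a r) \<le> e * measure lebesgue (cball a r)"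
    have "((\<lambda>r. measure lebesgue (S \<inter> cball a r) / measure lebesgue (cball a r)) \<longlongrightarrow> 0) (at_right 0)"
    proof (rule tendstoI)
      fix e :: real assume "e > 0"
      then obtain \<delta> where d: "\<delta> > 0" "\<And>r. 0 < r \<Longrightarrow> r < \<delta> \<Longrightarrow> measure lebesgue (S \<inter> cball a r) \<le> e / 2 * measure lebesgue (cball a r)"
        using R half_gt_zero by metis
      have "dist (measure lebesgue (S \<inter> cball a r) / measure lebesgue (cball a r)) 0 < e" if "0 < r" "r < \<delta>" for r
      proof -
        have "measure lebesgue (S \<inter> cball a r) / measure lebesgue (cball a r) \<le> e / 2"
          using d(2)[OF that] pos[OF that(1)] by (simp add: divide_le_eq)
        moreover have "0 \<le> measure lebesgue (S \<inter> cball a r) / measure lebesgue (cball a r)" by simp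
        ultimately show ?thesis using \<open>e > 0\<close> unfolding dist_real_def by linarith
      qed
      then show "\<forall>\<^sub>F r in at_right 0. dist (measure lebesgue (S \<inter> cball a r) / measure lebesgue (cball a r)) 0 < e"
        unfolding eventually_at_right_field using d(1) by (intro exI[of _ \<delta>]) auto
    qed
    then show "density_zero S a" by (simp add: density_zero_def)
  qed
qed

lemma density_zero_subset:
  fixes a :: "'a::euclidean_space"
  assumes T: "density_zero T a" "T \<in> sets lebesgue" and d: "d > 0" and sub: "S \<inter> cball a d \<subseteq> T"
  shows "density_zero S a"
  unfolding density_zero_iff
proof (intro allI impI)
  fix e :: real assume "e > 0"
  then obtain \<delta> where \<delta>: "\<delta> > 0" "\<And>r. 0 < r \<Longrightarrow> r < \<delta> \<Longrightarrow> measure lebesgue (T \<inter> cball a r) \<le> e * measure lebesgue (cball a r)"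
    using T(1) unfolding density_zero_iff by blast
  have le: "measure lebesgue (S \<inter> cball a r) \<le> measure lebesgue (T \<inter> cball a r)" if "r < d" for r
  \<comment> \<open>A non-measurable intersection has \<open>measure\<close> 0 by convention, which
    makes the bound trivial.\<close>
  proof (cases "S \<inter> cball a r \<in> sets lebesgue")
    case True
    have "cball a r \<subseteq> cball a d" using that by auto
    moreover have "cball a r \<inter> T \<in> lmeasurable" by (rule fmeasurable_Int_fmeasurable[OF lmeasurable_cball T(2)])
    ultimately show ?thesis using sub True
      by (intro measure_mono_fmeasurable) (auto simp: Int_commute)
  qed (simp add: measure_notin_sets)
  show "\<exists>\<delta>>0. \<forall>r. 0 < r \<and> r < \<delta> \<longrightarrow> measure lebesgue (S \<inter> cball a r) \<le> e * measure lebesgue (cball a r)"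
    using \<delta> d le by (intro exI[of _ "min \<delta> d"]) (auto intro: order_trans)
qed

lemma density_zero_Un:
  fixes a :: "'a::euclidean_space"
  assumes S: "density_zero S a" "S \<in> sets lebesgue" and T: "density_zero T a" "T \<in> sets lebesgue"
  shows "density_zero (S \<union> T) a"
  unfolding density_zero_iff
proof (intro allI impI)
  fix e :: real assume "e > 0"
  then have e2: "e / 2 > 0" by simp
  obtain \<delta> where \<delta>: "\<delta> > 0" "\<And>r. 0 < r \<Longrightarrow> r < \<delta> \<Longrightarrow> measure lebesgue (S \<inter> cball a r) \<le> e / 2 * measure lebesgue (cball a r)"
    using S(1) e2 unfolding density_zero_iff by blast
  obtain \<delta>' where \<delta>': "\<delta>' > 0" "\<And>r. 0 < r \<Longrightarrow> r < \<delta>' \<Longrightarrow> measure lebesgue (T \<inter> cball a r) \<le> e / 2 * measure lebesgue (cball a r)"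
    using T(1) e2 unfolding density_zero_iff by blast
  have "measure lebesgue ((S \<union> T) \<inter> cball a r) \<le> e * measure lebesgue (cball a r)" if "0 < r" "r < min \<delta> \<delta>'" for r
  proof -
    have "measure lebesgue ((S \<union> T) \<inter> cball a r) \<le> measure lebesgue (S \<inter> cball a r) + measure lebesgue (T \<inter> cball a r)"
      unfolding Int_Un_distrib2 using S T by (intro measure_Un_le) auto
    also have "\<dots> \<le> e / 2 * measure lebesgue (cball a r) + e / 2 * measure lebesgue (cball a r)"
      using that by (intro add_mono \<delta>(2) \<delta>'(2)) auto
    finally show ?thesis by simp
  qed
  then show "\<exists>\<delta>>0. \<forall>r. 0 < r \<and> r < \<delta> \<longrightarrow> measure lebesgue ((S \<union> T) \<inter> cball a r) \<le> e * measure lebesgue (cball a r)"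
    using \<delta>(1) \<delta>'(1) by (intro exI[of _ "min \<delta> \<delta>'"]) auto
qed

text \<open>A ball of radius \<open>d * dist x a\<close> about \<open>x\<close> fills the fraction
  \<open>(d / (1 + d)) ^ DIM('a)\<close> of the ball of radius \<open>(1 + d) * dist x a\<close>
  about \<open>a\<close>, too much for a set of density zero. In this way information on a set of
  full density reaches all nearby points.\<close>

lemma density_zero_escape:
  fixes a :: "'a::euclidean_space"
  assumes N: "density_zero N a" "N \<in> sets lebesgue" and d: "d > 0"
  obtains r0 where "r0 > 0" "\<And>x. 0 < dist x a \<Longrightarrow> dist x a < r0 \<Longrightarrow> \<exists>y. y \<notin> N \<and> dist y x < d * dist x a"
proof -
  define e where "e = (d / (1 + d)) ^ DIM('a) / 2"
  have e: "e > 0" using d by (simp add: e_def)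
  obtain \<delta> where \<delta>: "\<delta> > 0" "\<And>r. 0 < r \<Longrightarrow> r < \<delta> \<Longrightarrow> measure lebesgue (N \<inter> cball a r) \<le> e * measure lebesgue (cball a r)"
    using N(1) e unfolding density_zero_iff by blast
  have "\<exists>y. y \<notin> N \<and> dist y x < d * dist x a" if x: "0 < dist x a" "dist x a < \<delta> / (1 + d)" for x
  proof (rule ccontr)
    assume "\<not> (\<exists>y. y \<notin> N \<and> dist y x < d * dist x a)"
    then have sub: "ball x (d * dist x a) \<subseteq> N" by (auto simp: dist_commute)
    define R where "R = (1 + d) * dist x a"
    have R: "0 < R" "R < \<delta>"
      using x d by (simp_all add: R_def add_pos_pos pos_less_divide_eq mult.commute)
    have "ball x (d * dist x a) \<subseteq> cball a R"
    proof
      fix y assume "y \<in> ball x (d * dist x a)"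
      then show "y \<in> cball a R" using dist_triangle[of a y x] by (simp add: R_def dist_commute algebra_simps)
    qed
    moreover have "cball a R \<inter> N \<in> lmeasurable" by (rule fmeasurable_Int_fmeasurable[OF lmeasurable_cball N(2)])
    ultimately have "measure lebesgue (ball x (d * dist x a)) \<le> measure lebesgue (N \<inter> cball a R)"
      using sub by (intro measure_mono_fmeasurable) (auto simp: Int_commute)
    also have "\<dots> \<le> e * measure lebesgue (cball a R)" by (rule \<delta>(2)[OF R])
    finally have "(d * dist x a) ^ DIM('a) \<le> e * R ^ DIM('a)"
      using d x R by (simp add: content_ball content_cball field_simps mult_le_cancel_left)
    also have "e * R ^ DIM('a) = (d * dist x a) ^ DIM('a) / 2"
      using d by (simp add: e_def R_def power_divide power_mult_distrib)
    finally have "(d * dist x a) ^ DIM('a) \<le> (d * dist x a) ^ DIM('a) / 2" .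
    moreover have "(d * dist x a) ^ DIM('a) > 0" using d x by (intro zero_less_power mult_pos_pos)
    ultimately show False by linarith
  qed
  then show ?thesis using \<delta>(1) d by (intro that[of "\<delta> / (1 + d)"]) auto
qed

text \<open>Near a point of \<open>P\<close> the open set \<open>T k\<close> contains whole balls,
  so the missing part lies in \<open>T k - P\<close>. Its indicator has small integral, hence by the
  weak type inequality a small maximal function off a small set.\<close>

lemma AE_density_point:
  fixes P :: "'a::euclidean_space set"
  assumes P[measurable]: "P \<in> sets borel"
  shows "AE x in lborel. x \<in> P \<longrightarrow> density_zero (- P) x"
proof -
  have "\<exists>T. open T \<and> P \<subseteq> T \<and> emeasure lborel (T - P) < ennreal (1 / Suc k)" for k :: nat
  proof -
    obtain T where "open T" "P \<subseteq> T" "emeasure lborel (T - P) < ennreal (1 / Suc k)"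
      using outer_regular_lborel[OF P, of "1 / Suc k"] by auto
    then show ?thesis by blast
  qed
  then obtain T where T: "\<And>k. open (T k)" "\<And>k. P \<subseteq> T k" "\<And>k::nat. emeasure lborel (T k - P) < ennreal (1 / Suc k)" by metis
  define w :: "nat \<Rightarrow> 'a \<Rightarrow> ennreal" where "w k = indicator (T k - P)" for k
  have [measurable]: "T k \<in> sets borel" for k using T(1) by auto
  have [measurable]: "w k \<in> borel_measurable borel" for k unfolding w_def by measurable
  have null: "AE x in lborel. \<exists>k. maximal (w k) x \<le> ennreal s" if s: "s > 0" for s
  proof -
    define B where "B = {x. \<forall>k. \<not> (maximal (w k) x \<le> ennreal s)}"
    have [measurable]: "B \<in> sets borel" unfolding B_def by measurable
    have "ennreal s * emeasure lborel B \<le> 5 ^ DIM('a) * ennreal (1 / Suc k)" for k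
    proof -
      have "ennreal s * emeasure lborel B \<le> ennreal s * emeasure lborel {x. ennreal s < maximal (w k) x}"
        by (intro mult_left_mono emeasure_mono) (auto simp: B_def not_le)
      also have "\<dots> \<le> 5 ^ DIM('a) * (\<integral>\<^sup>+x. w k x \<partial>lborel)"
        by (rule maximal_weak_type) measurable
      also have "\<dots> \<le> 5 ^ DIM('a) * ennreal (1 / Suc k)"
        using T(3)[of k] by (intro mult_left_mono) (auto simp: w_def)
      finally show ?thesis .
    qed
    moreover have "(\<lambda>k. 5 ^ DIM('a) * ennreal (1 / Suc k)) \<longlonglongrightarrow> 5 ^ DIM('a) * ennreal 0"
      by (intro ennreal_tendsto_cmult tendsto_ennrealI) (simp add: less_top[symmetric] power_eq_top_ennreal, real_asymp)
    ultimately have "ennreal s * emeasure lborel B \<le> 5 ^ DIM('a) * ennreal 0" by (intro LIMSEQ_le_const) auto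
    then have "emeasure lborel B = 0" using s by simp
    then have "B \<in> null_sets lborel" by (simp add: null_sets_def)
    then have "AE x in lborel. x \<notin> B" by (rule AE_not_in)
    then show ?thesis by (simp add: B_def)
  qed
  have "AE x in lborel. \<forall>n::nat. \<exists>k. maximal (w k) x \<le> ennreal (1 / Suc n)"
    unfolding AE_all_countable by (intro allI null) simp
  then show ?thesis
  proof eventually_elim
    case (elim x)
    show ?case
      unfolding density_zero_iff
    proof (intro impI allI)
      fix e :: real assume x: "x \<in> P" and e: "e > 0"
      \<comment> \<open>The factor pays for the passage from \<open>cball x r\<close> to
        \<open>ball x (2 * r)\<close>.\<close>
      define e' where "e' = e / 2 ^ DIM('a)"
      have e': "e' > 0" using e by (simp add: e'_def)
      obtain n where n: "1 / real (Suc n) < e'" using e' nat_approx_posE by blast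
      obtain k where k: "maximal (w k) x \<le> ennreal (1 / Suc n)" using elim by blast
      obtain \<delta> where d: "\<delta> > 0" "ball x \<delta> \<subseteq> T k" using T(1,2) x by (meson openE subsetD)
      have "measure lebesgue (- P \<inter> cball x r) \<le> e * measure lebesgue (cball x r)" if r: "0 < r" "r < min (\<delta> / 2) 1" for r
      proof -
        have "emeasure lborel (- P \<inter> cball x r) \<le> (\<integral>\<^sup>+y\<in>ball x (2 * r). w k y \<partial>lborel)"
        proof -
          have "- P \<inter> cball x r \<subseteq> (T k - P) \<inter> ball x (2 * r)" using r d by (auto simp: subset_iff)
          then have "emeasure lborel (- P \<inter> cball x r) \<le> emeasure lborel ((T k - P) \<inter> ball x (2 * r))" by (intro emeasure_mono) auto
          then show ?thesis by (simp add: w_def indicator_inter_arith[symmetric])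
        qed
        also have "\<dots> \<le> maximal (w k) x * ball_vol TYPE('a) (2 * r)" using r by (intro ball_integral_le_maximal) auto
        also have "\<dots> \<le> ennreal e' * ball_vol TYPE('a) (2 * r)"
          using n by (intro mult_right_mono order_trans[OF k] ennreal_leI) auto
        also have "\<dots> = ennreal (e * measure lebesgue (cball x r))"
          using r e by (simp add: ball_vol_def content_cball e'_def power_mult_distrib ennreal_mult[symmetric])
        finally have "emeasure lborel (- P \<inter> cball x r) \<le> ennreal (e * measure lebesgue (cball x r))" .
        then have "measure lborel (- P \<inter> cball x r) \<le> e * measure lebesgue (cball x r)"
          using e by (simp add: measure_def enn2real_leI)
        moreover have "- P \<inter> cball x r \<in> sets lborel" by simp
        ultimately show ?thesis by (simp add: measure_completion)
      qed
      then show "\<exists>\<delta>>0. \<forall>r. 0 < r \<and> r < \<delta> \<longrightarrow> measure lebesgue (- P \<inter> cball x r) \<le> e * measure lebesgue (cball x r)"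
        using d(1) by (intro exI[of _ "min (\<delta> / 2) 1"]) auto
    qed
  qed
qed

section \<open>Approximate derivatives\<close>

lemma borel_map_on_total:
  fixes f :: "'a::topological_space \<Rightarrow> 'b::topological_space"
  assumes "borel_map_on U f" "U \<in> sets borel"
  shows "(\<lambda>x. if x \<in> U then f x else c) \<in> borel_measurable borel"
  using assms measurable_restrict_space_iff[of U borel c borel f] unfolding borel_map_on_def by simp

lemma affine_map_continuous:
  fixes A :: "'a::euclidean_space \<Rightarrow> 'h::real_normed_vector"
  assumes "affine_map A" shows "continuous_on S A"
proof -
  have "linear (\<lambda>x. A x - A 0)" using assms by (simp add: affine_map_def)
  then have "bounded_linear (\<lambda>x. A x - A 0)" by (simp add: linear_conv_bounded_linear)
  then have "continuous_on S (\<lambda>x. A x - A 0)" by (rule bounded_linear.continuous_on[OF _ continuous_on_id])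
  then have "continuous_on S (\<lambda>x. (A x - A 0) + A 0)" by (rule continuous_on_add[OF _ continuous_on_const])
  then show ?thesis by (simp only: diff_add_cancel)
qed

lemma affine_map_diff:
  assumes "affine_map A" shows "A x - A a = A (x - a) - A 0"
proof -
  have lin: "linear (\<lambda>x. A x - A 0)" using assms by (simp add: affine_map_def)
  show ?thesis using linear_diff[OF lin, of x a] by simp
qed

lemma approx_affine_exceptional_set:
  fixes f :: "real ^ 'm \<Rightarrow> ('h::{real_inner,polish_space}, 'q::finite) utuple"
  assumes f: "borel_map_on U f" and U: "open U" and A: "\<And>i. affine_map (A $ i)"
  shows "{x \<in> U. dist (f x) (unordered (\<chi> i. (A $ i) x)) > e * norm (x - a)} \<in> sets borel"
proof -
  define g where "g x = (if x \<in> U then f x else undefined)" for x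
  have [measurable]: "U \<in> sets borel" using U by simp
  have [measurable]: "g \<in> borel_measurable borel" unfolding g_def using f by (rule borel_map_on_total) simp
  have "continuous_on UNIV (\<lambda>x. unordered (\<chi> i. (A $ i) x))"
    by (intro continuous_on_compose2[OF continuous_unordered[of UNIV]] continuous_on_vec_lambda affine_map_continuous A) auto
  then have [measurable]: "(\<lambda>x. unordered (\<chi> i. (A $ i) x)) \<in> borel_measurable borel"
    by (rule borel_measurable_continuous_onI)
  have "{x \<in> U. dist (g x) (unordered (\<chi> i. (A $ i) x)) > e * norm (x - a)} \<in> sets borel" by measurable
  moreover have "{x \<in> U. dist (g x) (unordered (\<chi> i. (A $ i) x)) > e * norm (x - a)} =
    {x \<in> U. dist (f x) (unordered (\<chi> i. (A $ i) x)) > e * norm (x - a)}" by (auto simp: g_def)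
  ultimately show ?thesis by simp
qed

text \<open>Proper subspaces are Lebesgue null. The lemma will select one permutation that works for
  all directions at once.\<close>

lemma finite_union_proper_subspaces:
  fixes V :: "'i \<Rightarrow> ('a::euclidean_space) set"
  assumes "finite I" "\<And>i. i \<in> I \<Longrightarrow> subspace (V i)" "(\<Union>i\<in>I. V i) = UNIV"
  shows "\<exists>i\<in>I. V i = UNIV"
proof (rule ccontr)
  assume neg: "\<not> (\<exists>i\<in>I. V i = UNIV)"
  have "negligible (V i)" if "i \<in> I" for i
  proof (rule negligible_lowdim)
    have "dim (V i) \<noteq> DIM('a)"
      using neg that assms(2)[OF that] by (metis dim_eq_full span_eq_iff)
    then show "dim (V i) < DIM('a)" using dim_subset_UNIV[of "V i"] by linarith
  qed
  then have "negligible (\<Union>i\<in>I. V i)" using assms(1) by (intro negligible_Union) auto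
  then show False using assms(3) non_negligible_UNIV by simp
qed

text \<open>In each direction \<open>v\<close> there are points near
  \<open>a + r *\<^sub>R v\<close>, off both exceptional sets, with \<open>r\<close> tending to 0.
  The matching of the two affine tuples at these points takes one value \<tau> infinitely often, and
  in the limit the values at \<open>a\<close> and the linear parts at \<open>v\<close> agree up to
  \<tau>. So finitely many subspaces \<open>V \<sigma>\<close> cover the space, and one of them is
  everything.\<close>

lemma approx_affine_at_unique:
  fixes f :: "real ^ 'm \<Rightarrow> ('h::{real_inner,polish_space}, 'q::finite) utuple"
  assumes f: "borel_map_on U f" and U: "open U" "a \<in> U"
    and A: "approx_affine_at U f a A" and B: "approx_affine_at U f a B"
  shows "unordered (\<chi> i. (\<lambda>x. (A $ i) x - (A $ i) 0)) = unordered (\<chi> i. (\<lambda>x. (B $ i) x - (B $ i) 0))"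
proof -
  have affA: "affine_map (A $ i)" and affB: "affine_map (B $ i)" for i
    using A B by (auto simp: approx_affine_at_def)
  define L M where "L i x = (A $ i) x - (A $ i) 0" and "M i x = (B $ i) x - (B $ i) 0" for i x
  have linL: "linear (L i)" and linM: "linear (M i)" for i
    using affA[of i] affB[of i] by (simp_all add: affine_map_def L_def[abs_def] M_def[abs_def])
  define V where "V \<sigma> = {v. \<forall>i. L i v = M (\<sigma> i) v}" for \<sigma>
  define \<Sigma> where "\<Sigma> = {\<sigma>. \<sigma> permutes UNIV \<and> (\<forall>i. (A $ i) a = (B $ \<sigma> i) a)}"
  have subV: "subspace (V \<sigma>)" for \<sigma>
    unfolding V_def subspace_def
    by (auto simp: linear_add[OF linL] linear_add[OF linM] linear_0[OF linL] linear_0[OF linM]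
        linear_scale[OF linL] linear_scale[OF linM])
  obtain \<rho> where \<rho>: "\<rho> > 0" "ball a \<rho> \<subseteq> U" using U by (meson openE)
  have dir: "\<exists>\<sigma>\<in>\<Sigma>. v \<in> V \<sigma>" if v: "v \<noteq> 0" for v
  proof -
    have "\<exists>r y. 0 < r \<and> r \<le> 1 / Suc n \<and> norm (y - a - r *\<^sub>R v) \<le> r * norm v / Suc n \<and>
        dist (unordered (\<chi> i. (A $ i) y)) (unordered (\<chi> i. (B $ i) y)) \<le> 4 * r * norm v / Suc n" for n :: nat
    proof -
      define e where "e = 1 / real (Suc n)"
      have e: "0 < e" "e \<le> 1" by (auto simp: e_def)
      define N where "N = {x \<in> U. dist (f x) (unordered (\<chi> i. (A $ i) x)) > e * norm (x - a)} \<union>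
        {x \<in> U. dist (f x) (unordered (\<chi> i. (B $ i) x)) > e * norm (x - a)}"
      have "density_zero N a"
        unfolding N_def using A B e(1) approx_affine_exceptional_set[OF f U(1) affA] approx_affine_exceptional_set[OF f U(1) affB]
        by (intro density_zero_Un) (auto simp: approx_affine_at_def)
      moreover have "N \<in> sets lebesgue"
        unfolding N_def using approx_affine_exceptional_set[OF f U(1) affA] approx_affine_exceptional_set[OF f U(1) affB] by auto
      ultimately obtain r0 where r0: "r0 > 0" "\<And>x. 0 < dist x a \<Longrightarrow> dist x a < r0 \<Longrightarrow> \<exists>y. y \<notin> N \<and> dist y x < e * dist x a"
        using density_zero_escape[OF _ _ e(1)] by metis
      have nv: "norm v > 0" using v by simp
      \<comment> \<open>At most \<open>e\<close> so that the points tend to \<open>a\<close>, below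
        the escape radius \<open>r0\<close>, and small enough for \<open>y\<close> to lie in
        \<open>U\<close>.\<close>
      define r where "r = min e (min (r0 / (2 * norm v)) (\<rho> / (4 * norm v)))"
      have r: "0 < r" "r \<le> e" "r * norm v < r0" "2 * (r * norm v) < \<rho>"
        using e r0(1) \<rho>(1) nv by (auto simp: r_def min_def field_simps)
      define x where "x = a + r *\<^sub>R v"
      have dx: "dist x a = r * norm v" using r by (simp add: x_def dist_norm)
      obtain y where y: "y \<notin> N" "dist y x < e * dist x a" using r0(2)[of x] dx r nv by auto
      have yx: "dist y x \<le> r * norm v * e" using y(2) dx by (simp add: mult.commute)
      have ya: "norm (y - a) \<le> 2 * (r * norm v)"
      proof -
        have "e * (r * norm v) \<le> 1 * (r * norm v)" using e r nv by (intro mult_right_mono) auto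
        then show ?thesis using dist_triangle[of y a x] y(2) dx by (simp add: dist_norm)
      qed
      then have "y \<in> U" using \<rho>(2) r(4) by (auto simp: dist_norm norm_minus_commute)
      then have 1: "dist (f y) (unordered (\<chi> i. (A $ i) y)) \<le> e * norm (y - a)" "dist (f y) (unordered (\<chi> i. (B $ i) y)) \<le> e * norm (y - a)"
        using y(1) by (auto simp: N_def)
      have "dist (unordered (\<chi> i. (A $ i) y)) (unordered (\<chi> i. (B $ i) y)) \<le> 2 * (e * norm (y - a))"
        using dist_triangle3[of "unordered (\<chi> i. (A $ i) y)" "unordered (\<chi> i. (B $ i) y)" "f y"] 1 by linarith
      also have "\<dots> \<le> 2 * (e * (2 * (r * norm v)))" using ya e by (intro mult_left_mono) auto
      finally have "dist (unordered (\<chi> i. (A $ i) y)) (unordered (\<chi> i. (B $ i) y)) \<le> 4 * r * norm v * e" by (simp add: algebra_simps)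
      moreover have "norm (y - a - r *\<^sub>R v) \<le> r * norm v * e" using yx by (simp add: x_def dist_norm algebra_simps)
      ultimately show ?thesis using r by (intro exI[of _ r] exI[of _ y]) (simp add: e_def)
    qed
    then obtain r y where ry: "\<And>n. 0 < r n" "\<And>n::nat. r n \<le> 1 / Suc n" "\<And>n. norm (y n - a - r n *\<^sub>R v) \<le> r n * norm v / Suc n"
        "\<And>n. dist (unordered (\<chi> i. (A $ i) (y n))) (unordered (\<chi> i. (B $ i) (y n))) \<le> 4 * r n * norm v / Suc n" by metis
    have "\<exists>\<sigma>. \<sigma> permutes UNIV \<and> (\<forall>i. norm ((A $ i) (y n) - (B $ \<sigma> i) (y n)) \<le> 4 * r n * norm v / Suc n)" for n
    proof -
      obtain \<sigma> where \<sigma>: "\<sigma> permutes UNIV" "dist (unordered (\<chi> i. (A $ i) (y n))) (unordered (\<chi> i. (B $ i) (y n))) =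
          dist (\<chi> i. (A $ i) (y n)) (\<chi> i. (\<chi> i. (B $ i) (y n)) $ \<sigma> i)" by (rule nearest_perm)
      have "norm ((A $ i) (y n) - (B $ \<sigma> i) (y n)) \<le> 4 * r n * norm v / Suc n" for i
        using dist_vec_nth_le[of "\<chi> i. (A $ i) (y n)" i "\<chi> i. (\<chi> i. (B $ i) (y n)) $ \<sigma> i"] \<sigma>(2) ry(4)[of n]
        by (simp add: dist_norm)
      then show ?thesis using \<sigma>(1) by blast
    qed
    then obtain \<sigma> where \<sigma>: "\<And>n. \<sigma> n permutes UNIV" "\<And>n i. norm ((A $ i) (y n) - (B $ \<sigma> n i) (y n)) \<le> 4 * r n * norm v / Suc n"
      by metis
    have "finite (range \<sigma>)" using \<sigma>(1) finite_perms by (metis (mono_tags) finite_subset image_subset_iff mem_Collect_eq)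
    then obtain n0 where n0: "infinite {n. \<sigma> n = \<sigma> n0}"
      using pigeonhole_infinite[of "UNIV::nat set" \<sigma>] by auto
    define \<tau> where "\<tau> = \<sigma> n0"
    obtain k :: "nat \<Rightarrow> nat" where "strict_mono k \<and> (\<forall>n. k n \<in> {n. \<sigma> n = \<sigma> n0})"
      using infinite_enumerate[OF n0] by blast
    then have k: "strict_mono k" "\<And>n. \<sigma> (k n) = \<tau>" by (auto simp: \<tau>_def)
    have inv0: "(\<lambda>n. 1 / real (Suc (k n))) \<longlonglongrightarrow> 0"
      using filterlim_compose[OF LIMSEQ_inverse_real_of_nat filterlim_subseq[OF k(1)]] by (simp add: inverse_eq_divide)
    have rk: "(\<lambda>n. r (k n)) \<longlonglongrightarrow> 0"
      by (rule tendsto_sandwich[OF _ _ tendsto_const inv0]) (intro always_eventually allI less_imp_le[OF ry(1)] ry(2))+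
    define w where "w n = (y (k n) - a) /\<^sub>R r (k n)" for n
    have wv: "w \<longlonglongrightarrow> v"
    proof (rule Lim_null_comparison[THEN LIM_zero_cancel])
      show "\<forall>\<^sub>F n in sequentially. norm (w n - v) \<le> norm v * (1 / real (Suc (k n)))"
      proof (intro always_eventually allI)
        fix n
        have "w n - v = (y (k n) - a - r (k n) *\<^sub>R v) /\<^sub>R r (k n)"
          using ry(1)[of "k n"] by (simp add: w_def scaleR_diff_right)
        then have "norm (w n - v) = norm (y (k n) - a - r (k n) *\<^sub>R v) / r (k n)"
          using ry(1)[of "k n"] by (simp add: divide_inverse mult.commute)
        also have "\<dots> \<le> (r (k n) * norm v / Suc (k n)) / r (k n)"
          using ry(1)[of "k n"] by (intro divide_right_mono ry(3)) simp
        finally show "norm (w n - v) \<le> norm v * (1 / real (Suc (k n)))" using ry(1)[of "k n"] by simp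
      qed
      show "(\<lambda>n. norm v * (1 / real (Suc (k n)))) \<longlonglongrightarrow> 0" using tendsto_mult_left[OF inv0, of "norm v"] by simp
    qed
    have yk: "y (k n) = a + r (k n) *\<^sub>R w n" for n using ry(1)[of "k n"] by (simp add: w_def)
    have ya: "(\<lambda>n. y (k n)) \<longlonglongrightarrow> a"
      unfolding yk using tendsto_add[OF tendsto_const tendsto_scaleR[OF rk wv], of a] by simp
    have contA: "isCont (A $ i) x" and contB: "isCont (B $ i) x" for i x
      using affine_map_continuous[OF affA, of UNIV i] affine_map_continuous[OF affB, of UNIV i]
      by (auto simp: continuous_on_eq_continuous_at)
    have diff: "(A $ i) a = (B $ \<tau> i) a" for i
    proof -
      have "(\<lambda>n. (A $ i) (y (k n)) - (B $ \<tau> i) (y (k n))) \<longlonglongrightarrow> (A $ i) a - (B $ \<tau> i) a"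
        by (intro tendsto_diff isCont_tendsto_compose[OF contA ya] isCont_tendsto_compose[OF contB ya])
      moreover have "(\<lambda>n. (A $ i) (y (k n)) - (B $ \<tau> i) (y (k n))) \<longlonglongrightarrow> 0"
      proof (rule Lim_null_comparison)
        show "\<forall>\<^sub>F n in sequentially. norm ((A $ i) (y (k n)) - (B $ \<tau> i) (y (k n))) \<le> 4 * r (k n) * norm v * (1 / real (Suc (k n)))"
          using \<sigma>(2)[of i "k _"] k(2) by (intro always_eventually allI) (metis mult_1_right times_divide_eq_right)
        show "(\<lambda>n. 4 * r (k n) * norm v * (1 / real (Suc (k n)))) \<longlonglongrightarrow> 0"
          using tendsto_mult[OF tendsto_mult_right[OF tendsto_mult_left[OF rk, of 4], of "norm v"] inv0] by simp
      qed
      ultimately show ?thesis using LIMSEQ_unique by fastforce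
    qed
    have "L i v = M (\<tau> i) v" for i
    proof -
      have cL: "isCont (L i) v" and cM: "isCont (M (\<tau> i)) v"
        unfolding L_def[abs_def] M_def[abs_def] by (intro continuous_intros contA contB)+
      have "(\<lambda>n. L i (w n) - M (\<tau> i) (w n)) \<longlonglongrightarrow> L i v - M (\<tau> i) v"
        by (intro tendsto_diff isCont_tendsto_compose[OF cL wv] isCont_tendsto_compose[OF cM wv])
      moreover have "(\<lambda>n. L i (w n) - M (\<tau> i) (w n)) \<longlonglongrightarrow> 0"
      proof (rule Lim_null_comparison)
        show "\<forall>\<^sub>F n in sequentially. norm (L i (w n) - M (\<tau> i) (w n)) \<le> 4 * norm v * (1 / real (Suc (k n)))"
        proof (intro always_eventually allI)
          fix n
          have rp: "r (k n) > 0" by (rule ry)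
          have e1: "(A $ i) (y (k n)) - (A $ i) a = r (k n) *\<^sub>R L i (w n)"
            by (rule trans[OF affine_map_diff[OF affA]]) (use linear_scale[OF linL, of i "r (k n)" "w n"] in \<open>simp add: L_def yk\<close>)
          have e2: "(B $ \<tau> i) (y (k n)) - (B $ \<tau> i) a = r (k n) *\<^sub>R M (\<tau> i) (w n)"
            by (rule trans[OF affine_map_diff[OF affB]]) (use linear_scale[OF linM, of "\<tau> i" "r (k n)" "w n"] in \<open>simp add: M_def yk\<close>)
          have "r (k n) *\<^sub>R (L i (w n) - M (\<tau> i) (w n)) = (A $ i) (y (k n)) - (B $ \<tau> i) (y (k n))"
            unfolding scaleR_diff_right e1[symmetric] e2[symmetric] diff[of i] by simp
          then have "r (k n) * norm (L i (w n) - M (\<tau> i) (w n)) = norm ((A $ i) (y (k n)) - (B $ \<tau> i) (y (k n)))"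
            using rp by (metis abs_of_pos norm_scaleR)
          also have "\<dots> \<le> 4 * r (k n) * norm v / Suc (k n)" using \<sigma>(2)[of i "k n"] k(2) by simp
          also have "\<dots> = r (k n) * (4 * norm v * (1 / real (Suc (k n))))" by simp
          finally show "norm (L i (w n) - M (\<tau> i) (w n)) \<le> 4 * norm v * (1 / real (Suc (k n)))"
            using rp by (simp only: mult_le_cancel_left_pos)
        qed
        show "(\<lambda>n. 4 * norm v * (1 / real (Suc (k n)))) \<longlonglongrightarrow> 0" using tendsto_mult_left[OF inv0, of "4 * norm v"] by simp
      qed
      ultimately show ?thesis using LIMSEQ_unique by fastforce
    qed
    then have "v \<in> V \<tau>" by (simp add: V_def)
    moreover have "\<tau> \<in> \<Sigma>" using diff \<sigma>(1)[of n0] by (simp add: \<Sigma>_def \<tau>_def)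
    ultimately show ?thesis by blast
  qed
  have "(\<Union>\<sigma>\<in>\<Sigma>. V \<sigma>) = UNIV"
  proof -
    have "v \<in> (\<Union>\<sigma>\<in>\<Sigma>. V \<sigma>)" for v
    proof (cases "v = 0")
      case True
      \<comment> \<open>Any nonzero direction would do; only a member of \<Sigma> is wanted.\<close>
      obtain \<sigma> where "\<sigma> \<in> \<Sigma>" using dir[of "axis undefined 1"] by (auto simp: axis_eq_0_iff)
      then show ?thesis using subspace_0[OF subV] True by blast
    qed (use dir in blast)
    then show ?thesis by blast
  qed
  moreover have "finite \<Sigma>" using finite_perms by (rule finite_subset[rotated]) (auto simp: \<Sigma>_def)
  ultimately obtain \<sigma> where \<sigma>: "\<sigma> \<in> \<Sigma>" "V \<sigma> = UNIV"
    using finite_union_proper_subspaces[of \<Sigma> V] subV by blast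
  have "L i = M (\<sigma> i)" for i using \<sigma>(2) by (auto simp: V_def)
  then have "(\<chi> i. L i) = (\<chi> i. (\<chi> i. M i) $ \<sigma> i)" by (simp add: vec_eq_iff)
  moreover have "\<sigma> permutes UNIV" using \<sigma>(1) by (simp add: \<Sigma>_def)
  ultimately have "unordered (\<chi> i. L i) = unordered (\<chi> i. M i)" using unordered_permute by metis
  then show ?thesis by (simp add: L_def[abs_def] M_def[abs_def])
qed

lemma approx_deriv_eq:
  fixes f :: "real ^ 'm \<Rightarrow> ('h::{real_inner,polish_space}, 'q::finite) utuple"
  assumes f: "borel_map_on U f" and U: "open U" "a \<in> U" and A: "approx_affine_at U f a A"
  shows "approx_deriv U f a = unordered (\<chi> i. (\<lambda>x. (A $ i) x - (A $ i) 0))"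
proof -
  have "approx_differentiable U f a" using assms by (auto simp: approx_differentiable_def)
  moreover have "(THE T. \<exists>A. approx_affine_at U f a A \<and> T = unordered (\<chi> i. (\<lambda>x. (A $ i) x - (A $ i) 0))) =
    unordered (\<chi> i. (\<lambda>x. (A $ i) x - (A $ i) 0))"
  proof (rule the_equality)
    show "\<exists>A'. approx_affine_at U f a A' \<and> unordered (\<chi> i. (\<lambda>x. (A $ i) x - (A $ i) 0)) =
        unordered (\<chi> i. (\<lambda>x. (A' $ i) x - (A' $ i) 0))" using A by blast
  next
    fix T assume "\<exists>A. approx_affine_at U f a A \<and> T = unordered (\<chi> i. (\<lambda>x. (A $ i) x - (A $ i) 0))"
    then obtain B where B: "approx_affine_at U f a B" "T = unordered (\<chi> i. (\<lambda>x. (B $ i) x - (B $ i) 0))" by blast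
    show "T = unordered (\<chi> i. (\<lambda>x. (A $ i) x - (A $ i) 0))"
      unfolding B(2) by (rule approx_affine_at_unique[OF f U B(1) A])
  qed
  ultimately show ?thesis unfolding approx_deriv_def by (simp only: if_True)
qed

text \<open>The Hilbert-Schmidt norm, written as the norm of the vector of column norms because
  \<open>grad\<close> below is that vector.\<close>

definition HS :: "(real ^ 'm \<Rightarrow> 'h::real_normed_vector ^ 'q::finite) \<Rightarrow> real" where
  "HS L = norm (\<chi> j. norm (L (axis j 1)))"

text \<open>On \<open>P\<close> the tuple distance is at most the distance of lifts, and the
  complement of \<open>P\<close> has density zero at \<open>a\<close>; so the coordinates of the
  first order expansion of \<open>u\<close> form an approximating affine tuple.\<close>

lemma approx_deriv_lift:
  fixes f :: "real ^ 'm \<Rightarrow> ('h::{real_inner,polish_space}, 'q::finite) utuple"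
  assumes f: "borel_map_on U f" and U: "open U" "a \<in> U" and P: "P \<in> sets borel" "density_zero (- P) a"
    and fu: "\<And>x. x \<in> P \<Longrightarrow> f x = unordered (u x)" and u: "(u has_derivative L) (at a)"
  shows "approx_differentiable U f a" "utuple_HS_norm (approx_deriv U f a) = HS L"
proof -
  have bl: "bounded_linear L" using u by (rule has_derivative_bounded_linear)
  define A where "A = (\<chi> i. (\<lambda>x. (u a + L (x - a)) $ i))"
  have lin: "(A $ i) x - (A $ i) 0 = L x $ i" for i x
    by (simp add: A_def bounded_linear.linear[OF bl, THEN linear_diff] linear_0[OF bounded_linear.linear[OF bl]])
  have "linear (\<lambda>x. L x $ i)" for i
    using bounded_linear.linear[OF bl] by (auto intro!: linearI simp: linear_add linear_scale)
  then have aff: "affine_map (A $ i)" for i unfolding affine_map_def lin .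
  have vec: "(\<chi> i. (A $ i) x) = u a + L (x - a)" for x by (simp add: A_def vec_eq_iff)
  have aa: "approx_affine_at U f a A"
    unfolding approx_affine_at_def
  proof (intro conjI allI impI aff)
    fix e :: real assume e: "e > 0"
    obtain d where d: "d > 0" "\<And>y. norm (y - a) < d \<Longrightarrow> norm (u y - u a - L (y - a)) \<le> e * norm (y - a)"
      using u e unfolding has_derivative_at_alt by blast
    show "density_zero {x \<in> U. dist (f x) (unordered (\<chi> i. (A $ i) x)) > e * norm (x - a)} a"
    proof (rule density_zero_subset[OF P(2)])
      show "- P \<in> sets lebesgue" using P(1) by auto
      show "d / 2 > 0" using d by simp
      show "{x \<in> U. dist (f x) (unordered (\<chi> i. (A $ i) x)) > e * norm (x - a)} \<inter> cball a (d / 2) \<subseteq> - P"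
      proof
        fix x assume x: "x \<in> {x \<in> U. dist (f x) (unordered (\<chi> i. (A $ i) x)) > e * norm (x - a)} \<inter> cball a (d / 2)"
        have "x \<notin> P"
        proof
          assume "x \<in> P"
          then have "dist (f x) (unordered (\<chi> i. (A $ i) x)) \<le> dist (u x) (u a + L (x - a))"
            unfolding vec using dist_unordered_le by (simp add: fu)
          also have "\<dots> \<le> e * norm (x - a)"
            using d(2)[of x] x d(1) by (simp add: dist_norm norm_minus_commute algebra_simps)
          finally show False using x by simp
        qed
        then show "x \<in> - P" by simp
      qed
    qed
  qed
  show "approx_differentiable U f a" using f U aa by (auto simp: approx_differentiable_def)
  have "approx_deriv U f a = unordered (\<chi> i. (\<lambda>x. L x $ i))"
    using approx_deriv_eq[OF f U aa] by (simp add: lin)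
  then have "utuple_HS_norm (approx_deriv U f a) = sqrt (\<Sum>i\<in>UNIV. \<Sum>j\<in>UNIV. (norm (L (axis j 1) $ i))\<^sup>2)"
    by (simp add: utuple_HS_norm.abs_eq)
  also have "(\<Sum>i\<in>UNIV. \<Sum>j\<in>UNIV. (norm (L (axis j 1) $ i))\<^sup>2) = (\<Sum>j\<in>UNIV. \<Sum>i\<in>UNIV. (norm (L (axis j 1) $ i))\<^sup>2)"
    by (rule sum.swap)
  also have "\<dots> = (\<Sum>j\<in>UNIV. (norm (L (axis j 1)))\<^sup>2)"
    by (simp add: norm_vec_def L2_set_def sum_nonneg)
  finally show "utuple_HS_norm (approx_deriv U f a) = HS L"
    by (simp add: HS_def norm_vec_def L2_set_def)
qed

lemma norm_le_HS:
  fixes L :: "real ^ 'm \<Rightarrow> 'h::real_normed_vector ^ 'q::finite"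
  assumes "linear L" shows "norm (L z) \<le> norm z * HS L"
proof -
  have "L z = (\<Sum>j\<in>UNIV. (z $ j) *\<^sub>R L (axis j 1))"
  proof -
    have "(\<Sum>j\<in>UNIV. (z $ j) *\<^sub>R axis j 1) = z" using basis_expansion[of z] by (simp add: scalar_mult_eq_scaleR)
    then have "L z = L (\<Sum>j\<in>UNIV. (z $ j) *\<^sub>R axis j 1)" by (rule arg_cong[OF sym])
    also have "\<dots> = (\<Sum>j\<in>UNIV. (z $ j) *\<^sub>R L (axis j 1))"
      using assms by (simp add: linear_sum linear_scale)
    finally show ?thesis .
  qed
  then have "norm (L z) \<le> (\<Sum>j\<in>UNIV. \<bar>z $ j\<bar> * \<bar>norm (L (axis j 1))\<bar>)" by (auto intro!: order_trans[OF norm_sum])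
  also have "\<dots> \<le> L2_set (\<lambda>j. z $ j) UNIV * L2_set (\<lambda>j. norm (L (axis j 1))) UNIV" by (rule L2_set_mult_ineq)
  also have "L2_set (\<lambda>j. z $ j) UNIV = norm z" by (simp add: norm_vec_def L2_set_def)
  also have "L2_set (\<lambda>j. norm (L (axis j 1))) UNIV = HS L" unfolding HS_def by (subst norm_vec_def) (simp add: L2_set_def)
  finally show ?thesis .
qed

lemma rademacher_vec:
  fixes u :: "'a::euclidean_space \<Rightarrow> 'h::{real_inner,polish_space} ^ 'q::finite"
  assumes lip: "C-lipschitz_on UNIV u"
  shows "AE x in lborel. \<exists>L. (u has_derivative L) (at x)"
proof -
  have "AE x in lborel. \<exists>L. ((\<lambda>x. u x $ i) has_derivative L) (at x)" for i
  proof (rule rademacher)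
    show "C-lipschitz_on UNIV (\<lambda>x. u x $ i)"
      using lipschitz_onD[OF lip] lipschitz_on_nonneg[OF lip] order_trans[OF dist_vec_nth_le]
      by (intro lipschitz_onI) blast+
  qed
  then have "AE x in lborel. \<forall>i\<in>UNIV. \<exists>L. ((\<lambda>x. u x $ i) has_derivative L) (at x)"
    by (intro AE_finite_allI finite)
  then show ?thesis
  proof eventually_elim
    case (elim x)
    then have "\<forall>i. \<exists>L. ((\<lambda>x. u x $ i) has_derivative L) (at x)" by blast
    then obtain L where "\<forall>i. ((\<lambda>x. u x $ i) has_derivative L i) (at x)" by (rule exE[OF choice])
    then have L: "\<And>i. ((\<lambda>x. u x $ i) has_derivative L i) (at x)" by (rule spec)
    have lin: "linear (\<lambda>z. \<chi> i. L i z)"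
      using has_derivative_bounded_linear[OF L, THEN bounded_linear.linear]
      by (intro linearI) (simp_all add: vec_eq_iff linear_add linear_scale)
    have "(u has_derivative (\<lambda>z. \<chi> i. L i z)) (at x)"
      unfolding has_derivative_at_alt
    proof (intro conjI allI impI)
      show "bounded_linear (\<lambda>z. \<chi> i. L i z)" using lin by (simp add: linear_conv_bounded_linear)
      fix e :: real assume e: "e > 0"
      define e' where "e' = e / CARD('q)"
      have e': "e' > 0" using e by (simp add: e'_def)
      have "\<forall>i. \<exists>d>0. \<forall>y. norm (y - x) < d \<longrightarrow> norm (u y $ i - u x $ i - L i (y - x)) \<le> e' * norm (y - x)"
        using L e' unfolding has_derivative_at_alt by blast
      then obtain d where d: "\<And>i. d i > 0" "\<And>i y. norm (y - x) < d i \<Longrightarrow> norm (u y $ i - u x $ i - L i (y - x)) \<le> e' * norm (y - x)"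
        by metis
      define D where "D = Min (range d)"
      have D: "D > 0" "\<And>i. D \<le> d i" using d(1) by (auto simp: D_def)
      have "norm (u y - u x - (\<chi> i. L i (y - x))) \<le> e * norm (y - x)" if y: "norm (y - x) < D" for y
      proof -
        have "norm (u y - u x - (\<chi> i. L i (y - x))) \<le> (\<Sum>i\<in>UNIV. norm (u y $ i - u x $ i - L i (y - x)))"
          using norm_vec_le_sum[of "u y - u x - (\<chi> i. L i (y - x))"] by simp
        also have "\<dots> \<le> (\<Sum>i\<in>(UNIV::'q set). e' * norm (y - x))"
          using y D(2) by (intro sum_mono d(2)) (meson less_le_trans)
        also have "\<dots> = e * norm (y - x)" by (simp add: e'_def)
        finally show ?thesis .
      qed
      then show "\<exists>d>0. \<forall>y. norm (y - x) < d \<longrightarrow> norm (u y - u x - (\<chi> i. L i (y - x))) \<le> e * norm (y - x)"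
        using D(1) by blast
    qed
    then show ?case by blast
  qed
qed

section \<open>Decomposition into Lipschitz sheets\<close>

text \<open>\<open>Y i\<close> is Lipschitz on the whole space so that Rademacher's theorem applies,
  but it lifts \<open>f\<close> isometrically on \<open>P i\<close> only, and \<open>M i\<close> may
  be unbounded in \<open>i\<close>. \<open>f_eq\<close> serves the derivative, \<open>f_iso\<close>
  the metric difference quotients.\<close>

locale sheet_cover =
  fixes U :: "(real ^ 'm) set"
    and f :: "real ^ 'm \<Rightarrow> ('h::{real_inner,polish_space}, 'q::finite) utuple"
    and P :: "nat \<Rightarrow> (real ^ 'm) set" and Y :: "nat \<Rightarrow> real ^ 'm \<Rightarrow> 'h ^ 'q" and M :: "nat \<Rightarrow> real"
  assumes open_dom: "open U" and borel_f: "borel_map_on U f"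
    and P_borel[measurable]: "\<And>i. P i \<in> sets borel" and P_disj: "disjoint_family P"
    and P_sub: "\<And>i. P i \<subseteq> U" and Y_lip: "\<And>i. (M i)-lipschitz_on UNIV (Y i)"
    and f_eq: "\<And>i x. x \<in> P i \<Longrightarrow> f x = unordered (Y i x)"
    and f_iso: "\<And>i x x'. x \<in> P i \<Longrightarrow> x' \<in> P i \<Longrightarrow> dist (f x) (f x') = dist (Y i x) (Y i x')"
    and P_cover: "AE x in lborel. x \<in> U \<longrightarrow> x \<in> (\<Union>i. P i)"

text \<open>The constant precedes sets and maps so that all pieces and levels can share it; the type
  argument fixes domain and target.\<close>

definition extends_lipschitz :: "real \<Rightarrow> ('a::euclidean_space \<Rightarrow> 'x::metric_space) itself \<Rightarrow> bool" where
  "extends_lipschitz K _ \<longleftrightarrow> (\<forall>(A::'a set) (u::'a \<Rightarrow> 'x) L. closed A \<longrightarrow> A \<noteq> {} \<longrightarrow> L-lipschitz_on A u \<longrightarrow>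
     (\<exists>F. (K * L)-lipschitz_on UNIV F \<and> (\<forall>x\<in>A. F x = u x)))"

lemma extends_lipschitz_exists:
  assumes "has_cones TYPE('x::metric_space) \<kappa>"
  shows "\<exists>K\<ge>1. extends_lipschitz K TYPE('a::euclidean_space \<Rightarrow> 'x)"
  using lipschitz_extension[OF assms, where 'a='a] unfolding extends_lipschitz_def by blast

lemma lipschitz_sheet_lift:
  fixes f :: "real ^ 'm \<Rightarrow> ('h::{real_inner,polish_space}, 'q::finite) utuple"
  assumes K: "extends_lipschitz K TYPE(real ^ 'm \<Rightarrow> 'h ^ 'q)" and ws: "well_separated t r"
    and B: "\<And>x. x \<in> B \<Longrightarrow> f x \<in> unordered ` sheets t r" and lip: "L-lipschitz_on B f"
  shows "\<exists>Y. (K * L)-lipschitz_on UNIV Y \<and> (\<forall>x\<in>B. f x = unordered (Y x)) \<and>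
    (\<forall>x\<in>B. \<forall>x'\<in>B. dist (f x) (f x') = dist (Y x) (Y x'))"
proof (cases "B = {}")
  case True
  have "\<exists>Y. (K * L)-lipschitz_on (UNIV::(real^'m) set) (Y::_ \<Rightarrow> 'h^'q)"
  proof -
    \<comment> \<open>A constant map has constant \<open>K * L\<close> only if this is nonnegative;
      extending from a singleton supplies that.\<close>
    have "L-lipschitz_on {0::real^'m} (\<lambda>_. 0::'h^'q)" using lipschitz_on_nonneg[OF lip] by (intro lipschitz_onI) auto
    then show ?thesis using K unfolding extends_lipschitz_def by (metis closed_singleton insert_not_empty)
  qed
  then show ?thesis using True by blast
next
  case False
  have "\<forall>x\<in>B. \<exists>y. y \<in> sheets t r \<and> f x = unordered y" using B by blast
  then have "\<exists>u. \<forall>x\<in>B. u x \<in> sheets t r \<and> f x = unordered (u x)" by (rule bchoice)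
  then obtain u where "\<forall>x\<in>B. u x \<in> sheets t r \<and> f x = unordered (u x)" by blast
  then have u: "\<And>x. x \<in> B \<Longrightarrow> u x \<in> sheets t r" "\<And>x. x \<in> B \<Longrightarrow> f x = unordered (u x)" by blast+
  have iso: "dist (f x) (f x') = dist (u x) (u x')" if "x \<in> B" "x' \<in> B" for x x'
    using sheets_isometry[OF ws u(1)[OF that(1)] u(1)[OF that(2)]] u(2) that by simp
  have "L-lipschitz_on B u"
  proof (rule lipschitz_onI)
    fix x y assume "x \<in> B" "y \<in> B"
    then show "dist (u x) (u y) \<le> L * dist x y" using iso lipschitz_onD[OF lip, of x y] by simp
  qed (rule lipschitz_on_nonneg[OF lip])
  then obtain g where g: "L-lipschitz_on (closure B) g" "\<forall>x\<in>B. g x = u x"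
    using lipschitz_extend_closure by blast
  have "\<exists>Y. (K * L)-lipschitz_on UNIV Y \<and> (\<forall>x\<in>closure B. Y x = g x)"
    using K g(1) False unfolding extends_lipschitz_def by (metis closed_closure closure_eq_empty)
  then obtain Y where Y: "(K * L)-lipschitz_on UNIV Y" "\<forall>x\<in>closure B. Y x = g x" by blast
  have "Y x = u x" if "x \<in> B" for x using Y(2) g(2) closure_subset that by (metis subsetD)
  then show ?thesis using Y(1) u(2) iso by metis
qed

text \<open>Each Lipschitz piece is cut by the preimages of countably many closed sheets, lifted
  there, and the pieces are made disjoint at the end. The constants are recorded since they bound
  the gradient of a Lipschitz map.\<close>

lemma sheet_cover_exists:
  fixes f :: "real ^ 'm \<Rightarrow> ('h::{real_inner,polish_space}, 'q::finite) utuple"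
  assumes K: "extends_lipschitz K TYPE(real ^ 'm \<Rightarrow> 'h ^ 'q)"
    and U: "open U" and f: "borel_map_on U f"
    and A: "\<And>n::nat. A n \<in> sets borel" "\<And>n. A n \<subseteq> U" "\<And>n. (L n)-lipschitz_on (A n) f"
    and cover: "AE x in lborel. x \<in> U \<longrightarrow> x \<in> (\<Union>n. A n)"
  shows "\<exists>P Y M. sheet_cover U f P Y M \<and> (\<forall>i. \<exists>n. M i = K * L n)"
proof -
  have "\<exists>I :: (('h ^ 'q) \<times> real) set. countable I \<and> (\<forall>t r. (t, r) \<in> I \<longrightarrow> r > 0 \<and> well_separated t r) \<and>
      (\<Union>(t,r)\<in>I. unordered ` sheets t r) = UNIV"
    by (rule countable_sheet_cover) blast
  then obtain I :: "(('h ^ 'q) \<times> real) set"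
    where I: "countable I" "\<forall>t r. (t, r) \<in> I \<longrightarrow> r > 0 \<and> well_separated t r"
      "(\<Union>(t,r)\<in>I. unordered ` sheets t r) = UNIV"
    by blast
  have Ine: "I \<noteq> {}" using I(3) by auto
  define c where "c k = from_nat_into I k" for k
  have c: "c k \<in> I" for k unfolding c_def using from_nat_into[OF Ine] .
  have rc: "range c = I" unfolding c_def using range_from_nat_into[OF Ine I(1)] .
  define S where "S k = unordered ` sheets (fst (c k)) (snd (c k))" for k
  have ws: "well_separated (fst (c k)) (snd (c k))" for k using I(2) c[of k] by (metis prod.collapse)
  have clS: "closed (S k)" for k unfolding S_def by (rule closed_unordered_sheets[OF ws])
  have US: "(\<Union>k. S k) = UNIV"
    using I(3) unfolding S_def rc[symmetric] by (simp add: case_prod_unfold image_image)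
  define B where "B i = {x \<in> A (fst (prod_decode i)). f x \<in> S (snd (prod_decode i))}" for i
  have BA: "B i \<subseteq> A (fst (prod_decode i))" for i by (auto simp: B_def)
  have Bm: "B i \<in> sets borel" for i
  proof -
    define g where "g x = (if x \<in> U then f x else undefined)" for x
    have [measurable]: "U \<in> sets borel" "A (fst (prod_decode i)) \<in> sets borel" "S (snd (prod_decode i)) \<in> sets borel"
      using U A(1) clS by auto
    have [measurable]: "g \<in> borel_measurable borel" unfolding g_def using f by (rule borel_map_on_total) simp
    have "{x \<in> A (fst (prod_decode i)). g x \<in> S (snd (prod_decode i))} \<in> sets borel" by measurable
    moreover have "{x \<in> A (fst (prod_decode i)). g x \<in> S (snd (prod_decode i))} = B i"
      using A(2) by (auto simp: B_def g_def)
    ultimately show ?thesis by simp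
  qed
  have "\<exists>Y. (K * L (fst (prod_decode i)))-lipschitz_on UNIV Y \<and> (\<forall>x\<in>B i. f x = unordered (Y x)) \<and>
    (\<forall>x\<in>B i. \<forall>x'\<in>B i. dist (f x) (f x') = dist (Y x) (Y x'))" for i
  proof (rule lipschitz_sheet_lift[OF K ws[of "snd (prod_decode i)"]])
    show "f x \<in> unordered ` sheets (fst (c (snd (prod_decode i)))) (snd (c (snd (prod_decode i))))" if "x \<in> B i" for x
      using that by (simp add: B_def S_def)
    show "(L (fst (prod_decode i)))-lipschitz_on (B i) f" using lipschitz_on_subset[OF A(3) BA] .
  qed
  then have "\<forall>i. \<exists>Y. (K * L (fst (prod_decode i)))-lipschitz_on UNIV Y \<and> (\<forall>x\<in>B i. f x = unordered (Y x)) \<and>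
    (\<forall>x\<in>B i. \<forall>x'\<in>B i. dist (f x) (f x') = dist (Y x) (Y x'))" by blast
  then obtain Y where Y: "\<forall>i. (K * L (fst (prod_decode i)))-lipschitz_on UNIV (Y i) \<and> (\<forall>x\<in>B i. f x = unordered (Y i x)) \<and>
    (\<forall>x\<in>B i. \<forall>x'\<in>B i. dist (f x) (f x') = dist (Y i x) (Y i x'))" by (rule exE[OF choice])
  define P where "P = disjointed B"
  have PB: "P i \<subseteq> B i" for i unfolding P_def by (rule disjointed_subset)
  have UP: "(\<Union>i. P i) = (\<Union>n. A n)"
  proof -
    have "(\<Union>i. P i) = (\<Union>i. B i)" unfolding P_def by (rule UN_disjointed_eq)
    also have "\<dots> = (\<Union>n. A n)"
    proof
      show "(\<Union>i. B i) \<subseteq> (\<Union>n. A n)" using BA by blast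
      show "(\<Union>n. A n) \<subseteq> (\<Union>i. B i)"
      proof
        fix x assume "x \<in> (\<Union>n. A n)"
        then obtain n where n: "x \<in> A n" by blast
        obtain k where k: "f x \<in> S k" using US by blast
        have "x \<in> B (prod_encode (n, k))" using n k by (simp add: B_def)
        then show "x \<in> (\<Union>i. B i)" by blast
      qed
    qed
    finally show ?thesis .
  qed
  have "sheet_cover U f P Y (\<lambda>i. K * L (fst (prod_decode i)))"
  proof
    show "open U" "borel_map_on U f" by fact+
    show "P i \<in> sets borel" for i
      using sets.range_disjointed_sets[of B borel] Bm unfolding P_def by auto
    show "disjoint_family P" unfolding P_def by (rule disjoint_family_disjointed)
    show "P i \<subseteq> U" for i using PB BA A(2) by blast
    show "(K * L (fst (prod_decode i)))-lipschitz_on UNIV (Y i)" for i using Y by blast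
    show "f x = unordered (Y i x)" if "x \<in> P i" for x i using Y PB that by blast
    show "dist (f x) (f x') = dist (Y i x) (Y i x')" if "x \<in> P i" "x' \<in> P i" for x x' i using Y PB that by blast
    show "AE x in lborel. x \<in> U \<longrightarrow> x \<in> (\<Union>i. P i)" unfolding UP by (rule cover)
  qed
  then show ?thesis by blast
qed

lemma speed_tendsto_differentiable:
  fixes u :: "'a::euclidean_space \<Rightarrow> 'b::real_normed_vector"
  assumes "(u has_derivative L) (at x)"
  shows "(\<lambda>n. ennreal (real (Suc n) * dist (u (x + z /\<^sub>R real (Suc n))) (u x))) \<longlonglongrightarrow> ennreal (norm (L z))"
proof -
  have lin: "linear L" using assms has_derivative_bounded_linear bounded_linear.linear by blast
  have "(\<lambda>n. real (Suc n) * dist (u (x + z /\<^sub>R real (Suc n))) (u x)) \<longlonglongrightarrow> norm (L z)"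
  proof -
    have "(\<lambda>n. real (Suc n) *\<^sub>R (u (x + z /\<^sub>R real (Suc n)) - u x)) \<longlonglongrightarrow> L z"
    proof (cases "z = 0")
      case True
      then show ?thesis using linear_0[OF lin] by simp
    next
      case z: False
      have inv: "(\<lambda>n. inverse (real (Suc n))) \<longlonglongrightarrow> 0" by (rule LIMSEQ_inverse_real_of_nat)
      have zlim: "(\<lambda>n. z /\<^sub>R real (Suc n)) \<longlonglongrightarrow> 0" using tendsto_scaleR[OF inv tendsto_const, of z] by simp
      have "filterlim (\<lambda>n. z /\<^sub>R real (Suc n)) (at 0) sequentially"
        using zlim z by (intro filterlim_atI) auto
      moreover have "((\<lambda>h. norm (u (x + h) - u x - L h) / norm h) \<longlongrightarrow> 0) (at 0)"
        using assms by (simp add: has_derivative_at)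
      ultimately have "(\<lambda>n. norm (u (x + z /\<^sub>R real (Suc n)) - u x - L (z /\<^sub>R real (Suc n))) / norm (z /\<^sub>R real (Suc n))) \<longlonglongrightarrow> 0"
        by (rule filterlim_compose[rotated])
      then have l0: "(\<lambda>n. norm z * (norm (u (x + z /\<^sub>R real (Suc n)) - u x - L (z /\<^sub>R real (Suc n))) / norm (z /\<^sub>R real (Suc n)))) \<longlonglongrightarrow> norm z * 0"
        by (rule tendsto_mult_left)
      have "norm z * (norm (u (x + z /\<^sub>R real (Suc n)) - u x - L (z /\<^sub>R real (Suc n))) / norm (z /\<^sub>R real (Suc n))) =
        norm (real (Suc n) *\<^sub>R (u (x + z /\<^sub>R real (Suc n)) - u x) - L z)" for n
      proof -
        have "L (z /\<^sub>R real (Suc n)) = L z /\<^sub>R real (Suc n)" by (rule linear_scale[OF lin])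
        then have e: "real (Suc n) *\<^sub>R (u (x + z /\<^sub>R real (Suc n)) - u x) - L z =
          real (Suc n) *\<^sub>R (u (x + z /\<^sub>R real (Suc n)) - u x - L (z /\<^sub>R real (Suc n)))"
          by (simp add: scaleR_diff_right del: of_nat_Suc)
        show ?thesis unfolding e norm_scaleR using z by (simp add: divide_simps del: of_nat_Suc)
      qed
      then have "(\<lambda>n. norm (real (Suc n) *\<^sub>R (u (x + z /\<^sub>R real (Suc n)) - u x) - L z)) \<longlonglongrightarrow> 0"
        using l0 by simp
      then show ?thesis by (simp only: tendsto_norm_zero_iff LIM_zero_iff)
    qed
    then have "(\<lambda>n. norm (real (Suc n) *\<^sub>R (u (x + z /\<^sub>R real (Suc n)) - u x))) \<longlonglongrightarrow> norm (L z)"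
      by (rule tendsto_norm)
    then show ?thesis by (simp add: dist_norm del: of_nat_Suc)
  qed
  then show ?thesis by (rule tendsto_ennrealI)
qed

lemma upper_speed_differentiable:
  fixes u :: "'a::euclidean_space \<Rightarrow> 'b::real_normed_vector"
  assumes "(u has_derivative L) (at x)"
  shows "upper_speed u z x = ennreal (norm (L z))"
  unfolding upper_speed_def
  by (rule lim_imp_Limsup[OF sequentially_bot speed_tendsto_differentiable[OF assms]])

lemma upper_speed_le_lipschitz:
  assumes "C-lipschitz_on UNIV u"
  shows "upper_speed u z x \<le> ennreal (C * norm z)"
  unfolding upper_speed_def
proof (rule Limsup_bounded, intro always_eventually allI ennreal_leI)
  fix n
  have "dist (u (x + z /\<^sub>R real (Suc n))) (u x) \<le> C * dist (x + z /\<^sub>R real (Suc n)) x"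
    using lipschitz_onD[OF assms] by blast
  also have "\<dots> = C * norm z / real (Suc n)" by (simp add: dist_norm divide_inverse mult.commute)
  finally show "real (Suc n) * dist (u (x + z /\<^sub>R real (Suc n))) (u x) \<le> C * norm z"
    by (simp add: pos_le_divide_eq mult.commute del: of_nat_Suc)
qed

lemma borel_measurable_upper_speed:
  fixes u :: "'a::euclidean_space \<Rightarrow> 'b::metric_space"
  assumes "continuous_on UNIV u"
  shows "upper_speed u z \<in> borel_measurable borel"
proof -
  have [measurable]: "(\<lambda>x. dist (u (x + z /\<^sub>R real (Suc n))) (u x)) \<in> borel_measurable borel" for n
    by (intro borel_measurable_continuous_onI continuous_on_dist assms continuous_on_compose2[OF assms] continuous_intros) auto
  show ?thesis unfolding upper_speed_def[abs_def] by measurable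
qed

section \<open>The vector of partial speeds of a decomposed map\<close>

context sheet_cover
begin

text \<open>The vector of the column norms \<open>|\<partial>_j f|\<close>, glued from the pieces
  and 0 outside them. Upper speeds in place of derivatives make it a Borel function defined
  everywhere; its norm is \<open>|Df|\<close> almost everywhere.\<close>

definition grad :: "real ^ 'm \<Rightarrow> real ^ 'm" where
  "grad x = (\<chi> j. enn2real (\<Sum>i. upper_speed (Y i) (axis j 1) x * indicator (P i) x))"

lemma continuous_Y: "continuous_on UNIV (Y i)"
  using Y_lip lipschitz_on_continuous_on by blast

lemma borel_measurable_grad[measurable]: "grad \<in> borel_measurable borel"
proof -
  have [measurable]: "upper_speed (Y i) z \<in> borel_measurable borel" for i z
    by (rule borel_measurable_upper_speed[OF continuous_Y])
  have [measurable]: "(\<lambda>x. grad x $ j) \<in> borel_measurable borel" for j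
    unfolding grad_def vec_lambda_beta by measurable
  show ?thesis
    by (subst borel_measurable_euclidean_space) (auto simp: Basis_vec_def inner_axis)
qed

lemma grad_eq:
  assumes "x \<in> P i" shows "grad x $ j = enn2real (upper_speed (Y i) (axis j 1) x)"
  unfolding grad_def by (simp add: suminf_cmult_indicator[OF P_disj assms])

lemma grad_nonneg: "grad x $ j \<ge> 0" by (simp add: grad_def)

lemma grad_outside: assumes "\<And>i. x \<notin> P i" shows "grad x = 0"
  using assms by (simp add: grad_def vec_eq_iff)

lemma grad_le:
  assumes M: "\<And>i. M i \<le> C" and C: "0 \<le> C"
  shows "norm (grad x) \<le> real CARD('m) * C"
proof -
  have c: "grad x $ j \<le> C" for j
  proof (cases "\<exists>i. x \<in> P i")
    case True
    then obtain i where i: "x \<in> P i" by blast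
    have "upper_speed (Y i) (axis j 1) x \<le> ennreal (M i * norm (axis j 1 :: real ^ 'm))" by (rule upper_speed_le_lipschitz[OF Y_lip])
    also have "\<dots> \<le> ennreal C" using M by (simp add: ennreal_leI)
    finally show ?thesis using i C by (simp add: grad_eq enn2real_leI)
  next
    case False
    then show ?thesis using grad_outside[of x] C by simp
  qed
  have "norm (grad x) \<le> (\<Sum>j\<in>UNIV. norm (grad x $ j))" by (rule norm_vec_le_sum)
  also have "\<dots> \<le> (\<Sum>j\<in>(UNIV::'m set). C)" using c grad_nonneg by (intro sum_mono) simp
  finally show ?thesis by simp
qed

definition good :: "nat \<Rightarrow> real ^ 'm \<Rightarrow> (real ^ 'm \<Rightarrow> 'h ^ 'q) \<Rightarrow> bool" where
  "good i x L \<longleftrightarrow> x \<in> P i \<and> density_zero (- P i) x \<and> (Y i has_derivative L) (at x)"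

lemma AE_good: "AE x in lborel. x \<in> U \<longrightarrow> (\<exists>i L. good i x L)"
proof -
  have "AE x in lborel. \<forall>i. x \<in> P i \<longrightarrow> density_zero (- P i) x"
    using AE_density_point[OF P_borel] by (simp add: AE_all_countable)
  moreover have "AE x in lborel. \<forall>i. \<exists>L. (Y i has_derivative L) (at x)"
    using rademacher_vec[OF Y_lip] by (simp add: AE_all_countable)
  ultimately show ?thesis using P_cover
    by eventually_elim (auto simp: good_def)
qed

lemma good_grad:
  assumes "good i x L" shows "grad x $ j = norm (L (axis j 1))" "norm (grad x) = HS L"
proof -
  show e: "grad x $ j = norm (L (axis j 1))" for j
    using assms by (simp add: good_def grad_eq[of x i] upper_speed_differentiable[of "Y i" L])
  have "grad x = (\<chi> j. norm (L (axis j 1)))" by (simp add: vec_eq_iff e)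
  then show "norm (grad x) = HS L" by (simp add: HS_def)
qed

lemma good_approx_deriv:
  assumes "good i x L"
  shows "approx_differentiable U f x" "utuple_HS_norm (approx_deriv U f x) = norm (grad x)"
proof -
  have g: "x \<in> P i" "density_zero (- P i) x" "(Y i has_derivative L) (at x)" using assms by (auto simp: good_def)
  have xU: "x \<in> U" using g(1) P_sub by blast
  show "approx_differentiable U f x"
    by (rule approx_deriv_lift(1)[OF borel_f open_dom xU P_borel g(2) f_eq g(3)])
  show "utuple_HS_norm (approx_deriv U f x) = norm (grad x)"
    unfolding good_grad(2)[OF assms]
    by (rule approx_deriv_lift(2)[OF borel_f open_dom xU P_borel g(2) f_eq g(3)])
qed

lemma AE_approx_deriv:
  "AE x in lborel. x \<in> U \<longrightarrow> approx_differentiable U f x \<and> utuple_HS_norm (approx_deriv U f x) = norm (grad x)"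
  using AE_good by eventually_elim (use good_approx_deriv in blast)

lemma deriv_integral_eq:
  assumes V: "V \<in> sets borel" "V \<subseteq> U"
  shows "deriv_integral p U f V = (\<integral>\<^sup>+x\<in>V. ennreal (norm (grad x) powr p) \<partial>lborel)"
proof -
  have "AE x in lebesgue. x \<in> U \<longrightarrow> approx_differentiable U f x \<and> utuple_HS_norm (approx_deriv U f x) = norm (grad x)"
    using AE_approx_deriv by (rule AE_completion)
  then have "deriv_integral p U f V = (\<integral>\<^sup>+x\<in>V. ennreal (norm (grad x) powr p) \<partial>lebesgue)"
    unfolding deriv_integral_def using V(2)
    by (intro nn_integral_cong_AE) (auto elim!: eventually_mono simp: indicator_def)
  then show ?thesis by (simp add: nn_integral_completion)
qed

text \<open>The point \<open>x + z /\<^sub>R real (Suc n)\<close> may miss \<open>P i\<close>, but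
  \<open>density_zero_escape\<close> finds a point of \<open>P i\<close> at relative distance
  \<open>d\<close> from it. Replacing the one by the other costs \<open>C + M i\<close> times that
  distance, and on \<open>P i\<close> the distances of \<open>f\<close> are those of
  \<open>Y i\<close>.\<close>

lemma good_upper_speed:
  assumes lip: "C-lipschitz_on U f" and good: "good i x L"
  shows "upper_speed f z x \<le> ennreal (norm (L z))"
proof (cases "z = 0")
  case True
  have "upper_speed f z x = limsup (\<lambda>n. 0)" using True by (simp add: upper_speed_def)
  then show ?thesis by (simp add: Limsup_const)
next
  case z: False
  have g: "x \<in> P i" "density_zero (- P i) x" "(Y i has_derivative L) (at x)" using good by (auto simp: good_def)
  have Mi: "M i \<ge> 0" and C: "C \<ge> 0" using lipschitz_on_nonneg[OF Y_lip] lipschitz_on_nonneg[OF lip] by auto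
  obtain \<rho> where \<rho>: "\<rho> > 0" "ball x \<rho> \<subseteq> U" using open_dom g(1) P_sub by (meson openE subsetD)
  have "upper_speed f z x \<le> ennreal (norm (L z)) + ennreal \<epsilon>" if \<epsilon>: "\<epsilon> > 0" for \<epsilon>
  proof -
    define d where "d = min 1 (\<epsilon> / ((C + M i + 1) * norm z))"
    have nz: "norm z > 0" using z by simp
    have d: "d > 0" "d \<le> 1" using \<epsilon> nz C Mi by (auto simp: d_def)
    have dC: "(C + M i) * (d * norm z) \<le> \<epsilon>"
    proof -
      have "d * ((C + M i + 1) * norm z) \<le> \<epsilon>"
        using nz C Mi by (simp add: d_def min_def pos_le_divide_eq) 
      moreover have "(C + M i) * (d * norm z) \<le> d * ((C + M i + 1) * norm z)"
        using d nz by (simp add: algebra_simps)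
      ultimately show ?thesis by linarith
    qed
    have mP: "- P i \<in> sets lebesgue" using P_borel by auto
    obtain r0 where r0: "r0 > 0" "\<And>y. 0 < dist y x \<Longrightarrow> dist y x < r0 \<Longrightarrow> \<exists>w. w \<notin> - P i \<and> dist w y < d * dist y x"
      using density_zero_escape[OF g(2) mP d(1)] by metis
    have "(\<lambda>n. inverse (real (Suc n)) * norm z) \<longlonglongrightarrow> 0 * norm z"
      by (intro tendsto_mult LIMSEQ_inverse_real_of_nat tendsto_const)
    then have ev: "\<forall>\<^sub>F n in sequentially. inverse (real (Suc n)) * norm z < min r0 \<rho>"
      using r0(1) \<rho>(1) by (intro order_tendstoD(2)) auto
    have "upper_speed f z x \<le> limsup (\<lambda>n. ennreal (real (Suc n) * dist (Y i (x + z /\<^sub>R real (Suc n))) (Y i x)) + ennreal \<epsilon>)"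
      unfolding upper_speed_def
    proof (rule Limsup_mono)
      show "\<forall>\<^sub>F n in sequentially. ennreal (real (Suc n) * dist (f (x + z /\<^sub>R real (Suc n))) (f x)) \<le>
         ennreal (real (Suc n) * dist (Y i (x + z /\<^sub>R real (Suc n))) (Y i x)) + ennreal \<epsilon>"
        using ev
      proof eventually_elim
        case (elim n)
        define N where "N = real (Suc n)"
        have N: "N > 0" by (simp add: N_def)
        define y where "y = x + z /\<^sub>R N"
        have dy: "dist y x = inverse N * norm z" using N by (simp add: y_def dist_norm)
        have dy0: "0 < dist y x" "dist y x < r0" "dist y x < \<rho>" unfolding dy using elim nz N by (auto simp: N_def)
        obtain w where w: "w \<in> P i" "dist w y < d * dist y x" using r0(2)[OF dy0(1,2)] by auto
        have yU: "y \<in> U" using \<rho>(2) dy0(3) by (auto simp: dist_commute)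
        have wU: "w \<in> U" using w(1) P_sub by blast
        have 1: "dist (f y) (f w) \<le> C * (d * dist y x)"
          using lipschitz_onD[OF lip yU wU] mult_left_mono[OF less_imp_le[OF w(2)] C] by (simp add: dist_commute)
        have 2: "dist (f w) (f x) = dist (Y i w) (Y i x)" by (rule f_iso[OF w(1) g(1)])
        have 3: "dist (Y i w) (Y i y) \<le> M i * (d * dist y x)"
          using lipschitz_onD[OF Y_lip, of w y i] mult_left_mono[OF less_imp_le[OF w(2)] Mi] by simp
        have "dist (f y) (f x) \<le> dist (Y i y) (Y i x) + (C * (d * dist y x) + M i * (d * dist y x))"
          using dist_triangle[of "f y" "f x" "f w"] dist_triangle[of "Y i w" "Y i x" "Y i y"] 1 2 3 by linarith
        also have "C * (d * dist y x) + M i * (d * dist y x) = inverse N * ((C + M i) * (d * norm z))"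
          unfolding dy by (simp add: algebra_simps)
        also have "\<dots> \<le> inverse N * \<epsilon>" using dC N by (intro mult_left_mono) auto
        finally have "dist (f y) (f x) \<le> dist (Y i y) (Y i x) + inverse N * \<epsilon>" by simp
        then have "N * dist (f y) (f x) \<le> N * (dist (Y i y) (Y i x) + inverse N * \<epsilon>)" using N by (intro mult_left_mono) auto
        also have "\<dots> = N * dist (Y i y) (Y i x) + \<epsilon>" using N by (simp add: distrib_left)
        finally have "ennreal (N * dist (f y) (f x)) \<le> ennreal (N * dist (Y i y) (Y i x) + \<epsilon>)" by (rule ennreal_leI)
        also have "\<dots> = ennreal (N * dist (Y i y) (Y i x)) + ennreal \<epsilon>" using N \<epsilon> by (intro ennreal_plus) auto
        finally show ?case unfolding y_def N_def .
      qed
    qed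
    also have "\<dots> = ennreal (norm (L z)) + ennreal \<epsilon>"
      by (intro lim_imp_Limsup sequentially_bot tendsto_add speed_tendsto_differentiable[OF g(3)] tendsto_const)
    finally show ?thesis .
  qed
  then show ?thesis by (rule ennreal_le_epsilon)
qed

lemma AE_upper_speed_le:
  assumes lip: "C-lipschitz_on U f"
  shows "AE x in lborel. x \<in> U \<longrightarrow> (\<forall>z. upper_speed f z x \<le> ennreal (norm z * norm (grad x)))"
    "AE x in lborel. x \<in> U \<longrightarrow> (\<forall>j h. upper_speed f (h *\<^sub>R axis j 1) x \<le> ennreal (\<bar>h\<bar> * grad x $ j))"
proof -
  have 1: "upper_speed f z x \<le> ennreal (norm z * norm (grad x))" if "good i x L" for i x L z
  proof -
    have "linear L" using that has_derivative_bounded_linear bounded_linear.linear unfolding good_def by blast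
    then have "norm (L z) \<le> norm z * norm (grad x)" unfolding good_grad(2)[OF that] by (rule norm_le_HS)
    then show ?thesis using good_upper_speed[OF lip that, of z] by (meson ennreal_leI order_trans)
  qed
  have 2: "upper_speed f (h *\<^sub>R axis j 1) x \<le> ennreal (\<bar>h\<bar> * grad x $ j)" if "good i x L" for i x L j h
  proof -
    have "linear L" using that has_derivative_bounded_linear bounded_linear.linear unfolding good_def by blast
    then have "norm (L (h *\<^sub>R axis j 1)) = \<bar>h\<bar> * grad x $ j" unfolding good_grad(1)[OF that] by (simp add: linear_scale)
    then show ?thesis using good_upper_speed[OF lip that, of "h *\<^sub>R axis j 1"] by simp
  qed
  show "AE x in lborel. x \<in> U \<longrightarrow> (\<forall>z. upper_speed f z x \<le> ennreal (norm z * norm (grad x)))"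
    using AE_good by eventually_elim (use 1 in blast)
  show "AE x in lborel. x \<in> U \<longrightarrow> (\<forall>j h. upper_speed f (h *\<^sub>R axis j 1) x \<le> ennreal (\<bar>h\<bar> * grad x $ j))"
    using AE_good by eventually_elim (use 2 in blast)
qed

end

text \<open>The whole of \<open>U\<close> serves as every Lipschitz piece, so all lifts have the
  constant \<open>K * C\<close> and the gradient has a bound linear in \<open>C\<close>. Limit
  arguments see Lipschitz maps only through such a \<open>g\<close>.\<close>

lemma lipschitz_gradient:
  fixes F :: "real ^ 'm \<Rightarrow> ('h::{real_inner,polish_space}, 'q::finite) utuple"
  assumes K: "extends_lipschitz K TYPE(real ^ 'm \<Rightarrow> 'h ^ 'q)" "K \<ge> 0"
    and U: "open U" and lip: "C-lipschitz_on U F"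
  shows "\<exists>g :: real ^ 'm \<Rightarrow> real ^ 'm. g \<in> borel_measurable borel \<and> (\<forall>x j. g x $ j \<ge> 0) \<and>
    (\<forall>x. norm (g x) \<le> real CARD('m) * (K * C)) \<and>
    (\<forall>V p. V \<in> sets borel \<longrightarrow> V \<subseteq> U \<longrightarrow> deriv_integral p U F V = (\<integral>\<^sup>+x\<in>V. ennreal (norm (g x) powr p) \<partial>lborel)) \<and>
    (AE x in lborel. x \<in> U \<longrightarrow> utuple_HS_norm (approx_deriv U F x) = norm (g x)) \<and>
    (AE x in lborel. x \<in> U \<longrightarrow> (\<forall>z. upper_speed F z x \<le> ennreal (norm z * norm (g x)))) \<and>
    (AE x in lborel. x \<in> U \<longrightarrow> (\<forall>j h. upper_speed F (h *\<^sub>R axis j 1) x \<le> ennreal (\<bar>h\<bar> * g x $ j)))"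
proof -
  have bm: "borel_map_on U F"
    unfolding borel_map_on_def using lipschitz_on_continuous_on[OF lip]
    by (rule borel_measurable_continuous_on_restrict)
  have C: "C \<ge> 0" using lip by (rule lipschitz_on_nonneg)
  have "\<exists>P Y M. sheet_cover U F P Y M \<and> (\<forall>i. \<exists>n::nat. M i = K * C)"
    by (rule sheet_cover_exists[OF K(1) U bm, where A="\<lambda>_. U" and L="\<lambda>_. C"]) (use U lip in auto)
  then obtain P Y M where sc: "sheet_cover U F P Y M" and M: "\<And>i. M i = K * C" by blast
  interpret sheet_cover U F P Y M by (rule sc)
  show ?thesis
  proof (intro exI[of _ grad] conjI allI impI)
    show "norm (grad x) \<le> real CARD('m) * (K * C)" for x
      by (rule grad_le) (use M K(2) C in auto)
    show "AE x in lborel. x \<in> U \<longrightarrow> utuple_HS_norm (approx_deriv U F x) = norm (grad x)"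
      using AE_approx_deriv by eventually_elim blast
  qed (fact borel_measurable_grad grad_nonneg deriv_integral_eq AE_upper_speed_le[OF lip])+
qed

section \<open>Convergence in the mean\<close>

lemma Lp_dist_tendsto_iff:
  fixes f :: "real ^ 'm \<Rightarrow> ('h::real_normed_vector, 'q::finite) utuple"
  assumes p: "p > 0"
  shows "(\<lambda>j. Lp_dist p U f (F j)) \<longlonglongrightarrow> 0 \<longleftrightarrow>
    (\<lambda>j. \<integral>\<^sup>+x\<in>U. ennreal (dist (f x) (F j x) powr p) \<partial>lborel) \<longlonglongrightarrow> 0"
proof -
  define I where "I j = (\<integral>\<^sup>+x\<in>U. ennreal (dist (f x) (F j x) powr p) \<partial>lborel)" for j
  have L: "Lp_dist p U f (F j) = (if I j = \<infinity> then \<infinity> else ennreal (enn2real (I j) powr (1 / p)))" for j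
    by (simp add: Lp_dist_def I_def nn_integral_completion Let_def)
  have fin: "\<forall>\<^sub>F j in sequentially. v j \<noteq> \<infinity>" if "v \<longlonglongrightarrow> (0::ennreal)" for v
  proof -
    have "\<forall>\<^sub>F j in sequentially. v j < 1" using that by (rule order_tendstoD) simp
    then show ?thesis by eventually_elim auto
  qed
  show ?thesis unfolding I_def[symmetric]
  proof
    assume l: "(\<lambda>j. Lp_dist p U f (F j)) \<longlonglongrightarrow> 0"
    have e: "\<forall>\<^sub>F j in sequentially. I j \<noteq> \<infinity>" using fin[OF l] by eventually_elim (auto simp: L split: if_splits)
    have e2: "\<forall>\<^sub>F j in sequentially. enn2real (Lp_dist p U f (F j)) powr p = enn2real (I j)"
      using e by eventually_elim (use p in \<open>simp add: L powr_powr\<close>)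
    have "(\<lambda>j. enn2real (Lp_dist p U f (F j))) \<longlonglongrightarrow> 0" using l by (intro tendsto_enn2real) auto
    then have "(\<lambda>j. enn2real (Lp_dist p U f (F j)) powr p) \<longlonglongrightarrow> 0"
      by (rule tendsto_zero_powrI[OF _ tendsto_const]) (use p in auto)
    then have "(\<lambda>j. enn2real (I j)) \<longlonglongrightarrow> 0" using tendsto_cong[OF e2] by blast
    then have "(\<lambda>j. ennreal (enn2real (I j))) \<longlonglongrightarrow> 0" by (simp add: ennreal_tendsto_0_iff)
    moreover have "\<forall>\<^sub>F j in sequentially. ennreal (enn2real (I j)) = I j"
      using e by eventually_elim (simp add: less_top)
    ultimately show "I \<longlonglongrightarrow> 0" by (subst (asm) tendsto_cong)
  next
    assume l: "I \<longlonglongrightarrow> 0"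
    have "(\<lambda>j. enn2real (I j)) \<longlonglongrightarrow> 0" using l by (intro tendsto_enn2real) auto
    then have "(\<lambda>j. enn2real (I j) powr (1 / p)) \<longlonglongrightarrow> 0"
      by (rule tendsto_zero_powrI[OF _ tendsto_const]) (use p in auto)
    then have "(\<lambda>j. ennreal (enn2real (I j) powr (1 / p))) \<longlonglongrightarrow> 0" by (simp add: ennreal_tendsto_0_iff)
    moreover have "\<forall>\<^sub>F j in sequentially. ennreal (enn2real (I j) powr (1 / p)) = Lp_dist p U f (F j)"
      using fin[OF l] by eventually_elim (simp add: L)
    ultimately show "(\<lambda>j. Lp_dist p U f (F j)) \<longlonglongrightarrow> 0" by (subst (asm) tendsto_cong)
  qed
qed

lemma fast_subsequence:
  fixes v :: "nat \<Rightarrow> ennreal"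
  assumes "v \<longlonglongrightarrow> 0"
  obtains k :: "nat \<Rightarrow> nat" where "strict_mono k" "\<And>i. v (k i) \<le> ennreal ((1/2) ^ i)"
proof -
  have "\<exists>N. \<forall>n\<ge>N. v n \<le> ennreal ((1/2) ^ i)" for i :: nat
  proof -
    have "\<forall>\<^sub>F n in sequentially. v n < ennreal ((1/2) ^ i)" using assms by (rule order_tendstoD) simp
    then show ?thesis unfolding eventually_sequentially by (meson less_imp_le)
  qed
  then obtain N where N: "\<And>i n. n \<ge> N i \<Longrightarrow> v n \<le> ennreal ((1/2) ^ i)" by metis
  define k where "k i = (\<Sum>j\<le>i. N j) + i" for i
  have "k i < k (Suc i)" for i by (simp add: k_def)
  then have "strict_mono k" by (simp add: strict_mono_Suc_iff)
  moreover have "N i \<le> k i" for i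
    using member_le_sum[of i "{..i}" N] by (simp add: k_def)
  ultimately show ?thesis using that N by blast
qed

lemma AE_tendsto_subsequence:
  fixes A :: "nat \<Rightarrow> 'a \<Rightarrow> ennreal"
  assumes [measurable]: "\<And>i. A i \<in> borel_measurable M" and lim: "(\<lambda>i. \<integral>\<^sup>+x. A i x \<partial>M) \<longlonglongrightarrow> 0"
  obtains k :: "nat \<Rightarrow> nat" where "strict_mono k" "AE x in M. (\<lambda>i. A (k i) x) \<longlonglongrightarrow> 0"
proof -
  obtain k where k: "strict_mono k" "\<And>i. (\<integral>\<^sup>+x. A (k i) x \<partial>M) \<le> ennreal ((1/2) ^ i)"
    using fast_subsequence[OF lim] by blast
  have "AE x in M. (\<lambda>i. A (k i) x) \<longlonglongrightarrow> 0" by (rule AE_tendsto_zero[OF _ k(2)]) measurable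
  then show ?thesis using k(1) that by blast
qed

lemma Lp_AE_subsequence:
  fixes f :: "real ^ 'm \<Rightarrow> ('h::{real_inner,polish_space}, 'q::finite) utuple"
  assumes p: "p > 0" and U: "open U" and f: "borel_map_on U f" and F: "\<And>j. borel_map_on U (F j)"
    and lim: "(\<lambda>j. Lp_dist p U f (F j)) \<longlonglongrightarrow> 0"
  obtains k :: "nat \<Rightarrow> nat" where "strict_mono k" "AE x in lborel. x \<in> U \<longrightarrow> (\<lambda>j. F (k j) x) \<longlonglongrightarrow> f x"
proof -
  have [measurable]: "U \<in> sets borel" using U by simp
  define g where "g x = (if x \<in> U then f x else undefined)" for x
  define G where "G j x = (if x \<in> U then F j x else undefined)" for j x
  have [measurable]: "g \<in> borel_measurable borel" unfolding g_def using f by (rule borel_map_on_total) simp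
  have [measurable]: "G j \<in> borel_measurable borel" for j unfolding G_def using F by (rule borel_map_on_total) simp
  define A where "A j x = ennreal (dist (g x) (G j x) powr p) * indicator U x" for j x
  have "(\<lambda>j. \<integral>\<^sup>+x. A j x \<partial>lborel) \<longlonglongrightarrow> 0"
  proof -
    have "(\<integral>\<^sup>+x. A j x \<partial>lborel) = (\<integral>\<^sup>+x\<in>U. ennreal (dist (f x) (F j x) powr p) \<partial>lborel)" for j
      by (intro nn_integral_cong) (simp add: A_def g_def G_def indicator_def)
    then show ?thesis using lim by (simp add: Lp_dist_tendsto_iff[OF p])
  qed
  moreover have "A j \<in> borel_measurable lborel" for j unfolding A_def by measurable
  ultimately obtain k where k: "strict_mono k" "AE x in lborel. (\<lambda>i. A (k i) x) \<longlonglongrightarrow> 0"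
    using AE_tendsto_subsequence by metis
  have "AE x in lborel. x \<in> U \<longrightarrow> (\<lambda>j. F (k j) x) \<longlonglongrightarrow> f x"
    using k(2)
  proof eventually_elim
    case (elim x)
    show ?case
    proof
      assume x: "x \<in> U"
      have "(\<lambda>i. dist (f x) (F (k i) x) powr p) \<longlonglongrightarrow> 0"
        using elim x by (simp add: A_def g_def G_def ennreal_tendsto_0_iff)
      then have "(\<lambda>i. (dist (f x) (F (k i) x) powr p) powr (1 / p)) \<longlonglongrightarrow> 0"
        by (rule tendsto_zero_powrI[OF _ tendsto_const]) (use p in auto)
      then have "(\<lambda>i. dist (F (k i) x) (f x)) \<longlonglongrightarrow> 0" using p by (simp add: powr_powr dist_commute)
      then show "(\<lambda>j. F (k j) x) \<longlonglongrightarrow> f x" by (rule tendsto_dist_iff[THEN iffD2])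
    qed
  qed
  then show ?thesis using k(1) that by blast
qed

section \<open>Lipschitz restrictions of Sobolev maps\<close>

lemma AE_translate:
  fixes z :: "'a::euclidean_space"
  assumes "AE x in lborel. Q x" shows "AE x in lborel. Q (x + z)"
proof -
  obtain N where N: "{x. \<not> Q x} \<subseteq> N" "N \<in> null_sets lborel" using assms by (auto elim: AE_E simp: null_sets_def)
  have [measurable]: "N \<in> sets borel" using N(2) by auto
  have "(\<integral>\<^sup>+x. indicator N (x + z) \<partial>lborel) = (\<integral>\<^sup>+x. indicator N x \<partial>lborel)"
    by (rule nn_integral_lborel_shift) measurable
  also have "\<dots> = 0" using null_setsD1[OF N(2)] by simp
  finally have "AE x in lborel. indicator N (x + z) = (0::ennreal)" by (subst (asm) nn_integral_0_iff_AE) auto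
  then show ?thesis by eventually_elim (use N(1) in \<open>auto simp: indicator_def split: if_splits\<close>)
qed

lemma Liminf_mult_const_ennreal:
  fixes a :: "nat \<Rightarrow> ennreal"
  assumes "c < top"
  shows "liminf (\<lambda>j. c * a j) = c * liminf a"
  by (rule Liminf_compose_continuous_mono)
     (use assms in \<open>auto intro!: ennreal_continuous_on_cmult continuous_on_id monoI mult_left_mono\<close>)

text \<open>Fatou's lemma in \<open>z\<close>, at each vertex \<open>x\<close> where
  \<open>F j x\<close> converges. Lower limits of maximal functions suffice, so the gradients need
  not converge in any sense.\<close>

lemma cone_average_limit:
  fixes f :: "'a::euclidean_space \<Rightarrow> 'x::{metric_space,second_countable_topology}"
  assumes U: "convex U" and Um[measurable]: "U \<in> sets borel"
    and f[measurable]: "f \<in> borel_measurable borel"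
    and lip: "\<And>j::nat. (C j)-lipschitz_on UNIV (F j)"
    and \<Gamma>[measurable]: "\<And>j. \<Gamma> j \<in> borel_measurable borel"
    and speed: "\<And>j. AE y in lborel. y \<in> U \<longrightarrow> (\<forall>z. upper_speed (F j) z y \<le> ennreal (norm z) * \<Gamma> j y)"
    and lim: "AE x in lborel. x \<in> U \<longrightarrow> (\<lambda>j. F j x) \<longlonglongrightarrow> f x"
  shows "AE x in lborel. x \<in> U \<longrightarrow> (\<forall>r\<in>{0<..<2}.
    (\<integral>\<^sup>+z\<in>ball 0 r. ennreal (dist (f (x + z)) (f x) / norm z) * indicator U (x + z) \<partial>lborel)
      \<le> liminf (\<lambda>j. maximal (\<lambda>y. \<Gamma> j y * indicator U y) x) * ball_vol TYPE('a) r)"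
proof -
  have [measurable]: "F j \<in> borel_measurable borel" for j
    by (rule borel_measurable_continuous_onI) (rule lipschitz_on_continuous_on[OF lip])
  show ?thesis
    using lim
  proof eventually_elim
    case (elim x)
    show ?case
    proof (intro impI ballI)
      fix r :: real assume x: "x \<in> U" and r: "r \<in> {0<..<2}"
      define I where "I j z = ennreal (dist (F j (x + z)) (F j x) / norm z) * indicator U (x + z) * indicator (ball 0 r) z" for j z
      have [measurable]: "I j \<in> borel_measurable lborel" for j unfolding I_def by measurable
      have AEz: "AE z in lborel. x + z \<in> U \<longrightarrow> (\<lambda>j. F j (x + z)) \<longlonglongrightarrow> f (x + z)"
        using AE_translate[OF lim, of x] by (simp add: add.commute)
      have 2: "(\<lambda>j. F j x) \<longlonglongrightarrow> f x" using elim x by blast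
      have "(\<integral>\<^sup>+z\<in>ball 0 r. ennreal (dist (f (x + z)) (f x) / norm z) * indicator U (x + z) \<partial>lborel) \<le>
        (\<integral>\<^sup>+z. liminf (\<lambda>j. I j z) \<partial>lborel)"
      proof (rule nn_integral_mono_AE)
        show "AE z in lborel. ennreal (dist (f (x + z)) (f x) / norm z) * indicator U (x + z) * indicator (ball 0 r) z \<le> liminf (\<lambda>j. I j z)"
          using AEz
        proof eventually_elim
          case (elim z)
          show ?case
          proof (cases "x + z \<in> U")
            case True
            then have 1: "(\<lambda>j. F j (x + z)) \<longlonglongrightarrow> f (x + z)" using elim by blast
            have "(\<lambda>j. dist (F j (x + z)) (F j x) * inverse (norm z)) \<longlonglongrightarrow> dist (f (x + z)) (f x) * inverse (norm z)"
              by (intro tendsto_mult tendsto_dist 1 2 tendsto_const)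
            then have "(\<lambda>j. ennreal (dist (F j (x + z)) (F j x) / norm z)) \<longlonglongrightarrow> ennreal (dist (f (x + z)) (f x) / norm z)"
              by (simp add: divide_inverse tendsto_ennrealI)
            then have "liminf (\<lambda>j. ennreal (dist (F j (x + z)) (F j x) / norm z)) = ennreal (dist (f (x + z)) (f x) / norm z)"
              by (intro lim_imp_Liminf sequentially_bot)
            then show ?thesis using True by (cases "z \<in> ball 0 r") (simp_all add: I_def)
          qed simp
        qed
      qed
      also have "\<dots> \<le> liminf (\<lambda>j. \<integral>\<^sup>+z. I j z \<partial>lborel)" by (rule nn_integral_liminf) measurable
      also have "\<dots> \<le> liminf (\<lambda>j. ball_vol TYPE('a) r * maximal (\<lambda>y. \<Gamma> j y * indicator U y) x)"
      proof (intro Liminf_mono always_eventually allI)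
        fix j
        have "(\<integral>\<^sup>+z\<in>ball 0 r. ennreal (dist (F j (x + z)) (F j x) / norm z) * indicator U (x + z) \<partial>lborel)
            \<le> maximal (\<lambda>y. \<Gamma> j y * indicator U y) x * ball_vol TYPE('a) r"
          using x r by (intro lipschitz_cone_average[OF lipschitz_on_subset[OF lip] U \<Gamma> Um speed]) auto
        then show "(\<integral>\<^sup>+z. I j z \<partial>lborel) \<le> ball_vol TYPE('a) r * maximal (\<lambda>y. \<Gamma> j y * indicator U y) x"
          by (simp add: I_def mult.commute)
      qed
      also have "\<dots> = ball_vol TYPE('a) r * liminf (\<lambda>j. maximal (\<lambda>y. \<Gamma> j y * indicator U y) x)"
        by (rule Liminf_mult_const_ennreal) (use ball_vol_finite in auto)
      finally show "(\<integral>\<^sup>+z\<in>ball 0 r. ennreal (dist (f (x + z)) (f x) / norm z) * indicator U (x + z) \<partial>lborel)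
        \<le> liminf (\<lambda>j. maximal (\<lambda>y. \<Gamma> j y * indicator U y) x) * ball_vol TYPE('a) r" by (simp add: mult.commute)
    qed
  qed
qed

text \<open>The triangle inequality through \<open>w\<close> is averaged over a ball
  \<open>W\<close> of radius \<open>r / 4\<close> that lies within \<open>r\<close> of both points.
  The factor 2 counts the two cones and \<open>4 ^ DIM('a)\<close> is the ratio of volumes.\<close>

lemma dist_le_cone_averages:
  fixes f :: "'a::euclidean_space \<Rightarrow> 'x::{metric_space,second_countable_topology}"
  assumes f[measurable]: "f \<in> borel_measurable borel" and xy: "x \<in> ball 0 1" "y \<in> ball 0 1" and l: "l \<ge> 0"
    and cone: "\<And>w r. w \<in> {x, y} \<Longrightarrow> 0 < r \<Longrightarrow> r < 2 \<Longrightarrow>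
      (\<integral>\<^sup>+z\<in>ball 0 r. ennreal (dist (f (w + z)) (f w) / norm z) * indicator (ball 0 1) (w + z) \<partial>lborel)
        \<le> ennreal l * ball_vol TYPE('a) r"
  shows "dist (f x) (f y) \<le> 2 * 4 ^ DIM('a) * l * dist x y"
proof (cases "x = y")
  case False
  define r where "r = dist x y"
  have r: "0 < r" "r < 2" using False xy dist_triangle2[of x y 0] by (auto simp: r_def)
  define mid where "mid = (1/2) *\<^sub>R (x + y)"
  have midx: "dist mid x = r / 2" "dist mid y = r / 2"
  proof -
    have "mid - x = (1/2) *\<^sub>R (y - x)" "mid - y = (1/2) *\<^sub>R (x - y)" by (simp_all add: mid_def algebra_simps flip: scaleR_add_left)
    then show "dist mid x = r / 2" "dist mid y = r / 2" by (simp_all add: dist_norm r_def norm_minus_commute)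
  qed
  have mid1: "norm mid < 1"
  proof -
    have "norm (x + y) < 2" using xy norm_triangle_ineq[of x y] by simp
    then show ?thesis by (simp add: mid_def)
  qed
  \<comment> \<open>The midpoint is pulled towards the origin by at most \<open>r / 4\<close>, so
    that \<open>W\<close> stays in the unit ball and within \<open>r / 2 + r / 4 + r / 4\<close> of
    \<open>x\<close> and \<open>y\<close>.\<close>
  obtain c where c: "dist c mid \<le> r / 4" "norm c + r / 4 \<le> 1"
  proof (cases "norm mid \<le> r / 4")
    case True
    then show ?thesis using that[of 0] r by simp
  next
    case False
    define c where "c = (1 - r / 4 / norm mid) *\<^sub>R mid"
    have m0: "norm mid > 0" using False r by linarith
    have "mid - c = (r / 4 / norm mid) *\<^sub>R mid" by (simp add: c_def algebra_simps)
    then have "dist mid c = r / 4" using m0 r by (simp add: dist_norm)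
    moreover have "norm c = norm mid - r / 4"
    proof -
      have "1 - r / 4 / norm mid \<ge> 0" using False m0 by (simp add: divide_le_eq)
      then have "norm c = (1 - r / 4 / norm mid) * norm mid" unfolding c_def norm_scaleR by simp
      also have "\<dots> = norm mid - r / 4" using m0 by (simp add: left_diff_distrib)
      finally show ?thesis .
    qed
    ultimately show ?thesis using that[of c] mid1 by (simp add: dist_commute)
  qed
  define W where "W = ball c (r / 4)"
  have Wm[measurable]: "W \<in> sets borel" by (simp add: W_def)
  have WU: "W \<subseteq> ball 0 1"
  proof
    fix w assume "w \<in> W"
    then show "w \<in> ball 0 1" using c(2) dist_triangle2[of w 0 c] by (simp add: W_def dist_commute)
  qed
  have Wb: "dist v w < r" if "v \<in> {x, y}" "w \<in> W" for v w
  proof -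
    have "dist v mid = r / 2" using that(1) midx by (auto simp: dist_commute)
    then show ?thesis using that(2) c(1) dist_triangle[of v w mid] dist_triangle[of mid w c] unfolding W_def
      by (simp add: dist_commute)
  qed
  define A where "A v w = ennreal (dist (f w) (f v) / norm (w - v)) * indicator (ball 0 1) w * indicator (ball 0 r) (w - v)" for v w
  have [measurable]: "A v \<in> borel_measurable borel" for v unfolding A_def by measurable
  have Aint: "(\<integral>\<^sup>+w. A v w \<partial>lborel) \<le> ennreal l * ball_vol TYPE('a) r" if v: "v \<in> {x, y}" for v
  proof -
    have "(\<integral>\<^sup>+w. A v w \<partial>lborel) = (\<integral>\<^sup>+z. A v (z + v) \<partial>lborel)" by (rule nn_integral_lborel_shift[symmetric]) measurable
    also have "\<dots> = (\<integral>\<^sup>+z\<in>ball 0 r. ennreal (dist (f (v + z)) (f v) / norm z) * indicator (ball 0 1) (v + z) \<partial>lborel)"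
      by (intro nn_integral_cong) (simp add: A_def add.commute)
    also have "\<dots> \<le> ennreal l * ball_vol TYPE('a) r" using v r by (rule cone)
    finally show ?thesis .
  qed
  have pt: "ennreal (dist (f x) (f y)) * indicator W w \<le> ennreal r * (A x w + A y w)" for w
  proof (cases "w \<in> W")
    case True
    have s: "dist (f w) (f v) \<le> r * (dist (f w) (f v) / norm (w - v))" if "v \<in> {x, y}" for v
    proof (cases "w = v")
      case False
      then have "norm (w - v) > 0" by simp
      moreover have "norm (w - v) \<le> r" using Wb[OF that True] by (simp add: dist_norm norm_minus_commute)
      ultimately have "dist (f w) (f v) * norm (w - v) \<le> r * dist (f w) (f v)" by (metis mult.commute mult_right_mono zero_le_dist)
      then show ?thesis using \<open>norm (w - v) > 0\<close> by (simp add: pos_le_divide_eq)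
    qed simp
    have Av: "A v w = ennreal (dist (f w) (f v) / norm (w - v))" if "v \<in> {x, y}" for v
      using Wb[OF that True] WU True by (auto simp: A_def dist_norm norm_minus_commute indicator_def)
    have "dist (f x) (f y) \<le> r * (dist (f w) (f x) / norm (w - x) + dist (f w) (f y) / norm (w - y))"
      using dist_triangle3[of "f x" "f y" "f w"] s[of x] s[of y] by (simp add: distrib_left)
    then have "ennreal (dist (f x) (f y)) \<le> ennreal (r * (dist (f w) (f x) / norm (w - x) + dist (f w) (f y) / norm (w - y)))"
      by (rule ennreal_leI)
    also have "\<dots> = ennreal r * (A x w + A y w)" using r by (simp add: Av ennreal_mult ennreal_plus)
    finally show ?thesis using True by simp
  qed simp
  have "ennreal (dist (f x) (f y)) * ball_vol TYPE('a) (r / 4) = (\<integral>\<^sup>+w\<in>W. ennreal (dist (f x) (f y)) \<partial>lborel)"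
    using r by (simp add: W_def nn_integral_cmult_indicator emeasure_ball_vol)
  also have "\<dots> \<le> (\<integral>\<^sup>+w. ennreal r * (A x w + A y w) \<partial>lborel)" by (intro nn_integral_mono pt)
  also have "\<dots> = ennreal r * ((\<integral>\<^sup>+w. A x w \<partial>lborel) + (\<integral>\<^sup>+w. A y w \<partial>lborel))"
    by (simp add: nn_integral_cmult nn_integral_add)
  also have "\<dots> \<le> ennreal r * (ennreal l * ball_vol TYPE('a) r + ennreal l * ball_vol TYPE('a) r)"
    by (intro mult_left_mono add_mono Aint) auto
  also have "ball_vol TYPE('a) r = ennreal (4 ^ DIM('a)) * ball_vol TYPE('a) (r / 4)"
    using ball_vol_scale[of 4 "r / 4", where 'a='a] by simp
  also have "ennreal r * (ennreal l * (ennreal (4 ^ DIM('a)) * ball_vol TYPE('a) (r / 4)) + ennreal l * (ennreal (4 ^ DIM('a)) * ball_vol TYPE('a) (r / 4)))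
    = ennreal (2 * 4 ^ DIM('a) * l * r) * ball_vol TYPE('a) (r / 4)"
  proof -
    have e: "ennreal l * (ennreal (4 ^ DIM('a)) * ball_vol TYPE('a) (r / 4)) + ennreal l * (ennreal (4 ^ DIM('a)) * ball_vol TYPE('a) (r / 4))
      = (ennreal 2 * (ennreal l * ennreal (4 ^ DIM('a)))) * ball_vol TYPE('a) (r / 4)"
      by (simp add: mult.assoc mult_2 distrib_right)
    have "ennreal (2 * 4 ^ DIM('a) * l * r) = ennreal (r * (2 * (l * 4 ^ DIM('a))))" by (simp add: mult_ac)
    also have "\<dots> = ennreal r * (ennreal 2 * (ennreal l * ennreal (4 ^ DIM('a))))"
      using r l by (simp only: ennreal_mult mult_nonneg_nonneg zero_le_numeral zero_le_power less_imp_le)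
    finally show ?thesis unfolding e by (simp add: mult.assoc)
  qed
  finally have "ball_vol TYPE('a) (r / 4) * ennreal (dist (f x) (f y)) \<le> ball_vol TYPE('a) (r / 4) * ennreal (2 * 4 ^ DIM('a) * l * r)"
    by (simp add: mult.commute)
  then have "ennreal (dist (f x) (f y)) \<le> ennreal (2 * 4 ^ DIM('a) * l * r)"
    using ball_vol_pos[of "r / 4", where 'a='a] ball_vol_finite[of "r / 4", where 'a='a] r
    by (subst (asm) ennreal_mult_le_mult_iff) auto
  then show ?thesis using l r by (simp add: r_def)
qed simp

lemma ennreal_terms_tendsto_zero:
  fixes u :: "nat \<Rightarrow> ennreal"
  assumes "(\<Sum>n. u n) \<noteq> top" shows "u \<longlonglongrightarrow> 0"
proof -
  have fin: "u n \<noteq> top" for n using assms ennreal_suminf_lessD[of u top n] by (simp add: less_top)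
  then have e: "u n = ennreal (enn2real (u n))" for n by (simp add: less_top)
  have "summable (\<lambda>n. enn2real (u n))"
    by (rule summable_suminf_not_top) (use assms e in auto)
  then have "(\<lambda>n. enn2real (u n)) \<longlonglongrightarrow> 0" by (rule summable_LIMSEQ_zero)
  then have "(\<lambda>n. ennreal (enn2real (u n))) \<longlonglongrightarrow> 0" by (simp add: ennreal_tendsto_0_iff)
  then show ?thesis using e by simp
qed

text \<open>The weighted sum of indicators of superlevel sets is dominated by the lower limit of the
  corresponding sums for the single maximal functions, so Fatou's lemma transfers the bound of
  \<open>maximal_strong_type\<close>.\<close>

lemma maximal_liminf_tail:
  fixes h :: "nat \<Rightarrow> 'a::euclidean_space \<Rightarrow> real"
  assumes [measurable]: "\<And>j. h j \<in> borel_measurable borel" and h: "\<And>j x. h j x \<ge> 0" and p: "p > 1"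
    and B: "\<And>j. (\<integral>\<^sup>+y. ennreal (h j y powr p) \<partial>lborel) \<le> B"
  shows "(\<Sum>n. ennreal (2 powr (p * real n)) *
      emeasure lborel {x. ennreal (2 ^ Suc n) < liminf (\<lambda>j. maximal (\<lambda>y. ennreal (h j y)) x)})
    \<le> 5 ^ DIM('a) * ennreal (2 powr (p - 1) / (2 powr (p - 1) - 1)) * B"
proof -
  define m where "m j x = maximal (\<lambda>y. ennreal (h j y)) x" for j x
  define G where "G x = liminf (\<lambda>j. m j x)" for x
  define a s where "a n = ennreal (2 powr (p * real n))" and "s n = ennreal (2 ^ Suc n)" for n
  define c where "c = 5 ^ DIM('a) * ennreal (2 powr (p - 1) / (2 powr (p - 1) - 1))"
  have [measurable]: "m j \<in> borel_measurable borel" for j unfolding m_def[abs_def] by measurable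
  have [measurable]: "G \<in> borel_measurable borel" unfolding G_def[abs_def] by measurable
  define \<Phi> where "\<Phi> j x = (\<Sum>n. a n * indicator {x. s n < m j x} x)" for j x
  have [measurable]: "\<Phi> j \<in> borel_measurable lborel" for j unfolding \<Phi>_def by measurable
  have \<Phi>int: "(\<integral>\<^sup>+x. \<Phi> j x \<partial>lborel) \<le> c * B" for j
  proof -
    have "(\<integral>\<^sup>+x. \<Phi> j x \<partial>lborel) = (\<Sum>n. \<integral>\<^sup>+x. a n * indicator {x. s n < m j x} x \<partial>lborel)"
      unfolding \<Phi>_def by (rule nn_integral_suminf) measurable
    also have "\<dots> = (\<Sum>n. a n * emeasure lborel {x. s n < m j x})" by (simp add: nn_integral_cmult_indicator)
    also have "\<dots> \<le> c * (\<integral>\<^sup>+y. ennreal (h j y powr p) \<partial>lborel)"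
      unfolding a_def s_def m_def c_def using h p by (intro maximal_strong_type) auto
    also have "\<dots> \<le> c * B" by (intro mult_left_mono B) auto
    finally show ?thesis .
  qed
  \<comment> \<open>In a finite partial sum every strict inequality for the lower limit holds
    eventually for the members.\<close>
  have pt: "(\<Sum>n. a n * indicator {x. s n < G x} x) \<le> liminf (\<lambda>j. \<Phi> j x)" for x
    unfolding suminf_eq_SUP
  proof (rule SUP_least)
    fix N :: nat
    have "\<forall>\<^sub>F j in sequentially. \<forall>n\<in>{..<N}. s n < G x \<longrightarrow> s n < m j x"
    proof (intro eventually_ball_finite ballI)
      fix n
      show "\<forall>\<^sub>F j in sequentially. s n < G x \<longrightarrow> s n < m j x"
        by (cases "s n < G x") (auto simp: G_def dest: less_LiminfD)
    qed simp
    then show "(\<Sum>n<N. a n * indicator {x. s n < G x} x) \<le> liminf (\<lambda>j. \<Phi> j x)"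
    proof (intro Liminf_bounded, eventually_elim)
      case (elim j)
      have "(\<Sum>n<N. a n * indicator {x. s n < G x} x) \<le> (\<Sum>n<N. a n * indicator {x. s n < m j x} x)"
        using elim by (intro sum_mono mult_left_mono) (auto simp: indicator_def)
      also have "\<dots> \<le> \<Phi> j x" unfolding \<Phi>_def by (rule sum_le_suminf) auto
      finally show ?case .
    qed
  qed
  have "(\<Sum>n. a n * emeasure lborel {x. s n < G x}) = (\<Sum>n. \<integral>\<^sup>+x. a n * indicator {x. s n < G x} x \<partial>lborel)"
    by (simp add: nn_integral_cmult_indicator)
  also have "\<dots> = (\<integral>\<^sup>+x. (\<Sum>n. a n * indicator {x. s n < G x} x) \<partial>lborel)"
    by (rule nn_integral_suminf[symmetric]) measurable
  also have "\<dots> \<le> (\<integral>\<^sup>+x. liminf (\<lambda>j. \<Phi> j x) \<partial>lborel)" by (intro nn_integral_mono pt)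
  also have "\<dots> \<le> liminf (\<lambda>j. \<integral>\<^sup>+x. \<Phi> j x \<partial>lborel)" by (rule nn_integral_liminf) measurable
  also have "\<dots> \<le> c * B" using \<Phi>int by (intro Liminf_le always_eventually) auto
  finally show ?thesis unfolding a_def s_def G_def m_def c_def .
qed

lemma lipschitz_borel_map_on: "C-lipschitz_on U F \<Longrightarrow> borel_map_on U F"
  unfolding borel_map_on_def
  by (rule borel_measurable_continuous_on_restrict) (rule lipschitz_on_continuous_on)

text \<open>\<open>G\<close> is the lower limit of the maximal functions, set to infinity on the
  null set where the cone estimate fails. On its sublevel sets the estimate then holds at every
  point, as \<open>dist_le_cone_averages\<close> requires at both ends.\<close>

lemma sobolev_lusin:
  fixes f :: "real ^ 'm \<Rightarrow> ('h::{real_inner,polish_space}, 'q::finite) utuple"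
  assumes p: "1 < p" and f: "f \<in> W1p_class p (ball 0 1)"
  shows "\<exists>G :: real ^ 'm \<Rightarrow> ennreal. G \<in> borel_measurable borel \<and>
    (\<forall>l\<ge>0. (2 * 4 ^ CARD('m) * l)-lipschitz_on {x \<in> ball 0 1. G x \<le> ennreal l} f) \<and>
    (\<lambda>n. ennreal (2 powr (p * real n)) * emeasure lborel {x \<in> ball 0 1. ennreal (2 ^ Suc n) < G x}) \<longlonglongrightarrow> 0"
proof -
  define U where "U = (ball 0 1 :: (real ^ 'm) set)"
  have [measurable]: "U \<in> sets borel" and openU: "open U" and convU: "convex U" by (auto simp: U_def)
  obtain F0 where F0: "\<And>j::nat. lipschitz_map_on UNIV (F0 j)" "(SUP j. deriv_integral p UNIV (F0 j) U) < \<infinity>"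
    "(\<lambda>j. Lp_dist p U f (F0 j)) \<longlonglongrightarrow> 0" and fb: "borel_map_on U f"
    using f unfolding W1p_class_def Lp_class_def U_def by blast
  obtain C0 where C0: "\<And>j. (C0 j)-lipschitz_on UNIV (F0 j)" using F0(1) unfolding lipschitz_map_on_def by metis
  have bF0: "borel_map_on U (F0 j)" for j
    by (rule lipschitz_borel_map_on[OF lipschitz_on_subset[OF C0]]) simp
  obtain k :: "nat \<Rightarrow> nat" where k: "strict_mono k" "AE x in lborel. x \<in> U \<longrightarrow> (\<lambda>j. F0 (k j) x) \<longlonglongrightarrow> f x"
    by (rule Lp_AE_subsequence[OF _ openU fb bF0 F0(3)]) (use p in auto)
  define F where "F j = F0 (k j)" for j
  define B where "B = (SUP j. deriv_integral p UNIV (F0 j) U)"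
  have FB: "deriv_integral p UNIV (F j) U \<le> B" for j unfolding F_def B_def by (rule SUP_upper) simp
  have lipF: "(C0 (k j))-lipschitz_on UNIV (F j)" for j unfolding F_def by (rule C0)
  obtain K where K: "K \<ge> 1" "extends_lipschitz K TYPE(real ^ 'm \<Rightarrow> 'h ^ 'q)"
    using extends_lipschitz_exists[OF has_cones_normed] by blast
  have K0: "K \<ge> 0" using K by simp
  have "\<exists>g :: real ^ 'm \<Rightarrow> real ^ 'm. g \<in> borel_measurable borel \<and> deriv_integral p UNIV (F j) U = (\<integral>\<^sup>+x\<in>U. ennreal (norm (g x) powr p) \<partial>lborel) \<and>
     (AE x in lborel. x \<in> UNIV \<longrightarrow> (\<forall>z. upper_speed (F j) z x \<le> ennreal (norm z * norm (g x))))" (is "\<exists>g. ?grad j g") for j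
    using lipschitz_gradient[OF K(2) K0 open_UNIV lipF, of j] by (elim exE conjE, intro exI conjI) auto
  then obtain g where G: "\<And>j. ?grad j (g j)" using choice[of ?grad] by blast
  then have g[measurable]: "g j \<in> borel_measurable borel" and gint: "deriv_integral p UNIV (F j) U = (\<integral>\<^sup>+x\<in>U. ennreal (norm (g j x) powr p) \<partial>lborel)"
    and speed: "AE x in lborel. x \<in> UNIV \<longrightarrow> (\<forall>z. upper_speed (F j) z x \<le> ennreal (norm z * norm (g j x)))" for j by blast+
  \<comment> \<open>Cut off outside the ball, where the energies of the approximating maps are not
    controlled.\<close>
  define h where "h j y = norm (g j y) * indicator U y" for j y
  have [measurable]: "h j \<in> borel_measurable borel" for j unfolding h_def by measurable
  have hint: "(\<integral>\<^sup>+y. ennreal (h j y powr p) \<partial>lborel) \<le> B" for j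
  proof -
    have "(\<integral>\<^sup>+y. ennreal (h j y powr p) \<partial>lborel) = (\<integral>\<^sup>+x\<in>U. ennreal (norm (g j x) powr p) \<partial>lborel)"
      by (intro nn_integral_cong) (simp add: h_def indicator_def)
    then show ?thesis using FB[of j] gint[of j] by simp
  qed
  define G0 where "G0 x = liminf (\<lambda>j. maximal (\<lambda>y. ennreal (h j y)) x)" for x
  have [measurable]: "G0 \<in> borel_measurable borel" unfolding G0_def by measurable
  define f0 where "f0 x = (if x \<in> U then f x else undefined)" for x
  have f0m[measurable]: "f0 \<in> borel_measurable borel" unfolding f0_def using fb by (rule borel_map_on_total) simp
  have cone: "AE x in lborel. x \<in> U \<longrightarrow> (\<forall>r\<in>{0<..<2}.
    (\<integral>\<^sup>+z\<in>ball 0 r. ennreal (dist (f0 (x + z)) (f0 x) / norm z) * indicator U (x + z) \<partial>lborel)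
      \<le> G0 x * ball_vol TYPE(real ^ 'm) r)"
  proof -
    have e: "(\<lambda>y. ennreal (norm (g j y)) * indicator U y) = (\<lambda>y. ennreal (h j y))" for j
      by (auto simp: h_def indicator_def)
    have "AE x in lborel. x \<in> U \<longrightarrow> (\<forall>r\<in>{0<..<2}.
      (\<integral>\<^sup>+z\<in>ball 0 r. ennreal (dist (f0 (x + z)) (f0 x) / norm z) * indicator U (x + z) \<partial>lborel)
      \<le> liminf (\<lambda>j. maximal (\<lambda>y. ennreal (norm (g j y)) * indicator U y) x) * ball_vol TYPE(real ^ 'm) r)"
    proof (rule cone_average_limit[where F=F, OF convU _ f0m lipF])
      show "AE y in lborel. y \<in> U \<longrightarrow> (\<forall>z. upper_speed (F j) z y \<le> ennreal (norm z) * ennreal (norm (g j y)))" for j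
        using speed[of j] by eventually_elim (simp add: ennreal_mult)
      show "AE x in lborel. x \<in> U \<longrightarrow> (\<lambda>j. F j x) \<longlonglongrightarrow> f0 x"
        using k(2) by eventually_elim (simp add: f0_def F_def)
    qed simp_all
    then show ?thesis unfolding e G0_def .
  qed
  obtain N where N: "{x. \<not> (x \<in> U \<longrightarrow> (\<forall>r\<in>{0<..<2}.
    (\<integral>\<^sup>+z\<in>ball 0 r. ennreal (dist (f0 (x + z)) (f0 x) / norm z) * indicator U (x + z) \<partial>lborel)
      \<le> G0 x * ball_vol TYPE(real ^ 'm) r))} \<subseteq> N" "N \<in> null_sets lborel"
    using cone by (auto elim: AE_E simp: null_sets_def)
  have Nm[measurable]: "N \<in> sets borel" using N(2) by auto
  define G where "G x = (if x \<in> N then top else G0 x)" for x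
  have Gm: "G \<in> borel_measurable borel" unfolding G_def by measurable
  have lip: "(2 * 4 ^ CARD('m) * l)-lipschitz_on {x \<in> U. G x \<le> ennreal l} f" if l: "l \<ge> 0" for l
  proof (rule lipschitz_onI)
    fix x y assume x: "x \<in> {x \<in> U. G x \<le> ennreal l}" and y: "y \<in> {x \<in> U. G x \<le> ennreal l}"
    have "dist (f0 x) (f0 y) \<le> 2 * 4 ^ DIM(real ^ 'm) * l * dist x y"
    proof (rule dist_le_cone_averages[OF f0m _ _ l])
      show "x \<in> ball 0 1" "y \<in> ball 0 1" using x y by (auto simp: U_def)
      fix w r assume w: "w \<in> {x, y}" and r: "0 < r" "r < (2::real)"
      have w1: "w \<in> U" "G w \<le> ennreal l" using x y w by auto
      then have "w \<notin> N" by (auto simp: G_def top_unique)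
      then have G0l: "G0 w \<le> ennreal l" using w1(2) by (simp add: G_def)
      have "w \<in> U \<longrightarrow> (\<forall>r\<in>{0<..<2}.
        (\<integral>\<^sup>+z\<in>ball 0 r. ennreal (dist (f0 (w + z)) (f0 w) / norm z) * indicator U (w + z) \<partial>lborel)
          \<le> G0 w * ball_vol TYPE(real ^ 'm) r)" using N(1) \<open>w \<notin> N\<close> by blast
      then have "(\<integral>\<^sup>+z\<in>ball 0 r. ennreal (dist (f0 (w + z)) (f0 w) / norm z) * indicator U (w + z) \<partial>lborel)
        \<le> G0 w * ball_vol TYPE(real ^ 'm) r" using w1(1) r greaterThanLessThan_iff by blast
      also have "\<dots> \<le> ennreal l * ball_vol TYPE(real ^ 'm) r" using G0l by (intro mult_right_mono) auto
      finally show "(\<integral>\<^sup>+z\<in>ball 0 r. ennreal (dist (f0 (w + z)) (f0 w) / norm z) * indicator (ball 0 1) (w + z) \<partial>lborel)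
        \<le> ennreal l * ball_vol TYPE(real ^ 'm) r" unfolding U_def .
    qed
    then show "dist (f x) (f y) \<le> 2 * 4 ^ CARD('m) * l * dist x y" using x y by (simp add: f0_def)
  qed (use l in simp)
  have "(\<Sum>n. ennreal (2 powr (p * real n)) * emeasure lborel {x. ennreal (2 ^ Suc n) < G0 x})
    \<le> 5 ^ DIM(real ^ 'm) * ennreal (2 powr (p - 1) / (2 powr (p - 1) - 1)) * B"
    unfolding G0_def by (rule maximal_liminf_tail[OF _ _ p hint]) (auto simp: h_def)
  also have "\<dots> < top"
    using F0(2) unfolding B_def[symmetric] by (auto simp: ennreal_mult_less_top power_less_top_ennreal)
  finally have t: "(\<lambda>n. ennreal (2 powr (p * real n)) * emeasure lborel {x. ennreal (2 ^ Suc n) < G0 x}) \<longlonglongrightarrow> 0"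
    by (intro ennreal_terms_tendsto_zero) auto
  have tail: "(\<lambda>n. ennreal (2 powr (p * real n)) * emeasure lborel {x \<in> U. ennreal (2 ^ Suc n) < G x}) \<longlonglongrightarrow> 0"
  proof (rule tendsto_sandwich[OF _ _ tendsto_const t])
    show "\<forall>\<^sub>F n in sequentially. ennreal (2 powr (p * real n)) * emeasure lborel {x \<in> U. ennreal (2 ^ Suc n) < G x} \<le>
      ennreal (2 powr (p * real n)) * emeasure lborel {x. ennreal (2 ^ Suc n) < G0 x}"
    proof (intro always_eventually allI mult_left_mono)
      fix n
      have "emeasure lborel {x \<in> U. ennreal (2 ^ Suc n) < G x} \<le> emeasure lborel ({x. ennreal (2 ^ Suc n) < G0 x} \<union> N)"
        by (intro emeasure_mono) (auto simp: G_def split: if_splits)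
      also have "\<dots> = emeasure lborel {x. ennreal (2 ^ Suc n) < G0 x}" by (rule emeasure_Un_null_set) (use N in auto)
      finally show "emeasure lborel {x \<in> U. ennreal (2 ^ Suc n) < G x} \<le> emeasure lborel {x. ennreal (2 ^ Suc n) < G0 x}" .
    qed simp
  qed simp
  show ?thesis using Gm lip tail unfolding U_def by blast
qed

section \<open>Lower semicontinuity\<close>

lemma borel_measurable_vec_nth[measurable (raw)]:
  fixes g :: "'a \<Rightarrow> real ^ 'm"
  assumes "g \<in> borel_measurable M" shows "(\<lambda>x. g x $ i) \<in> borel_measurable M"
  by (rule borel_measurable_continuous_on[OF _ assms, of "\<lambda>v. v $ i"]) (intro continuous_intros)

text \<open>Points of \<open>P\<close> stay in an open superset \<open>T\<close> under small shifts,
  so the measure of those leaving \<open>T\<close> vanishes by dominated convergence; the rest land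
  in \<open>T - P\<close>, which is small by outer regularity.\<close>

lemma translate_escape_tendsto_zero:
  fixes P :: "'a::euclidean_space set"
  assumes P[measurable]: "P \<in> sets borel" and fin: "emeasure lborel P < \<infinity>" and z: "z \<longlonglongrightarrow> 0"
  shows "(\<lambda>n. emeasure lborel {x \<in> P. x + z n \<notin> P}) \<longlonglongrightarrow> 0"
proof (rule order_tendstoI)
  fix c :: ennreal assume c: "0 < c"
  obtain \<epsilon> :: real where \<epsilon>: "\<epsilon> > 0" "ennreal (2 * \<epsilon>) < c"
  proof -
    obtain d where d: "0 < d" "d < c" using dense[OF c] by blast
    then obtain r where r: "d = ennreal r" "r > 0" by (cases d) (auto simp: ennreal_less_zero_iff less_top)
    then show ?thesis using that[of "r / 2"] d by simp
  qed
  obtain T where T: "open T" "P \<subseteq> T" "emeasure lborel (T - P) < ennreal \<epsilon>"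
    using outer_regular_lborel[OF P \<epsilon>(1)] by auto
  have [measurable]: "T \<in> sets borel" using T(1) by simp
  have "(\<lambda>n. \<integral>\<^sup>+x. indicator {x \<in> P. x + z n \<notin> T} x \<partial>lborel) \<longlonglongrightarrow> (\<integral>\<^sup>+x. (0::ennreal) \<partial>(lborel::'a measure))"
  proof (rule nn_integral_dominated_convergence[where w="indicator P"])
    show "(\<integral>\<^sup>+x. indicator P x \<partial>lborel) < \<infinity>" using fin by simp
    show "AE x in lborel. (\<lambda>n. indicator {x \<in> P. x + z n \<notin> T} x :: ennreal) \<longlonglongrightarrow> 0"
    proof (intro AE_I2)
      fix x
      show "(\<lambda>n. indicator {x \<in> P. x + z n \<notin> T} x :: ennreal) \<longlonglongrightarrow> 0"
      proof (cases "x \<in> P")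
        case True
        have "(\<lambda>n. x + z n) \<longlonglongrightarrow> x + 0" by (intro tendsto_add tendsto_const z)
        then have "\<forall>\<^sub>F n in sequentially. x + z n \<in> T" using T(1,2) True by (auto dest: topological_tendstoD)
        then have "\<forall>\<^sub>F n in sequentially. indicator {x \<in> P. x + z n \<notin> T} x = (0::ennreal)"
          by eventually_elim simp
        then show ?thesis by (rule tendsto_eventually)
      qed simp
    qed
  qed (auto intro!: AE_I2 simp: indicator_def)
  then have "(\<lambda>n. emeasure lborel {x \<in> P. x + z n \<notin> T}) \<longlonglongrightarrow> 0" by simp
  then have "\<forall>\<^sub>F n in sequentially. emeasure lborel {x \<in> P. x + z n \<notin> T} < ennreal \<epsilon>"
    by (rule order_tendstoD) (use \<epsilon> in simp)
  then show "\<forall>\<^sub>F n in sequentially. emeasure lborel {x \<in> P. x + z n \<notin> P} < c"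
  proof eventually_elim
    case (elim n)
    have "emeasure lborel {x. x + z n \<in> T - P} = (\<integral>\<^sup>+x. indicator (T - P) (x + z n) \<partial>lborel)"
    proof -
      have "emeasure lborel {x. x + z n \<in> T - P} = (\<integral>\<^sup>+x. indicator {x. x + z n \<in> T - P} x \<partial>lborel)"
        by (rule nn_integral_indicator[symmetric]) measurable
      also have "\<dots> = (\<integral>\<^sup>+x. indicator (T - P) (x + z n) \<partial>lborel)"
        by (intro nn_integral_cong) (auto simp: indicator_def)
      finally show ?thesis .
    qed
    also have "\<dots> = (\<integral>\<^sup>+x. indicator (T - P) x \<partial>lborel)" by (rule nn_integral_lborel_shift) measurable
    also have "\<dots> < ennreal \<epsilon>" using T(3) by simp
    finally have s: "emeasure lborel {x. x + z n \<in> T - P} < ennreal \<epsilon>" .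
    have "emeasure lborel {x \<in> P. x + z n \<notin> P} \<le> emeasure lborel ({x \<in> P. x + z n \<notin> T} \<union> {x. x + z n \<in> T - P})"
      by (intro emeasure_mono) auto
    also have "\<dots> \<le> emeasure lborel {x \<in> P. x + z n \<notin> T} + emeasure lborel {x. x + z n \<in> T - P}"
      by (intro emeasure_subadditive) measurable
    also have "\<dots> \<le> ennreal \<epsilon> + ennreal \<epsilon>" using elim s by (intro add_mono) auto
    also have "\<dots> = ennreal (2 * \<epsilon>)" using \<epsilon> by (simp add: ennreal_plus[symmetric] del: ennreal_plus)
    finally show ?case using \<epsilon>(2) by simp
  qed
qed simp

text \<open>Superadditivity of lower limits, read as Fatou's lemma for counting measure.\<close>

lemma sum_liminf_le:
  fixes u :: "'i \<Rightarrow> nat \<Rightarrow> ennreal"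
  assumes "finite J"
  shows "(\<Sum>j\<in>J. liminf (u j)) \<le> liminf (\<lambda>k. \<Sum>j\<in>J. u j k)"
proof -
  have "(\<Sum>j\<in>J. liminf (u j)) = (\<integral>\<^sup>+j. liminf (\<lambda>k. u j k) \<partial>count_space J)"
    using assms by (simp add: nn_integral_count_space_finite)
  also have "\<dots> \<le> liminf (\<lambda>k. \<integral>\<^sup>+j. u j k \<partial>count_space J)" by (rule nn_integral_liminf) simp
  finally show ?thesis using assms by (simp add: nn_integral_count_space_finite)
qed

lemma suminf_liminf_le:
  fixes u :: "nat \<Rightarrow> nat \<Rightarrow> ennreal"
  shows "(\<Sum>i. liminf (u i)) \<le> liminf (\<lambda>k. \<Sum>i. u i k)"
proof -
  have "(\<Sum>i. liminf (u i)) = (\<integral>\<^sup>+i. liminf (\<lambda>k. u i k) \<partial>count_space UNIV)"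
    by (simp add: nn_integral_count_space_nat)
  also have "\<dots> \<le> liminf (\<lambda>k. \<integral>\<^sup>+i. u i k \<partial>count_space UNIV)" by (rule nn_integral_liminf) simp
  finally show ?thesis by (simp add: nn_integral_count_space_nat)
qed

section \<open>Behaviour of partial speeds under convergence almost everywhere\<close>

locale lipschitz_approximation = sheet_cover U f P Y M
  for U :: "(real ^ 'm) set" and f :: "real ^ 'm \<Rightarrow> ('h::{real_inner,polish_space}, 'q::finite) utuple" and P Y M +
  fixes C :: "nat \<Rightarrow> real" and F :: "nat \<Rightarrow> real ^ 'm \<Rightarrow> ('h, 'q) utuple" and b :: "nat \<Rightarrow> real ^ 'm \<Rightarrow> real ^ 'm"
  assumes finU: "emeasure lborel U < \<infinity>" and lipF: "\<And>k. (C k)-lipschitz_on U (F k)"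
    and b[measurable]: "\<And>k. b k \<in> borel_measurable borel" and b0: "\<And>k x j. b k x $ j \<ge> 0"
    and speed: "\<And>k. AE x in lborel. x \<in> U \<longrightarrow> (\<forall>j h. upper_speed (F k) (h *\<^sub>R axis j 1) x \<le> ennreal (\<bar>h\<bar> * b k x $ j))"
    and lim: "AE x in lborel. x \<in> U \<longrightarrow> (\<lambda>k. F k x) \<longlonglongrightarrow> f x"

text \<open>The shift estimate for \<open>F k\<close> passes to \<open>f\<close> by Fatou's lemma
  and bounds the mean difference quotients of \<open>f\<close> at step \<open>h n\<close> by
  \<Lambda>. On a piece these are the quotients of \<open>Y i\<close>, up to points that leave the
  piece, and a second use of Fatou, in \<open>n\<close>, produces the partial speed.\<close>

lemma (in lipschitz_approximation) partial_lsc_open: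
  assumes W: "open W" "W \<subseteq> U"
  shows "(\<integral>\<^sup>+x\<in>W. ennreal (grad x $ j) \<partial>lborel) \<le> liminf (\<lambda>k. \<integral>\<^sup>+x\<in>W. ennreal (b k x $ j) \<partial>lborel)"
proof -
  define e where "e = (axis j 1 :: real ^ 'm)"
  define h where "h n = 1 / real (Suc n)" for n
  define z where "z n = e /\<^sub>R real (Suc n)" for n
  have h0: "h n > 0" for n by (simp add: h_def)
  have zh: "z n = h n *\<^sub>R e" for n by (simp add: z_def h_def divide_inverse)
  have nz: "norm (z n) = h n" for n using h0[of n] by (simp add: zh e_def)
  have z0: "z \<longlonglongrightarrow> 0"
    using tendsto_scaleR[OF LIMSEQ_inverse_real_of_nat tendsto_const, of e] by (simp add: z_def[abs_def])
  have [measurable]: "W \<in> sets borel" "U \<in> sets borel" using W(1) open_dom by auto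
  have Wne: "- W \<noteq> {}"
  proof
    assume "- W = {}"
    then have "U = UNIV" using W(2) by auto
    then show False using finU by simp
  qed
  \<comment> \<open>At depth more than \<open>h n\<close> in \<open>W\<close> the whole segment to
    \<open>x + z n\<close> stays in \<open>W\<close>.\<close>
  define T where "T n = {x. h n < infdist x (- W)}" for n
  have [measurable]: "(\<lambda>x. infdist x (- W)) \<in> borel_measurable borel"
    by (intro borel_measurable_continuous_onI continuous_intros)
  have [measurable]: "T n \<in> sets borel" for n unfolding T_def by measurable
  have TW: "x + t *\<^sub>R z n \<in> W" if "x \<in> T n" "t \<in> {0..1}" for x n t
  proof (rule ccontr)
    assume "x + t *\<^sub>R z n \<notin> W"
    then have "infdist x (- W) \<le> dist x (x + t *\<^sub>R z n)" by (intro infdist_le) auto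
    also have "\<dots> = t * h n" using that(2) by (simp add: dist_norm nz)
    also have "\<dots> \<le> 1 * h n" using that(2) h0[of n] by (intro mult_right_mono) auto
    finally show False using that(1) by (simp add: T_def)
  qed
  have TsubW: "T n \<subseteq> W" for n using TW[of _ n 0] by auto
  have Tz: "x + z n \<in> W" if "x \<in> T n" for x n using TW[OF that, of 1] by simp
  have evT: "\<forall>\<^sub>F n in sequentially. x \<in> T n" if "x \<in> W" for x
  proof -
    have "0 < infdist x (- W)" using W(1) Wne that by (intro infdist_pos_not_in_closed) auto
    moreover have "h \<longlonglongrightarrow> 0" using LIMSEQ_inverse_real_of_nat by (simp add: h_def[abs_def] inverse_eq_divide)
    ultimately show ?thesis unfolding T_def by (auto dest: order_tendstoD)
  qed
  define f0 where "f0 x = (if x \<in> U then f x else undefined)" for x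
  define G where "G k x = (if x \<in> U then F k x else undefined)" for k x
  have [measurable]: "f0 \<in> borel_measurable borel" unfolding f0_def using borel_f by (rule borel_map_on_total) simp
  have [measurable]: "G k \<in> borel_measurable borel" for k
    unfolding G_def using lipschitz_borel_map_on[OF lipF] by (rule borel_map_on_total) simp
  define \<Lambda> where "\<Lambda> = liminf (\<lambda>k. \<integral>\<^sup>+x\<in>W. ennreal (b k x $ j) \<partial>lborel)"
  have lim0: "AE x in lborel. x \<in> U \<longrightarrow> (\<lambda>k. G k x) \<longlonglongrightarrow> f0 x"
    using lim by eventually_elim (simp add: G_def f0_def)
  have step1: "(\<integral>\<^sup>+x\<in>T n. ennreal (dist (f0 (x + z n)) (f0 x)) \<partial>lborel) \<le> ennreal (h n) * \<Lambda>" for n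
  proof -
    have "(\<integral>\<^sup>+x\<in>T n. ennreal (dist (f0 (x + z n)) (f0 x)) \<partial>lborel) \<le>
      (\<integral>\<^sup>+x. liminf (\<lambda>k. ennreal (dist (G k (x + z n)) (G k x)) * indicator (T n) x) \<partial>lborel)"
    proof (rule nn_integral_mono_AE)
      show "AE x in lborel. ennreal (dist (f0 (x + z n)) (f0 x)) * indicator (T n) x \<le>
        liminf (\<lambda>k. ennreal (dist (G k (x + z n)) (G k x)) * indicator (T n) x)"
        using lim0 AE_translate[OF lim0, of "z n"]
      proof eventually_elim
        case (elim x)
        show ?case
        proof (cases "x \<in> T n")
          case True
          then have "x \<in> U" "x + z n \<in> U" using TsubW Tz W(2) by blast+
          then have 1: "(\<lambda>k. G k x) \<longlonglongrightarrow> f0 x" and 2: "(\<lambda>k. G k (x + z n)) \<longlonglongrightarrow> f0 (x + z n)"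
            using elim by blast+
          have "liminf (\<lambda>k. ennreal (dist (G k (x + z n)) (G k x))) = ennreal (dist (f0 (x + z n)) (f0 x))"
            by (intro lim_imp_Liminf sequentially_bot tendsto_ennrealI tendsto_dist 1 2)
          then show ?thesis using True by simp
        qed simp
      qed
    qed
    also have "\<dots> \<le> liminf (\<lambda>k. \<integral>\<^sup>+x\<in>T n. ennreal (dist (G k (x + z n)) (G k x)) \<partial>lborel)"
      by (rule nn_integral_liminf) measurable
    also have "\<dots> \<le> liminf (\<lambda>k. ennreal (h n) * (\<integral>\<^sup>+x\<in>W. ennreal (b k x $ j) \<partial>lborel))"
    proof (intro Liminf_mono always_eventually allI)
      fix k
      have "(\<integral>\<^sup>+x\<in>T n. ennreal (dist (G k (x + z n)) (G k x)) \<partial>lborel) \<le>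
        (\<integral>\<^sup>+x\<in>{x. \<forall>t\<in>{0..1}. x + t *\<^sub>R z n \<in> W}. ennreal (dist (F k (x + z n)) (F k x)) \<partial>lborel)"
      proof (intro nn_integral_mono)
        fix x
        show "ennreal (dist (G k (x + z n)) (G k x)) * indicator (T n) x \<le>
          ennreal (dist (F k (x + z n)) (F k x)) * indicator {x. \<forall>t\<in>{0..1}. x + t *\<^sub>R z n \<in> W} x"
        proof (cases "x \<in> T n")
          case True
          then have "x \<in> U" "x + z n \<in> U" using TsubW Tz W(2) by blast+
          moreover have "x \<in> {x. \<forall>t\<in>{0..1}. x + t *\<^sub>R z n \<in> W}" using TW[OF True] by blast
          ultimately show ?thesis using True by (simp add: G_def)
        qed simp
      qed
      also have "\<dots> \<le> (\<integral>\<^sup>+x\<in>W. ennreal (h n * b k x $ j) \<partial>lborel)"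
      proof (rule lipschitz_shift_integral[OF lipschitz_on_subset[OF lipF W(2)]])
        show "(\<lambda>x. ennreal (h n * b k x $ j)) \<in> borel_measurable borel" by measurable
        show "W \<in> sets borel" by measurable
        show "AE y in lborel. y \<in> W \<longrightarrow> upper_speed (F k) (z n) y \<le> ennreal (h n * b k y $ j)"
          using speed[of k]
        proof eventually_elim
          case (elim x)
          show ?case
          proof
            assume "x \<in> W"
            then have "upper_speed (F k) (h n *\<^sub>R axis j 1) x \<le> ennreal (\<bar>h n\<bar> * b k x $ j)" using elim W(2) by blast
            then show "upper_speed (F k) (z n) x \<le> ennreal (h n * b k x $ j)" using h0[of n] by (simp add: zh e_def)
          qed
        qed
      qed
      also have "\<dots> = (\<integral>\<^sup>+x. ennreal (h n) * (ennreal (b k x $ j) * indicator W x) \<partial>lborel)"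
        using h0[of n] b0 by (intro nn_integral_cong) (simp add: ennreal_mult mult.assoc)
      also have "\<dots> = ennreal (h n) * (\<integral>\<^sup>+x\<in>W. ennreal (b k x $ j) \<partial>lborel)"
        by (rule nn_integral_cmult) measurable
      finally show "(\<integral>\<^sup>+x\<in>T n. ennreal (dist (G k (x + z n)) (G k x)) \<partial>lborel) \<le>
        ennreal (h n) * (\<integral>\<^sup>+x\<in>W. ennreal (b k x $ j) \<partial>lborel)" .
    qed
    also have "\<dots> = ennreal (h n) * \<Lambda>" unfolding \<Lambda>_def by (rule Liminf_mult_const_ennreal) simp
    finally show ?thesis .
  qed
  have [measurable]: "Y i \<in> borel_measurable borel" for i by (rule borel_measurable_continuous_onI[OF continuous_Y])
  have Ym[measurable]: "(\<lambda>x. dist (Y i (x + z n)) (Y i x)) \<in> borel_measurable borel" for i n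
    by (intro borel_measurable_continuous_onI continuous_on_dist continuous_Y continuous_on_compose2[OF continuous_Y] continuous_intros) auto
  \<comment> \<open>Only finitely many pieces at a time: the constants \<open>M i\<close> are not
    summable against the escaping measures in general.\<close>
  define Q where "Q I = (\<Union>i<I. P i)" for I :: nat
  have [measurable]: "Q I \<in> sets borel" for I unfolding Q_def by measurable
  have step2: "(\<integral>\<^sup>+x. ennreal (grad x $ j) * indicator (Q I \<inter> W) x \<partial>lborel) \<le> \<Lambda>" for I
  proof -
    define \<phi> where "\<phi> n x = (\<Sum>i<I. ennreal (real (Suc n) * dist (Y i (x + z n)) (Y i x)) * indicator (P i \<inter> T n) x)" for n x
    have [measurable]: "\<phi> n \<in> borel_measurable lborel" for n unfolding \<phi>_def by measurable
    \<comment> \<open>On points of \<open>P i\<close> that leave \<open>P i\<close> under the shift,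
      only the Lipschitz bound of \<open>Y i\<close> is available.\<close>
    define r where "r n = (\<Sum>i<I. ennreal (M i) * emeasure lborel {x \<in> P i. x + z n \<notin> P i})" for n
    have rlim: "r \<longlonglongrightarrow> 0"
    proof -
      have "emeasure lborel (P i) < \<infinity>" for i
        using emeasure_mono[OF P_sub, of lborel i] finU by (auto intro: le_less_trans)
      then have "(\<lambda>n. ennreal (M i) * emeasure lborel {x \<in> P i. x + z n \<notin> P i}) \<longlonglongrightarrow> ennreal (M i) * 0" for i
        by (intro ennreal_tendsto_cmult translate_escape_tendsto_zero z0 P_borel) auto
      then have "r \<longlonglongrightarrow> (\<Sum>i<I. ennreal (M i) * 0)" unfolding r_def by (intro tendsto_sum)
      then show ?thesis by simp
    qed
    have pt: "\<phi> n x \<le> ennreal (real (Suc n)) * (ennreal (dist (f0 (x + z n)) (f0 x)) * indicator (T n) x) +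
        (\<Sum>i<I. ennreal (M i) * indicator {x \<in> P i. x + z n \<notin> P i} x)" for n x
    proof -
      define q where "q = ennreal (real (Suc n)) * (ennreal (dist (f0 (x + z n)) (f0 x)) * indicator (T n) x)"
      have t: "ennreal (real (Suc n) * dist (Y i (x + z n)) (Y i x)) * indicator (P i \<inter> T n) x \<le>
          q * indicator (P i) x + ennreal (M i) * indicator {x \<in> P i. x + z n \<notin> P i} x" for i
      proof (cases "x \<in> P i \<inter> T n")
        case True
        then have xU: "x \<in> U" "x + z n \<in> U" using TsubW Tz W(2) by blast+
        show ?thesis
        proof (cases "x + z n \<in> P i")
          case zP: True
          have "dist (Y i (x + z n)) (Y i x) = dist (f0 (x + z n)) (f0 x)"
            using f_iso[OF zP, of x] True xU by (simp add: f0_def)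
          then show ?thesis using True zP by (simp add: q_def ennreal_mult)
        next
          case False
          have "dist (Y i (x + z n)) (Y i x) \<le> M i * h n"
            using lipschitz_onD[OF Y_lip, of "x + z n" x i] by (simp add: dist_norm nz)
          then have "real (Suc n) * dist (Y i (x + z n)) (Y i x) \<le> real (Suc n) * (M i * h n)" by (intro mult_left_mono) auto
          also have "\<dots> = M i" by (simp add: h_def)
          finally have "ennreal (real (Suc n) * dist (Y i (x + z n)) (Y i x)) \<le> ennreal (M i)" by (rule ennreal_leI)
          then show ?thesis using True False by (simp add: add_increasing)
        qed
      qed simp
      have "\<phi> n x \<le> (\<Sum>i<I. q * indicator (P i) x + ennreal (M i) * indicator {x \<in> P i. x + z n \<notin> P i} x)"
        unfolding \<phi>_def by (intro sum_mono t)
      also have "\<dots> = q * (\<Sum>i<I. indicator (P i) x) + (\<Sum>i<I. ennreal (M i) * indicator {x \<in> P i. x + z n \<notin> P i} x)"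
        by (simp add: sum.distrib sum_distrib_left)
      also have "(\<Sum>i<I. indicator (P i) x) = (indicator (\<Union>i<I. P i) x :: ennreal)"
        by (rule indicator_UN_disjoint[symmetric]) (use P_disj in \<open>auto simp: disjoint_family_on_def\<close>)
      also have "q * indicator (\<Union>i<I. P i) x \<le> q" by (simp add: indicator_def)
      finally show ?thesis by (simp add: q_def)
    qed
    have \<phi>int: "(\<integral>\<^sup>+x. \<phi> n x \<partial>lborel) \<le> \<Lambda> + r n" for n
    proof -
      have "(\<integral>\<^sup>+x. \<phi> n x \<partial>lborel) \<le> (\<integral>\<^sup>+x. ennreal (real (Suc n)) * (ennreal (dist (f0 (x + z n)) (f0 x)) * indicator (T n) x) +
        (\<Sum>i<I. ennreal (M i) * indicator {x \<in> P i. x + z n \<notin> P i} x) \<partial>lborel)"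
        by (intro nn_integral_mono pt)
      also have "\<dots> = ennreal (real (Suc n)) * (\<integral>\<^sup>+x\<in>T n. ennreal (dist (f0 (x + z n)) (f0 x)) \<partial>lborel) + r n"
      proof -
        have "(\<integral>\<^sup>+x. (\<Sum>i<I. ennreal (M i) * indicator {x \<in> P i. x + z n \<notin> P i} x) \<partial>lborel) =
          (\<Sum>i<I. \<integral>\<^sup>+x. ennreal (M i) * indicator {x \<in> P i. x + z n \<notin> P i} x \<partial>lborel)"
          by (rule nn_integral_sum) measurable
        also have "\<dots> = r n" unfolding r_def by (intro sum.cong refl nn_integral_cmult_indicator) measurable
        finally have 1: "(\<integral>\<^sup>+x. (\<Sum>i<I. ennreal (M i) * indicator {x \<in> P i. x + z n \<notin> P i} x) \<partial>lborel) = r n" .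
        have 2: "(\<integral>\<^sup>+x. ennreal (real (Suc n)) * (ennreal (dist (f0 (x + z n)) (f0 x)) * indicator (T n) x) \<partial>lborel) =
          ennreal (real (Suc n)) * (\<integral>\<^sup>+x\<in>T n. ennreal (dist (f0 (x + z n)) (f0 x)) \<partial>lborel)"
          by (rule nn_integral_cmult) measurable
        show ?thesis unfolding 1[symmetric] 2[symmetric] by (rule nn_integral_add) measurable
      qed
      also have "\<dots> \<le> ennreal (real (Suc n)) * (ennreal (h n) * \<Lambda>) + r n"
        by (intro add_mono mult_left_mono step1) auto
      also have "ennreal (real (Suc n)) * (ennreal (h n) * \<Lambda>) = \<Lambda>"
      proof -
        have "ennreal (real (Suc n)) * ennreal (h n) = ennreal (real (Suc n) * h n)" using h0[of n] by (intro ennreal_mult[symmetric]) auto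
        also have "real (Suc n) * h n = 1" by (simp add: h_def)
        finally show ?thesis by (simp add: mult.assoc[symmetric])
      qed
      finally show ?thesis .
    qed
    have "(\<integral>\<^sup>+x. ennreal (grad x $ j) * indicator (Q I \<inter> W) x \<partial>lborel) \<le> (\<integral>\<^sup>+x. liminf (\<lambda>n. \<phi> n x) \<partial>lborel)"
    proof (rule nn_integral_mono_AE)
      show "AE x in lborel. ennreal (grad x $ j) * indicator (Q I \<inter> W) x \<le> liminf (\<lambda>n. \<phi> n x)"
        using AE_good
      proof eventually_elim
        case (elim x)
        show ?case
        proof (cases "x \<in> Q I \<inter> W")
          case True
          then obtain i L where g: "good i x L" using elim W(2) by blast
          obtain i' where i': "i' < I" "x \<in> P i'" using True by (auto simp: Q_def)
          have "i = i'" using g i'(2) P_disj by (auto simp: good_def disjoint_family_on_def)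
          then have iI: "i < I" using i'(1) by simp
          have xP: "x \<in> P i" and dY: "(Y i has_derivative L) (at x)" using g by (auto simp: good_def)
          have "ennreal (grad x $ j) = liminf (\<lambda>n. ennreal (real (Suc n) * dist (Y i (x + z n)) (Y i x)))"
            unfolding good_grad(1)[OF g] z_def e_def
            by (rule lim_imp_Liminf[OF sequentially_bot speed_tendsto_differentiable[OF dY], symmetric])
          also have "\<dots> \<le> liminf (\<lambda>n. \<phi> n x)"
          proof (rule Liminf_mono)
            have "\<forall>\<^sub>F n in sequentially. x \<in> T n" using evT True by blast
            then show "\<forall>\<^sub>F n in sequentially. ennreal (real (Suc n) * dist (Y i (x + z n)) (Y i x)) \<le> \<phi> n x"
            proof eventually_elim
              case (elim n)
              have "ennreal (real (Suc n) * dist (Y i (x + z n)) (Y i x)) =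
                ennreal (real (Suc n) * dist (Y i (x + z n)) (Y i x)) * indicator (P i \<inter> T n) x" using elim xP by simp
              also have "\<dots> \<le> \<phi> n x" unfolding \<phi>_def using iI by (intro member_le_sum) auto
              finally show ?case .
            qed
          qed
          finally show ?thesis using True by simp
        qed simp
      qed
    qed
    also have "\<dots> \<le> liminf (\<lambda>n. \<integral>\<^sup>+x. \<phi> n x \<partial>lborel)" by (rule nn_integral_liminf) measurable
    also have "\<dots> \<le> liminf (\<lambda>n. \<Lambda> + r n)" by (intro Liminf_mono always_eventually allI \<phi>int)
    also have "\<dots> = \<Lambda> + 0" by (intro lim_imp_Liminf sequentially_bot tendsto_add tendsto_const rlim)
    finally show ?thesis by simp
  qed
  have "(\<integral>\<^sup>+x\<in>W. ennreal (grad x $ j) \<partial>lborel) \<le> (\<integral>\<^sup>+x. liminf (\<lambda>I. ennreal (grad x $ j) * indicator (Q I \<inter> W) x) \<partial>lborel)"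
  proof (intro nn_integral_mono Liminf_bounded)
    fix x
    show "\<forall>\<^sub>F I in sequentially. ennreal (grad x $ j) * indicator W x \<le> ennreal (grad x $ j) * indicator (Q I \<inter> W) x"
    proof (cases "\<exists>i. x \<in> P i")
      case True
      then obtain i where i: "x \<in> P i" by blast
      have "\<forall>\<^sub>F I in sequentially. i < I" by (rule eventually_gt_at_top)
      then show ?thesis by eventually_elim (use i in \<open>auto simp: Q_def indicator_def\<close>)
    next
      case False
      then have "grad x = 0" by (intro grad_outside) blast
      then show ?thesis by simp
    qed
  qed
  also have "\<dots> \<le> liminf (\<lambda>I. \<integral>\<^sup>+x. ennreal (grad x $ j) * indicator (Q I \<inter> W) x \<partial>lborel)"
    by (rule nn_integral_liminf) measurable
  also have "\<dots> \<le> \<Lambda>" by (rule Liminf_le) (simp_all add: step2)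
  finally show ?thesis unfolding \<Lambda>_def .
qed

text \<open>Either \<open>t\<close> is below the threshold, or \<open>t powr (p - 1)\<close> exceeds
  \<open>1 / \<epsilon>\<close>. It expresses that a bound in L^p gives equi-integrability.\<close>

lemma le_eps_powr:
  fixes t :: real
  assumes "p > 1" "\<epsilon> > 0" "t \<ge> 0"
  shows "t \<le> \<epsilon> * t powr p + (1 / \<epsilon>) powr (1 / (p - 1))"
proof (cases "t \<le> (1 / \<epsilon>) powr (1 / (p - 1))")
  case True
  then show ?thesis using assms by (simp add: add_increasing)
next
  case False
  define s where "s = (1 / \<epsilon>) powr (1 / (p - 1))"
  have s: "0 \<le> s" "s < t" using False by (auto simp: s_def)
  have "1 / \<epsilon> = s powr (p - 1)" using assms by (simp add: s_def powr_powr)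
  also have "\<dots> \<le> t powr (p - 1)" using s assms by (intro powr_mono2) auto
  finally have "1 \<le> \<epsilon> * t powr (p - 1)" using assms by (simp add: divide_le_eq mult.commute)
  then have "t * 1 \<le> t * (\<epsilon> * t powr (p - 1))" using assms by (intro mult_left_mono) auto
  also have "t * (\<epsilon> * t powr (p - 1)) = \<epsilon> * t powr p"
    using s powr_add[of t 1 "p - 1"] by simp
  finally show ?thesis using s(1) unfolding s_def by linarith
qed

text \<open>The graph of the convex function \<open>v \<mapsto> |v|^p\<close> lies above its tangent
  at \<open>c\<close>, by Young's inequality for \<open>p\<close> and
  \<open>p / (p - 1)\<close>.\<close>

lemma powr_tangent_le:
  fixes c v :: "'a::euclidean_space"
  assumes p: "p > 1"
  shows "p * norm c powr (p - 2) * (c \<bullet> v) \<le> norm v powr p + (p - 1) * norm c powr p"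
proof (cases "c = 0")
  case False
  define q where "q = p / (p - 1)"
  have q: "q > 1" "1 / p + 1 / q = 1" using p by (auto simp: q_def field_simps)
  have n: "norm c > 0" using False by simp
  have e: "norm c powr (p - 2) * norm c = norm c powr (p - 1)"
    using powr_add[of "norm c" "p - 2" 1] n by simp
  have e2: "(norm c powr (p - 1)) powr q = norm c powr p" using p by (simp add: q_def powr_powr)
  have "p * norm c powr (p - 2) * (c \<bullet> v) \<le> p * norm c powr (p - 2) * (norm c * norm v)"
    using p by (intro mult_left_mono norm_cauchy_schwarz) auto
  also have "\<dots> = p * (norm v * norm c powr (p - 1))" unfolding e[symmetric] by (simp add: mult_ac)
  also have "\<dots> \<le> p * (norm v powr p / p + norm c powr p / q)"
    using Youngs_inequality[OF p q, of "norm v" "norm c powr (p - 1)"] p by (intro mult_left_mono) (auto simp: e2)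
  also have "\<dots> = norm v powr p + (p - 1) * norm c powr p" using p by (simp add: q_def distrib_left)
  finally show ?thesis .
qed (use p in simp)

text \<open>At \<open>c = v\<close> the tangent inequality is an equality, and the tangent
  expression is continuous in \<open>c\<close>. Absolute values turn a dense set into centres with
  nonnegative coordinates and fix \<open>v\<close>.\<close>

lemma powr_tangent_dense:
  fixes v :: "real ^ 'm"
  assumes p: "p > 1" and \<epsilon>: "\<epsilon> > 0" and v: "\<And>j. v $ j \<ge> 0" and D: "\<And>X :: (real ^ 'm) set. open X \<Longrightarrow> X \<noteq> {} \<Longrightarrow> \<exists>d\<in>D. d \<in> X"
  shows "\<exists>d\<in>D. let c = (\<chi> j. \<bar>d $ j\<bar>) in
    norm v powr p + (p - 1) * norm c powr p \<le> p * norm c powr (p - 2) * (c \<bullet> v) + \<epsilon>"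
proof -
  define a where "a d = (\<chi> j. \<bar>d $ j\<bar>)" for d :: "real ^ 'm"
  define \<Psi> where "\<Psi> c = p * norm c powr (p - 2) * (c \<bullet> v) - (p - 1) * norm c powr p" for c
  have av: "a v = v" using v by (simp add: a_def vec_eq_iff)
  have "continuous_on UNIV a" unfolding a_def by (intro continuous_on_vec_lambda continuous_intros)
  then have "isCont a v" by (simp add: continuous_on_eq_continuous_at)
  then have alim: "(a \<longlongrightarrow> v) (at v)" using av by (simp add: isCont_def)
  have \<Psi>v: "\<Psi> v = norm v powr p"
  proof (cases "v = 0")
    case False
    then have "norm v powr (p - 2) * (v \<bullet> v) = norm v powr p"
      using powr_add[of "norm v" "p - 2" 2] by (simp add: power2_norm_eq_inner[symmetric] powr_numeral)
    then show ?thesis by (simp add: \<Psi>_def algebra_simps)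
  qed (use p in \<open>simp add: \<Psi>_def\<close>)
  have "((\<lambda>d. \<Psi> (a d)) \<longlongrightarrow> \<Psi> v) (at v)"
  \<comment> \<open>At \<open>v = 0\<close> the factor \<open>norm c powr (p - 2)\<close> may be
    singular, but there the inner product vanishes.\<close>
  proof (cases "v = 0")
    case True
    have "((\<lambda>d. norm (a d) powr p) \<longlongrightarrow> 0) (at v)"
      by (rule tendsto_zero_powrI[OF _ tendsto_const]) (use p True alim tendsto_norm_zero in auto)
    then have "((\<lambda>d. - ((p - 1) * norm (a d) powr p)) \<longlongrightarrow> - ((p - 1) * 0)) (at v)"
      by (intro tendsto_minus tendsto_mult_left)
    then show ?thesis using True p by (simp add: \<Psi>_def)
  next
    case False
    show ?thesis unfolding \<Psi>_def
      by (intro tendsto_intros alim) (use False in auto)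
  qed
  then have "\<forall>\<^sub>F d in at v. \<Psi> v - \<epsilon> < \<Psi> (a d)" by (rule order_tendstoD) (use \<epsilon> in simp)
  then obtain S where S: "open S" "v \<in> S" "\<And>d. d \<in> S \<Longrightarrow> d \<noteq> v \<Longrightarrow> \<Psi> v - \<epsilon> < \<Psi> (a d)"
    unfolding eventually_at_topological by blast
  obtain d where d: "d \<in> D" "d \<in> S" using D[OF S(1)] S(2) by blast
  have "\<Psi> v - \<epsilon> < \<Psi> (a d)" using S(3)[OF d(2)] av \<epsilon> by (cases "d = v") auto
  then have "norm v powr p + (p - 1) * norm (a d) powr p \<le> p * norm (a d) powr (p - 2) * (a d \<bullet> v) + \<epsilon>"
    unfolding \<Psi>v by (simp add: \<Psi>_def)
  then show ?thesis using d(1) unfolding a_def Let_def by blast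
qed

text \<open>Enlarge \<open>E\<close> to an open \<open>W\<close> with small excess. On the excess
  the integrals of \<open>b k\<close> are small uniformly in \<open>k\<close>, by the bound in L^p;
  this uses \<open>p > 1\<close>.\<close>

lemma (in lipschitz_approximation) partial_lsc:
  assumes V: "open V" "V \<subseteq> U"
    and p: "p > 1" and B: "B \<ge> 0" "\<And>k. (\<integral>\<^sup>+x\<in>V. ennreal (norm (b k x) powr p) \<partial>lborel) \<le> ennreal B"
    and E[measurable]: "E \<in> sets borel" "E \<subseteq> V"
  shows "(\<integral>\<^sup>+x\<in>E. ennreal (grad x $ j) \<partial>lborel) \<le> liminf (\<lambda>k. \<integral>\<^sup>+x\<in>E. ennreal (b k x $ j) \<partial>lborel)"
proof (rule ennreal_le_epsilon)
  fix e :: real assume e: "0 < e"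
  \<comment> \<open>The choices make the energy term \<open>\<epsilon> * B\<close> and the measure
    term \<open>t * \<eta>\<close> each at most \<open>e / 2\<close>.\<close>
  define \<epsilon> where "\<epsilon> = e / (2 * (B + 1))"
  define t where "t = (1 / \<epsilon>) powr (1 / (p - 1))"
  define \<eta> where "\<eta> = e / (2 * (t + 1))"
  have pos: "\<epsilon> > 0" "t \<ge> 0" "\<eta> > 0" using e B(1) by (auto simp: \<epsilon>_def t_def \<eta>_def add_nonneg_pos)
  have le_e: "\<epsilon> * B + t * \<eta> \<le> e"
  proof -
    have "\<epsilon> * B \<le> \<epsilon> * (B + 1)" "t * \<eta> \<le> (t + 1) * \<eta>" using pos by (simp_all add: algebra_simps)
    moreover have "\<epsilon> * (B + 1) = e / 2" using B(1) by (simp add: \<epsilon>_def divide_simps)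
    moreover have "(t + 1) * \<eta> = e / 2" using pos(2) by (simp add: \<eta>_def divide_simps)
    ultimately show ?thesis by linarith
  qed
  obtain T where T: "open T" "E \<subseteq> T" "emeasure lborel (T - E) < ennreal \<eta>"
    using outer_regular_lborel[OF E(1) pos(3)] by auto
  define W where "W = T \<inter> V"
  have W: "open W" "W \<subseteq> U" "E \<subseteq> W" "W \<subseteq> V" using T V E by (auto simp: W_def)
  have [measurable]: "W \<in> sets borel" "V \<in> sets borel" "T \<in> sets borel" using W(1) V(1) T(1) by auto
  have WE: "emeasure lborel (W - E) \<le> ennreal \<eta>"
  proof -
    have "emeasure lborel (W - E) \<le> emeasure lborel (T - E)" by (intro emeasure_mono) (auto simp: W_def)
    then show ?thesis using T(3) by simp
  qed
  have rest: "(\<integral>\<^sup>+x\<in>W - E. ennreal (b k x $ j) \<partial>lborel) \<le> ennreal e" for k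
  proof -
    have "(\<integral>\<^sup>+x\<in>W - E. ennreal (b k x $ j) \<partial>lborel) \<le>
      (\<integral>\<^sup>+x. ennreal \<epsilon> * (ennreal (norm (b k x) powr p) * indicator V x) + ennreal t * indicator (W - E) x \<partial>lborel)"
    proof (intro nn_integral_mono)
      fix x
      show "ennreal (b k x $ j) * indicator (W - E) x \<le>
        ennreal \<epsilon> * (ennreal (norm (b k x) powr p) * indicator V x) + ennreal t * indicator (W - E) x"
      proof (cases "x \<in> W - E")
        case True
        have "b k x $ j \<le> norm (b k x)" using component_le_norm_cart[of "b k x" j] by simp
        also have "\<dots> \<le> \<epsilon> * norm (b k x) powr p + t" unfolding t_def using p pos(1) by (intro le_eps_powr) auto
        finally have "ennreal (b k x $ j) \<le> ennreal (\<epsilon> * norm (b k x) powr p + t)" by (rule ennreal_leI)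
        also have "\<dots> = ennreal \<epsilon> * ennreal (norm (b k x) powr p) + ennreal t"
          using pos by (simp add: ennreal_plus ennreal_mult)
        finally show ?thesis using True W(4) by (auto simp: indicator_def)
      qed simp
    qed
    also have "\<dots> = ennreal \<epsilon> * (\<integral>\<^sup>+x\<in>V. ennreal (norm (b k x) powr p) \<partial>lborel) + ennreal t * emeasure lborel (W - E)"
      by (simp add: nn_integral_add nn_integral_cmult nn_integral_cmult_indicator)
    also have "\<dots> \<le> ennreal \<epsilon> * ennreal B + ennreal t * ennreal \<eta>" by (intro add_mono mult_left_mono B(2) WE) auto
    also have "\<dots> = ennreal (\<epsilon> * B + t * \<eta>)" using pos B(1) by (simp add: ennreal_plus ennreal_mult)
    also have "\<dots> \<le> ennreal e" using le_e by (rule ennreal_leI)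
    finally show ?thesis .
  qed
  have "(\<integral>\<^sup>+x\<in>E. ennreal (grad x $ j) \<partial>lborel) \<le> (\<integral>\<^sup>+x\<in>W. ennreal (grad x $ j) \<partial>lborel)"
    using W(3) by (intro nn_integral_mono) (auto simp: indicator_def)
  also have "\<dots> \<le> liminf (\<lambda>k. \<integral>\<^sup>+x\<in>W. ennreal (b k x $ j) \<partial>lborel)"
    by (rule partial_lsc_open[OF W(1,2)])
  also have "\<dots> \<le> liminf (\<lambda>k. (\<integral>\<^sup>+x\<in>E. ennreal (b k x $ j) \<partial>lborel) + ennreal e)"
  proof (intro Liminf_mono always_eventually allI)
    fix k
    have "(\<integral>\<^sup>+x\<in>W. ennreal (b k x $ j) \<partial>lborel) =
      (\<integral>\<^sup>+x. ennreal (b k x $ j) * indicator E x + ennreal (b k x $ j) * indicator (W - E) x \<partial>lborel)"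
      using W(3) by (intro nn_integral_cong) (auto simp: indicator_def)
    also have "\<dots> = (\<integral>\<^sup>+x\<in>E. ennreal (b k x $ j) \<partial>lborel) + (\<integral>\<^sup>+x\<in>W - E. ennreal (b k x $ j) \<partial>lborel)"
      by (rule nn_integral_add) measurable
    also have "\<dots> \<le> (\<integral>\<^sup>+x\<in>E. ennreal (b k x $ j) \<partial>lborel) + ennreal e" by (intro add_left_mono rest)
    finally show "(\<integral>\<^sup>+x\<in>W. ennreal (b k x $ j) \<partial>lborel) \<le> (\<integral>\<^sup>+x\<in>E. ennreal (b k x $ j) \<partial>lborel) + ennreal e" .
  qed
  also have "\<dots> = liminf (\<lambda>k. \<integral>\<^sup>+x\<in>E. ennreal (b k x $ j) \<partial>lborel) + ennreal e"
    by (rule Liminf_add_const) simp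
  finally show "(\<integral>\<^sup>+x\<in>E. ennreal (grad x $ j) \<partial>lborel) \<le> liminf (\<lambda>k. \<integral>\<^sup>+x\<in>E. ennreal (b k x $ j) \<partial>lborel) + ennreal e" .
qed

text \<open>The convex function \<open>v \<mapsto> |v|^p\<close> is the supremum of its tangents at countably many points \<open>c\<close>
  with non-negative coordinates, and for these \<open>c \<bullet> grad\<close> is a non-negative combination
  of partial derivatives.\<close>

lemma (in lipschitz_approximation) energy_lsc:
  assumes V: "open V" "V \<subseteq> U"
    and p: "p > 1" and B: "B \<ge> 0" "\<And>k. (\<integral>\<^sup>+x\<in>V. ennreal (norm (b k x) powr p) \<partial>lborel) \<le> ennreal B"
  shows "(\<integral>\<^sup>+x\<in>V. ennreal (norm (grad x) powr p) \<partial>lborel) \<le> liminf (\<lambda>k. \<integral>\<^sup>+x\<in>V. ennreal (norm (b k x) powr p) \<partial>lborel)"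
proof (rule ennreal_le_epsilon)
  fix e :: real assume e: "0 < e"
  have [measurable]: "V \<in> sets borel" using V(1) by simp
  have "emeasure lborel V \<le> emeasure lborel U" using V(2) open_dom by (intro emeasure_mono) auto
  then have finV: "emeasure lborel V < \<infinity>" using finU by (rule le_less_trans)
  define m where "m = enn2real (emeasure lborel V)"
  have m: "emeasure lborel V = ennreal m" "m \<ge> 0" using finV by (auto simp: m_def less_top)
  define \<epsilon> where "\<epsilon> = e / (m + 1)"
  have \<epsilon>: "\<epsilon> > 0" "\<epsilon> * m \<le> e" using e m(2) by (auto simp: \<epsilon>_def divide_simps add_nonneg_pos)
  obtain D :: "(real ^ 'm) set" where "countable D \<and> (\<forall>X. open X \<longrightarrow> X \<noteq> {} \<longrightarrow> (\<exists>d\<in>D. d \<in> X))"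
    using countable_dense_exists by blast
  then have D: "countable D" "\<And>X. open X \<Longrightarrow> X \<noteq> {} \<Longrightarrow> \<exists>d\<in>D. d \<in> X" by blast+
  define c where "c i = (\<chi> j. \<bar>from_nat_into D i $ j\<bar>)" for i
  define w \<kappa> where "w i = p * norm (c i) powr (p - 2)" and "\<kappa> i = (p - 1) * norm (c i) powr p" for i
  have w0: "w i \<ge> 0" "\<kappa> i \<ge> 0" "c i $ j \<ge> 0" for i j using p by (auto simp: w_def \<kappa>_def c_def)
  \<comment> \<open>Where the i-th tangent evaluated at \<open>grad x\<close> is within \<epsilon>
    of \<open>norm (grad x) powr p\<close>; by density these sets exhaust \<open>V\<close>.\<close>
  define A where "A i = {x \<in> V. norm (grad x) powr p + \<kappa> i \<le> w i * (c i \<bullet> grad x) + \<epsilon>}" for i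
  have Am: "A i \<in> sets borel" for i unfolding A_def by measurable
  define E where "E = disjointed A"
  have EA: "E i \<subseteq> A i" for i unfolding E_def by (rule disjointed_subset)
  have Em[measurable]: "E i \<in> sets borel" for i using sets.range_disjointed_sets[of A borel] Am unfolding E_def by auto
  have EV: "E i \<subseteq> V" for i using EA by (auto simp: A_def)
  have Edisj: "disjoint_family E" unfolding E_def by (rule disjoint_family_disjointed)
  have UE: "(\<Union>i. E i) = V"
  proof -
    have "V \<subseteq> (\<Union>i. A i)"
    proof
      fix x assume x: "x \<in> V"
      obtain d where d: "d \<in> D" "let c = (\<chi> j. \<bar>d $ j\<bar>) in
        norm (grad x) powr p + (p - 1) * norm c powr p \<le> p * norm c powr (p - 2) * (c \<bullet> grad x) + \<epsilon>"
        using powr_tangent_dense[OF p \<epsilon>(1) grad_nonneg D(2)] by blast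
      obtain i where i: "from_nat_into D i = d" using from_nat_into_surj[OF D(1) d(1)] by blast
      have "x \<in> A i" using d(2) x by (simp add: A_def w_def \<kappa>_def c_def i Let_def)
      then show "x \<in> (\<Union>i. A i)" by blast
    qed
    moreover have "(\<Union>i. A i) \<subseteq> V" by (auto simp: A_def)
    ultimately show ?thesis unfolding E_def UN_disjointed_eq by blast
  qed
  have piece: "(\<integral>\<^sup>+x\<in>E i. ennreal (norm (grad x) powr p) \<partial>lborel) \<le>
    liminf (\<lambda>k. \<integral>\<^sup>+x\<in>E i. ennreal (norm (b k x) powr p) \<partial>lborel) + ennreal \<epsilon> * emeasure lborel (E i)" for i
  proof -
    have fE: "emeasure lborel (E i) < \<infinity>"
      using emeasure_mono[OF EV, of lborel i] finV by (auto intro: le_less_trans)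
    \<comment> \<open>The constant term of the tangent is moved to the other side to keep all
      integrands nonnegative; being finite, it is cancelled at the end.\<close>
    define \<mu> where "\<mu> = ennreal (\<kappa> i) * emeasure lborel (E i)"
    have \<mu>: "\<mu> < top" using fE by (simp add: \<mu>_def ennreal_mult_less_top)
    have lin: "(\<integral>\<^sup>+x\<in>E i. ennreal (w i * (c i \<bullet> g x)) \<partial>lborel) =
      (\<Sum>j\<in>UNIV. ennreal (w i * c i $ j) * (\<integral>\<^sup>+x\<in>E i. ennreal (g x $ j) \<partial>lborel))"
      if [measurable]: "g \<in> borel_measurable borel" and g0: "\<And>x j. g x $ j \<ge> 0" for g :: "real ^ 'm \<Rightarrow> real ^ 'm"
    proof -
      have "(\<integral>\<^sup>+x\<in>E i. ennreal (w i * (c i \<bullet> g x)) \<partial>lborel) =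
        (\<integral>\<^sup>+x. (\<Sum>j\<in>UNIV. ennreal (w i * c i $ j) * (ennreal (g x $ j) * indicator (E i) x)) \<partial>lborel)"
      proof (intro nn_integral_cong)
        fix x
        have "w i * (c i \<bullet> g x) = (\<Sum>j\<in>UNIV. (w i * c i $ j) * g x $ j)"
          by (simp add: inner_vec_def sum_distrib_left mult.assoc)
        then have "ennreal (w i * (c i \<bullet> g x)) = (\<Sum>j\<in>UNIV. ennreal (w i * c i $ j) * ennreal (g x $ j))"
          using w0 g0 by (simp add: ennreal_mult[symmetric] sum_ennreal)
        then show "ennreal (w i * (c i \<bullet> g x)) * indicator (E i) x =
          (\<Sum>j\<in>UNIV. ennreal (w i * c i $ j) * (ennreal (g x $ j) * indicator (E i) x))"
          by (simp add: sum_distrib_right mult.assoc)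
      qed
      also have "\<dots> = (\<Sum>j\<in>UNIV. \<integral>\<^sup>+x. ennreal (w i * c i $ j) * (ennreal (g x $ j) * indicator (E i) x) \<partial>lborel)"
        by (rule nn_integral_sum) measurable
      also have "\<dots> = (\<Sum>j\<in>UNIV. ennreal (w i * c i $ j) * (\<integral>\<^sup>+x\<in>E i. ennreal (g x $ j) \<partial>lborel))"
        by (intro sum.cong refl nn_integral_cmult) measurable
      finally show ?thesis .
    qed
    have "(\<integral>\<^sup>+x\<in>E i. ennreal (norm (grad x) powr p) \<partial>lborel) + \<mu> =
      (\<integral>\<^sup>+x. ennreal (norm (grad x) powr p) * indicator (E i) x + ennreal (\<kappa> i) * indicator (E i) x \<partial>lborel)"
      unfolding \<mu>_def by (simp add: nn_integral_add nn_integral_cmult_indicator)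
    also have "\<dots> \<le> (\<integral>\<^sup>+x. ennreal (w i * (c i \<bullet> grad x)) * indicator (E i) x + ennreal \<epsilon> * indicator (E i) x \<partial>lborel)"
    proof (intro nn_integral_mono)
      fix x
      show "ennreal (norm (grad x) powr p) * indicator (E i) x + ennreal (\<kappa> i) * indicator (E i) x \<le>
        ennreal (w i * (c i \<bullet> grad x)) * indicator (E i) x + ennreal \<epsilon> * indicator (E i) x"
      proof (cases "x \<in> E i")
        case True
        have nn: "0 \<le> w i * (c i \<bullet> grad x)"
          using w0 grad_nonneg by (auto simp: inner_vec_def intro!: mult_nonneg_nonneg sum_nonneg)
        have "norm (grad x) powr p + \<kappa> i \<le> w i * (c i \<bullet> grad x) + \<epsilon>" using True EA by (auto simp: A_def)
        then have "ennreal (norm (grad x) powr p + \<kappa> i) \<le> ennreal (w i * (c i \<bullet> grad x) + \<epsilon>)" by (rule ennreal_leI)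
        then have "ennreal (norm (grad x) powr p) + ennreal (\<kappa> i) \<le> ennreal (w i * (c i \<bullet> grad x)) + ennreal \<epsilon>"
          using nn \<epsilon>(1) w0 by (simp add: ennreal_plus)
        then show ?thesis using True by simp
      qed simp
    qed
    also have "\<dots> = (\<integral>\<^sup>+x\<in>E i. ennreal (w i * (c i \<bullet> grad x)) \<partial>lborel) + ennreal \<epsilon> * emeasure lborel (E i)"
      by (simp add: nn_integral_add nn_integral_cmult_indicator)
    also have "(\<integral>\<^sup>+x\<in>E i. ennreal (w i * (c i \<bullet> grad x)) \<partial>lborel) \<le>
      liminf (\<lambda>k. \<integral>\<^sup>+x\<in>E i. ennreal (w i * (c i \<bullet> b k x)) \<partial>lborel)"
    proof -
      have "(\<integral>\<^sup>+x\<in>E i. ennreal (w i * (c i \<bullet> grad x)) \<partial>lborel) =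
        (\<Sum>j\<in>UNIV. ennreal (w i * c i $ j) * (\<integral>\<^sup>+x\<in>E i. ennreal (grad x $ j) \<partial>lborel))"
        by (rule lin[OF borel_measurable_grad grad_nonneg])
      also have "\<dots> \<le> (\<Sum>j\<in>UNIV. ennreal (w i * c i $ j) * liminf (\<lambda>k. \<integral>\<^sup>+x\<in>E i. ennreal (b k x $ j) \<partial>lborel))"
        by (intro sum_mono mult_left_mono partial_lsc[OF V p B Em EV]) auto
      also have "\<dots> = (\<Sum>j\<in>UNIV. liminf (\<lambda>k. ennreal (w i * c i $ j) * (\<integral>\<^sup>+x\<in>E i. ennreal (b k x $ j) \<partial>lborel)))"
        by (intro sum.cong refl Liminf_mult_const_ennreal[symmetric]) simp
      also have "\<dots> \<le> liminf (\<lambda>k. \<Sum>j\<in>UNIV. ennreal (w i * c i $ j) * (\<integral>\<^sup>+x\<in>E i. ennreal (b k x $ j) \<partial>lborel))"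
        by (rule sum_liminf_le) simp
      also have "\<dots> = liminf (\<lambda>k. \<integral>\<^sup>+x\<in>E i. ennreal (w i * (c i \<bullet> b k x)) \<partial>lborel)"
        by (simp only: lin[OF b b0])
      finally show ?thesis .
    qed
    \<comment> \<open>For \<open>b k\<close> the tangent inequality is used in the other direction,
      where it holds at every vector.\<close>
    also have "liminf (\<lambda>k. \<integral>\<^sup>+x\<in>E i. ennreal (w i * (c i \<bullet> b k x)) \<partial>lborel) \<le>
      liminf (\<lambda>k. (\<integral>\<^sup>+x\<in>E i. ennreal (norm (b k x) powr p) \<partial>lborel) + \<mu>)"
    proof (intro Liminf_mono always_eventually allI)
      fix k
      have "(\<integral>\<^sup>+x\<in>E i. ennreal (w i * (c i \<bullet> b k x)) \<partial>lborel) \<le>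
        (\<integral>\<^sup>+x. ennreal (norm (b k x) powr p) * indicator (E i) x + ennreal (\<kappa> i) * indicator (E i) x \<partial>lborel)"
      proof (intro nn_integral_mono)
        fix x
        have "ennreal (w i * (c i \<bullet> b k x)) \<le> ennreal (norm (b k x) powr p + \<kappa> i)"
          unfolding w_def \<kappa>_def by (intro ennreal_leI powr_tangent_le p)
        then show "ennreal (w i * (c i \<bullet> b k x)) * indicator (E i) x \<le>
          ennreal (norm (b k x) powr p) * indicator (E i) x + ennreal (\<kappa> i) * indicator (E i) x"
          using w0(2)[of i] by (simp add: ennreal_plus indicator_def)
      qed
      also have "\<dots> = (\<integral>\<^sup>+x\<in>E i. ennreal (norm (b k x) powr p) \<partial>lborel) + \<mu>"
        unfolding \<mu>_def by (simp add: nn_integral_add nn_integral_cmult_indicator)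
      finally show "(\<integral>\<^sup>+x\<in>E i. ennreal (w i * (c i \<bullet> b k x)) \<partial>lborel) \<le> (\<integral>\<^sup>+x\<in>E i. ennreal (norm (b k x) powr p) \<partial>lborel) + \<mu>" .
    qed
    also have "\<dots> = liminf (\<lambda>k. \<integral>\<^sup>+x\<in>E i. ennreal (norm (b k x) powr p) \<partial>lborel) + \<mu>"
      by (rule Liminf_add_const) simp
    finally have "\<mu> + (\<integral>\<^sup>+x\<in>E i. ennreal (norm (grad x) powr p) \<partial>lborel) \<le>
      \<mu> + (liminf (\<lambda>k. \<integral>\<^sup>+x\<in>E i. ennreal (norm (b k x) powr p) \<partial>lborel) + ennreal \<epsilon> * emeasure lborel (E i))"
      by (simp add: add_mono ac_simps)
    then show ?thesis using \<mu> by (auto simp: ennreal_add_left_cancel_le)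
  qed
  have split: "(\<integral>\<^sup>+x\<in>V. ennreal (norm (g x) powr p) \<partial>lborel) = (\<Sum>i. \<integral>\<^sup>+x\<in>E i. ennreal (norm (g x) powr p) \<partial>lborel)"
    if [measurable]: "g \<in> borel_measurable borel" for g :: "real ^ 'm \<Rightarrow> real ^ 'm"
    unfolding UE[symmetric] by (rule nn_integral_disjoint_family[OF _ _ Edisj]) simp_all
  have "(\<integral>\<^sup>+x\<in>V. ennreal (norm (grad x) powr p) \<partial>lborel) = (\<Sum>i. \<integral>\<^sup>+x\<in>E i. ennreal (norm (grad x) powr p) \<partial>lborel)"
    by (rule split) measurable
  also have "\<dots> \<le> (\<Sum>i. liminf (\<lambda>k. \<integral>\<^sup>+x\<in>E i. ennreal (norm (b k x) powr p) \<partial>lborel) + ennreal \<epsilon> * emeasure lborel (E i))"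
    by (intro suminf_le piece summableI)
  also have "\<dots> = (\<Sum>i. liminf (\<lambda>k. \<integral>\<^sup>+x\<in>E i. ennreal (norm (b k x) powr p) \<partial>lborel)) + (\<Sum>i. ennreal \<epsilon> * emeasure lborel (E i))"
    by (intro suminf_add[symmetric] summableI)
  also have "(\<Sum>i. ennreal \<epsilon> * emeasure lborel (E i)) = ennreal \<epsilon> * emeasure lborel V"
    unfolding UE[symmetric] using suminf_emeasure[of E lborel] Edisj by (simp add: image_subset_iff)
  also have "\<dots> = ennreal (\<epsilon> * m)" unfolding m(1) using \<epsilon>(1) m(2) by (simp add: ennreal_mult)
  also have "(\<Sum>i. liminf (\<lambda>k. \<integral>\<^sup>+x\<in>E i. ennreal (norm (b k x) powr p) \<partial>lborel)) \<le>
    liminf (\<lambda>k. \<Sum>i. \<integral>\<^sup>+x\<in>E i. ennreal (norm (b k x) powr p) \<partial>lborel)"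
    by (rule suminf_liminf_le)
  also have "\<dots> = liminf (\<lambda>k. \<integral>\<^sup>+x\<in>V. ennreal (norm (b k x) powr p) \<partial>lborel)" by (simp only: split[OF b])
  finally show "(\<integral>\<^sup>+x\<in>V. ennreal (norm (grad x) powr p) \<partial>lborel) \<le>
    liminf (\<lambda>k. \<integral>\<^sup>+x\<in>V. ennreal (norm (b k x) powr p) \<partial>lborel) + ennreal e"
    using \<epsilon>(2) by (meson add_left_mono ennreal_leI order_trans add_mono order_refl)
qed

text \<open>Pass to a subsequence that realises the lower limit with energies below a fixed bound,
  then to one that converges almost everywhere; the bound is the hypothesis of
  \<open>energy_lsc\<close>. An infinite lower limit leaves nothing to prove.\<close>

lemma (in sheet_cover) deriv_integral_le_liminf:
  assumes V: "open V" "V \<subseteq> U" and finU: "emeasure lborel U < \<infinity>" and p: "p > 1"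
    and F: "\<And>j::nat. lipschitz_map_on U (F j)" and lim: "(\<lambda>j. Lp_dist p U f (F j)) \<longlonglongrightarrow> 0"
  shows "deriv_integral p U f V \<le> liminf (\<lambda>j. deriv_integral p U (F j) V)"
proof (cases "liminf (\<lambda>j. deriv_integral p U (F j) V) = \<infinity>")
  case False
  define I where "I j = deriv_integral p U (F j) V" for j
  define l where "l = liminf I"
  have Vm: "V \<in> sets borel" using V(1) by simp
  have l: "l \<noteq> \<infinity>" using False by (simp add: l_def I_def[abs_def])
  obtain r where r: "strict_mono r" "(I \<circ> r) \<longlonglongrightarrow> l" unfolding l_def using liminf_subseq_lim by blast
  define B where "B = enn2real l + 1"
  have lB: "l < ennreal B"
    using l by (cases l) (auto simp: B_def less_top ennreal_less_iff)
  have "\<forall>\<^sub>F j in sequentially. (I \<circ> r) j < ennreal B" using r(2) lB by (rule order_tendstoD)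
  then obtain j0 where j0: "\<And>j. j \<ge> j0 \<Longrightarrow> I (r j) < ennreal B" unfolding eventually_sequentially by auto
  define s where "s j = r (j + j0)" for j
  have s: "strict_mono s" using r(1) by (simp add: s_def strict_mono_def)
  obtain C where C: "\<And>j. (C j)-lipschitz_on U (F j)" using F unfolding lipschitz_map_on_def by metis
  have "(\<lambda>j. Lp_dist p U f (F (s j))) \<longlonglongrightarrow> 0" using LIMSEQ_subseq_LIMSEQ[OF lim s] by (simp add: o_def)
  then obtain k :: "nat \<Rightarrow> nat" where k: "strict_mono k" "AE x in lborel. x \<in> U \<longrightarrow> (\<lambda>j. F (s (k j)) x) \<longlonglongrightarrow> f x"
    by (rule Lp_AE_subsequence[OF _ open_dom borel_f lipschitz_borel_map_on[OF C], rotated]) (use p in auto)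
  define F' where "F' j = F (s (k j))" for j
  have lipF': "(C (s (k j)))-lipschitz_on U (F' j)" for j unfolding F'_def by (rule C)
  obtain K where K: "K \<ge> 1" "extends_lipschitz K TYPE(real ^ 'm \<Rightarrow> 'h ^ 'q)"
    using extends_lipschitz_exists[OF has_cones_normed] by blast
  have K0: "K \<ge> 0" using K by simp
  have "\<exists>g :: real ^ 'm \<Rightarrow> real ^ 'm. g \<in> borel_measurable borel \<and> (\<forall>x j. g x $ j \<ge> 0) \<and>
     deriv_integral p U (F' i) V = (\<integral>\<^sup>+x\<in>V. ennreal (norm (g x) powr p) \<partial>lborel) \<and>
     (AE x in lborel. x \<in> U \<longrightarrow> (\<forall>j h. upper_speed (F' i) (h *\<^sub>R axis j 1) x \<le> ennreal (\<bar>h\<bar> * g x $ j)))" (is "\<exists>g. ?grad i g") for i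
    using lipschitz_gradient[OF K(2) K0 open_dom lipF', of i] Vm V(2) by (elim exE conjE, intro exI conjI) auto
  then obtain b where grads: "\<And>i. ?grad i (b i)" using choice[of ?grad] by blast
  interpret lipschitz_approximation U f P Y M "\<lambda>j. C (s (k j))" F' b
    by unfold_locales (use finU lipF' grads k(2) in \<open>simp_all add: F'_def\<close>)
  have bV: "deriv_integral p U (F' i) V = (\<integral>\<^sup>+x\<in>V. ennreal (norm (b i x) powr p) \<partial>lborel)" for i using grads by blast
  have "(\<integral>\<^sup>+x\<in>V. ennreal (norm (grad x) powr p) \<partial>lborel) \<le> liminf (\<lambda>i. \<integral>\<^sup>+x\<in>V. ennreal (norm (b i x) powr p) \<partial>lborel)"
  proof (rule energy_lsc[OF V p])
    show "B \<ge> 0" by (simp add: B_def)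
    show "(\<integral>\<^sup>+x\<in>V. ennreal (norm (b i x) powr p) \<partial>lborel) \<le> ennreal B" for i
      unfolding bV[symmetric] using j0[of "k i + j0"] by (simp add: F'_def I_def s_def less_imp_le)
  qed
  also have "\<dots> = liminf (\<lambda>i. I (s (k i)))" unfolding bV[symmetric] by (simp add: F'_def I_def)
  also have "\<dots> = l"
  proof (rule lim_imp_Liminf[OF sequentially_bot])
    have "strict_mono (\<lambda>i. k i + j0)" using k(1) by (simp add: strict_mono_def)
    from LIMSEQ_subseq_LIMSEQ[OF r(2) this] show "(\<lambda>i. I (s (k i))) \<longlonglongrightarrow> l" by (simp add: o_def s_def)
  qed
  finally show ?thesis unfolding deriv_integral_eq[OF Vm V(2)] l_def I_def[abs_def] .
qed simp

lemma nn_integral_small_sets: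
  fixes g :: "'a \<Rightarrow> real"
  assumes [measurable]: "g \<in> borel_measurable M" "\<And>n. S n \<in> sets M"
    and fin: "(\<integral>\<^sup>+x. ennreal (g x) \<partial>M) < \<infinity>" and S: "(\<lambda>n. emeasure M (S n)) \<longlonglongrightarrow> 0"
  shows "(\<lambda>n. \<integral>\<^sup>+x\<in>S n. ennreal (g x) \<partial>M) \<longlonglongrightarrow> 0"
proof (rule order_tendstoI)
  fix c :: ennreal assume c: "0 < c"
  obtain d where d: "0 < d" "d + d < c"
  proof -
    obtain d' where d': "0 < d'" "d' < c" using dense[OF c] by blast
    then obtain r where r: "d' = ennreal r" "r > 0" by (cases d') (auto simp: ennreal_less_zero_iff less_top)
    have "ennreal (r / 2) + ennreal (r / 2) = ennreal r" using r by (simp add: ennreal_plus[symmetric] del: ennreal_plus)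
    then show ?thesis using that[of "ennreal (r / 2)"] d' r by simp
  qed
  have "(\<lambda>N. \<integral>\<^sup>+x. ennreal (g x) * indicator {x. real N < g x} x \<partial>M) \<longlonglongrightarrow> (\<integral>\<^sup>+x. 0 \<partial>M)"
  proof (rule nn_integral_dominated_convergence[where w="\<lambda>x. ennreal (g x)"])
    show "AE x in M. (\<lambda>N. ennreal (g x) * indicator {x. real N < g x} x) \<longlonglongrightarrow> 0"
    proof (intro AE_I2)
      fix x
      have "\<forall>\<^sub>F N in sequentially. g x \<le> real N" by (rule eventually_sequentiallyI[of "nat \<lceil>g x\<rceil>"]) linarith
      then have "\<forall>\<^sub>F N in sequentially. ennreal (g x) * indicator {x. real N < g x} x = 0"
        by eventually_elim simp
      then show "(\<lambda>N. ennreal (g x) * indicator {x. real N < g x} x) \<longlonglongrightarrow> 0" by (rule tendsto_eventually)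
    qed
  qed (use fin in \<open>auto intro!: AE_I2 simp: indicator_def\<close>)
  then have "(\<lambda>N. \<integral>\<^sup>+x. ennreal (g x) * indicator {x. real N < g x} x \<partial>M) \<longlonglongrightarrow> 0" by simp
  then have "\<forall>\<^sub>F N in sequentially. (\<integral>\<^sup>+x. ennreal (g x) * indicator {x. real N < g x} x \<partial>M) < d"
    by (rule order_tendstoD) (rule d)
  then obtain N :: nat where N: "(\<integral>\<^sup>+x. ennreal (g x) * indicator {x. real N < g x} x \<partial>M) < d"
    by (auto simp: eventually_sequentially)
  have "(\<lambda>n. ennreal (real N) * emeasure M (S n)) \<longlonglongrightarrow> ennreal (real N) * 0" by (intro ennreal_tendsto_cmult S) simp
  then have "\<forall>\<^sub>F n in sequentially. ennreal (real N) * emeasure M (S n) < d" by (rule order_tendstoD) (use d in simp)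
  then show "\<forall>\<^sub>F n in sequentially. (\<integral>\<^sup>+x\<in>S n. ennreal (g x) \<partial>M) < c"
  proof eventually_elim
    case (elim n)
    have "(\<integral>\<^sup>+x\<in>S n. ennreal (g x) \<partial>M) \<le>
      (\<integral>\<^sup>+x. ennreal (g x) * indicator {x. real N < g x} x + ennreal (real N) * indicator (S n) x \<partial>M)"
      by (intro nn_integral_mono) (auto simp: indicator_def intro: ennreal_leI)
    also have "\<dots> = (\<integral>\<^sup>+x. ennreal (g x) * indicator {x. real N < g x} x \<partial>M) + ennreal (real N) * emeasure M (S n)"
      by (subst nn_integral_add) (auto simp: nn_integral_cmult_indicator)
    also have "\<dots> \<le> d + d" using N elim by (intro add_mono) auto
    finally show ?case using d(2) by simp
  qed
qed simp

lemma powr_add_le: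
  fixes a b :: real
  assumes "a \<ge> 0" "b \<ge> 0" "p > 0"
  shows "(a + b) powr p \<le> 2 powr p * (a powr p + b powr p)"
proof -
  have "(a + b) powr p \<le> (2 * max a b) powr p" using assms by (intro powr_mono2) auto
  also have "\<dots> = 2 powr p * max a b powr p" using assms by (intro powr_mult) 
  also have "\<dots> \<le> 2 powr p * (a powr p + b powr p)" by (intro mult_left_mono) (auto simp: max_def)
  finally show ?thesis .
qed

lemma inner_closed_lborel:
  fixes A :: "'a::euclidean_space set"
  assumes "A \<in> sets borel" "e > 0"
  obtains D where "closed D" "D \<subseteq> A" "emeasure lborel (A - D) < ennreal e"
proof -
  have "- A \<in> sets borel" using assms(1) by simp
  then obtain T where T: "open T" "- A \<subseteq> T" "emeasure lborel (T - - A) < ennreal e"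
    using outer_regular_lborel[of "- A" e] assms(2) by auto
  have "A - - T = T - - A" by blast
  then show ?thesis using that[of "- T"] T by auto
qed

section \<open>Recovery sequence\<close>

text \<open>Both errors, the distance in L^p and the excess energy, are at most a constant times the
  p-th power of the level times the measure of \<open>S n\<close>, apart from an integral of
  \<open>f\<close> itself over \<open>S n\<close>; the tail hypothesis makes them vanish.\<close>

lemma (in sheet_cover) recovery_sequence:
  fixes G :: "real ^ 'm \<Rightarrow> ennreal"
  assumes U: "bounded U" and p: "p > 1" and f: "f \<in> Lp_class p U"
    and G[measurable]: "G \<in> borel_measurable borel"
    and lip: "\<And>l. l \<ge> 0 \<Longrightarrow> (c * l)-lipschitz_on {x \<in> U. G x \<le> ennreal l} f"
    and tail: "(\<lambda>n. ennreal (2 powr (p * real n)) * emeasure lborel {x \<in> U. ennreal (2 ^ Suc n) < G x}) \<longlonglongrightarrow> 0"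
    and V: "open V" "V \<subseteq> U" and ne: "\<exists>x\<in>U. G x < top"
  shows "\<exists>F. (\<forall>j::nat. lipschitz_map_on U (F j)) \<and> (\<lambda>j. Lp_dist p U f (F j)) \<longlonglongrightarrow> 0 \<and>
    liminf (\<lambda>j. deriv_integral p U (F j) V) \<le> deriv_integral p U f V"
proof -
  have Um[measurable]: "U \<in> sets borel" and Vm[measurable]: "V \<in> sets borel" using open_dom V by auto
  obtain R where R: "R \<ge> 0" "\<And>x y. x \<in> U \<Longrightarrow> y \<in> U \<Longrightarrow> dist x y \<le> R"
    using U diameter_bounded_bound[OF U] diameter_ge_0[OF U] by blast
  define Z :: "('h, 'q) utuple" where "Z = unordered (\<chi> i. 0)"
  define f0 where "f0 x = (if x \<in> U then f x else undefined)" for x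
  have [measurable]: "f0 \<in> borel_measurable borel" unfolding f0_def using borel_f by (rule borel_map_on_total) simp
  \<comment> \<open>A point common to all the closed sets: it anchors the extensions, whose
    Lipschitz constants grow, and so bounds their size.\<close>
  obtain y0 where y0: "y0 \<in> U" "G y0 < top" using ne by blast
  obtain n0 where n0: "G y0 \<le> ennreal (2 ^ Suc n0)"
  proof -
    obtain r where r: "G y0 = ennreal r" "r \<ge> 0" using y0(2) by (cases "G y0") auto
    obtain n where "r < 2 ^ n" using real_arch_pow[of 2 r] by auto
    also have "(2::real) ^ n \<le> 2 ^ Suc n" by (intro power_increasing) auto
    finally have "r \<le> 2 ^ Suc n" by (rule less_imp_le)
    then show ?thesis using that[of n] r by (simp add: ennreal_leI del: power_Suc)
  qed
  \<comment> \<open>Weight and level of the tail hypothesis at index \<open>n + n0\<close>, tuned so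
    that \<open>l n powr p = 2 powr p * a n\<close>; \<open>n0\<close> puts \<open>y0\<close> into
    every sublevel set.\<close>
  define a where "a n = 2 powr (p * real (n + n0))" for n
  define l where "l n = (2::real) ^ Suc (n + n0)" for n
  define A where "A n = {x \<in> U. G x \<le> ennreal (l n)}" for n
  have a: "a n > 0" "a n \<ge> 1" for n using p by (auto simp: a_def ge_one_powr_ge_zero)
  have l: "l n > 0" "l n \<ge> 1" for n by (auto simp: l_def simp del: power_Suc)
  have la: "l n powr p = 2 powr p * a n" for n
  proof -
    have "l n = 2 powr real (Suc (n + n0))" unfolding l_def by (rule powr_realpow[symmetric]) simp
    then have "l n powr p = 2 powr (real (Suc (n + n0)) * p)" by (simp add: powr_powr)
    also have "real (Suc (n + n0)) * p = p + p * real (n + n0)" by (simp add: algebra_simps)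
    finally show ?thesis by (simp add: a_def powr_add)
  qed
  have Am[measurable]: "A n \<in> sets borel" for n unfolding A_def by measurable
  have y0A: "y0 \<in> A n" for n
  proof -
    have "(2::real) ^ Suc n0 \<le> l n" unfolding l_def by (intro power_increasing) auto
    then have "G y0 \<le> ennreal (l n)" using n0 by (meson ennreal_leI order_trans)
    then show ?thesis using y0 by (simp add: A_def)
  qed
  \<comment> \<open>The measure lost is divided by \<open>a n\<close>, so it is still negligible
    after multiplication by \<open>a n\<close>; adjoining \<open>y0\<close> keeps the set
    closed.\<close>
  have "\<exists>D. closed D \<and> D \<subseteq> A n \<and> y0 \<in> D \<and> emeasure lborel (A n - D) \<le> ennreal ((1/2) ^ n / a n)" for n
  proof -
    have "(1/2) ^ n / a n > 0" using a(1)[of n] by simp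
    then obtain D where D: "closed D" "D \<subseteq> A n" "emeasure lborel (A n - D) < ennreal ((1/2) ^ n / a n)"
      using inner_closed_lborel[OF Am] by blast
    have "emeasure lborel (A n - insert y0 D) \<le> emeasure lborel (A n - D)"
      using D(1) by (intro emeasure_mono) auto
    then have "emeasure lborel (A n - insert y0 D) \<le> ennreal ((1/2) ^ n / a n)" using D(3) by (meson less_imp_le order_trans)
    then show ?thesis using D y0A by (intro exI[of _ "insert y0 D"]) auto
  qed
  then obtain D where D: "\<And>n. closed (D n)" "\<And>n. D n \<subseteq> A n" "\<And>n. y0 \<in> D n"
    "\<And>n. emeasure lborel (A n - D n) \<le> ennreal ((1/2) ^ n / a n)" by metis
  have Dm[measurable]: "D n \<in> sets borel" for n using D(1) by simp
  define S where "S n = U - D n" for n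
  have Sm[measurable]: "S n \<in> sets borel" for n unfolding S_def by measurable
  have aS: "(\<lambda>n. ennreal (a n) * emeasure lborel (S n)) \<longlonglongrightarrow> 0"
  proof (rule tendsto_sandwich[OF _ _ tendsto_const])
    define t where "t n = ennreal (2 powr (p * real n)) * emeasure lborel {x \<in> U. ennreal (2 ^ Suc n) < G x}" for n
    have "(\<lambda>n. t (n + n0)) \<longlonglongrightarrow> 0" using tail unfolding t_def by (rule LIMSEQ_ignore_initial_segment)
    moreover have "(\<lambda>n. ennreal ((1/2) ^ n)) \<longlonglongrightarrow> ennreal 0" by (intro tendsto_ennrealI LIMSEQ_realpow_zero) auto
    ultimately show "(\<lambda>n. t (n + n0) + ennreal ((1/2) ^ n)) \<longlonglongrightarrow> 0" using tendsto_add by fastforce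
    show "\<forall>\<^sub>F n in sequentially. ennreal (a n) * emeasure lborel (S n) \<le> t (n + n0) + ennreal ((1/2) ^ n)"
    proof (intro always_eventually allI)
      fix n
      have "emeasure lborel (S n) \<le> emeasure lborel ({x \<in> U. ennreal (l n) < G x} \<union> (A n - D n))"
        by (intro emeasure_mono) (auto simp: S_def A_def)
      also have "\<dots> \<le> emeasure lborel {x \<in> U. ennreal (l n) < G x} + emeasure lborel (A n - D n)"
        by (intro emeasure_subadditive) measurable
      also have "\<dots> \<le> emeasure lborel {x \<in> U. ennreal (l n) < G x} + ennreal ((1/2) ^ n / a n)"
        by (intro add_left_mono D(4))
      finally have "ennreal (a n) * emeasure lborel (S n) \<le>
        ennreal (a n) * (emeasure lborel {x \<in> U. ennreal (l n) < G x} + ennreal ((1/2) ^ n / a n))"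
        by (intro mult_left_mono) auto
      also have "\<dots> = t (n + n0) + ennreal (a n) * ennreal ((1/2) ^ n / a n)"
        by (simp add: distrib_left t_def a_def l_def)
      also have "ennreal (a n) * ennreal ((1/2) ^ n / a n) = ennreal (a n * ((1/2) ^ n / a n))"
        using a(1)[of n] by (intro ennreal_mult[symmetric]) auto
      also have "a n * ((1/2) ^ n / a n) = (1/2) ^ n" using a(1)[of n] by simp
      finally show "ennreal (a n) * emeasure lborel (S n) \<le> t (n + n0) + ennreal ((1/2) ^ n)" .
    qed
  qed simp
  have S0: "(\<lambda>n. emeasure lborel (S n)) \<longlonglongrightarrow> 0"
  proof (rule tendsto_sandwich[OF _ _ tendsto_const aS])
    show "\<forall>\<^sub>F n in sequentially. emeasure lborel (S n) \<le> ennreal (a n) * emeasure lborel (S n)"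
    proof (intro always_eventually allI)
      fix n
      have "1 \<le> ennreal (a n)" using a(2)[of n] ennreal_leI[of 1 "a n"] by simp
      then have "1 * emeasure lborel (S n) \<le> ennreal (a n) * emeasure lborel (S n)" by (intro mult_right_mono) auto
      then show "emeasure lborel (S n) \<le> ennreal (a n) * emeasure lborel (S n)" by simp
    qed
  qed simp
  obtain K where K: "K \<ge> 1" "extends_lipschitz K TYPE(real ^ 'm \<Rightarrow> 'h ^ 'q)"
    using extends_lipschitz_exists[OF has_cones_normed] by blast
  obtain H where H: "H \<ge> 1" "extends_lipschitz H TYPE(real ^ 'm \<Rightarrow> ('h, 'q) utuple)"
    using extends_lipschitz_exists[OF has_cones_utuple] by blast
  have c0: "c \<ge> 0" using lipschitz_on_nonneg[OF lip[of 1]] by simp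
  have "\<exists>F. (H * (c * l n))-lipschitz_on UNIV F \<and> (\<forall>x\<in>D n. F x = f x)" for n
  proof -
    have "(c * l n)-lipschitz_on (D n) f"
      by (rule lipschitz_on_subset[OF lip]) (use l D(2) in \<open>auto simp: A_def less_imp_le\<close>)
    moreover have "D n \<noteq> {}" using D(3) by blast
    ultimately show ?thesis using H(2) D(1) unfolding extends_lipschitz_def by blast
  qed
  then obtain F where F: "\<And>n. (H * (c * l n))-lipschitz_on UNIV (F n)" "\<And>n x. x \<in> D n \<Longrightarrow> F n x = f x" by metis
  have lipFU: "(H * (c * l n))-lipschitz_on U (F n)" for n using lipschitz_on_subset[OF F(1)] by simp
  have [measurable]: "F n \<in> borel_measurable borel" for n
    by (rule borel_measurable_continuous_onI) (rule lipschitz_on_continuous_on[OF F(1)])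
  have Lp: "(\<lambda>j. Lp_dist p U f (F j)) \<longlonglongrightarrow> 0"
  proof -
    \<comment> \<open>\<open>b * a n\<close> bounds the p-th power of the distance from
      \<open>F n x\<close> to \<open>Z\<close> on \<open>U\<close>, through the anchor
      \<open>y0\<close> and the constant \<open>H * (c * l n)\<close>.\<close>
    define b where "b = (dist (f y0) Z + H * c * R) powr p * 2 powr p"
    have b0: "b \<ge> 0" by (simp add: b_def)
    define g where "g x = dist (f0 x) Z powr p * indicator U x" for x
    have [measurable]: "g \<in> borel_measurable lborel" unfolding g_def by measurable
    have gfin: "(\<integral>\<^sup>+x. ennreal (g x) \<partial>lborel) < \<infinity>"
    proof -
      have "(\<integral>\<^sup>+x. ennreal (g x) \<partial>lborel) = (\<integral>\<^sup>+x\<in>U. ennreal (dist (f x) Z powr p) \<partial>lborel)"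
        by (intro nn_integral_cong) (simp add: g_def f0_def indicator_def)
      also have "\<dots> < \<infinity>" using f unfolding Lp_class_def Z_def by (simp add: nn_integral_completion)
      finally show ?thesis .
    qed
    have g0: "(\<lambda>n. \<integral>\<^sup>+x\<in>S n. ennreal (g x) \<partial>lborel) \<longlonglongrightarrow> 0"
      by (rule nn_integral_small_sets[OF _ _ gfin S0]) measurable
    have "(\<lambda>n. ennreal (2 powr p) * ((\<integral>\<^sup>+x\<in>S n. ennreal (g x) \<partial>lborel) + ennreal b * (ennreal (a n) * emeasure lborel (S n)))) \<longlonglongrightarrow>
      ennreal (2 powr p) * (0 + ennreal b * 0)"
      by (intro ennreal_tendsto_cmult tendsto_add g0 aS) auto
    then have up: "(\<lambda>n. ennreal (2 powr p) * ((\<integral>\<^sup>+x\<in>S n. ennreal (g x) \<partial>lborel) + ennreal b * (ennreal (a n) * emeasure lborel (S n)))) \<longlonglongrightarrow> 0"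
      by simp
    have "(\<lambda>n. \<integral>\<^sup>+x\<in>U. ennreal (dist (f x) (F n x) powr p) \<partial>lborel) \<longlonglongrightarrow> 0"
    proof (rule tendsto_sandwich[OF _ _ tendsto_const up])
      show "\<forall>\<^sub>F n in sequentially. (\<integral>\<^sup>+x\<in>U. ennreal (dist (f x) (F n x) powr p) \<partial>lborel) \<le>
        ennreal (2 powr p) * ((\<integral>\<^sup>+x\<in>S n. ennreal (g x) \<partial>lborel) + ennreal b * (ennreal (a n) * emeasure lborel (S n)))"
      proof (intro always_eventually allI)
        fix n
        have "(\<integral>\<^sup>+x\<in>U. ennreal (dist (f x) (F n x) powr p) \<partial>lborel) \<le>
          (\<integral>\<^sup>+x. ennreal (2 powr p) * (ennreal (g x) * indicator (S n) x + ennreal (b * a n) * indicator (S n) x) \<partial>lborel)"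
        proof (intro nn_integral_mono)
          fix x
          show "ennreal (dist (f x) (F n x) powr p) * indicator U x \<le>
            ennreal (2 powr p) * (ennreal (g x) * indicator (S n) x + ennreal (b * a n) * indicator (S n) x)"
          proof (cases "x \<in> S n")
            case True
            then have xU: "x \<in> U" by (simp add: S_def)
            have "dist (F n x) Z \<le> dist (F n x) (F n y0) + dist (F n y0) Z" by (rule dist_triangle)
            also have "dist (F n x) (F n y0) \<le> H * (c * l n) * dist x y0" using lipschitz_onD[OF F(1)] by blast
            also have "\<dots> \<le> H * (c * l n) * R" using H(1) c0 l(1)[of n] R(2)[OF xU y0(1)] by (intro mult_left_mono) auto
            also have "F n y0 = f y0" using F(2) D(3) by blast
            also have "H * (c * l n) * R + dist (f y0) Z \<le> (dist (f y0) Z + H * c * R) * l n"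
              using mult_left_mono[OF l(2)[of n], of "dist (f y0) Z"] by (simp add: algebra_simps)
            finally have "dist (F n x) Z powr p \<le> ((dist (f y0) Z + H * c * R) * l n) powr p"
              using p by (intro powr_mono2) auto
            also have "\<dots> = b * a n"
              using H(1) c0 R(1) l(1)[of n] by (subst powr_mult) (simp_all add: la b_def)
            finally have Fb: "dist (F n x) Z powr p \<le> b * a n" .
            have "dist (f x) (F n x) powr p \<le> (dist (f x) Z + dist (F n x) Z) powr p"
              using p dist_triangle2 by (intro powr_mono2) auto
            also have "\<dots> \<le> 2 powr p * (dist (f x) Z powr p + dist (F n x) Z powr p)" using p by (intro powr_add_le) auto
            also have "\<dots> \<le> 2 powr p * (g x + b * a n)" using Fb xU by (intro mult_left_mono add_mono) (auto simp: g_def f0_def)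
            finally have "ennreal (dist (f x) (F n x) powr p) \<le> ennreal (2 powr p * (g x + b * a n))" by (rule ennreal_leI)
            also have "\<dots> = ennreal (2 powr p) * (ennreal (g x) + ennreal (b * a n))"
              using b0 a(1)[of n] by (simp add: ennreal_mult ennreal_plus g_def)
            finally show ?thesis using True xU by simp
          next
            case False
            then show ?thesis using F(2)[of x n] p by (auto simp: S_def indicator_def)
          qed
        qed
        also have "\<dots> = ennreal (2 powr p) * ((\<integral>\<^sup>+x\<in>S n. ennreal (g x) \<partial>lborel) + ennreal (b * a n) * emeasure lborel (S n))"
          by (simp add: nn_integral_cmult nn_integral_add nn_integral_cmult_indicator)
        also have "ennreal (b * a n) * emeasure lborel (S n) = ennreal b * (ennreal (a n) * emeasure lborel (S n))"
          using b0 a(1)[of n] by (simp add: ennreal_mult mult.assoc)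
        finally show "(\<integral>\<^sup>+x\<in>U. ennreal (dist (f x) (F n x) powr p) \<partial>lborel) \<le>
          ennreal (2 powr p) * ((\<integral>\<^sup>+x\<in>S n. ennreal (g x) \<partial>lborel) + ennreal b * (ennreal (a n) * emeasure lborel (S n)))" .
      qed
    qed simp
    then show ?thesis using Lp_dist_tendsto_iff[of p U f F] p by simp
  qed
  \<comment> \<open>\<open>k * a n\<close> is the p-th power of the gradient bound that
    \<open>lipschitz_gradient\<close> gives for the constant \<open>H * (c * l n)\<close>.\<close>
  define k where "k = (real CARD('m) * (K * (H * c))) powr p * 2 powr p"
  have k0: "k \<ge> 0" by (simp add: k_def)
  have energy: "deriv_integral p U (F n) V \<le> deriv_integral p U f V + ennreal k * (ennreal (a n) * emeasure lborel (S n))" for n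
  proof -
    have K0: "K \<ge> 0" using K by simp
    obtain g :: "real ^ 'm \<Rightarrow> real ^ 'm" where g: "g \<in> borel_measurable borel"
      "\<forall>x. norm (g x) \<le> real CARD('m) * (K * (H * (c * l n)))"
      "\<forall>V p. V \<in> sets borel \<longrightarrow> V \<subseteq> U \<longrightarrow> deriv_integral p U (F n) V = (\<integral>\<^sup>+x\<in>V. ennreal (norm (g x) powr p) \<partial>lborel)"
      "AE x in lborel. x \<in> U \<longrightarrow> utuple_HS_norm (approx_deriv U (F n) x) = norm (g x)"
      using lipschitz_gradient[OF K(2) K0 open_dom lipFU, of n] by (elim exE conjE) rule
    \<comment> \<open>At common density points of \<open>P i\<close> and \<open>D n\<close> the lift
      \<open>Y i\<close> represents both \<open>f\<close> and \<open>F n\<close>, so their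
      approximate derivatives have the same norm.\<close>
    have eqD: "AE x in lborel. x \<in> D n \<longrightarrow> norm (g x) = norm (grad x)"
      using AE_good AE_density_point[OF Dm, of n] g(4)
    proof eventually_elim
      case (elim x)
      show ?case
      proof
        assume x: "x \<in> D n"
        then have xU: "x \<in> U" using D(2) by (auto simp: A_def)
        obtain i L where good: "good i x L" using elim xU by blast
        have gd: "x \<in> P i" "density_zero (- P i) x" "(Y i has_derivative L) (at x)" using good by (auto simp: good_def)
        have dz: "density_zero (- (P i \<inter> D n)) x"
        proof -
          have "density_zero (- P i \<union> - D n) x"
            using gd(2) elim(2) x P_borel Dm by (intro density_zero_Un) auto
          then show ?thesis by (simp add: Compl_Int)
        qed
        have "utuple_HS_norm (approx_deriv U (F n) x) = HS L"
        proof (rule approx_deriv_lift(2)[OF lipschitz_borel_map_on[OF lipFU] open_dom xU _ dz _ gd(3)])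
          show "P i \<inter> D n \<in> sets borel" by measurable
          show "F n y = unordered (Y i y)" if "y \<in> P i \<inter> D n" for y using that F(2) f_eq by simp
        qed
        then show "norm (g x) = norm (grad x)" using elim(3) xU good_grad(2)[OF good] by simp
      qed
    qed
    have "deriv_integral p U (F n) V = (\<integral>\<^sup>+x\<in>V. ennreal (norm (g x) powr p) \<partial>lborel)" using g(3) Vm V(2) by blast
    also have "\<dots> \<le> (\<integral>\<^sup>+x. ennreal (norm (grad x) powr p) * indicator V x + ennreal (k * a n) * indicator (S n) x \<partial>lborel)"
    proof (rule nn_integral_mono_AE)
      show "AE x in lborel. ennreal (norm (g x) powr p) * indicator V x \<le>
        ennreal (norm (grad x) powr p) * indicator V x + ennreal (k * a n) * indicator (S n) x"
        using eqD
      proof eventually_elim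
        case (elim x)
        show ?case
        proof (cases "x \<in> V \<and> x \<notin> D n")
          case True
          have "norm (g x) powr p \<le> (real CARD('m) * (K * (H * c)) * l n) powr p"
            using g(2) p by (intro powr_mono2) (auto simp: mult_ac)
          also have "\<dots> = k * a n"
            using K0 H(1) c0 l(1)[of n] by (subst powr_mult) (simp_all add: la k_def)
          finally have "ennreal (norm (g x) powr p) \<le> ennreal (k * a n)" by (rule ennreal_leI)
          then show ?thesis using True V(2) by (auto simp: S_def indicator_def intro: add_increasing)
        next
          case False
          then show ?thesis using elim by (auto simp: indicator_def)
        qed
      qed
    qed
    also have "\<dots> = (\<integral>\<^sup>+x\<in>V. ennreal (norm (grad x) powr p) \<partial>lborel) + ennreal (k * a n) * emeasure lborel (S n)"
      by (simp add: nn_integral_add nn_integral_cmult_indicator)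
    also have "ennreal (k * a n) * emeasure lborel (S n) = ennreal k * (ennreal (a n) * emeasure lborel (S n))"
      using k0 a(1)[of n] by (simp add: ennreal_mult mult.assoc)
    finally show ?thesis unfolding deriv_integral_eq[OF Vm V(2)] .
  qed
  have "liminf (\<lambda>n. deriv_integral p U (F n) V) \<le>
    liminf (\<lambda>n. deriv_integral p U f V + ennreal k * (ennreal (a n) * emeasure lborel (S n)))"
    by (intro Liminf_mono always_eventually allI energy)
  also have "\<dots> = deriv_integral p U f V + ennreal k * 0"
    by (intro lim_imp_Liminf sequentially_bot tendsto_add tendsto_const ennreal_tendsto_cmult aS) auto
  finally have "liminf (\<lambda>n. deriv_integral p U (F n) V) \<le> deriv_integral p U f V" by simp
  moreover have "lipschitz_map_on U (F n)" for n using lipFU unfolding lipschitz_map_on_def by blast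
  ultimately show ?thesis using Lp by blast
qed

theorem corollary4p6p4:
  fixes f :: "real ^ 'm \<Rightarrow> ('h::{real_inner, polish_space}, 'q::finite) utuple"
    and p :: real
  assumes "\<not> (\<exists>B :: 'h set. finite B \<and> span B = UNIV)"
    and "1 < p"
    and "f \<in> W1p_class p (ball 0 1)"
  shows "(AE x in lebesgue. x \<in> ball 0 1 \<longrightarrow> approx_differentiable (ball 0 1) f x) \<and>
    (\<forall>V. open V \<and> V \<subseteq> ball 0 1 \<longrightarrow>
       p_energy p (ball 0 1) f V =
       (\<integral>\<^sup>+x\<in>V. ennreal (utuple_HS_norm (approx_deriv (ball 0 1) f x) powr p) \<partial>lebesgue))"
proof -
  define U where "U = (ball 0 1 :: (real ^ 'm) set)"
  have U: "open U" "bounded U" "emeasure lborel U < \<infinity>" "emeasure lborel U > 0" and Um[measurable]: "U \<in> sets borel"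
    using ball_vol_pos[of 1, where 'a="real ^ 'm"] ball_vol_finite[of 1, where 'a="real ^ 'm"]
    by (auto simp: U_def emeasure_ball_vol)
  define a where "a n = ennreal (2 powr (p * real n))" for n
  obtain G :: "real ^ 'm \<Rightarrow> ennreal" where G[measurable]: "G \<in> borel_measurable borel"
    and lip: "\<forall>l\<ge>0. (2 * 4 ^ CARD('m) * l)-lipschitz_on {x \<in> U. G x \<le> ennreal l} f"
    and tail: "(\<lambda>n. a n * emeasure lborel {x \<in> U. ennreal (2 ^ Suc n) < G x}) \<longlonglongrightarrow> 0"
    using sobolev_lusin[OF assms(2,3)] unfolding U_def a_def by blast
  have fLp: "f \<in> Lp_class p U" using assms(3) by (simp add: W1p_class_def U_def)
  then have bf: "borel_map_on U f" by (simp add: Lp_class_def)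
  \<comment> \<open>The weights are at least 1 and the set lies in every superlevel set of the tail,
    so the limit 0 forces measure 0.\<close>
  have top0: "emeasure lborel {x \<in> U. G x = top} = 0"
  proof -
    have "emeasure lborel {x \<in> U. G x = top} \<le> a n * emeasure lborel {x \<in> U. ennreal (2 ^ Suc n) < G x}" for n
    proof -
      have "2 powr (p * real n) \<ge> 1" using assms(2) by (simp add: ge_one_powr_ge_zero)
      then have "1 \<le> a n" using ennreal_leI[of 1 "2 powr (p * real n)"] by (simp add: a_def)
      then have "1 * emeasure lborel {x \<in> U. G x = top} \<le> a n * emeasure lborel {x \<in> U. ennreal (2 ^ Suc n) < G x}"
        by (intro mult_mono emeasure_mono) (auto simp del: power_Suc)
      then show ?thesis by simp
    qed
    then have "emeasure lborel {x \<in> U. G x = top} \<le> 0"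
      using LIMSEQ_le_const[OF tail] by blast
    then show ?thesis by simp
  qed
  have fin: "AE x in lborel. x \<in> U \<longrightarrow> G x \<noteq> top"
    by (rule AE_I[where N="{x \<in> U. G x = top}"]) (use top0 in auto)
  obtain K where K: "K \<ge> 1" "extends_lipschitz K TYPE(real ^ 'm \<Rightarrow> 'h ^ 'q)"
    using extends_lipschitz_exists[OF has_cones_normed] by blast
  have "\<exists>P Y M. sheet_cover U f P Y M \<and> (\<forall>i. \<exists>n. M i = K * (2 * 4 ^ CARD('m) * real n))"
  \<comment> \<open>Integer levels exhaust the ball up to the null set where \<open>G\<close> is
    infinite.\<close>
  proof (rule sheet_cover_exists[OF K(2) U(1) bf, where A="\<lambda>n. {x \<in> U. G x \<le> ennreal (real n)}"])
    show "(2 * 4 ^ CARD('m) * real n)-lipschitz_on {x \<in> U. G x \<le> ennreal (real n)} f" for n using lip by simp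
    show "AE x in lborel. x \<in> U \<longrightarrow> x \<in> (\<Union>n. {x \<in> U. G x \<le> ennreal (real n)})"
      using fin
    proof eventually_elim
      case (elim x)
      show ?case
      proof
        assume x: "x \<in> U"
        then obtain r where r: "G x = ennreal r" "r \<ge> 0" using elim by (cases "G x") auto
        obtain n where "r \<le> real n" using real_arch_simple by blast
        then show "x \<in> (\<Union>n. {x \<in> U. G x \<le> ennreal (real n)})" using x r by (auto intro: ennreal_leI)
      qed
    qed
  qed auto
  then obtain P Y M where "sheet_cover U f P Y M" by blast
  then interpret sheet_cover U f P Y M .
  have ae: "AE x in lebesgue. x \<in> U \<longrightarrow> approx_differentiable U f x"
  proof (rule AE_completion)
    show "AE x in lborel. x \<in> U \<longrightarrow> approx_differentiable U f x" using AE_approx_deriv by eventually_elim blast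
  qed
  \<comment> \<open>Provides the anchor of the recovery sequence: the ball has positive
    measure.\<close>
  have ne: "\<exists>x\<in>U. G x < top"
  proof (rule ccontr)
    assume "\<not> (\<exists>x\<in>U. G x < top)"
    then have "{x \<in> U. G x = top} = U" using less_top by blast
    then show False using top0 U(4) by simp
  qed
  have "p_energy p U f V = deriv_integral p U f V" if V: "open V" "V \<subseteq> U" for V
  proof (rule antisym)
    obtain F where F: "\<forall>j::nat. lipschitz_map_on U (F j)" "(\<lambda>j. Lp_dist p U f (F j)) \<longlonglongrightarrow> 0"
      "liminf (\<lambda>j. deriv_integral p U (F j) V) \<le> deriv_integral p U f V"
      using recovery_sequence[OF U(2) assms(2) fLp G _ tail[unfolded a_def] V ne, of "2 * 4 ^ CARD('m)"] lip by blast
    show "p_energy p U f V \<le> deriv_integral p U f V"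
      unfolding p_energy_def
    proof (rule INF_lower2)
      show "F \<in> {F. (\<forall>j::nat. lipschitz_map_on U (F j)) \<and> (\<lambda>j. Lp_dist p U f (F j)) \<longlonglongrightarrow> 0}" using F by blast
    qed (rule F(3))
    show "deriv_integral p U f V \<le> p_energy p U f V"
      unfolding p_energy_def using deriv_integral_le_liminf[OF V U(3) assms(2)] by (intro INF_greatest) auto
  qed
  then show ?thesis using ae unfolding U_def deriv_integral_def by blast
qed

end
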